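(* Let $\Omega\subset\mathbb R^n$ be a uniformly convex domain with $\partial\Omega\in C^3$ such that, for some $\rho>0$, $\Omega\subset B_{1/\rho}(0)$ and for each $y\in\partial\Omega$ there is a ball $B_\rho(z)\subset\Omega$ tangent to $\partial\Omega$ at $y$. Let $\phi\in C(\overline\Omega)\cap C^2(\Omega)$ be a convex function satisfying $$0<\lambda\le\det D^2\phi\le\Lambda\ \text{ in }\Omega,\qquad \phi=0\ \text{ on }\partial\Omega .$$ Let $v$ be the convex solution to $$\Phi^{ij}v_{ij}=f\ \text{ in }\Omega,\qquad v=0\ \text{ on }\partial\Omega ,$$ where $f\in L^\infty(\Omega)$. Then there exist $\gamma>1$ and $C>0$ depending only on $\lambda,\Lambda,n$ and $\Omega$ such that $$\|D^2v\|_{L^\gamma(\Omega)}\le C\,\|f\|_{L^\infty(\Omega)} .$$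
   Context: $\Phi=(\Phi^{ij})=(\det D^2\phi)(D^2\phi)^{-1}$ is the cofactor matrix of $D^2\phi$, and repeated indices are summed. It is part of the hypothesis that the solution $v$ is convex. As elsewhere for this equation, $v\in C(\overline\Omega)\cap W^{2,n}_{loc}(\Omega)$ and the equation holds almost everywhere. *)

theory Defs
  imports "HOL-Analysis.Analysis" "HOL-Probability.Essential_Supremum"
begin

section \<open>Classical differentiability\<close>

text \<open>\<open>Ck_on k S f\<close> is \<open>f \<in> C\<^sup>k(S)\<close>; it is meant for open \<open>S\<close> only, since the derivatives
  are taken in the whole space.\<close>

primrec Ck_on :: "nat \<Rightarrow> 'a::real_normed_vector set \<Rightarrow> ('a \<Rightarrow> real) \<Rightarrow> bool" where
  "Ck_on 0 S f \<longleftrightarrow> continuous_on S f"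
| "Ck_on (Suc k) S f \<longleftrightarrow> (\<forall>x\<in>S. f differentiable (at x)) \<and>
     (\<forall>v. Ck_on k S (\<lambda>x. frechet_derivative f (at x) v))"

definition partial_deriv :: "'n \<Rightarrow> (real^'n::finite \<Rightarrow> real) \<Rightarrow> real^'n \<Rightarrow> real" where
  "partial_deriv i f x = frechet_derivative f (at x) (axis i 1)"

definition hessian :: "(real^'n::finite \<Rightarrow> real) \<Rightarrow> real^'n \<Rightarrow> real^'n^'n" where
  "hessian f x = (\<chi> i j. partial_deriv i (partial_deriv j f) x)"

definition cofactor_matrix :: "real^'n::finite^'n \<Rightarrow> real^'n^'n" where
  "cofactor_matrix A = det A *\<^sub>R matrix_inv A"


section \<open>Lebesgue and Sobolev spaces\<close>

definition in_Lp :: "real \<Rightarrow> 'a::euclidean_space set \<Rightarrow> ('a \<Rightarrow> 'b::real_normed_vector) \<Rightarrow> bool" where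
  "in_Lp p \<Omega> f \<longleftrightarrow> f \<in> borel_measurable (lebesgue_on \<Omega>) \<and>
     integrable (lebesgue_on \<Omega>) (\<lambda>x. norm (f x) powr p)"

text \<open>For matrix-valued \<open>f\<close> the norm is the Frobenius norm.\<close>

definition Lp_norm :: "real \<Rightarrow> 'a::euclidean_space set \<Rightarrow> ('a \<Rightarrow> 'b::real_normed_vector) \<Rightarrow> real" where
  "Lp_norm p \<Omega> f = (LINT x|lebesgue_on \<Omega>. norm (f x) powr p) powr (1 / p)"

definition in_Linf :: "'a::euclidean_space set \<Rightarrow> ('a \<Rightarrow> real) \<Rightarrow> bool" where
  "in_Linf \<Omega> f \<longleftrightarrow> f \<in> borel_measurable (lebesgue_on \<Omega>) \<and>
     esssup (lebesgue_on \<Omega>) (\<lambda>x. ereal \<bar>f x\<bar>) < \<infinity>"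

definition Linf_norm :: "'a::euclidean_space set \<Rightarrow> ('a \<Rightarrow> real) \<Rightarrow> real" where
  "Linf_norm \<Omega> f = real_of_ereal (esssup (lebesgue_on \<Omega>) (\<lambda>x. ereal \<bar>f x\<bar>))"

definition in_Lp_loc :: "real \<Rightarrow> 'a::euclidean_space set \<Rightarrow> ('a \<Rightarrow> 'b::real_normed_vector) \<Rightarrow> bool" where
  "in_Lp_loc p \<Omega> f \<longleftrightarrow> (\<forall>K. compact K \<and> K \<subseteq> \<Omega> \<longrightarrow> in_Lp p K f)"

definition test_function :: "'a::euclidean_space set \<Rightarrow> ('a \<Rightarrow> real) \<Rightarrow> bool" where
  "test_function \<Omega> \<psi> \<longleftrightarrow> (\<forall>k. Ck_on k UNIV \<psi>) \<and>
     compact (closure {x. \<psi> x \<noteq> 0}) \<and> closure {x. \<psi> x \<noteq> 0} \<subseteq> \<Omega>"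

definition weak_partial ::
  "(real^'n::finite) set \<Rightarrow> 'n \<Rightarrow> (real^'n \<Rightarrow> real) \<Rightarrow> (real^'n \<Rightarrow> real) \<Rightarrow> bool" where
  "weak_partial \<Omega> i v g \<longleftrightarrow> in_Lp_loc 1 \<Omega> v \<and> in_Lp_loc 1 \<Omega> g \<and>
     (\<forall>\<psi>. test_function \<Omega> \<psi> \<longrightarrow>
        (LINT x|lebesgue_on \<Omega>. v x * partial_deriv i \<psi> x) = - (LINT x|lebesgue_on \<Omega>. g x * \<psi> x))"

text \<open>\<open>W_loc k p \<Omega> v\<close> is \<open>v \<in> W\<^sup>k\<^sup>,\<^sup>p\<close> locally in \<open>\<Omega>\<close>.\<close>

primrec W_loc :: "nat \<Rightarrow> real \<Rightarrow> (real^'n::finite) set \<Rightarrow> (real^'n \<Rightarrow> real) \<Rightarrow> bool" where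
  "W_loc 0 p \<Omega> v \<longleftrightarrow> in_Lp_loc p \<Omega> v"
| "W_loc (Suc k) p \<Omega> v \<longleftrightarrow> in_Lp_loc p \<Omega> v \<and> (\<forall>i. \<exists>g. weak_partial \<Omega> i v g \<and> W_loc k p \<Omega> g)"

text \<open>\<open>weak_hessian \<Omega> v H\<close> says that \<open>H\<close> is a representative of the weak Hessian of \<open>v\<close>, which
  is determined only up to a null set.\<close>

definition weak_hessian ::
  "(real^'n::finite) set \<Rightarrow> (real^'n \<Rightarrow> real) \<Rightarrow> (real^'n \<Rightarrow> real^'n^'n) \<Rightarrow> bool" where
  "weak_hessian \<Omega> v H \<longleftrightarrow> (\<exists>G::real^'n \<Rightarrow> real^'n.
     \<forall>j. weak_partial \<Omega> j v (\<lambda>x. G x $ j) \<and>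
       (\<forall>i. weak_partial \<Omega> i (\<lambda>x. G x $ j) (\<lambda>x. H x $ i $ j)))"


section \<open>Domains with smooth boundary and uniform convexity\<close>

text \<open>Orthogonal projection onto the hyperplane through 0 with unit normal \<open>\<nu>\<close>; this hyperplane
  plays the role of the space \<open>\<real>\<^sup>n\<^sup>-\<^sup>1\<close> of the first \<open>n - 1\<close> coordinates after a rotation taking
  \<open>\<nu>\<close> to the last coordinate vector.\<close>

definition hyp_proj :: "'a::euclidean_space \<Rightarrow> 'a \<Rightarrow> 'a" where
  "hyp_proj \<nu> x = x - (x \<bullet> \<nu>) *\<^sub>R \<nu>"

text \<open>Near \<open>y\<close>, the set \<open>\<Omega>\<close> is the part of space above the graph, in direction \<open>\<nu>\<close>, of the
  \<open>C\<^sup>k\<close> function \<open>g\<close>. Only the values of \<open>g\<close> on the hyperplane orthogonal to \<open>\<nu>\<close> matter.\<close>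

definition boundary_chart ::
  "nat \<Rightarrow> 'a::euclidean_space set \<Rightarrow> 'a \<Rightarrow> 'a \<Rightarrow> real \<Rightarrow> ('a \<Rightarrow> real) \<Rightarrow> bool" where
  "boundary_chart k \<Omega> y \<nu> r g \<longleftrightarrow> norm \<nu> = 1 \<and> r > 0 \<and> Ck_on k (ball (hyp_proj \<nu> y) r) g \<and>
     \<Omega> \<inter> ball y r = {x \<in> ball y r. g (hyp_proj \<nu> x) < x \<bullet> \<nu>}"

definition Ck_boundary :: "nat \<Rightarrow> 'a::euclidean_space set \<Rightarrow> bool" where
  "Ck_boundary k \<Omega> \<longleftrightarrow> (\<forall>y\<in>frontier \<Omega>. \<exists>\<nu> r g. boundary_chart k \<Omega> y \<nu> r g)"

text \<open>The principal curvatures of the boundary at \<open>y\<close>, positive for a sphere seen from inside,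
  are the eigenvalues of the Hessian of \<open>g\<close> (on the tangent hyperplane) in a chart whose direction
  \<open>\<nu>\<close> is the inner normal at \<open>y\<close>, that is, a chart in which the gradient of \<open>g\<close> vanishes at the
  projection of \<open>y\<close>. The eigenvalue equation is written in weak form, tested against all
  tangent \<open>\<sigma>\<close>.\<close>

definition principal_curvature :: "'a::euclidean_space set \<Rightarrow> 'a \<Rightarrow> real \<Rightarrow> bool" where
  "principal_curvature \<Omega> y \<kappa> \<longleftrightarrow> (\<exists>\<nu> r g. boundary_chart 2 \<Omega> y \<nu> r g \<and>
     (\<forall>\<sigma>. \<sigma> \<bullet> \<nu> = 0 \<longrightarrow> frechet_derivative g (at (hyp_proj \<nu> y)) \<sigma> = 0) \<and>
     (\<exists>\<tau>. \<tau> \<noteq> 0 \<and> \<tau> \<bullet> \<nu> = 0 \<and>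
        (\<forall>\<sigma>. \<sigma> \<bullet> \<nu> = 0 \<longrightarrow>
           frechet_derivative (\<lambda>x. frechet_derivative g (at x) \<tau>) (at (hyp_proj \<nu> y)) \<sigma>
             = \<kappa> * (\<tau> \<bullet> \<sigma>))))"

definition uniformly_convex_domain :: "'a::euclidean_space set \<Rightarrow> bool" where
  "uniformly_convex_domain \<Omega> \<longleftrightarrow> open \<Omega> \<and> \<Omega> \<noteq> {} \<and> bounded \<Omega> \<and> convex \<Omega> \<and> Ck_boundary 2 \<Omega> \<and>
     (\<exists>\<kappa>\<^sub>0>0. \<forall>y\<in>frontier \<Omega>. \<forall>\<kappa>. principal_curvature \<Omega> y \<kappa> \<longrightarrow> \<kappa>\<^sub>0 \<le> \<kappa>)"

end

theory Submission
 imports Defs "HOL-Real_Asymp.Real_Asymp" "HOL-Computational_Algebra.Polynomial"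
begin

text \<open>Pointwise, \<open>D\<^sup>2v\<close> is positive semidefinite because \<open>v\<close> is convex, and \<open>\<Phi>\<close> is at least a multiple
  of \<open>1 / \<Delta>\<phi>\<close>; hence \<open>\<bar>D\<^sup>2v\<bar> \<le> C \<bar>f\<bar> \<Delta>\<phi>\<close>, and everything reduces to a bound for \<open>\<Delta>\<phi>\<close> in \<open>L\<^sup>\<gamma>\<close> up to
  the boundary. On a section of \<open>\<phi>\<close> (a sublevel set of \<open>\<phi>\<close> minus a tangent plane) the mean of \<open>\<Delta>\<phi>\<close> is
  controlled by its flux through the boundary; with the lower bound of the determinant, \<open>\<Delta>\<phi>\<close> is at least
  a multiple of that mean on half of a smaller section. Sections engulf each other, so a covering argument
  bounds the mass of \<open>{\<Delta>\<phi> > t}\<close> by \<open>C t\<close> times the volume of \<open>{\<Delta>\<phi> > c t}\<close>, plus the mass of those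
  sections on which the mean is still at least \<open>t\<close> when they come close to touching the boundary. These lie
  in a boundary layer of width \<open>t\<close> to a negative power, whose mass is small because the gradient of \<open>\<phi>\<close> is
  Hoelder continuous at the boundary.
  Iteration gives higher integrability of \<open>\<Delta>\<phi>\<close>.\<close>

text \<open>\<open>phi\<close> is C2 inside and merely continuous up to the boundary, so even the
  finiteness of the integral of the Laplacian has to be proved, and every section used must stay
  compactly inside. The Monge-Ampere bounds are affine invariant while the Laplacian is not: a
  simplex of maximal volume in a cut supplies an affine frame, in the role of John's ellipsoid, and
  in that frame the Laplacian becomes the trace of a product with a constant matrix. All barriers
  rest on one fact: if \<open>det A < det B\<close> with \<open>B\<close> positive definite, then
  \<open>A - B\<close> is not positive semidefinite, so the difference of the two functions has no
  interior minimum. The geometry of the boundary enters through two balls touching at each boundary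
  point with a common normal: an enclosing one, obtained from the curvature bound, and an interior
  one, given by hypothesis. Since exponent and constant have to be independent of
  \<open>phi\<close>, all constants are explicit terms in the other data, and the step to higher
  integrability fixes its exponent before the function.\<close>

abbreviation vol :: "'a::euclidean_space set \<Rightarrow> real" where "vol \<equiv> measure lborel"

section \<open>Positive matrices\<close>

definition psd :: "real^'n::finite^'n => bool" where
 "psd A \<longleftrightarrow> transpose A = A \<and> (\<forall>v. 0 \<le> v \<bullet> (A *v v))"

definition pd :: "real^'n::finite^'n => bool" where
 "pd A \<longleftrightarrow> transpose A = A \<and> (\<forall>v. v \<noteq> 0 \<longrightarrow> 0 < v \<bullet> (A *v v))"

definition outer :: "real^'n::finite => real^'n => real^'n^'n" where
 "outer u v = (\<chi> i j. u $ i * v $ j)"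

lemma pd_imp_psd: "pd A ==> psd A" unfolding pd_def psd_def by (metis inner_zero_left less_imp_le order_refl)

lemma sym_entry: "transpose A = A ==> A $ i $ j = A $ j $ i" for A :: "real^'n^'n"
proof -
 assume "transpose A = A"
 hence "A $ i $ j = transpose A $ i $ j" by simp
 thus ?thesis by (simp only: transpose_def vec_lambda_beta)
qed

lemma sym_inner: "transpose A = A ==> v \<bullet> (A *v w) = w \<bullet> (A *v v)" for A :: "real^'n^'n"
 by (metis dot_lmul_matrix inner_commute transpose_matrix_vector)

lemma outer_mult_vec: "outer u v *v w = (v \<bullet> w) *\<^sub>R u"
 by (simp add: outer_def matrix_vector_mult_def vec_eq_iff inner_vec_def sum_distrib_left mult_ac)

lemma transpose_outer: "transpose (outer u u) = outer u u" by (simp add: outer_def transpose_def vec_eq_iff)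

lemma matrix_add_rdistrib: "(B + C) ** A = B ** A + C ** A" for A :: "real^'n^'m"
 by (simp add: matrix_matrix_mult_def vec_eq_iff sum.distrib distrib_right)

lemma matrix_diff_rdistrib: "(B - C) ** A = B ** A - C ** A" for A :: "real^'n^'m"
 by (simp add: matrix_matrix_mult_def vec_eq_iff sum_subtractf left_diff_distrib)

lemma transpose_add: "transpose (A + B) = transpose A + transpose B" for A B :: "real^'n^'m"
 by (simp add: transpose_def vec_eq_iff)

lemma transpose_diff: "transpose (A - B) = transpose A - transpose B" for A B :: "real^'n^'m"
 by (simp add: transpose_def vec_eq_iff)

lemma transpose_scaleR: "transpose (c *\<^sub>R A) = c *\<^sub>R transpose A" for A :: "real^'n^'m"
 by (simp add: transpose_def vec_eq_iff)

lemma scaleR_mat_vec: "(c *\<^sub>R A) *v v = c *\<^sub>R (A *v v)" for A :: "real^'n^'m"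
 by (simp add: matrix_vector_mult_def vec_eq_iff sum_distrib_left mult_ac)

lemma inner_axis_mat: "axis i 1 \<bullet> (A *v axis j 1) = A $ i $ j" for A :: "real^'n^'n"
 by (simp add: inner_axis' matrix_vector_mul_component inner_axis)

lemma psd_outer: "psd (outer u u)"
 unfolding psd_def by (simp add: transpose_outer outer_mult_vec inner_commute)

lemma pd_add_psd: "pd A ==> psd B ==> pd (A + B)" unfolding psd_def pd_def
 by (simp add: transpose_add matrix_vector_mult_add_rdistrib inner_add_right add_pos_nonneg)

section \<open>Semidefinite forms as sums of rank-one matrices\<close>

lemma psd_cauchy_schwarz:
 assumes "psd H" shows "(v \<bullet> (H *v w))\<^sup>2 \<le> (v \<bullet> (H *v v)) * (w \<bullet> (H *v w))"
proof -
 have q: "0 \<le> v \<bullet> (H *v v) + 2 * t * (v \<bullet> (H *v w)) + t\<^sup>2 * (w \<bullet> (H *v w))" for t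
 proof -
  have "0 \<le> (v + t *\<^sub>R w) \<bullet> (H *v (v + t *\<^sub>R w))" using assms by (simp add: psd_def)
  also have "\<dots> = v \<bullet> (H *v v) + 2 * t * (v \<bullet> (H *v w)) + t\<^sup>2 * (w \<bullet> (H *v w))"
   using sym_inner[of H v w] assms by (simp add: psd_def algebra_simps power2_eq_square)
  finally show ?thesis .
 qed
 define a where "a = v \<bullet> (H *v v)"
 define b where "b = v \<bullet> (H *v w)"
 define c where "c = w \<bullet> (H *v w)"
 have q': "0 \<le> a + 2 * t * b + t\<^sup>2 * c" for t using q[of t] by (simp add: a_def b_def c_def)
 have c0: "0 \<le> c" using assms by (simp add: psd_def c_def)
 have "b\<^sup>2 \<le> a * c"
 proof (cases "c = 0")
  case True
  have "b = 0"
  proof (rule ccontr)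
   assume "b \<noteq> 0"
   thus False using q'[of "- (a + 1) / (2 * b)"] True by (simp add: field_simps)
  qed
  thus ?thesis using True by simp
 next
  case False
  thus ?thesis using q'[of "- b / c"] c0 by (simp add: field_simps power2_eq_square)
 qed
 thus ?thesis by (simp add: a_def b_def c_def)
qed

lemma psd_diag_nonneg: "psd H ==> 0 \<le> H $ i $ i" by (metis inner_axis_mat psd_def)

lemma psd_diag_zero:
 assumes "psd H" "H $ i $ i = 0" shows "H $ j $ i = 0"
 using psd_cauchy_schwarz[OF assms(1), of "axis j 1" "axis i 1"] assms(2) by (simp add: inner_axis_mat)

lemma psd_induct [consumes 1, case_names zero step]:
 assumes "psd H" and zero: "P 0"
  and step: "\<And>A u. psd A ==> P A ==> P (A + outer u u)"
 shows "P H" using assms(1)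
proof (induction "card {i. H $ i $ i \<noteq> 0}" arbitrary: H rule: less_induct)
 case less
 show ?case
 proof (cases "\<exists>i. H $ i $ i \<noteq> 0")
  case False
  hence "H = 0" using psd_diag_zero[OF less.prems] by (simp add: vec_eq_iff)
  thus ?thesis using zero by simp
 next
  case True
  then obtain i where i: "H $ i $ i \<noteq> 0" by blast
  hence a: "0 < H $ i $ i" using psd_diag_nonneg[OF less.prems, of i] by simp
  have symH: "transpose H = H" using less.prems by (simp add: psd_def)
  define u where "u = (1 / sqrt (H $ i $ i)) *\<^sub>R (H *v axis i 1)"
  define H' where "H' = H - outer u u"
  have uj: "u $ j * u $ j = (H $ j $ i)\<^sup>2 / H $ i $ i" for j
   using a by (simp add: u_def matrix_vector_mul_component inner_axis power2_eq_square)
  have vu: "(u \<bullet> v)\<^sup>2 = (v \<bullet> (H *v axis i 1))\<^sup>2 / H $ i $ i" for v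
   using a by (simp add: u_def power_divide inner_commute)
  have "0 \<le> v \<bullet> (H' *v v)" for v
  proof -
   have "v \<bullet> (H' *v v) = v \<bullet> (H *v v) - (u \<bullet> v)\<^sup>2"
    by (simp add: H'_def matrix_vector_mult_diff_rdistrib outer_mult_vec inner_diff_right
      power2_eq_square inner_commute)
   moreover have "(u \<bullet> v)\<^sup>2 \<le> v \<bullet> (H *v v)"
    using psd_cauchy_schwarz[OF less.prems, of v "axis i 1"] a by (simp add: vu inner_axis_mat field_simps)
   ultimately show ?thesis by simp
  qed
  hence H': "psd H'" by (simp add: psd_def H'_def transpose_diff transpose_outer symH)
  \<comment> \<open>Entry \<open>i\<close> is cancelled exactly; a zero diagonal entry cannot become
    nonzero, because it could only decrease and the new diagonal is nonnegative.\<close>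
  have sub: "{j. H' $ j $ j \<noteq> 0} \<subseteq> {j. H $ j $ j \<noteq> 0} - {i}"
  proof
   fix j assume j: "j \<in> {j. H' $ j $ j \<noteq> 0}"
   have e: "H' $ j $ j = H $ j $ j - (H $ j $ i)\<^sup>2 / H $ i $ i"
    using uj[of j] by (simp add: H'_def outer_def)
   have "j \<noteq> i" using j e by (auto simp: power2_eq_square)
   moreover have "H $ j $ j \<noteq> 0"
    using j e psd_diag_nonneg[OF H', of j] a by (auto simp: divide_le_0_iff)
   ultimately show "j \<in> {j. H $ j $ j \<noteq> 0} - {i}" by simp
  qed
  have "card {j. H' $ j $ j \<noteq> 0} < card {j. H $ j $ j \<noteq> 0}"
  proof -
   have "card {j. H' $ j $ j \<noteq> 0} \<le> card ({j. H $ j $ j \<noteq> 0} - {i})"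
    by (rule card_mono[OF _ sub]) simp
   also have "\<dots> < card {j. H $ j $ j \<noteq> 0}" by (rule card_Diff1_less) (use i in auto)
   finally show ?thesis .
  qed
  from less.hyps[OF this H'] have "P H'" .
  from step[OF H' this, of u] show ?thesis by (simp add: H'_def)
 qed
qed

lemma trace_mult_outer: "trace (M ** outer u u) = u \<bullet> (M *v u)"
 unfolding trace_def matrix_matrix_mult_def outer_def inner_vec_def matrix_vector_mult_def
 by (simp add: sum_distrib_left mult_ac)

lemma trace_mult_psd_nonneg:
 assumes "psd H" "psd M" shows "0 \<le> trace (M ** H)" using assms(1)
proof (induction rule: psd_induct)
 case (step A u)
 thus ?case using assms(2) by (simp add: matrix_add_ldistrib trace_add trace_mult_outer psd_def)
qed (simp add: trace_def)

section \<open>Rank-one updates of determinants\<close>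

lemma exists_matrix_axis:
 assumes "a \<noteq> (0::real^'n)" obtains P Q :: "real^'n^'n" and k
 where "P ** Q = mat 1" "Q ** P = mat 1" "P *v a = axis k 1"
proof -
 obtain k where k: "a $ k \<noteq> 0" using assms by (auto simp: vec_eq_iff)
 define Q :: "real^'n^'n" where "Q = (\<chi> i j. if j = k then a $ i else if i = j then 1 else 0)"
 have Qk: "Q *v axis k 1 = a" by (simp add: Q_def matrix_vector_mul_component vec_eq_iff inner_axis)
 have "inj ((*v) Q)"
 proof (subst linear_injective_0, simp, intro allI impI)
  fix x assume x: "Q *v x = 0"
  have c: "(Q *v x) $ i = (if i = k then a $ k * x $ k else x $ i + a $ i * x $ k)" for i
  proof -
   have "(Q *v x) $ i = (\<Sum>j\<in>UNIV. (if j = k then a $ i * x $ k else 0) + (if j = i then (if i = k then 0 else x $ i) else 0))"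
    unfolding Q_def matrix_vector_mult_def vec_lambda_beta by (rule sum.cong) auto
   also have "\<dots> = (if i = k then a $ k * x $ k else x $ i + a $ i * x $ k)" by (simp add: sum.distrib)
   finally show ?thesis .
  qed
  have "x $ k = 0" using c[of k] x k by simp
  have "x $ i = 0" for i using c[of i] x \<open>x $ k = 0\<close> by (cases "i = k") auto
  thus "x = 0" by (simp add: vec_eq_iff)
 qed
 hence "invertible Q" by (simp add: invertible_left_inverse matrix_left_invertible_injective)
 then obtain P where P: "Q ** P = mat 1" "P ** Q = mat 1" by (auto simp: invertible_def)
 have "P *v a = axis k 1" by (metis P(2) Qk matrix_vector_mul_assoc matrix_vector_mul_lid)
 thus ?thesis using that P by blast
qed

text \<open>The matrix differs from the identity in row \<open>k\<close>, which is a linear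
  combination of the rows of the identity, so Cramer's rule for rows reads off the
  determinant.\<close>

lemma det_mat1_add_axis: "det (mat 1 + outer (axis k 1) c) = 1 + c $ k" for c :: "real^'n"
proof -
 have r: "row i (mat 1 :: real^'n^'n) = axis i 1" for i by (simp add: row_def mat_def axis_def vec_eq_iff)
 have eq: "mat 1 + outer (axis k 1) c =
   (\<chi> i. if i = k then sum (\<lambda>i. (axis k 1 + c) $ i *s row i (mat 1 :: real^'n^'n)) UNIV
     else row i (mat 1))" unfolding r basis_expansion by (auto simp: vec_eq_iff outer_def mat_def axis_def)
 show ?thesis unfolding eq cramer_lemma_transpose by simp
qed

lemma matrix_mult_outer: "P ** outer a b ** Q = outer (P *v a) (transpose Q *v b)"
 for P Q :: "real^'n^'n"
proof -
 have "(P ** outer a b ** Q) *v v = outer (P *v a) (transpose Q *v b) *v v" for v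
  by (simp add: matrix_vector_mul_assoc[symmetric] outer_mult_vec matrix_vector_mult_scaleR dot_lmul_matrix)
 thus ?thesis by (simp add: matrix_eq)
qed

lemma det_mat1_add_outer: "det (mat 1 + outer a b) = 1 + a \<bullet> b" for a b :: "real^'n"
proof (cases "a = 0")
 case True
 hence "outer a b = 0" by (simp add: outer_def vec_eq_iff)
 with True show ?thesis by simp
next
 case False
 then obtain P Q :: "real^'n^'n" and k where PQ: "P ** Q = mat 1" "Q ** P = mat 1" "P *v a = axis k 1"
  by (rule exists_matrix_axis)
 \<comment> \<open>Conjugation moves \<open>a\<close> to a coordinate vector and preserves both the
   determinant and the pairing of \<open>a\<close> with \<open>b\<close>.\<close>
 have "P ** (mat 1 + outer a b) ** Q = mat 1 + outer (axis k 1) (transpose Q *v b)"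
  by (simp add: matrix_add_ldistrib matrix_add_rdistrib PQ matrix_mult_outer)
 hence "det P * det (mat 1 + outer a b) * det Q = 1 + (transpose Q *v b) $ k"
  by (metis det_mul det_mat1_add_axis)
 moreover have "det P * det Q = 1" by (metis PQ(1) det_I det_mul)
 moreover have "(transpose Q *v b) $ k = a \<bullet> b"
 proof -
  have "(transpose Q *v b) $ k = (transpose Q *v b) \<bullet> (P *v a)" by (simp add: PQ(3) inner_axis)
  also have "\<dots> = b \<bullet> (Q *v (P *v a))" by (simp add: dot_lmul_matrix)
  also have "Q *v (P *v a) = a" using PQ(2) by (metis matrix_vector_mul_assoc matrix_vector_mul_lid)
  also have "b \<bullet> a = a \<bullet> b" by (rule inner_commute)
  finally show ?thesis .
 qed
 ultimately show ?thesis by (metis mult.assoc mult.commute mult.right_neutral)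
qed

lemma pd_inverse:
 assumes "pd A" obtains B where "A ** B = mat 1" "B ** A = mat 1" "pd B"
proof -
 have "inj ((*v) A)"
 proof (subst linear_injective_0, simp, intro allI impI)
  fix x assume "A *v x = 0" thus "x = 0" using assms unfolding pd_def by auto
 qed
 hence "invertible A" by (simp add: invertible_left_inverse matrix_left_invertible_injective)
 then obtain B where B: "A ** B = mat 1" "B ** A = mat 1" by (auto simp: invertible_def)
 have "transpose A = A" using assms by (simp add: pd_def)
 hence sB: "transpose B = B" by (metis B matrix_mul_assoc matrix_mul_rid matrix_transpose_mul)
 have "0 < v \<bullet> (B *v v)" if "v \<noteq> 0" for v
 proof -
  have v: "A *v (B *v v) = v" by (simp add: matrix_vector_mul_assoc B)
  have "B *v v \<noteq> 0" using that v by force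
  hence "0 < (B *v v) \<bullet> (A *v (B *v v))" using assms by (simp add: pd_def)
  thus ?thesis by (simp add: v inner_commute)
 qed
 thus ?thesis using that B sB by (simp add: pd_def)
qed

lemma det_add_outer:
 fixes A :: "real^'n^'n"
 assumes "A ** B = mat 1"
 shows "det (A + outer u u) = det A * (1 + (B *v u) \<bullet> u)"
proof -
 have "A + outer u u = A ** (mat 1 + outer (B *v u) u)"
 proof -
  have "outer (A *v (B *v u)) u = A ** outer (B *v u) u"
   using matrix_mult_outer[of A "B *v u" u "mat 1"] by simp
  thus ?thesis by (simp add: matrix_add_ldistrib assms matrix_vector_mul_assoc)
 qed
 thus ?thesis by (simp add: det_mul det_mat1_add_outer)
qed

lemma scaleR_mat_mult: "(c *\<^sub>R A) ** B = c *\<^sub>R (A ** B)" for A :: "real^'n^'m"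
 by (simp add: matrix_matrix_mult_def vec_eq_iff sum_distrib_left mult_ac)

lemma pd_mat_scaleR: "0 < c ==> pd (c *\<^sub>R mat 1)" by (simp add: pd_def scaleR_mat_vec transpose_scaleR)

lemma det_scaleR_mat1: "det (c *\<^sub>R mat 1 :: real^'n^'n) = c ^ CARD('n)"
 by (subst det_diagonal) (auto simp: mat_def)

text \<open>Adding \<open>outer u u\<close> multiplies the determinant by one plus a value of the
  inverse form, which is at least 1; so the determinant grows along the rank-one decomposition of
  \<open>H\<close>. This is the matrix input of the comparison principle.\<close>

lemma pd_det_pos_mono:
 assumes "psd H" "pd B" "0 < det B" shows "det B \<le> det (B + H)" using assms(1)
proof (induction rule: psd_induct)
 case (step A u)
 have p: "pd (B + A)" using pd_add_psd assms(2) step by blast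
 obtain C where C: "(B + A) ** C = mat 1" "pd C" using pd_inverse[OF p] by metis
 have "0 \<le> (C *v u) \<bullet> u" using pd_imp_psd[OF C(2)] by (simp add: psd_def inner_commute)
 hence "det (B + A) * 1 \<le> det (B + A) * (1 + (C *v u) \<bullet> u)" using step(2) assms(3) by simp
 thus ?case using step det_add_outer[OF C(1), of u] by (simp add: add.assoc)
qed simp

lemma psd_abs_entry: assumes "psd A" shows "\<bar>A $ i $ j\<bar> \<le> trace A"
proof -
 have d: "0 \<le> A $ k $ k" "A $ k $ k \<le> trace A" for k
  using psd_diag_nonneg[OF assms] by (auto simp: trace_def intro: member_le_sum)
 have "(A $ i $ j)\<^sup>2 \<le> A $ i $ i * A $ j $ j"
  using psd_cauchy_schwarz[OF assms, of "axis i 1" "axis j 1"] by (simp add: inner_axis_mat)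
 also have "\<dots> \<le> trace A * trace A" using d by (intro mult_mono) (auto intro: order_trans)
 finally have "(A $ i $ j)\<^sup>2 \<le> (trace A)\<^sup>2" by (simp add: power2_eq_square)
 moreover have "0 \<le> trace A" using d[of i] by simp
 ultimately show ?thesis using power2_le_iff_abs_le by blast
qed

text \<open>The smallest eigenvalue of the inverse is the reciprocal of the largest one of
  \<open>A\<close>, hence at least \<open>1 / trace A\<close>. Here this comes from Cauchy-Schwarz
  for the form \<open>A\<close>, applied to each coordinate vector and
  \<open>B *v v\<close>.\<close>

lemma norm_sq_le_trace_inverse:
 assumes "A ** B = mat 1" "psd A" shows "(norm v)\<^sup>2 \<le> trace A * (v \<bullet> (B *v v))"
proof -
 have v: "A *v (B *v v) = v" by (simp add: matrix_vector_mul_assoc assms)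
 have "(norm v)\<^sup>2 = (\<Sum>i\<in>UNIV. (v $ i)\<^sup>2)"
  unfolding power2_norm_eq_inner inner_vec_def by (simp add: power2_eq_square)
 also have "\<dots> \<le> (\<Sum>i\<in>UNIV. A $ i $ i * (v \<bullet> (B *v v)))"
 proof (rule sum_mono)
  fix i
  have "(axis i 1 \<bullet> (A *v (B *v v)))\<^sup>2 \<le> A $ i $ i * ((B *v v) \<bullet> (A *v (B *v v)))"
   using psd_cauchy_schwarz[OF assms(2), of "axis i 1" "B *v v"] by (simp add: inner_axis_mat)
  thus "(v $ i)\<^sup>2 \<le> A $ i $ i * (v \<bullet> (B *v v))" by (simp add: v inner_axis' inner_commute[of v])
 qed
 also have "\<dots> = trace A * (v \<bullet> (B *v v))" by (simp add: trace_def sum_distrib_right)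
 finally show ?thesis .
qed

lemma trace_le_trace_mult:
 assumes "psd H" "psd B" "\<And>v. c * (norm v)\<^sup>2 \<le> v \<bullet> (B *v v)"
 shows "c * trace H \<le> trace (B ** H)"
proof -
 have "psd (B - c *\<^sub>R mat 1)"
  using assms(2,3) by (simp add: psd_def transpose_diff transpose_scaleR matrix_vector_mult_diff_rdistrib scaleR_mat_vec inner_diff_right power2_norm_eq_inner)
 from trace_mult_psd_nonneg[OF assms(1) this]
 have "0 \<le> trace ((B - c *\<^sub>R mat 1) ** H)" .
 also have "(B - c *\<^sub>R mat 1) ** H = B ** H - c *\<^sub>R H"
  by (simp add: matrix_diff_rdistrib scaleR_mat_mult)
 finally show ?thesis by (simp add: trace_def sum_distrib_left sum_subtractf)
qed

lemma norm_matrix_le_trace: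
 fixes H :: "real^'n^'n"
 assumes "psd H" shows "norm H \<le> real CARD('n) ^ 2 * trace H"
proof -
 have "norm H \<le> (\<Sum>i\<in>UNIV. norm (H $ i))" unfolding norm_vec_def by (rule L2_set_le_sum) simp
 also have "\<dots> \<le> (\<Sum>i\<in>(UNIV::'n set). \<Sum>j\<in>(UNIV::'n set). \<bar>H $ i $ j\<bar>)"
  by (intro sum_mono) (metis norm_le_l1_cart)
 also have "\<dots> \<le> (\<Sum>i\<in>(UNIV::'n set). \<Sum>j\<in>(UNIV::'n set). trace H)"
  by (intro sum_mono psd_abs_entry assms)
 also have "\<dots> = real CARD('n) ^ 2 * trace H" by (simp add: power2_eq_square)
 finally show ?thesis .
qed

lemma abs_det_le:
 fixes A :: "real^'n^'n" and N :: real
 assumes "\<And>i j. \<bar>A $ i $ j\<bar> \<le> N" shows "\<bar>det A\<bar> \<le> fact CARD('n) * N ^ CARD('n)"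
proof -
 have "\<bar>det A\<bar> \<le> (\<Sum>p | p permutes (UNIV::'n set). \<bar>of_int (sign p) * (\<Prod>i\<in>UNIV. A $ i $ p i)\<bar>)"
  unfolding det_def by simp
 also have "\<dots> \<le> (\<Sum>p | p permutes (UNIV::'n set). N ^ CARD('n))"
 proof (rule sum_mono)
  fix p
  have "\<bar>of_int (sign p) * (\<Prod>i\<in>UNIV. A $ i $ p i)\<bar> = (\<Prod>i\<in>UNIV. \<bar>A $ i $ p i\<bar>)"
   by (simp add: abs_prod sign_def)
  also have "\<dots> \<le> (\<Prod>i\<in>(UNIV::'n set). N)" by (intro prod_mono) (auto simp: assms)
  finally show "\<bar>of_int (sign p) * (\<Prod>i\<in>UNIV. A $ i $ p i)\<bar> \<le> N ^ CARD('n)" by simp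
 qed
 also have "\<dots> = fact CARD('n) * N ^ CARD('n)" by (simp add: card_permutations[OF refl])
 finally show ?thesis .
qed

text \<open>A bounded trace and a determinant bounded below exclude small eigenvalues. Cramer's rule
  bounds the diagonal of the inverse; \<open>1 \<le> N\<close> lets the inserted unit column obey
  the same entry bound as the rest.\<close>

lemma pd_lower_bound:
 fixes M :: "real^'n^'n" and N m :: real
 assumes "pd M" "trace M \<le> N" "1 \<le> N" "m \<le> det M" "0 < m"
 shows "m / (CARD('n) * fact CARD('n) * N ^ CARD('n)) * (norm v)\<^sup>2 \<le> v \<bullet> (M *v v)"
proof -
 obtain B where B: "M ** B = mat 1" "B ** M = mat 1" "pd B" using pd_inverse[OF assms(1)] by metis
 have e: "B $ k $ k \<le> fact CARD('n) * N ^ CARD('n) / m" for k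
 proof -
  let ?C = "(\<chi> i j. if j = k then (M *v (B *v axis k 1)) $ i else M $ i $ j) :: real^'n^'n"
  have v: "M *v (B *v axis k 1) = axis k 1" by (simp add: matrix_vector_mul_assoc B)
  have "(B *v axis k 1) $ k * det M = det ?C" by (rule cramer_lemma[symmetric])
  also have "\<dots> \<le> fact CARD('n) * N ^ CARD('n)"
  proof -
   have "\<bar>?C $ i $ j\<bar> \<le> N" for i j
    unfolding v using assms(2,3) psd_abs_entry[OF pd_imp_psd[OF assms(1)], of i j] by (auto simp: axis_def)
   from abs_det_le[OF this] show ?thesis by simp
  qed
  finally have "B $ k $ k * det M \<le> fact CARD('n) * N ^ CARD('n)"
   by (simp add: matrix_vector_mul_component inner_axis)
  moreover have "B $ k $ k * m \<le> B $ k $ k * det M"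
   using psd_diag_nonneg[OF pd_imp_psd[OF B(3)], of k] assms(4) by (intro mult_left_mono) auto
  ultimately show ?thesis using assms(5) by (simp add: field_simps)
 qed
 have "trace B \<le> (\<Sum>k\<in>(UNIV::'n set). fact CARD('n) * N ^ CARD('n) / m)"
  unfolding trace_def by (intro sum_mono e)
 hence tr: "trace B \<le> CARD('n) * fact CARD('n) * N ^ CARD('n) / m" by simp
 have q0: "0 \<le> v \<bullet> (M *v v)" using pd_imp_psd[OF assms(1)] by (simp add: psd_def)
 have "(norm v)\<^sup>2 \<le> trace B * (v \<bullet> (M *v v))"
  using norm_sq_le_trace_inverse[OF B(2) pd_imp_psd[OF B(3)]] .
 also have "\<dots> \<le> CARD('n) * fact CARD('n) * N ^ CARD('n) / m * (v \<bullet> (M *v v))"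
  by (intro mult_right_mono tr q0)
 finally show ?thesis using assms(3,5) by (simp add: field_simps)
qed

section \<open>Images of compact sets under differentiable maps\<close>

text \<open>The library has change of variables only for index types that are well-ordered; the copy of
 a finite type below transports the bound needed here to arbitrary finite index types.\<close>

typedef 'a ordered_copy = "UNIV :: 'a set" ..

instance ordered_copy :: (finite) finite
proof
 have "inj (Rep_ordered_copy :: 'a ordered_copy => 'a)" by (simp add: inj_def Rep_ordered_copy_inject)
 thus "finite (UNIV :: 'a ordered_copy set)" by (rule finite_imageD[rotated]) simp
qed

definition copy_index :: "'a::finite ordered_copy => nat" where
 "copy_index x = (SOME f :: 'a => nat. inj f) (Rep_ordered_copy x)"

lemma inj_copy_index: "inj (copy_index :: 'a::finite ordered_copy => nat)"
proof -
 have "inj (SOME f :: 'a => nat. inj f)"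
  by (rule someI_ex[where P = inj]) (use finite_imp_inj_to_nat_seg[of "UNIV :: 'a set"] in blast)
 thus ?thesis by (metis (mono_tags, lifting) Rep_ordered_copy_inject copy_index_def injD injI)
qed

instantiation ordered_copy :: (finite) wellorder
begin
definition less_eq_ordered_copy :: "'a ordered_copy => 'a ordered_copy => bool" where
 "x \<le> y \<longleftrightarrow> copy_index x \<le> copy_index y"
definition less_ordered_copy :: "'a ordered_copy => 'a ordered_copy => bool" where
 "x < y \<longleftrightarrow> copy_index x < copy_index y"
instance
proof
 fix x y :: "'a ordered_copy" and P
 show "x \<le> y ==> y \<le> x ==> x = y"
  using inj_copy_index by (auto simp: less_eq_ordered_copy_def inj_def)
 show "P x" if "\<And>x. (\<And>y. y < x ==> P y) ==> P x"
  by (induction "copy_index x" arbitrary: x rule: less_induct)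
   (use that in \<open>auto simp: less_ordered_copy_def\<close>)
qed (auto simp: less_eq_ordered_copy_def less_ordered_copy_def)
end

lemma sign_conj:
 fixes R :: "'m::finite => 'n::finite"
 assumes "bij R" "p permutes UNIV"
 shows "sign (inv R \<circ> p \<circ> R) = sign p"
proof -
 have inv: "inv R x = y \<longleftrightarrow> x = R y" for x y using bij_inv_eq_iff[OF assms(1)] by metis
 have "permutation (inv R \<circ> p \<circ> R) \<and> sign (inv R \<circ> p \<circ> R) = sign p"
  using assms(2) finite[of "UNIV :: 'n set"]
 proof (induction rule: permutes_induct)
  case id
  thus ?case using assms(1) by (simp add: bij_is_inj)
 next
  case (swap a b p)
  have p: "permutation p" using swap.hyps by (auto simp: permutation_permutes)
  have e: "inv R \<circ> (Transposition.transpose a b \<circ> p) \<circ> R =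
    Transposition.transpose (inv R a) (inv R b) \<circ> (inv R \<circ> p \<circ> R)"
  proof
   fix x
   have "inv R (p (R x)) = inv R a \<longleftrightarrow> p (R x) = a" "inv R (p (R x)) = inv R b \<longleftrightarrow> p (R x) = b"
    by (metis inv)+
   thus "(inv R \<circ> (Transposition.transpose a b \<circ> p) \<circ> R) x =
     (Transposition.transpose (inv R a) (inv R b) \<circ> (inv R \<circ> p \<circ> R)) x" by auto
  qed
  have "inv R a = inv R b \<longleftrightarrow> a = b" by (simp add: inv) (metis inv)
  thus ?case unfolding e using swap p
   by (simp add: sign_compose permutation_swap_id permutation_compose sign_swap_id del: o_apply)
 qed
 thus ?thesis by blast
qed

text \<open>Conjugation of permutations by \<open>R\<close> matches the two Leibniz sums term by
  term, with equal signs by \<open>sign_conj\<close>.\<close>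

lemma det_reindex:
 fixes R :: "'m::finite => 'n::finite" and A :: "real^'n^'n"
 assumes "bij R" shows "det ((\<chi> i j. A $ R i $ R j) :: real^'m^'m) = det A"
proof -
 have inv: "inv R (R i) = i" "R (inv R k) = k" for i k
  using assms by (simp_all add: bij_is_inj bij_is_surj surj_f_inv_f)
 show ?thesis unfolding det_def
 proof (rule sum.reindex_bij_witness[where i = "\<lambda>p. inv R \<circ> p \<circ> R" and j = "\<lambda>q. R \<circ> q \<circ> inv R"])
  fix q assume q: "q \<in> {p. p permutes (UNIV :: 'm set)}"
  show "inv R \<circ> (R \<circ> q \<circ> inv R) \<circ> R = q" by (simp add: fun_eq_iff inv)
  have b: "bij q" using q by (simp add: permutes_bij)
  show p: "R \<circ> q \<circ> inv R \<in> {p. p permutes (UNIV :: 'n set)}"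
   using b assms by (auto intro!: bij_imp_permutes bij_comp bij_imp_bij_inv)
  have "sign (R \<circ> q \<circ> inv R) = sign q"
   using sign_conj[OF assms, of "R \<circ> q \<circ> inv R"] p by (simp add: comp_def inv)
  moreover have "(\<Prod>i\<in>UNIV. A $ i $ (R \<circ> q \<circ> inv R) i) = (\<Prod>i\<in>UNIV. A $ R i $ R (q i))"
   using prod.reindex_bij_betw[OF assms, of "\<lambda>i. A $ i $ (R \<circ> q \<circ> inv R) i"] by (simp add: inv)
  ultimately show "of_int (sign (R \<circ> q \<circ> inv R)) * (\<Prod>i\<in>UNIV. A $ i $ (R \<circ> q \<circ> inv R) i) =
    of_int (sign q) * (\<Prod>i\<in>UNIV. (\<chi> i j. A $ R i $ R j) $ i $ q i)" by simp
 next
  fix p assume p: "p \<in> {p. p permutes (UNIV :: 'n set)}"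
  show "R \<circ> (inv R \<circ> p \<circ> R) \<circ> inv R = p" by (simp add: fun_eq_iff inv)
  have b: "bij p" using p by (simp add: permutes_bij)
  show "inv R \<circ> p \<circ> R \<in> {p. p permutes (UNIV :: 'm set)}"
   using b assms by (auto intro!: bij_imp_permutes bij_comp bij_imp_bij_inv)
 qed
qed

definition to_copy :: "real^'n => real^('n::finite ordered_copy)" where
 "to_copy x = (\<chi> i. x $ Rep_ordered_copy i)"

definition of_copy :: "real^('n::finite ordered_copy) => real^'n" where
 "of_copy y = (\<chi> i. y $ Abs_ordered_copy i)"

lemma to_of_copy [simp]: "to_copy (of_copy y) = y" "of_copy (to_copy x) = x"
 by (simp_all add: to_copy_def of_copy_def Rep_ordered_copy_inverse Abs_ordered_copy_inverse)

lemma bij_Rep_ordered_copy: "bij Rep_ordered_copy"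
 by (metis Abs_ordered_copy_inverse Rep_ordered_copy_inverse UNIV_I bijI')

lemma bounded_linear_to_copy: "bounded_linear to_copy"
 unfolding to_copy_def linear_conv_bounded_linear[symmetric] by (intro linearI) (simp_all add: vec_eq_iff)

lemma bounded_linear_of_copy: "bounded_linear of_copy"
 unfolding of_copy_def linear_conv_bounded_linear[symmetric] by (intro linearI) (simp_all add: vec_eq_iff)

text \<open>Lebesgue measure is determined by its values on boxes, and renaming coordinates permutes
  the factors of a box volume.\<close>

lemma distr_of_copy: "distr lborel borel of_copy = (lborel :: (real^'n::finite) measure)"
proof (rule lborel_eqI[symmetric])
 have meas: "of_copy \<in> borel_measurable borel"
  by (intro borel_measurable_continuous_onI linear_continuous_on bounded_linear_of_copy)
 fix l u :: "real^'n"
 have mem: "of_copy y \<in> box l u \<longleftrightarrow> y \<in> box (to_copy l) (to_copy u)" for y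
 proof -
  have "(\<forall>i. l $ i < of_copy y $ i \<and> of_copy y $ i < u $ i) \<longleftrightarrow>
    (\<forall>j. l $ Rep_ordered_copy j < y $ j \<and> y $ j < u $ Rep_ordered_copy j)"
   unfolding of_copy_def vec_lambda_beta by (metis Abs_ordered_copy_inverse Rep_ordered_copy_inverse UNIV_I)
  thus ?thesis by (simp add: mem_box_cart to_copy_def)
 qed
 assume le: "\<And>b. b \<in> Basis ==> l \<bullet> b \<le> u \<bullet> b"
 have leb: "l $ i \<le> u $ i" for i using le[of "axis i 1"] by (simp add: inner_axis)
 have prod_Basis: "(\<Prod>b\<in>Basis. z \<bullet> b) = (\<Prod>i\<in>UNIV. z $ i)" for z :: "real^'k::finite"
  by (simp add: Basis_vec_def prod.UNION_disjoint inner_axis axis_eq_axis)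
 have "emeasure (distr lborel borel of_copy) (box l u) = emeasure lborel (box (to_copy l) (to_copy u))"
  using meas mem by (subst emeasure_distr) (auto intro!: arg_cong[where f = "emeasure lborel"])
 also have "\<dots> = ennreal (\<Prod>b\<in>Basis. (to_copy u - to_copy l) \<bullet> b)"
  by (rule emeasure_lborel_box) (use leb in \<open>auto simp: Basis_vec_def inner_axis to_copy_def\<close>)
 also have "(\<Prod>b\<in>Basis. (to_copy u - to_copy l) \<bullet> b) = (\<Prod>b\<in>Basis. (u - l) \<bullet> b)"
  unfolding prod_Basis using prod.reindex_bij_betw[OF bij_Rep_ordered_copy, of "\<lambda>i. u $ i - l $ i"]
  by (simp add: to_copy_def)
 finally show "emeasure (distr lborel borel of_copy) (box l u) = ennreal (\<Prod>b\<in>Basis. (u - l) \<bullet> b)" .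
qed simp

lemma measure_to_copy:
 fixes S :: "(real^'n::finite) set"
 assumes "compact S" shows "measure lebesgue (to_copy ` S) = measure lebesgue S"
proof -
 have S: "S \<in> sets borel" using assms by (simp add: borel_compact)
 have c: "compact (to_copy ` S)"
  by (intro compact_continuous_image linear_continuous_on bounded_linear_to_copy assms)
 have eq: "of_copy -` S = to_copy ` S" by force
 have meas: "of_copy \<in> borel_measurable borel"
  by (intro borel_measurable_continuous_onI linear_continuous_on bounded_linear_of_copy)
 have "measure lebesgue S = vol S" using S by simp
 also have "\<dots> = measure (distr lborel borel of_copy) S" by (simp add: distr_of_copy)
 also have "\<dots> = vol (to_copy ` S)" using S meas eq by (subst measure_distr) auto
 also have "\<dots> = measure lebesgue (to_copy ` S)" using borel_compact[OF c] by simp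
 finally show ?thesis by simp
qed

lemma continuous_on_det:
 fixes D :: "'a::topological_space => real^'n^'n"
 shows "continuous_on S D ==> continuous_on S (\<lambda>x. det (D x))"
 unfolding det_def by (intro continuous_intros)

text \<open>The upper half of the change of variables formula, for maps that need not be injective.
  Its main use is for gradient maps, whose Jacobian is the determinant of the Hessian.\<close>

lemma measure_compact_differentiable_image:
 fixes f :: "real^'n::finite => real^'n"
 assumes S: "compact S" and der: "\<And>x. x \<in> S ==> (f has_derivative (\<lambda>v. D x *v v)) (at x)"
  and cont: "continuous_on S D" and bd: "\<And>x. x \<in> S ==> \<bar>det (D x)\<bar> \<le> B"
 shows "measure lebesgue (f ` S) \<le> B * measure lebesgue S"
proof -
 define D' where "D' y = ((\<chi> i j. D (of_copy y) $ Rep_ordered_copy i $ Rep_ordered_copy j) ::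
   real^('n ordered_copy)^('n ordered_copy))" for y
 have det: "det (D' y) = det (D (of_copy y))" for y
  unfolding D'_def by (rule det_reindex[OF bij_Rep_ordered_copy])
 have conj: "to_copy (M *v of_copy v) = (\<chi> i j. M $ Rep_ordered_copy i $ Rep_ordered_copy j) *v v"
  for M :: "real^'n^'n" and v
 proof (subst vec_eq_iff, intro allI)
  fix i
  show "to_copy (M *v of_copy v) $ i = ((\<chi> i j. M $ Rep_ordered_copy i $ Rep_ordered_copy j) *v v) $ i"
   using sum.reindex_bij_betw[OF bij_Rep_ordered_copy, of "\<lambda>j. M $ Rep_ordered_copy i $ j * of_copy v $ j"]
   by (simp add: to_copy_def matrix_vector_mult_def of_copy_def Rep_ordered_copy_inverse)
 qed
 let ?S = "to_copy ` S"
 let ?f = "\<lambda>y. to_copy (f (of_copy y))"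
 have cS: "compact ?S" by (intro compact_continuous_image linear_continuous_on bounded_linear_to_copy S)
 have der': "(?f has_derivative (\<lambda>v. D' y *v v)) (at y within ?S)" if "y \<in> ?S" for y
 proof -
  have y: "of_copy y \<in> S" using that by auto
  have "((\<lambda>y. f (of_copy y)) has_derivative (\<lambda>v. D (of_copy y) *v of_copy v)) (at y within ?S)"
   by (rule has_derivative_compose[where f = of_copy and g = f, OF _ der[OF y]])
    (rule bounded_linear_imp_has_derivative[OF bounded_linear_of_copy])
  from bounded_linear.has_derivative[OF bounded_linear_to_copy this]
  show ?thesis by (simp add: conj D'_def)
 qed
 have "continuous_on ?S (\<lambda>y. det (D (of_copy y)))"
  by (rule continuous_on_compose2[OF continuous_on_det[OF cont]])
   (auto intro: linear_continuous_on bounded_linear_of_copy)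
 hence "continuous_on ?S (\<lambda>y. \<bar>det (D (of_copy y))\<bar>)" by (intro continuous_intros)
 from borel_integrable_compact[OF cS this]
 have "set_integrable lborel ?S (\<lambda>y. \<bar>det (D (of_copy y))\<bar>)"
  by (simp add: set_integrable_def)
 hence int: "(\<lambda>y. \<bar>det (matrix ((*v) (D' y)))\<bar>) integrable_on ?S"
  by (simp add: det set_borel_integral_eq_integral)
 have "measure lebesgue (?f ` ?S) \<le> B * measure lebesgue ?S"
 proof (rule measure_bounded_differentiable_image[OF _ der' int])
  show "?S \<in> lmeasurable" using cS by (rule lmeasurable_compact)
  show "\<bar>det (matrix ((*v) (D' y)))\<bar> \<le> B" if "y \<in> ?S" for y
   using that bd by (auto simp: det)
 qed
 moreover have "?f ` ?S = to_copy ` (f ` S)" by force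
 moreover have "compact (f ` S)" by (intro compact_continuous_image S continuous_at_imp_continuous_on ballI
    has_derivative_continuous[OF der])
 ultimately show ?thesis using measure_to_copy[OF S] measure_to_copy[of "f ` S"] by simp
qed

section \<open>Simplices of maximal volume\<close>

lemma compact_rows:
 assumes "compact (K :: (real^'n) set)" shows "compact {Y :: real^'n^'m. \<forall>i. Y $ i \<in> K}"
proof -
 have "closed {Y :: real^'n^'m. \<forall>i. Y $ i \<in> K}"
 proof -
  have "{Y :: real^'n^'m. \<forall>i. Y $ i \<in> K} = (\<Inter>i. (\<lambda>Y. Y $ i) -` K)" by auto
  also have "closed \<dots>"
   by (intro closed_INT ballI closed_vimage compact_imp_closed assms continuous_intros)
  finally show ?thesis .
 qed
 moreover have "bounded {Y :: real^'n^'m. \<forall>i. Y $ i \<in> K}"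
 proof -
  obtain b where b: "\<And>y. y \<in> K ==> norm y \<le> b"
   using compact_imp_bounded[OF assms] by (auto simp: bounded_iff)
  have "norm Y \<le> CARD('m) * b" if "\<forall>i. Y $ i \<in> K" for Y :: "real^'n^'m"
  proof -
   have "norm Y \<le> (\<Sum>i\<in>UNIV. norm (Y $ i))" unfolding norm_vec_def by (rule L2_set_le_sum) simp
   also have "\<dots> \<le> (\<Sum>i\<in>(UNIV::'m set). b)" by (intro sum_mono b) (use that in auto)
   finally show ?thesis by simp
  qed
  thus ?thesis by (auto simp: bounded_iff)
 qed
 ultimately show ?thesis by (simp add: compact_eq_bounded_closed)
qed

text \<open>Take a simplex of maximal volume with vertices in \<open>K\<close>. Replacing vertex
  \<open>k\<close> by \<open>y = y0 + B *v c\<close> multiplies the volume by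
  \<open>\<bar>c $ k\<bar>\<close>, so this factor is at most 1. Thus \<open>K\<close> lies between
  a simplex and a parallelepiped of the same frame, up to a dimensional factor the information in
  John's lemma.\<close>

lemma max_simplex:
 fixes K :: "(real^'n) set"
 assumes K: "compact K" "convex K" and int: "ball p rho \<subseteq> K" "0 < rho"
 obtains y0 and B :: "real^'n^'n" where "det B \<noteq> 0"
  "\<And>c. (\<forall>i. 0 \<le> c $ i) ==> (\<Sum>i\<in>UNIV. c $ i) \<le> 1 ==> y0 + B *v c \<in> K"
  "\<And>y. y \<in> K ==> \<exists>c. (\<forall>i. \<bar>c $ i\<bar> \<le> 1) \<and> y = y0 + B *v c"
proof -
 define T where "T = K \<times> {Y :: real^'n^'n. \<forall>i. Y $ i \<in> K}"
 define d where "d = (\<lambda>(y, Y). \<bar>det ((\<chi> i. Y $ i - y) :: real^'n^'n)\<bar>)"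
 have "compact T" unfolding T_def by (intro compact_Times compact_rows K)
 moreover have "continuous_on T d" unfolding d_def case_prod_unfold det_def by (intro continuous_intros)
 moreover have "(p, \<chi> i. p + (rho / 2) *\<^sub>R axis i 1) \<in> T"
  using int by (auto simp: T_def dist_norm)
 ultimately obtain t where t: "t \<in> T" "\<And>s. s \<in> T ==> d s \<le> d t"
  using continuous_attains_sup[of T d] by blast
 obtain y0 Y where tY: "t = (y0, Y)" by force
 define A :: "real^'n^'n" where "A = (\<chi> i. Y $ i - y0)"
 define B where "B = transpose A"
 \<comment> \<open>A small coordinate simplex inside the ball shows that the maximal volume is
   positive.\<close>
 have "0 < d (p, \<chi> i. p + (rho / 2) *\<^sub>R axis i 1)"
 proof -
  have "(\<chi> i. (p + (rho / 2) *\<^sub>R axis i 1) - p) = (rho / 2) *\<^sub>R (mat 1 :: real^'n^'n)"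
   by (simp add: vec_eq_iff mat_def axis_def)
  thus ?thesis using int(2) by (simp add: d_def det_scaleR_mat1)
 qed
 also have "\<dots> \<le> d t" by (rule t(2)) fact
 finally have "det A \<noteq> 0" by (simp add: tY d_def A_def)
 hence detB: "det B \<noteq> 0" by (simp add: B_def)
 have y0: "y0 \<in> K" and Y: "\<And>i. Y $ i \<in> K" using t(1) by (auto simp: tY T_def)
 have Bc: "B *v c = (\<Sum>i\<in>UNIV. c $ i *\<^sub>R (Y $ i - y0))" for c
  by (simp add: B_def matrix_mult_sum A_def column_def transpose_def vec_eq_iff)
 have 1: "y0 + B *v c \<in> K" if c: "\<forall>i. 0 \<le> c $ i" "(\<Sum>i\<in>UNIV. c $ i) \<le> 1" for c
 proof -
  let ?s = "\<Sum>i\<in>UNIV. c $ i"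
  have s0: "0 \<le> ?s" using c by (simp add: sum_nonneg)
  show ?thesis
  proof (cases "?s = 0")
   case True
   hence "c = 0" using c by (simp add: sum_nonneg_eq_0_iff vec_eq_iff)
   thus ?thesis using y0 by simp
  next
   case False
   have z: "(\<Sum>i\<in>UNIV. (c $ i / ?s) *\<^sub>R (Y $ i)) \<in> K" using False s0 c
    by (intro convex_sum K Y) (auto simp: sum_divide_distrib[symmetric] divide_nonneg_nonneg)
   have "(1 - ?s) *\<^sub>R y0 + ?s *\<^sub>R (\<Sum>i\<in>UNIV. (c $ i / ?s) *\<^sub>R (Y $ i)) \<in> K"
    using convexD[OF K(2) y0 z, of "1 - ?s" ?s] s0 c by simp
   moreover have "?s *\<^sub>R (\<Sum>i\<in>UNIV. (c $ i / ?s) *\<^sub>R (Y $ i)) = (\<Sum>i\<in>UNIV. c $ i *\<^sub>R Y $ i)"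
    using False by (simp add: scaleR_sum_right)
   moreover have "B *v c = (\<Sum>i\<in>UNIV. c $ i *\<^sub>R Y $ i) - ?s *\<^sub>R y0"
    by (simp add: Bc scaleR_diff_right sum_subtractf scaleR_sum_left)
   ultimately show ?thesis by (simp add: scaleR_diff_left add_diff_eq diff_add_eq)
  qed
 qed
 have 2: "\<exists>c. (\<forall>i. \<bar>c $ i\<bar> \<le> 1) \<and> y = y0 + B *v c" if y: "y \<in> K" for y
 proof -
  obtain c where c: "B *v c = y - y0" using cramer[OF detB, of _ "y - y0"] by blast
  have "\<bar>c $ k\<bar> \<le> 1" for k
  proof -
   let ?Y = "(\<chi> i. if i = k then y else Y $ i) :: real^'n^'n"
   have "(y0, ?Y) \<in> T" using y y0 Y by (auto simp: T_def)
   hence le: "d (y0, ?Y) \<le> \<bar>det A\<bar>" using t(2)[of "(y0, ?Y)"] by (simp add: tY d_def A_def)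
   have "(\<Sum>i\<in>UNIV. c $ i *s row i A) = y - y0" using c by (simp add: Bc A_def row_def vec_eq_iff)
   hence "(\<chi> i. ?Y $ i - y0) = (\<chi> i. if i = k then sum (\<lambda>i. c $ i *s row i A) UNIV else row i A)"
    by (simp add: vec_eq_iff A_def row_def)
   hence "d (y0, ?Y) = \<bar>c $ k * det A\<bar>"
    unfolding d_def by (simp only: case_prod_conv cramer_lemma_transpose)
   thus ?thesis using le \<open>det A \<noteq> 0\<close> by (simp add: abs_mult)
  qed
  moreover have "y = y0 + B *v c" using c by simp
  ultimately show ?thesis by blast
 qed
 show ?thesis using that[OF detB 1 2] by blast
qed

section \<open>Functions of class C2 and the comparison principle\<close>

text \<open>Gradient and Hessian are explicit arguments, so that differences with affine and
  quadratic functions carry their derivatives by computation.\<close>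

definition C2fun :: "(real^'n::finite) set => (real^'n => real) => (real^'n => real^'n)
  => (real^'n => real^'n^'n) => bool" where
 "C2fun U f g A \<longleftrightarrow> open U \<and> (\<forall>x\<in>U. (f has_derivative (\<lambda>v. g x \<bullet> v)) (at x)) \<and>
   (\<forall>x\<in>U. (g has_derivative (\<lambda>v. A x *v v)) (at x)) \<and> continuous_on U A \<and>
   (\<forall>x\<in>U. transpose (A x) = A x)"

lemma C2fun_subset: "C2fun U f g A ==> V \<subseteq> U ==> open V ==> C2fun V f g A"
 unfolding C2fun_def by (meson continuous_on_subset subset_eq)

lemma C2fun_diff:
 assumes "C2fun U f g A" "C2fun U f' g' A'"
 shows "C2fun U (\<lambda>x. f x - f' x) (\<lambda>x. g x - g' x) (\<lambda>x. A x - A' x)"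
 using assms unfolding C2fun_def by (auto intro!: derivative_eq_intros continuous_intros
   simp: inner_diff_left matrix_vector_mult_diff_rdistrib transpose_diff)

lemma C2fun_diff_affine:
 assumes "C2fun U f g A"
 shows "C2fun U (\<lambda>x. f x - q \<bullet> x - r) (\<lambda>x. g x - q) A" using assms unfolding C2fun_def
 by (auto intro!: derivative_eq_intros simp: inner_diff_left)

lemma bounded_linear_mat: "bounded_linear (\<lambda>v. M *v v)" for M :: "real^'n^'m" by simp

lemma continuous_on_mat [continuous_intros]:
 "continuous_on S f ==> continuous_on S (\<lambda>x. M *v f x)" for M :: "real^'n^'m"
 by (rule bounded_linear.continuous_on[OF bounded_linear_mat])

lemma C2fun_quadratic:
 assumes "open U" "transpose M = M"
 shows "C2fun U (\<lambda>x. 1 / 2 * ((x - p) \<bullet> (M *v (x - p))) + q \<bullet> x + r) (\<lambda>x. M *v (x - p) + q) (\<lambda>x. M)"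
proof -
 define h where "h = (\<lambda>x. M *v (x - p))"
 have h: "(h has_derivative (\<lambda>v. M *v v)) (at x)" for x unfolding h_def
  by (rule bounded_linear.has_derivative[OF bounded_linear_mat]) (auto intro!: derivative_eq_intros)
 have "((\<lambda>x. 1 / 2 * ((x - p) \<bullet> h x) + q \<bullet> x + r) has_derivative
   (\<lambda>v. 1 / 2 * ((x - p) \<bullet> (M *v v) + v \<bullet> h x) + q \<bullet> v)) (at x)" for x
  by (rule derivative_eq_intros h refl)+ simp
 moreover have "1 / 2 * ((x - p) \<bullet> (M *v v) + v \<bullet> h x) + q \<bullet> v = (h x + q) \<bullet> v" for x v
 proof -
  have "(x - p) \<bullet> (M *v v) = h x \<bullet> v"
   unfolding h_def by (metis sym_inner[OF assms(2)] inner_commute)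
  moreover have "v \<bullet> h x = h x \<bullet> v" by (rule inner_commute)
  ultimately show ?thesis by (simp add: inner_add_left)
 qed
 moreover have "((\<lambda>x. h x + q) has_derivative (\<lambda>v. M *v v)) (at x)" for x
  by (auto intro!: derivative_eq_intros h)
 ultimately have "C2fun U (\<lambda>x. 1 / 2 * ((x - p) \<bullet> h x) + q \<bullet> x + r) (\<lambda>x. h x + q) (\<lambda>x. M)"
  unfolding C2fun_def using assms by simp
 thus ?thesis unfolding h_def .
qed

lemma DERIV_along_line:
 assumes "(f has_derivative f') (at (x + t *\<^sub>R u))"
 shows "((\<lambda>t. f (x + t *\<^sub>R u)) has_real_derivative f' u) (at t)"
proof -
 have "((\<lambda>t. f (x + t *\<^sub>R u)) has_derivative (\<lambda>h. f' (h *\<^sub>R u))) (at t)"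
  by (rule has_derivative_compose[where g = f and f = "\<lambda>t. x + t *\<^sub>R u"]) (auto intro!: derivative_eq_intros assms)
 thus ?thesis unfolding has_field_derivative_def
  by (rule has_derivative_eq_rhs) (simp add: fun_eq_iff linear_scale[OF has_derivative_linear[OF assms]])
qed

lemma convex_above_tangent:
 assumes "convex_on S f" "(f has_derivative f') (at x)" "x \<in> S" "y \<in> S"
 shows "f' (y - x) \<le> f y - f x"
proof -
 have "((\<lambda>t. f (x + t *\<^sub>R (y - x))) has_real_derivative f' (y - x)) (at 0)"
  by (rule DERIV_along_line) (use assms(2) in simp)
 hence "((\<lambda>t. (f (x + t *\<^sub>R (y - x)) - f x) / t) \<longlongrightarrow> f' (y - x)) (at 0)"
  by (simp add: DERIV_def)
 hence lim: "((\<lambda>t. (f (x + t *\<^sub>R (y - x)) - f x) / t) \<longlongrightarrow> f' (y - x)) (at_right 0)"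
  by (rule filterlim_mono) (auto simp: at_le)
 show ?thesis
 proof (rule tendsto_upperbound[OF lim])
  have "(f (x + t *\<^sub>R (y - x)) - f x) / t \<le> f y - f x" if "0 < t" "t < 1" for t
  proof -
   have "f ((1 - t) *\<^sub>R x + t *\<^sub>R y) \<le> (1 - t) * f x + t * f y"
    using assms that by (auto simp: convex_on_def)
   moreover have "(1 - t) *\<^sub>R x + t *\<^sub>R y = x + t *\<^sub>R (y - x)" by (simp add: algebra_simps)
   ultimately have "f (x + t *\<^sub>R (y - x)) - f x \<le> (f y - f x) * t" by (simp add: algebra_simps)
   thus ?thesis using that by (simp add: pos_divide_le_eq)
  qed
  thus "\<forall>\<^sub>F t in at_right 0. (f (x + t *\<^sub>R (y - x)) - f x) / t \<le> f y - f x"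
   unfolding eventually_at_right_field by (intro exI[of _ 1]) auto
 qed simp
qed

lemma C2fun_min:
 assumes "C2fun U f g A" "x \<in> U" and min: "\<And>y. y \<in> U ==> f x \<le> f y"
 shows "g x = 0" "psd (A x)"
proof -
 have U: "open U" and df: "\<And>y. y \<in> U ==> (f has_derivative (\<lambda>v. g y \<bullet> v)) (at y)"
  and dg: "(g has_derivative (\<lambda>v. A x *v v)) (at x)" and sy: "transpose (A x) = A x"
  using assms unfolding C2fun_def by auto
 obtain rho where rho: "0 < rho" "ball x rho \<subseteq> U" using U assms(2) open_contains_ball by blast
 have "(\<lambda>v. g x \<bullet> v) = (\<lambda>v. 0)"
  using differential_zero_maxmin[OF assms(2) U df[OF assms(2)]] min by blast
 hence "g x \<bullet> g x = 0" by metis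
 thus g0: "g x = 0" by simp
 have "0 \<le> v \<bullet> (A x *v v)" for v
 proof (rule ccontr)
  assume neg: "\<not> 0 \<le> v \<bullet> (A x *v v)"
  hence v0: "v \<noteq> 0" by auto
  have "((\<lambda>t. g (x + t *\<^sub>R v) \<bullet> v) has_real_derivative (A x *v v) \<bullet> v) (at 0)"
   using dg by (intro DERIV_along_line[where f = "\<lambda>y. g y \<bullet> v"] has_derivative_inner_left) simp
  from DERIV_neg_dec_right[OF this] neg[unfolded inner_commute[of v]] obtain d where
   d: "0 < d" "\<And>h. 0 < h ==> h < d ==> g (x + h *\<^sub>R v) \<bullet> v < 0" using g0 by auto
  define s where "s = min (d / 2) (rho / (2 * norm v))"
  have s: "0 < s" "s < d" "s * norm v < rho"
  proof -
   show "0 < s" using d rho v0 by (simp add: s_def)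
   show "s < d" using d by (simp add: s_def)
   have "s * norm v \<le> rho / (2 * norm v) * norm v" by (intro mult_right_mono) (auto simp: s_def)
   thus "s * norm v < rho" using rho v0 by simp
  qed
  have inU: "x + t *\<^sub>R v \<in> U" if "0 \<le> t" "t \<le> s" for t
  proof -
   have "t * norm v \<le> s * norm v" using that by (intro mult_right_mono) auto
   thus ?thesis using s rho(2) that by (auto simp: dist_norm)
  qed
  have "\<exists>xi. 0 < xi \<and> xi < s \<and> f (x + s *\<^sub>R v) - f (x + 0 *\<^sub>R v) = (s - 0) * (g (x + xi *\<^sub>R v) \<bullet> v)"
  proof (rule MVT2[OF s(1)])
   fix t assume t: "0 \<le> t" "t \<le> s"
   show "((\<lambda>t. f (x + t *\<^sub>R v)) has_real_derivative g (x + t *\<^sub>R v) \<bullet> v) (at t)"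
    by (intro DERIV_along_line df inU t)
  qed
  then obtain xi where "0 < xi" "xi < s" "f (x + s *\<^sub>R v) - f x = s * (g (x + xi *\<^sub>R v) \<bullet> v)" by auto
  hence "f (x + s *\<^sub>R v) < f x" using d(2)[of xi] s mult_pos_neg[of s "g (x + xi *\<^sub>R v) \<bullet> v"] by simp
  thus False using min[OF inU[of s]] s by simp
 qed
 thus "psd (A x)" using sy by (simp add: psd_def)
qed

text \<open>At an interior minimum the Hessian would be psd, so the minimum over \<open>K\<close> is
  attained outside \<open>U\<close>. Requiring a Hessian that is not psd, instead of a determinant
  inequality, serves upper and lower barriers alike.\<close>

lemma C2fun_comparison:
 assumes "C2fun U f g A" "compact K" "U \<subseteq> K" "continuous_on K f"
  and bd: "\<And>x. x \<in> K ==> x \<notin> U ==> 0 \<le> f x"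
  and npsd: "\<And>x. x \<in> U ==> \<not> psd (A x)"
  and x: "x \<in> K"
 shows "0 \<le> f x"
proof -
 obtain y where y: "y \<in> K" "\<And>z. z \<in> K ==> f y \<le> f z"
  using continuous_attains_inf[OF assms(2) _ assms(4)] x by blast
 have "y \<notin> U" using C2fun_min(2)[OF assms(1), of y] y npsd assms(3) by blast
 thus ?thesis using bd y x by force
qed

text \<open>Otherwise \<open>A\<close>, being \<open>B\<close> plus a psd matrix, would have
  determinant at least \<open>det B\<close>.\<close>

lemma not_psd_diff:
 assumes "pd B" "0 < det B" "det A < det B" shows "\<not> psd (A - B)"
 using pd_det_pos_mono[of "A - B" B] assms by auto

section \<open>Cuts of a convex function with Monge-Ampere bounds\<close>

definition ma :: "(real^'n::finite) set => real => real => (real^'n => real) => (real^'n => real^'n)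
  => (real^'n => real^'n^'n) => bool" where
 "ma U lam Lam phi g A \<longleftrightarrow> 0 < lam \<and> C2fun U phi g A \<and> convex_on U phi \<and>
   (\<forall>x\<in>U. pd (A x) \<and> lam \<le> det (A x) \<and> det (A x) \<le> Lam)"

locale cut =
 fixes U :: "(real^'n::finite) set" and lam Lam phi g A q r
 assumes ma: "ma U lam Lam phi g A"
  and compact_sublevel: "compact {x \<in> U. phi x - q \<bullet> x - r \<le> 0}"
  and nonempty: "\<exists>x\<in>U. phi x - q \<bullet> x - r < 0"
begin

definition u :: "real^'n => real" where "u x = phi x - q \<bullet> x - r"

definition K :: "(real^'n) set" where "K = {x \<in> U. u x \<le> 0}"

lemma C2: "C2fun U u (\<lambda>x. g x - q) A"
 using C2fun_diff_affine[of U phi g A q r] ma by (simp add: ma_def u_def[abs_def])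

lemma openU: "open U" and convU: "convex U" and lam: "0 < lam"
 using ma by (auto simp: ma_def C2fun_def convex_on_imp_convex)

lemma compactK: "compact K" using compact_sublevel by (simp add: K_def u_def)

lemma KU: "K \<subseteq> U" by (auto simp: K_def)

lemma detA: "x \<in> U ==> lam \<le> det (A x)" "x \<in> U ==> det (A x) \<le> Lam" "x \<in> U ==> pd (A x)"
 using ma by (auto simp: ma_def)

lemma contu: "continuous_on U u"
 using C2 by (auto simp: C2fun_def intro!: continuous_at_imp_continuous_on has_derivative_continuous)

lemma contK: "continuous_on K u" using contu KU continuous_on_subset by blast

lemma convexu: "convex_on U u"
proof -
 have cv: "convex_on U phi" using ma by (simp add: ma_def)
 show ?thesis unfolding convex_on_def
 proof (intro conjI convU ballI allI impI)
  fix x y and a b :: real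
  assume *: "x \<in> U" "y \<in> U" "0 \<le> a" "0 \<le> b" "a + b = 1"
  have "phi (a *\<^sub>R x + b *\<^sub>R y) \<le> a * phi x + b * phi y"
   using cv * unfolding convex_on_def by blast
  moreover have "r = a * r + b * r" using *(5) by (metis distrib_right mult_1)
  ultimately show "u (a *\<^sub>R x + b *\<^sub>R y) \<le> a * u x + b * u y"
   by (simp add: u_def algebra_simps)
 qed
qed

lemma convexK: "convex K"
proof (rule convexI)
 fix x y and a b :: real
 assume *: "x \<in> K" "y \<in> K" "0 \<le> a" "0 \<le> b" "a + b = 1"
 have "u (a *\<^sub>R x + b *\<^sub>R y) \<le> a * u x + b * u y"
  using convexu * unfolding convex_on_def K_def by blast
 also have "\<dots> \<le> 0" using * by (intro add_nonpos_nonpos mult_nonneg_nonpos) (auto simp: K_def)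
 finally show "a *\<^sub>R x + b *\<^sub>R y \<in> K" using * convU by (auto simp: K_def intro: convexD)
qed

lemma ball_in_K: obtains p rho where "0 < rho" "ball p rho \<subseteq> K"
proof -
 obtain x where x: "x \<in> U" "u x < 0" using nonempty by (auto simp: u_def)
 have "open (U \<inter> u -` {..<0})" using contu openU by (intro continuous_open_preimage) auto
 then obtain rho where "0 < rho" "ball x rho \<subseteq> U \<inter> u -` {..<0}" using x open_contains_ball by blast
 thus ?thesis using that[of rho x] by (force simp: K_def)
qed

section \<open>Affine frames of a cut and the two-sided relation between its depth and
  volume\<close>

definition normalizing :: "real^'n => real^'n^'n => bool" where
 "normalizing y0 B \<longleftrightarrow> det B \<noteq> 0 \<and>
  (\<forall>c. (\<forall>i. 0 \<le> c $ i) \<longrightarrow> (\<Sum>i\<in>UNIV. c $ i) \<le> 1 \<longrightarrow> y0 + B *v c \<in> K) \<and>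
  (\<forall>y\<in>K. \<exists>c. (\<forall>i. \<bar>c $ i\<bar> \<le> 1) \<and> y = y0 + B *v c)"

lemma normalizing_exists: obtains y0 B where "normalizing y0 B"
proof -
 obtain p rho where "0 < rho" "ball p rho \<subseteq> K" by (rule ball_in_K)
 thus ?thesis using max_simplex[OF compactK convexK] that unfolding normalizing_def by metis
qed

text \<open>The depth \<open>H\<close> bounds the volume of the cut. If \<open>det B\<close> were
  larger, the paraboloid that vanishes on the boundary of an inscribed ellipsoid and equals
  \<open>- 2 * H\<close> at its centre would have determinant below \<open>lam\<close>, and
  comparison would push \<open>u\<close> down to \<open>- 2 * H\<close> at the centre.\<close>

lemma normalizing_lower:
 assumes nB: "normalizing y0 B" and H: "\<And>y. y \<in> K ==> - H \<le> u y"
 shows "lam * (det B)\<^sup>2 \<le> (16 * real CARD('n) ^ 2) ^ CARD('n) * H ^ CARD('n)"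
proof (rule ccontr)
 assume neg: "\<not> ?thesis"
 let ?n = "real CARD('n)"
 have dB: "det B \<noteq> 0" using nB by (simp add: normalizing_def)
 have H0: "0 < H" using nonempty H by (fastforce simp: u_def K_def)
 obtain Bi where Bi: "B ** Bi = mat 1" "Bi ** B = mat 1" using dB by (metis invertible_def invertible_det_nz)
 have Bi': "Bi *v (B *v c) = c" "B *v (Bi *v c) = c" for c by (simp_all add: matrix_vector_mul_assoc Bi)
 \<comment> \<open>With this radius the coordinates \<open>rho + c $ i\<close> are nonnegative and
   add up to at most 1, so the ellipsoid lies in the inscribed simplex.\<close>
 define rho where "rho = 1 / (2 * ?n)"
 have r0: "0 < rho" by (simp add: rho_def)
 define p where "p = y0 + B *v (\<chi> i. rho)"
 \<comment> \<open>The factor 4 makes the quadratic part equal to \<open>2 * H\<close> on the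
   boundary of the ellipsoid.\<close>
 define k where "k = 4 * H / rho\<^sup>2"
 define M where "M = k *\<^sub>R (transpose Bi ** Bi)"
 have symM: "transpose M = M" by (simp add: M_def transpose_scaleR matrix_transpose_mul)
 have Mq: "v \<bullet> (M *v v) = k * (norm (Bi *v v))\<^sup>2" for v
 proof -
  have "v \<bullet> (transpose Bi *v (Bi *v v)) = (Bi *v v) \<bullet> (Bi *v v)"
   by (metis dot_lmul_matrix transpose_matrix_vector transpose_transpose)
  thus ?thesis by (simp add: M_def scaleR_mat_vec matrix_vector_mul_assoc[symmetric] power2_norm_eq_inner)
 qed
 have detM: "det M < lam"
 proof -
  have "det M = k ^ CARD('n) * (det Bi)\<^sup>2"
  proof -
   have "det M = det ((k *\<^sub>R mat 1) ** (transpose Bi ** Bi))"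
    by (simp only: M_def scaleR_mat_mult matrix_mul_lid)
   thus ?thesis by (simp only: det_mul det_scaleR_mat1 det_transpose power2_eq_square)
  qed
  moreover have "det B * det Bi = 1" by (metis Bi(1) det_I det_mul)
  hence "det Bi = 1 / det B" using dB by (simp add: field_simps)
  moreover have "k = 16 * ?n ^ 2 * H" by (simp add: k_def rho_def field_simps)
  ultimately have "det M * (det B)\<^sup>2 = (16 * ?n ^ 2) ^ CARD('n) * H ^ CARD('n)"
   using dB by (simp add: power_mult_distrib power_divide)
  hence "det M * (det B)\<^sup>2 < lam * (det B)\<^sup>2" using neg by simp
  thus ?thesis by (simp add: mult_less_cancel_right)
 qed
 define E where "E = (\<lambda>c. p + B *v c) ` cball 0 rho"
 define V where "V = {y. norm (Bi *v (y - p)) < rho}"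
 have EK: "E \<subseteq> K"
 proof
  fix y assume "y \<in> E"
  then obtain c where c: "norm c \<le> rho" "y = p + B *v c" by (auto simp: E_def)
  have ci: "\<bar>c $ i\<bar> \<le> rho" for i using component_le_norm_cart[of c i] c by simp
  have y: "y = y0 + B *v (\<chi> i. rho + c $ i)"
  proof -
   have "(\<chi> i. rho + c $ i) = (\<chi> i. rho) + c" by (simp add: vec_eq_iff)
   thus ?thesis by (simp add: c p_def matrix_vector_right_distrib)
  qed
  have "(\<Sum>i\<in>(UNIV::'n set). rho + c $ i) \<le> (\<Sum>i\<in>(UNIV::'n set). 2 * rho)"
   by (intro sum_mono) (use ci abs_le_D1 in force)
  also have "\<dots> = 1" by (simp add: rho_def)
  moreover have "0 \<le> rho + c $ i" for i using ci[of i] by simp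
  ultimately show "y \<in> K" using nB unfolding y normalizing_def by simp
 qed
 have inE: "norm (Bi *v (y - p)) \<le> rho \<longleftrightarrow> y \<in> E" for y
 proof
  assume "norm (Bi *v (y - p)) \<le> rho"
  thus "y \<in> E" unfolding E_def by (intro image_eqI[of _ _ "Bi *v (y - p)"]) (auto simp: Bi')
 qed (auto simp: E_def Bi')
 have VE: "V \<subseteq> E" using inE by (force simp: V_def)
 have openV: "open V" unfolding V_def by (intro open_Collect_less continuous_intros)
 have cE: "compact E" unfolding E_def by (intro compact_continuous_image continuous_intros) auto
 define ps where "ps y = 1 / 2 * ((y - p) \<bullet> (M *v (y - p))) + 0 \<bullet> y + (- 2 * H)" for y
 have psi: "C2fun V ps (\<lambda>y. M *v (y - p) + 0) (\<lambda>y. M)"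
  unfolding ps_def by (rule C2fun_quadratic[OF openV symM])
 have VU: "V \<subseteq> U" using VE EK KU by blast
 have "0 \<le> ps p - u p"
 proof (rule C2fun_comparison[OF C2fun_diff[OF psi C2fun_subset[OF C2 VU openV]] cE VE])
  show "continuous_on E (\<lambda>x. ps x - u x)"
   unfolding ps_def using EK by (intro continuous_intros continuous_on_subset[OF contK]) auto
  show "p \<in> E" using r0 by (simp add: inE[symmetric])
  show "\<not> psd (M - A y)" if "y \<in> V" for y
   using not_psd_diff[of "A y" M] detM detA[of y] lam that VU by auto
  fix y assume y: "y \<in> E" "y \<notin> V"
  hence "norm (Bi *v (y - p)) = rho" using inE[of y] by (simp add: V_def)
  hence "ps y = 0" using r0 unfolding ps_def Mq by (simp add: k_def)
  thus "0 \<le> ps y - u y" using y EK by (auto simp: K_def)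
 qed
 moreover have "ps p = - 2 * H" by (simp add: ps_def)
 moreover have "p \<in> K" using EK inE[of p] r0 by auto
 ultimately show False using H[of p] H0 by simp
qed

lemma measure_K:
 assumes nB: "normalizing y0 B"
 shows "measure lebesgue K \<le> 2 ^ CARD('n) * \<bar>det B\<bar>"
proof -
 let ?b = "cbox (- 1) (1 :: real^'n)"
 let ?f = "\<lambda>c. y0 + B *v c"
 have sub: "K \<subseteq> ?f ` ?b"
 proof
  fix y assume "y \<in> K"
  then obtain c where c: "\<forall>i. \<bar>c $ i\<bar> \<le> 1" "y = ?f c" using nB by (auto simp: normalizing_def)
  hence "c \<in> ?b" by (auto simp: mem_box_cart abs_le_iff)
  thus "y \<in> ?f ` ?b" using c by blast
 qed
 have der: "(?f has_derivative (\<lambda>v. B *v v)) (at c)" for c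
  by (auto intro!: derivative_eq_intros bounded_linear_imp_has_derivative)
 have "compact (?f ` ?b)" by (intro compact_continuous_image continuous_intros) auto
 hence "measure lebesgue K \<le> measure lebesgue (?f ` ?b)"
  using sub compactK by (intro measure_mono_fmeasurable) (auto intro: lmeasurable_compact fmeasurableD)
 also have "\<dots> \<le> \<bar>det B\<bar> * measure lebesgue ?b"
  by (rule measure_compact_differentiable_image[of _ _ "\<lambda>_. B"]) (auto intro: der)
 also have "measure lebesgue ?b = 2 ^ CARD('n)" by (simp add: content_cbox_if_cart interval_ne_empty_cart)
 finally show ?thesis by (simp add: mult.commute)
qed

text \<open>Aleksandrov's argument: a slope whose linear function rises by less than
  \<open>- u x\<close> from \<open>x\<close> within \<open>K\<close> is a value of the gradient, so
  these slopes fill a volume of at most \<open>Lam\<close> times that of \<open>K\<close>. Since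
  \<open>K\<close> extends at most \<open>dlt\<close> beyond \<open>x\<close> in direction
  \<open>e\<close>, slopes along \<open>e\<close> of size \<open>- u x / dlt\<close> are admissible;
  this gain produces the factor \<open>dlt\<close> in the estimate.\<close>

lemma normalizing_upper:
 assumes nB: "normalizing y0 B" and x: "x \<in> K" "u x < 0" and z: "z \<in> K"
  and d: "\<And>y. y \<in> K ==> e \<bullet> (y - x) \<le> dlt" and W: "W \<le> e \<bullet> (x - z)"
 shows "(- u x) ^ CARD('n) * W \<le> 2 * (8 * real CARD('n)) ^ CARD('n) * Lam * (det B)\<^sup>2 * dlt"
proof -
 let ?n = "real CARD('n)"
 have n0: "0 < ?n" by simp
 have Lam0: "0 < Lam" using detA[of x] lam x by (auto simp: K_def)
 have d0: "0 \<le> dlt" using d[OF x(1)] by simp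
 show ?thesis
 proof (cases "W \<le> 0")
  case True
  hence "(- u x) ^ CARD('n) * W \<le> 0" using x by (intro mult_nonneg_nonpos) auto
  also have "0 \<le> 2 * (8 * ?n) ^ CARD('n) * Lam * (det B)\<^sup>2 * dlt" using Lam0 d0 by simp
  finally show ?thesis .
 next
  case W0: False
  define m where "m = - u x"
  have m0: "0 < m" using x by (simp add: m_def)
  have e0: "e \<noteq> 0" using W W0 by auto
  have dpos: "0 < dlt"
  proof -
   have "open (U \<inter> u -` {..<0})" using contu openU by (intro continuous_open_preimage) auto
   moreover have "x \<in> U \<inter> u -` {..<0}" using x by (auto simp: K_def)
   ultimately obtain rho where rho: "0 < rho" "ball x rho \<subseteq> U \<inter> u -` {..<0}"
    using open_contains_ball by blast
   let ?y = "x + (rho / (2 * norm e)) *\<^sub>R e"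
   have "?y \<in> ball x rho" using rho by (simp add: dist_norm)
   hence "?y \<in> K" using rho by (force simp: K_def)
   from d[OF this] have "rho / (2 * norm e) * (e \<bullet> e) \<le> dlt" by simp
   moreover have "0 < rho / (2 * norm e) * (e \<bullet> e)" using rho e0 by simp
   ultimately show ?thesis by simp
  qed
  have dB: "det B \<noteq> 0" using nB by (simp add: normalizing_def)
  obtain Bi where Bi: "B ** Bi = mat 1" "Bi ** B = mat 1" using dB by (metis invertible_def invertible_det_nz)
  have Bi': "Bi *v (B *v c) = c" for c by (simp add: matrix_vector_mul_assoc Bi)
  have coord: "\<exists>c. y - x = B *v c \<and> (\<forall>i. \<bar>c $ i\<bar> \<le> 2)" if y: "y \<in> K" "x \<in> K" for x y
  proof -
   obtain c c' where c: "\<forall>i. \<bar>c $ i\<bar> \<le> 1" "y = y0 + B *v c" "\<forall>i. \<bar>c' $ i\<bar> \<le> 1" "x = y0 + B *v c'"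
    using nB y unfolding normalizing_def by meson
   have "\<bar>(c - c') $ i\<bar> \<le> 2" for i using c(1)[rule_format, of i] c(3)[rule_format, of i] by simp
   thus ?thesis using c by (intro exI[of _ "c - c'"]) (simp add: matrix_vector_mult_diff_distrib)
  qed
  define ep where "ep = transpose B *v e"
  have eps: "e \<bullet> (B *v c) = ep \<bullet> c" for c
   unfolding ep_def by (simp only: transpose_matrix_vector dot_lmul_matrix)
  have eps': "transpose Bi *v ep = e" unfolding ep_def
   by (simp only: matrix_vector_mul_assoc matrix_transpose_mul[symmetric] Bi transpose_mat
     matrix_vector_mul_lid)
  \<comment> \<open>Some frame direction carries a fair share of the width \<open>W\<close> of
    \<open>K\<close> in direction \<open>e\<close>; its dual vector is the one exchanged for
    \<open>e\<close>.\<close>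
  obtain i where i: "W \<le> 2 * ?n * \<bar>ep $ i\<bar>"
  proof -
   obtain c where c: "x - z = B *v c" "\<forall>i. \<bar>c $ i\<bar> \<le> 2" using coord[OF x(1) z] by blast
   have "\<exists>i. W / ?n \<le> 2 * \<bar>ep $ i\<bar>"
   proof (rule ccontr)
    assume "\<not> ?thesis"
    hence lt: "2 * \<bar>ep $ i\<bar> < W / ?n" for i by (simp add: not_le)
    have "W \<le> ep \<bullet> c" using W c eps by simp
    also have "\<dots> \<le> (\<Sum>i\<in>UNIV. \<bar>ep $ i\<bar> * 2)" unfolding inner_vec_def
    proof (rule sum_mono)
     fix i
     have "ep $ i \<bullet> c $ i \<le> \<bar>ep $ i\<bar> * \<bar>c $ i\<bar>" by (simp add: abs_mult[symmetric])
     also have "\<dots> \<le> \<bar>ep $ i\<bar> * 2" using c by (intro mult_left_mono) auto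
     finally show "ep $ i \<bullet> c $ i \<le> \<bar>ep $ i\<bar> * 2" .
    qed
    also have "\<dots> < (\<Sum>i\<in>(UNIV::'n set). W / ?n)"
     by (rule sum_strict_mono) (use lt in \<open>auto simp: mult.commute\<close>)
    finally show False by simp
   qed
   thus ?thesis using that by (auto simp: field_simps)
  qed
  have ei: "ep $ i \<noteq> 0" using i W0 by auto
  \<comment> \<open>The columns are the dual frame with column \<open>i\<close> replaced by
    \<open>e\<close>; Cramer's rule gives the determinant because \<open>ep\<close> are the
    coordinates of \<open>e\<close> in the dual frame.\<close>
  define L where "L = (\<chi> k j. if j = i then (transpose Bi *v ep) $ k else (transpose Bi) $ k $ j)"
  have detL: "det L = ep $ i / det B"
  proof -
   have "det L = ep $ i * det (transpose Bi)" unfolding L_def by (rule cramer_lemma)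
   moreover have "det B * det Bi = 1" by (metis Bi(1) det_I det_mul)
   ultimately show ?thesis using dB by (simp add: field_simps)
  qed
  hence "det L \<noteq> 0" using ei dB by simp
  then obtain Li where Li: "L ** Li = mat 1" "Li ** L = mat 1" by (metis invertible_def invertible_det_nz)
  have detLi: "det Li = det B / ep $ i"
  proof -
   have "det L * det Li = 1" by (metis Li(1) det_I det_mul)
   thus ?thesis using detL dB by simp
  qed
  \<comment> \<open>The component along \<open>e\<close> raises the slope function by at most
    \<open>m / 4\<close> thanks to \<open>dlt\<close>; the others together add at most
    \<open>m / 4\<close>, since frame coordinates of differences within \<open>K\<close> are at most
    2.\<close>
  define l :: "real^'n" where "l = (\<chi> j. if j = i then 0 else - m / (8 * ?n))"
  define h :: "real^'n" where "h = (\<chi> j. if j = i then m / (4 * dlt) else m / (8 * ?n))"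
  have slope: "(L *v t) \<bullet> (y - x) < m" if t: "t \<in> cbox l h" and y: "y \<in> K" for t y
  proof -
   obtain c where c: "y - x = B *v c" "\<forall>i. \<bar>c $ i\<bar> \<le> 2" using coord[OF y x(1)] by blast
   have Lt: "L *v t = t $ i *\<^sub>R e + transpose Bi *v (\<chi> j. if j = i then 0 else t $ j)"
   proof (subst vec_eq_iff, intro allI)
    fix k
    have "(L *v t) $ k = (\<Sum>j\<in>UNIV. (if j = i then t $ i * e $ k else 0) +
      transpose Bi $ k $ j * (if j = i then 0 else t $ j))"
     unfolding L_def matrix_vector_mult_def[of _ t] vec_lambda_beta eps' by (rule sum.cong) auto
    thus "(L *v t) $ k = (t $ i *\<^sub>R e + transpose Bi *v (\<chi> j. if j = i then 0 else t $ j)) $ k"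
     by (simp add: sum.distrib matrix_vector_mult_def)
   qed
   have ti: "0 \<le> t $ i" "t $ i \<le> m / (4 * dlt)" and tj: "j \<noteq> i ==> \<bar>t $ j\<bar> \<le> m / (8 * ?n)" for j
   proof -
    have b: "l $ j \<le> t $ j" "t $ j \<le> h $ j" for j using t by (auto simp: mem_box_cart)
    show "0 \<le> t $ i" "t $ i \<le> m / (4 * dlt)" using b[of i] by (simp_all add: l_def h_def)
    show "\<bar>t $ j\<bar> \<le> m / (8 * ?n)" if "j \<noteq> i" using b[of j] that by (simp add: l_def h_def)
   qed
   have "(L *v t) \<bullet> (y - x) = t $ i * (e \<bullet> (y - x)) +
     (transpose Bi *v (\<chi> j. if j = i then 0 else t $ j)) \<bullet> (B *v c)"
    by (simp only: Lt inner_add_left inner_scaleR_left c)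
   also have "(transpose Bi *v (\<chi> j. if j = i then 0 else t $ j)) \<bullet> (B *v c) =
     (\<chi> j. if j = i then 0 else t $ j) \<bullet> c"
    by (simp only: Bi' transpose_matrix_vector dot_lmul_matrix)
   also have "\<dots> \<le> (\<Sum>j\<in>(UNIV::'n set). m / (8 * ?n) * 2)" unfolding inner_vec_def
   proof (rule sum_mono)
    fix j
    have "(if j = i then 0 else t $ j) * c $ j \<le> \<bar>if j = i then 0 else t $ j\<bar> * \<bar>c $ j\<bar>"
     by (metis abs_ge_self abs_mult)
    also have "\<dots> \<le> m / (8 * ?n) * 2" using tj c(2) m0 by (intro mult_mono) auto
    finally show "(\<chi> j. if j = i then 0 else t $ j) $ j \<bullet> c $ j \<le> m / (8 * ?n) * 2" by simp
   qed
   also have "\<dots> = m / 4" by simp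
   also have "t $ i * (e \<bullet> (y - x)) \<le> t $ i * dlt" using ti d[OF y] by (intro mult_left_mono)
   also have "t $ i * dlt \<le> m / (4 * dlt) * dlt" using ti dpos by (intro mult_right_mono) auto
   also have "m / (4 * dlt) * dlt = m / 4" using dpos by simp
   finally show ?thesis using m0 by simp
  qed
  define F where "F y = Li *v (g y - q)" for y
  have dg: "((\<lambda>y. g y - q) has_derivative (\<lambda>v. A y *v v)) (at y)" if "y \<in> K" for y
   using C2 that KU by (auto simp: C2fun_def)
  have dF: "(F has_derivative (\<lambda>v. (Li ** A y) *v v)) (at y)" if "y \<in> K" for y
   unfolding F_def using bounded_linear.has_derivative[OF bounded_linear_mat dg[OF that], of Li]
   by (simp add: matrix_vector_mul_assoc)
  have sub: "cbox l h \<subseteq> F ` K"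
  proof
   fix t assume t: "t \<in> cbox l h"
   \<comment> \<open>By \<open>slope\<close>, a minimum point has \<open>u y < 0\<close>, hence is
     interior, and there the gradient equals the prescribed slope.\<close>
   let ?f = "\<lambda>y. u y - (L *v t) \<bullet> y - 0"
   have "continuous_on K ?f" by (intro continuous_intros contK)
   then obtain y where y: "y \<in> K" "\<And>z. z \<in> K ==> ?f y \<le> ?f z"
    using continuous_attains_inf[OF compactK] x(1) by blast
   have uy: "u y < 0" using y(2)[OF x(1)] slope[OF t y(1)] by (simp add: m_def inner_diff_right)
   have opn: "open (U \<inter> u -` {..<0})" using contu openU by (intro continuous_open_preimage) auto
   have "C2fun (U \<inter> u -` {..<0}) ?f (\<lambda>y. (g y - q) - L *v t) A"
    by (rule C2fun_diff_affine[OF C2fun_subset[OF C2 _ opn]]) blast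
   from C2fun_min(1)[OF this, of y] have "g y - q - L *v t = 0" using y uy by (force simp: K_def)
   hence "F y = Li *v (L *v t)" by (simp add: F_def)
   hence "F y = t" by (simp add: matrix_vector_mul_assoc Li)
   thus "t \<in> F ` K" using y by blast
  qed
  have contA: "continuous_on K A" using C2 KU by (auto simp: C2fun_def intro: continuous_on_subset)
  have "continuous_on K (\<lambda>y. Li ** A y)"
   unfolding matrix_matrix_mult_def using contA by (intro continuous_intros)
  note im = measure_compact_differentiable_image[OF compactK dF this, of "\<bar>det Li\<bar> * Lam"]
  have "compact (F ` K)" by (intro compact_continuous_image compactK continuous_at_imp_continuous_on ballI
     has_derivative_continuous[OF dF])
  hence "measure lebesgue (cbox l h) \<le> measure lebesgue (F ` K)"
   using sub by (intro measure_mono_fmeasurable) (auto intro: lmeasurable_compact)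
  also have "\<dots> \<le> \<bar>det Li\<bar> * Lam * measure lebesgue K"
  proof (rule im)
   fix y assume "y \<in> K"
   hence "\<bar>det (A y)\<bar> \<le> Lam" using detA[of y] lam KU by auto
   thus "\<bar>det (Li ** A y)\<bar> \<le> \<bar>det Li\<bar> * Lam"
    by (simp add: det_mul abs_mult mult_left_mono)
  qed
  also have "\<dots> \<le> \<bar>det Li\<bar> * Lam * (2 ^ CARD('n) * \<bar>det B\<bar>)"
   using Lam0 by (intro mult_left_mono measure_K[OF nB]) auto
  also have "\<dots> = 2 ^ CARD('n) * Lam * (det B)\<^sup>2 / \<bar>ep $ i\<bar>"
   by (simp add: detLi power2_eq_square flip :)
  also have "\<dots> \<le> 2 ^ CARD('n) * Lam * (det B)\<^sup>2 / (W / (2 * ?n))"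
   using i W0 Lam0 by (intro divide_left_mono mult_pos_pos) (auto simp: field_simps)
  finally have le: "measure lebesgue (cbox l h) \<le> 2 ^ CARD('n) * Lam * (det B)\<^sup>2 / (W / (2 * ?n))" .
  have "measure lebesgue (cbox l h) = (\<Prod>j\<in>UNIV. if j = i then m / (4 * dlt) else m / (4 * ?n))"
  proof -
   have "cbox l h \<noteq> {}" using m0 dpos by (auto simp: interval_ne_empty_cart l_def h_def)
   hence "measure lebesgue (cbox l h) = (\<Prod>j\<in>UNIV. h $ j - l $ j)"
    by (simp add: content_cbox_if_cart)
   also have "\<dots> = (\<Prod>j\<in>UNIV. if j = i then m / (4 * dlt) else m / (4 * ?n))"
    by (rule prod.cong) (auto simp: l_def h_def field_simps)
   finally show ?thesis .
  qed
  also have "\<dots> = m / (4 * dlt) * (m / (4 * ?n)) ^ (CARD('n) - 1)"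
   by (subst prod.remove[of _ i]) (auto simp: card_Diff_singleton intro!: prod.cong)
  also have "\<dots> = m ^ CARD('n) * ?n / (dlt * (4 * ?n) ^ CARD('n))"
  proof -
   define a b where "a = (4 * ?n) ^ (CARD('n) - 1)" and "b = m ^ (CARD('n) - 1)"
   have "(4 * ?n) ^ CARD('n) = a * (4 * ?n)" "m ^ CARD('n) = b * m"
    unfolding a_def b_def by (rule power_minus_mult[symmetric], simp)+
   moreover have "(m / (4 * ?n)) ^ (CARD('n) - 1) = b / a" unfolding a_def b_def by (rule power_divide)
   ultimately show ?thesis by (simp add: mult_ac)
  qed
  finally have le': "m ^ CARD('n) * ?n / (dlt * (4 * ?n) ^ CARD('n)) \<le>
    2 ^ CARD('n) * Lam * (det B)\<^sup>2 / (W / (2 * ?n))" using le by simp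
  have gen: "X * W \<le> 2 * (P * Q) * L * D * d"
   if "X * n / (d * Q) \<le> P * L * D / (W / (2 * n))" "0 < n" "0 < d" "0 < Q" "0 < W"
   for X n d Q P L D W :: real using that by (simp add: field_simps)
  have "m ^ CARD('n) * W \<le> 2 * (2 ^ CARD('n) * (4 * ?n) ^ CARD('n)) * Lam * (det B)\<^sup>2 * dlt"
   by (rule gen[OF le']) (use W0 dpos n0 in \<open>auto intro!: zero_less_power\<close>)
  moreover have "2 ^ CARD('n) * (4 * ?n) ^ CARD('n) = (8 * ?n) ^ CARD('n)"
   by (subst power_mult_distrib[symmetric]) simp
  ultimately show ?thesis by (simp only: m_def)
 qed
qed

text \<open>Take for \<open>e\<close> a coordinate functional of the frame. It varies by at most 2
  from \<open>x\<close> over \<open>K\<close>, and its values at two vertices differ by 1, so one of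
  them is at distance at least 1/2 from \<open>x\<close> in this direction.\<close>

lemma normalizing_upper':
 assumes nB: "normalizing y0 B" and x: "x \<in> K" "u x < 0"
 shows "(- u x) ^ CARD('n) \<le> 8 * (8 * real CARD('n)) ^ CARD('n) * Lam * (det B)\<^sup>2"
proof -
 obtain i :: 'n where True by blast
 have dB: "det B \<noteq> 0" using nB by (simp add: normalizing_def)
 obtain Bi where Bi: "B ** Bi = mat 1" "Bi ** B = mat 1" using dB by (metis invertible_def invertible_det_nz)
 define e where "e = transpose Bi *v axis i 1"
 have e: "e \<bullet> (B *v c) = c $ i" for c
 proof -
  have "Bi *v (B *v c) = c" by (simp add: matrix_vector_mul_assoc Bi)
  thus ?thesis unfolding e_def by (simp add: dot_lmul_matrix inner_axis')
 qed
 obtain c where c: "\<forall>i. \<bar>c $ i\<bar> \<le> 1" "x = y0 + B *v c" using nB x by (auto simp: normalizing_def)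
 have ed: "e \<bullet> (y - x) \<le> 2" "- e \<bullet> (y - x) \<le> 2" if y: "y \<in> K" for y
 proof -
  obtain c' where c': "\<forall>i. \<bar>c' $ i\<bar> \<le> 1" "y = y0 + B *v c'" using nB y by (auto simp: normalizing_def)
  have "e \<bullet> (y - x) = c' $ i - c $ i" by (simp add: c' c inner_diff_right e)
  thus "e \<bullet> (y - x) \<le> 2" "- e \<bullet> (y - x) \<le> 2"
   using c(1)[rule_format, of i] c'(1)[rule_format, of i] by auto
 qed
 have simp: "y0 + B *v c \<in> K" if "\<forall>i. 0 \<le> c $ i" "(\<Sum>i\<in>UNIV. c $ i) \<le> 1" for c
  using nB that unfolding normalizing_def by blast
 have z: "y0 + B *v 0 \<in> K" "y0 + B *v axis i 1 \<in> K" by (rule simp; simp add: axis_def)+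
 have "(- u x) ^ CARD('n) * (1 / 2) \<le> 2 * (8 * real CARD('n)) ^ CARD('n) * Lam * (det B)\<^sup>2 * 2"
 proof (cases "1 / 2 \<le> c $ i")
  case True
  thus ?thesis by (intro normalizing_upper[OF nB x z(1) ed(1)]) (auto simp: c e)
 next
  case False
  have "- e \<bullet> (x - (y0 + B *v axis i 1)) = 1 - c $ i"
   using e[of c] e[of "axis i 1"] by (simp add: c inner_diff_right)
  thus ?thesis using False by (intro normalizing_upper[OF nB x z(2) ed(2)]) auto
 qed
 thus ?thesis by simp
qed

end

text \<open>Product of the constants of \<open>normalizing_upper\<close> and
  \<open>normalizing_lower\<close>, after elimination of the volume factor
  \<open>(det B)\<^sup>2\<close> between them.\<close>

definition key_const :: "nat => real => real => real" where
 "key_const n lam Lam = 2 * (8 * real n) ^ n * (16 * real n ^ 2) ^ n * (Lam / lam)"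

text \<open>An affine-invariant form of Aleksandrov's maximum principle: a point at which the cut is deep
 cannot be close to a supporting hyperplane of the cut.\<close>

lemma cut_depth:
 fixes U :: "(real^'n) set"
 assumes ma: "ma U lam Lam phi g A" and K: "compact {y \<in> U. phi y - q \<bullet> y - r \<le> 0}"
  and x: "x \<in> U" "phi x - q \<bullet> x - r < 0" and z: "z \<in> U" "phi z - q \<bullet> z - r \<le> 0"
  and d: "\<And>y. y \<in> U ==> phi y - q \<bullet> y - r \<le> 0 ==> e \<bullet> (y - x) \<le> dlt"
  and H: "\<And>y. y \<in> U ==> phi y - q \<bullet> y - r \<le> 0 ==> - H \<le> phi y - q \<bullet> y - r"
  and W: "W \<le> e \<bullet> (x - z)"
 shows "(- (phi x - q \<bullet> x - r)) ^ CARD('n) * W \<le> key_const CARD('n) lam Lam * H ^ CARD('n) * dlt"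
proof -
 interpret cut U lam Lam phi g A q r using ma K x by unfold_locales auto
 obtain y0 B where nB: "normalizing y0 B" by (rule normalizing_exists)
 have d0: "0 \<le> dlt" using d[of x] x by simp
 have Lam0: "0 < Lam" using detA[of x] lam x by auto
 have "(- u x) ^ CARD('n) * W \<le> 2 * (8 * real CARD('n)) ^ CARD('n) * Lam * (det B)\<^sup>2 * dlt"
  by (rule normalizing_upper[OF nB _ _ _ _ W]) (use x z d in \<open>auto simp: K_def u_def\<close>)
 also have "\<dots> = 2 * (8 * real CARD('n)) ^ CARD('n) * (Lam / lam) * (lam * (det B)\<^sup>2) * dlt"
  using lam by simp
 also have "\<dots> \<le> 2 * (8 * real CARD('n)) ^ CARD('n) * (Lam / lam) *
   ((16 * real CARD('n) ^ 2) ^ CARD('n) * H ^ CARD('n)) * dlt" using lam Lam0 d0 H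
  by (intro mult_right_mono mult_left_mono normalizing_lower[OF nB]) (auto simp: K_def u_def)
 finally show ?thesis by (simp add: u_def key_const_def mult_ac)
qed

section \<open>Sections and engulfing\<close>

text \<open>The constants form a chain: \<open>kap\<close> bounds the variation of the gradient at
  points of half depth, \<open>sg\<close> is small enough for \<open>32 * kap * sg < 1\<close>,
  which \<open>separation\<close> contradicts, and \<open>tht\<close> is small enough for
  \<open>2 * (1 + kap) * tht < sg\<close>, which \<open>sect_containment\<close> needs.\<close>

locale mafun =
 fixes U :: "(real^'n::finite) set" and lam Lam phi g A kap sg tht
 assumes ma: "ma U lam Lam phi g A" and U_ne: "U \<noteq> {}"
  and kap_def: "kap = 2 ^ CARD('n) * key_const CARD('n) lam Lam"
  and sg_def: "sg = 1 / (32 * kap + 8)"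
  and tht_def: "tht = sg / (4 * (1 + kap))"
begin

text \<open>The Bregman distance of \<open>phi\<close>: the height at \<open>y\<close> above the
  tangent plane at \<open>x\<close>.\<close>

definition breg :: "real^'n => real^'n => real" where
 "breg x y = phi y - phi x - g x \<bullet> (y - x)"

definition sect :: "real^'n => real => (real^'n) set" where
 "sect x h = {y \<in> U. breg x y < h}"

text \<open>Compactness inside the open set \<open>U\<close> says that the closed section does not
  reach the boundary.\<close>

definition room :: "real^'n => real => bool" where
 "room x h \<longleftrightarrow> x \<in> U \<and> 0 < h \<and> compact {y \<in> U. breg x y \<le> h}"

lemma openU: "open U" and convU: "convex U" and lam: "0 < lam" and conv: "convex_on U phi"
 and C2: "C2fun U phi g A" using ma by (auto simp: ma_def C2fun_def convex_on_imp_convex)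

lemma detA: "x \<in> U ==> lam \<le> det (A x)" "x \<in> U ==> det (A x) \<le> Lam" "x \<in> U ==> pd (A x)"
 using ma by (auto simp: ma_def)

lemma Lam: "lam \<le> Lam" "0 < Lam"
proof -
 obtain x where "x \<in> U" using U_ne by blast
 thus "lam \<le> Lam" using detA[of x] by simp
 thus "0 < Lam" using lam by simp
qed

lemma df: "x \<in> U ==> (phi has_derivative (\<lambda>v. g x \<bullet> v)) (at x)"
 and dg: "x \<in> U ==> (g has_derivative (\<lambda>v. A x *v v)) (at x)"
 and contA: "continuous_on U A" using C2 by (auto simp: C2fun_def)

lemma contphi: "continuous_on U phi"
 using df by (auto intro!: continuous_at_imp_continuous_on has_derivative_continuous)

lemma cont_breg: "continuous_on U (breg x)" unfolding breg_def by (intro continuous_intros contphi)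

lemma key_pos: "0 < key_const CARD('n) lam Lam" unfolding key_const_def using lam Lam by simp

lemma kap_pos: "0 < kap" using key_pos by (simp add: kap_def)

lemma sg: "0 < sg" "sg \<le> 1 / 8" "32 * kap * sg < 1" unfolding sg_def using kap_pos by auto

lemma tht: "0 < tht" "tht \<le> sg" "tht \<le> 1 / 8" "2 * (1 + kap) * tht < sg"
proof -
 show 1: "0 < tht" unfolding tht_def using sg kap_pos by simp
 have "sg = 4 * (1 + kap) * tht" using kap_pos by (simp add: tht_def)
 moreover from this show "2 * (1 + kap) * tht < sg" using sg(1) by linarith
 moreover have "0 \<le> kap * tht" using kap_pos 1 by simp
 ultimately show "tht \<le> sg" using 1 by (simp add: algebra_simps)
 thus "tht \<le> 1 / 8" using sg by simp
qed

lemma breg_nonneg: "x \<in> U ==> y \<in> U ==> 0 \<le> breg x y"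
 using convex_above_tangent[OF conv df] by (simp add: breg_def)

lemma breg_self [simp]: "breg x x = 0" by (simp add: breg_def)

lemma breg_three: "breg x z = breg x y + (g y - g x) \<bullet> (z - y) + breg y z"
 by (simp add: breg_def inner_diff_left inner_diff_right)

lemma breg_affine: "breg x y = phi y - g x \<bullet> y - (phi x - g x \<bullet> x)"
 by (simp add: breg_def inner_diff_right)

lemma breg_convex:
 assumes "y \<in> U" "z \<in> U" "0 \<le> t" "t \<le> 1"
 shows "breg x (y + t *\<^sub>R (z - y)) \<le> (1 - t) * breg x y + t * breg x z"
proof -
 have "phi ((1 - t) *\<^sub>R y + t *\<^sub>R z) \<le> (1 - t) * phi y + t * phi z"
  using conv assms by (auto simp: convex_on_def)
 moreover have "(1 - t) *\<^sub>R y + t *\<^sub>R z = y + t *\<^sub>R (z - y)" by (simp add: algebra_simps)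
 ultimately show ?thesis by (simp add: breg_affine algebra_simps)
qed

lemma segment_in_U: "y \<in> U ==> z \<in> U ==> 0 \<le> t ==> t \<le> 1 ==> y + t *\<^sub>R (z - y) \<in> U"
 using convexD_alt[OF convU, of y z t] by (simp add: algebra_simps)

lemma room_in_U: "room x h ==> x \<in> U" by (simp add: room_def)

lemma room_mono:
 assumes "room x h" "0 < h'" "h' \<le> h" shows "room x h'"
proof -
 have "{y \<in> U. breg x y \<le> h'} = {y \<in> {y \<in> U. breg x y \<le> h}. breg x y \<le> h'}" using assms by auto
 moreover have "compact {y \<in> {y \<in> U. breg x y \<le> h}. breg x y \<le> h'}"
 proof -
  have "closedin (top_of_set {y \<in> U. breg x y \<le> h}) ({y \<in> U. breg x y \<le> h} \<inter> breg x -` {..h'})"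
   by (rule continuous_closedin_preimage) (auto intro: continuous_on_subset[OF cont_breg])
  hence "compact ({y \<in> U. breg x y \<le> h} \<inter> breg x -` {..h'})"
   using assms closedin_compact unfolding room_def by blast
  moreover have "{y \<in> U. breg x y \<le> h} \<inter> breg x -` {..h'} = {y \<in> {y \<in> U. breg x y \<le> h}. breg x y \<le> h'}"
   by auto
  ultimately show ?thesis by simp
 qed
 ultimately show ?thesis using assms by (simp add: room_def)
qed

text \<open>The depth estimate for the cut of height \<open>h\<close> at \<open>x\<close>, in
  direction \<open>g y - g x\<close>: by the three-point identity the cut extends at most
  \<open>h\<close> beyond \<open>y\<close> in this direction, and \<open>y\<close> lies at depth at
  least \<open>h / 2\<close>, which accounts for the power of 2 in \<open>kap\<close>.\<close>

lemma gradient_bound: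
 assumes "room x h" "y \<in> U" "breg x y \<le> h / 2" "z \<in> U" "breg x z \<le> h"
 shows "(g y - g x) \<bullet> (y - z) \<le> kap * h"
proof -
 let ?p = "g y - g x"
 have x: "x \<in> U" and h: "0 < h" and cK: "compact {y \<in> U. breg x y \<le> h}"
  using assms(1) by (auto simp: room_def)
 have e: "phi w - g x \<bullet> w - (phi x - g x \<bullet> x + h) = breg x w - h" for w
  by (simp add: breg_affine)
 have "(- (phi y - g x \<bullet> y - (phi x - g x \<bullet> x + h))) ^ CARD('n) * (?p \<bullet> (y - z)) \<le>
   key_const CARD('n) lam Lam * h ^ CARD('n) * h"
 proof (rule cut_depth[OF ma, of "g x" "phi x - g x \<bullet> x + h" y z])
  show "compact {y \<in> U. phi y - g x \<bullet> y - (phi x - g x \<bullet> x + h) \<le> 0}" unfolding e using cK by simp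
  show "?p \<bullet> (w - y) \<le> h" if "w \<in> U" "phi w - g x \<bullet> w - (phi x - g x \<bullet> x + h) \<le> 0" for w
   using that breg_three[of x w y] breg_nonneg[OF assms(2) that(1)] breg_nonneg[OF x assms(2)]
   unfolding e by simp
  show "- h \<le> phi w - g x \<bullet> w - (phi x - g x \<bullet> x + h)" if "w \<in> U" for w
   using breg_nonneg[OF x that] unfolding e by simp
 qed (use assms h in \<open>auto simp: e\<close>)
 hence le: "(h - breg x y) ^ CARD('n) * (?p \<bullet> (y - z)) \<le> key_const CARD('n) lam Lam * h ^ CARD('n) * h"
  unfolding e by simp
 show ?thesis
 proof (cases "?p \<bullet> (y - z) \<le> 0")
  case True
  thus ?thesis using kap_pos h by (meson less_imp_le mult_nonneg_nonneg order_trans)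
 next
  case False
  have "(h / 2) ^ CARD('n) * (?p \<bullet> (y - z)) \<le> (h - breg x y) ^ CARD('n) * (?p \<bullet> (y - z))"
   using assms(3) h False by simp
  with le have "(h / 2) ^ CARD('n) * (?p \<bullet> (y - z)) \<le> key_const CARD('n) lam Lam * h ^ CARD('n) * h"
   by simp
  also have "\<dots> = (h / 2) ^ CARD('n) * (kap * h)" by (simp add: kap_def power_divide)
  finally show ?thesis using h by simp
 qed
qed

lemma engulf:
 assumes "room x h" "y \<in> U" "breg x y \<le> h / 2" "z \<in> U" "breg x z \<le> h"
 shows "breg y z \<le> (1 + kap) * h"
proof -
 have "breg y z = breg x z - breg x y + (g y - g x) \<bullet> (y - z)"
  using breg_three[of x z y] by (simp add: inner_diff_right)
 thus ?thesis using gradient_bound[OF assms] assms(5) breg_nonneg[OF room_in_U[OF assms(1)] assms(2)]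
  by (simp add: algebra_simps)
qed

text \<open>If \<open>breg y z\<close> were tiny, \<open>phi\<close> would have a kink at \<open>y\<close>: a slightly tilted cut through \<open>y\<close> would
 be deep at \<open>y\<close> although \<open>y\<close> lies close to its boundary, against the depth estimate.\<close>

lemma separation:
 assumes "room x h" "y \<in> U" "breg x y \<le> sg * h" "z \<in> U" "h \<le> breg x z"
 shows "sg * h \<le> breg y z"
proof (rule ccontr)
 assume neg: "\<not> ?thesis"
 define p where "p = g y - g x"
 \<comment> \<open>Twice \<open>sg\<close>: large enough to keep the tilted cut inside the section
   of \<open>x\<close>, small enough to keep its depth of order \<open>sg * h\<close>.\<close>
 define tau where "tau = 2 * sg"
 have x: "x \<in> U" and h: "0 < h" and cK: "compact {y \<in> U. breg x y \<le> h}"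
  using assms(1) by (auto simp: room_def)
 have tau: "0 < tau" "tau \<le> 1 / 4" using sg by (auto simp: tau_def)
 define s where "s w = p \<bullet> (w - y)" for w
 have three: "breg x w = breg x y + s w + breg y w" for w
  using breg_three[of x w y] by (simp add: s_def p_def)
 define q where "q = g y - tau *\<^sub>R p"
 define r where "r = phi y - q \<bullet> y + sg * h"
 have e: "phi w - q \<bullet> w - r = breg y w + tau * s w - sg * h" for w
  by (simp add: r_def q_def breg_def s_def algebra_simps)
 have sz: "h / 2 \<le> s z"
 proof -
  have "s z = breg x z - breg x y - breg y z" using three[of z] by simp
  also have "\<dots> \<ge> h - sg * h - sg * h" using assms neg by linarith
  also have "h - sg * h - sg * h = (1 - 2 * sg) * h" by (simp add: algebra_simps)
  also have "\<dots> \<ge> 1 / 2 * h" using sg h by simp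
  finally show ?thesis by simp
 qed
 \<comment> \<open>A point of the cut outside the section would give, on the segment from
   \<open>y\<close>, a point of the cut at height exactly \<open>h\<close>; there the three-point
   identity is incompatible with \<open>tau = 2 * sg\<close>.\<close>
 have K_sub: "breg x w \<le> h" if w: "w \<in> U" "breg y w + tau * s w \<le> sg * h" for w
 proof (rule ccontr)
  assume "\<not> breg x w \<le> h"
  define c where "c t = breg x (y + t *\<^sub>R (w - y))" for t
  have "continuous_on {0..1} c" unfolding c_def by (rule continuous_on_compose2[OF cont_breg])
    (auto intro!: continuous_intros segment_in_U assms w)
  moreover have "c 0 \<le> h" "h \<le> c 1"
  proof -
   have "sg * h \<le> 1 * h" using sg h by simp
   thus "c 0 \<le> h" using assms(3) by (simp add: c_def)
   show "h \<le> c 1" using \<open>\<not> breg x w \<le> h\<close> by (simp add: c_def)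
  qed
  ultimately obtain t where t: "0 \<le> t" "t \<le> 1" "c t = h" using IVT'[of c 0 h 1] by auto
  define w' where "w' = y + t *\<^sub>R (w - y)"
  have wU: "w' \<in> U" using segment_in_U assms w t unfolding w'_def by blast
  have st: "s w' = t * s w" by (simp add: s_def w'_def)
  have "breg y w' \<le> t * breg y w" using breg_convex[OF assms(2) w(1) t(1,2), of y] by (simp add: w'_def)
  hence "breg y w' + tau * s w' \<le> t * (breg y w + tau * s w)" by (simp add: st algebra_simps)
  also have "\<dots> \<le> t * (sg * h)" using w t by (intro mult_left_mono) auto
  also have "\<dots> \<le> 1 * (sg * h)" using t sg h by simp
  finally have 1: "breg y w' + tau * s w' \<le> sg * h" by simp
  have 2: "h = breg x y + s w' + breg y w'" using three[of w'] t by (simp add: c_def w'_def)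
  have 3: "0 \<le> breg y w'" by (rule breg_nonneg[OF assms(2) wU])
  have "tau * breg y w' \<le> 1 * breg y w'" using 3 tau by (intro mult_right_mono) auto
  hence "tau * (h - breg x y) \<le> sg * h" using 1 2 by (simp add: algebra_simps)
  moreover have "tau * (h - sg * h) \<le> tau * (h - breg x y)" using assms(3) tau by simp
  moreover have "sg * h < tau * (h - sg * h)"
  proof -
   have "tau * (h - sg * h) - sg * h = sg * h * (1 - 2 * sg)" by (simp add: tau_def algebra_simps)
   moreover have "0 < sg * h * (1 - 2 * sg)" using sg h by simp
   ultimately show ?thesis by simp
  qed
  ultimately show False by simp
 qed
 have cK': "compact {w \<in> U. phi w - q \<bullet> w - r \<le> 0}"
 proof -
  let ?K = "{w \<in> U. breg x w \<le> h}"
  have "closedin (top_of_set ?K) (?K \<inter> (\<lambda>w. phi w - q \<bullet> w - r) -` {..0})"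
   by (rule continuous_closedin_preimage) (auto intro!: continuous_intros continuous_on_subset[OF contphi])
  hence "compact (?K \<inter> (\<lambda>w. phi w - q \<bullet> w - r) -` {..0})" using cK closedin_compact by blast
  moreover have "?K \<inter> (\<lambda>w. phi w - q \<bullet> w - r) -` {..0} = {w \<in> U. phi w - q \<bullet> w - r \<le> 0}"
   using K_sub by (auto simp: e)
  ultimately show ?thesis by simp
 qed
 \<comment> \<open>The point with \<open>s\<close> equal to \<open>h / 4\<close> witnesses the width
   of the cut in direction \<open>p\<close>, while in direction \<open>- p\<close> the cut extends
   at most \<open>4 * sg * h\<close> beyond \<open>y\<close>.\<close>
 define t where "t = h / (4 * s z)"
 have t: "0 \<le> t" "t \<le> 1 / 2" "t * s z = h / 4" using sz h by (auto simp: t_def)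
 let ?z = "y + t *\<^sub>R (z - y)"
 have zU: "?z \<in> U" using segment_in_U assms t by simp
 have sz': "s ?z = h / 4" using t by (simp add: s_def)
 have bz': "breg y ?z \<le> sg * h / 2"
 proof -
  have "breg y ?z \<le> t * breg y z" using breg_convex[OF assms(2,4) t(1), of y] t by simp
  also have "\<dots> \<le> 1 / 2 * (sg * h)" using t neg breg_nonneg[OF assms(2,4)] by (intro mult_mono) auto
  finally show ?thesis by simp
 qed
 have low: "- (sg * h) \<le> s w + breg y w" if "w \<in> U" for w
  using three[of w] breg_nonneg[OF x that] assms(3) by simp
 have "(- (phi y - q \<bullet> y - r)) ^ CARD('n) * (h / 4) \<le>
   key_const CARD('n) lam Lam * (2 * (sg * h)) ^ CARD('n) * (4 * sg * h)"
 proof (rule cut_depth[OF ma cK', of y ?z "- p"])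
  show "y \<in> U" "?z \<in> U" by fact+
  show "phi y - q \<bullet> y - r < 0" using sg h by (simp add: e s_def)
  show "phi ?z - q \<bullet> ?z - r \<le> 0" unfolding e sz' using bz' by (simp add: tau_def mult.commute)
  show "h / 4 \<le> - p \<bullet> (y - ?z)" using sz' by (simp add: s_def)
  fix w assume w: "w \<in> U" "phi w - q \<bullet> w - r \<le> 0"
  hence w': "breg y w + tau * s w \<le> sg * h" by (simp add: e)
  have b: "0 \<le> breg y w" by (rule breg_nonneg[OF assms(2) w(1)])
  have "- s w \<le> 4 * sg * h"
  proof (cases "0 \<le> s w")
   case True
   thus ?thesis using sg h by (meson dual_order.trans mult_nonneg_nonneg less_imp_le neg_le_0_iff_le zero_le_numeral)
  next
   case False
   have "- tau * s w \<le> 1 / 4 * (- s w)" using False tau by simp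
   moreover have "4 * sg * h = 4 * (sg * h)" "0 < sg * h" "- tau * s w = - (tau * s w)" using sg h by auto
   ultimately show ?thesis using low[OF w(1)] w' by simp
  qed
  thus "- p \<bullet> (w - y) \<le> 4 * sg * h" by (simp add: s_def)
  have "tau * (- (sg * h)) \<le> tau * (s w + breg y w)" using low[OF w(1)] tau by (intro mult_left_mono) auto
  moreover have "tau * breg y w \<le> 1 * breg y w" using b tau by (intro mult_right_mono) auto
  moreover have "tau * (sg * h) \<le> 1 * (sg * h)" using sg h tau by simp
  ultimately have "- (sg * h) \<le> breg y w + tau * s w" by (simp add: distrib_left)
  thus "- (2 * (sg * h)) \<le> phi w - q \<bullet> w - r" unfolding e by linarith
 qed
 moreover have "- (phi y - q \<bullet> y - r) = sg * h" by (simp add: e s_def)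
 ultimately have "(sg * h) ^ CARD('n) * (h / 4) \<le> key_const CARD('n) lam Lam * (2 * (sg * h)) ^ CARD('n) * (4 * sg * h)"
  by simp
 also have "\<dots> = (sg * h) ^ CARD('n) * (4 * kap * sg * h)"
  by (simp only: kap_def power_mult_distrib[of 2]) (simp add: mult_ac)
 finally have "h / 4 \<le> 4 * kap * sg * h" using sg h by simp
 moreover have "32 * kap * sg * h < 1 * h" using sg(3) h by simp
 ultimately show False using h by simp
qed

text \<open>The Vitali property of sections. From a common point \<open>y\<close>, engulfing sees
  the second small section below height \<open>sg * h\<close>; if it left \<open>sect x h\<close>,
  separation would put that point at height at least \<open>sg * h\<close> from
  \<open>y\<close>.\<close>

lemma sect_containment:
 assumes "room x h" "room x' h'" "h' \<le> h" and meet: "sect x (tht * h) \<inter> sect x' (tht * h') \<noteq> {}"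
 shows "sect x' (tht * h') \<subseteq> sect x h"
proof
 fix z assume z: "z \<in> sect x' (tht * h')"
 obtain y where y: "y \<in> U" "breg x y < tht * h" "breg x' y < tht * h'" using meet by (auto simp: sect_def)
 have h: "0 < h" "0 < h'" using assms by (auto simp: room_def)
 have "2 * tht * h' \<le> 1 * h'" using tht h by simp
 hence r: "room x' (2 * tht * h')" using tht h by (intro room_mono[OF assms(2)]) auto
 have zU: "z \<in> U" using z by (simp add: sect_def)
 have "0 < tht * h'" "2 * tht * h' = tht * h' + tht * h'" using tht h by auto
 hence "tht * h' \<le> 2 * tht * h'" by linarith
 hence th: "breg x' z \<le> 2 * tht * h'" using z unfolding sect_def by (blast intro: order_trans less_imp_le)
 have "breg y z \<le> (1 + kap) * (2 * tht * h')"
  by (rule engulf[OF r y(1) _ zU]) (use y z th in \<open>auto simp: sect_def\<close>)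
 also have "\<dots> \<le> (1 + kap) * (2 * tht * h)" using kap_pos tht assms(3) by simp
 also have "\<dots> = (2 * (1 + kap) * tht) * h" by simp
 also have "\<dots> < sg * h" using tht h by simp
 finally have lt: "breg y z < sg * h" .
 have "tht * h \<le> sg * h" using tht h by simp
 hence "\<not> h \<le> breg x z" using separation[OF assms(1) y(1) _ zU] y lt by auto
 thus "z \<in> sect x h" using zU by (simp add: sect_def)
qed

end

section \<open>Integrals of directional derivatives over convex sets\<close>

lemma set_integrable_continuous_on_closure:
 fixes f :: "'a::euclidean_space => real"
 assumes "S \<in> sets borel" "S \<subseteq> K" "compact K" "continuous_on K f"
 shows "set_integrable lborel S f"
proof -
 have "set_integrable lborel K f"
  using borel_integrable_compact[OF assms(3,4)] by (simp add: set_integrable_def)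
 thus ?thesis by (rule set_integrable_subset) (use assms in auto)
qed

lemma lborel_integral_translate:
 fixes f :: "'a::euclidean_space => real"
 assumes "f \<in> borel_measurable borel"
 shows "(LINT x|lborel. f (x + a)) = (LINT x|lborel. f x)"
proof -
 have "(LINT x|lborel. f x) = (LINT x|distr lborel borel ((+) a). f x)" by (simp add: lborel_distr_plus)
 also have "\<dots> = (LINT x|lborel. f (a + x))" by (rule integral_distr) (use assms in auto)
 finally show ?thesis by (simp add: add.commute)
qed

lemma lborel_integral_homothety:
 fixes f :: "'a::euclidean_space => real"
 assumes "f \<in> borel_measurable borel" "0 < s"
 shows "(LINT x|lborel. f x) = s ^ DIM('a) * (LINT x|lborel. f (c + s *\<^sub>R (x - c)))"
proof -
 have "(LINT x|lborel. f x) =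
   (LINT x|density (distr lborel borel (\<lambda>x. (c - s *\<^sub>R c) + s *\<^sub>R x)) (\<lambda>_. ennreal (s ^ DIM('a))). f x)"
  using lborel_affine[of s "c - s *\<^sub>R c"] assms(2) by simp
 also have "\<dots> = (LINT x|lborel. s ^ DIM('a) * f ((c - s *\<^sub>R c) + s *\<^sub>R x))"
  using assms by (subst integral_density) (auto simp: integral_distr)
 finally show ?thesis by (simp add: algebra_simps)
qed

lemma set_integral_homothety:
 fixes f :: "'a::euclidean_space => real"
 assumes "set_integrable lborel T f" "0 < s" "\<And>x. c + s *\<^sub>R (x - c) \<in> T \<longleftrightarrow> x \<in> S"
 shows "(LINT x:T|lborel. f x) = s ^ DIM('a) * (LINT x:S|lborel. f (c + s *\<^sub>R (x - c)))"
proof -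
 have "indicator T (c + s *\<^sub>R (x - c)) = (indicator S x :: real)" for x using assms(3)[of x] by auto
 thus ?thesis using lborel_integral_homothety[of "\<lambda>x. indicator T x * f x" s c] assms(1,2)
  by (simp add: set_lebesgue_integral_def set_integrable_def)
qed

text \<open>The integral is the limit of \<open>(\<integral>\<^sub>S G - \<integral>\<^sub>T G) / (1 - s)\<close>, where \<open>T \<subseteq> S\<close> is the image of \<open>S\<close>
 under the homothety of ratio \<open>s < 1\<close> about \<open>c\<close>, and \<open>G\<close> is almost bounded by \<open>M\<close> on \<open>S - T\<close>.\<close>

lemma radial_flux:
 fixes G :: "'a::euclidean_space => real" and dG :: "'a => 'a"
 assumes S: "open S" "convex S" "bounded S" and c: "c \<in> S"
  and der: "\<And>x. x \<in> closure S ==> (G has_derivative (\<lambda>v. dG x \<bullet> v)) (at x)"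
  and cdG: "continuous_on (closure S) dG"
  and M: "\<And>y. y \<in> frontier S ==> \<bar>G y\<bar> \<le> M"
 shows "\<bar>LINT x:S|lborel. real DIM('a) * G x + dG x \<bullet> (x - c)\<bar> \<le> real DIM('a) * M * vol S"
proof -
 let ?n = "DIM('a)" and ?m = "vol S"
 define h where "h s x = c + s *\<^sub>R (x - c)" for s x
 \<comment> \<open>The derivative in \<open>s\<close> of \<open>s ^ n * G (h s x)\<close>, where
   \<open>n\<close> is the dimension; at \<open>s = 1\<close> it is the integrand of the
   statement.\<close>
 define H' where "H' s x = real ?n * s ^ (?n - 1) * G (h s x) + s ^ ?n * (dG (h s x) \<bullet> (x - c))" for s x
 define tau where "tau k = 1 / (real k + 2)" for k
 define q where "q k x = (G x - (1 - tau k) ^ ?n * G (h (1 - tau k) x)) / tau k" for k x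
 have tau: "0 < tau k" "tau k < 1" for k by (auto simp: tau_def)
 have tau0: "tau \<longlonglongrightarrow> 0" unfolding tau_def[abs_def] by real_asymp
 have cS: "compact (closure S)" using S(3) by simp
 have Sb: "S \<in> sets borel" using S(1) by simp
 have fin: "emeasure lborel S < \<infinity>" using S(3) by (rule emeasure_bounded_finite)
 have cG: "continuous_on (closure S) G"
  using der by (auto intro!: continuous_at_imp_continuous_on has_derivative_continuous)
 have hc: "h s x \<in> closure S" if "x \<in> closure S" "0 \<le> s" "s \<le> 1" for s x
  using convexD[OF convex_closure[OF S(2)] that(1), of c s "1 - s"] c closure_subset that
  by (auto simp: h_def algebra_simps)
 have hS: "h s x \<in> S" if "x \<in> S" "0 \<le> s" "s \<le> 1" for s x
  using convexD[OF S(2) that(1) c, of s "1 - s"] that by (simp add: h_def algebra_simps)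
 obtain B where B: "\<And>x. x \<in> closure S ==> \<bar>G x\<bar> \<le> B"
  using compact_imp_bounded[OF compact_continuous_image[OF cG cS]] by (auto simp: bounded_iff)
 obtain B' where B': "\<And>x. x \<in> closure S ==> norm (dG x) \<le> B'"
  using compact_imp_bounded[OF compact_continuous_image[OF cdG cS]] by (auto simp: bounded_iff)
 obtain D where D: "\<And>x. x \<in> closure S ==> norm (x - c) \<le> D"
  using bounded_translation[OF compact_imp_bounded[OF cS], of "- c"] by (auto simp: bounded_iff)
 have q: "\<exists>s. 1 - tau k < s \<and> s < 1 \<and> q k x = H' s x" if x: "x \<in> S" for k x
 proof -
  have "\<exists>s>1 - tau k. s < 1 \<and> 1 ^ ?n * G (h 1 x) - (1 - tau k) ^ ?n * G (h (1 - tau k) x) = (1 - (1 - tau k)) * H' s x"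
  proof (rule MVT2)
   fix s assume s: "1 - tau k \<le> s" "s \<le> 1"
   have "(h s x) \<in> closure S" using hc[of x s] x closure_subset s tau[of k] by auto
   hence "((\<lambda>s. G (h s x)) has_derivative (\<lambda>t. dG (h s x) \<bullet> (t *\<^sub>R (x - c)))) (at s)"
    by (intro has_derivative_compose[OF _ der, where f = "\<lambda>s. h s x"])
     (auto simp: h_def intro!: derivative_eq_intros)
   hence "((\<lambda>s. G (h s x)) has_real_derivative dG (h s x) \<bullet> (x - c)) (at s)"
    unfolding has_field_derivative_def by (rule has_derivative_eq_rhs) auto
   thus "((\<lambda>s. s ^ ?n * G (h s x)) has_real_derivative H' s x) (at s)"
    by (auto intro!: derivative_eq_intros simp: H'_def)
  qed (use tau in simp)
  thus ?thesis by (auto simp: q_def h_def)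
 qed
 have H'_le: "\<bar>H' s x\<bar> \<le> real ?n * B + B' * D" if "0 \<le> s" "s \<le> 1" "x \<in> S" for s x
 proof -
  have x: "x \<in> closure S" using that closure_subset by blast
  note hx = hc[OF x that(1,2)]
  have "\<bar>real ?n * s ^ (?n - 1) * G (h s x)\<bar> \<le> real ?n * 1 * B"
   unfolding abs_mult using B[OF hx] that by (intro mult_mono) (auto simp: power_le_one)
  moreover have "\<bar>s ^ ?n * (dG (h s x) \<bullet> (x - c))\<bar> \<le> 1 * (B' * D)"
   unfolding abs_mult using B'[OF hx] D[OF x] that by (intro mult_mono order_trans[OF Cauchy_Schwarz_ineq2])
    (auto simp: power_le_one intro: order_trans[OF norm_ge_zero])
  ultimately show ?thesis unfolding H'_def by simp
 qed
 have lim: "(\<lambda>k. LINT x:S|lborel. q k x) \<longlonglongrightarrow> (LINT x:S|lborel. real ?n * G x + dG x \<bullet> (x - c))"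
  unfolding set_lebesgue_integral_def
 proof (rule integral_dominated_convergence)
  show "integrable lborel (\<lambda>x. (real ?n * B + B' * D) * indicator S x)" using Sb fin by simp
  have "set_integrable lborel S (\<lambda>x. real ?n * G x + dG x \<bullet> (x - c))"
   by (intro set_integrable_continuous_on_closure[OF Sb closure_subset cS] continuous_intros cG cdG)
  thus "(\<lambda>x. indicator S x *\<^sub>R (real ?n * G x + dG x \<bullet> (x - c))) \<in> borel_measurable lborel"
   by (auto simp: set_integrable_def)
  have "continuous_on (closure S) (q k)" for k unfolding q_def using tau[of k] hc[of _ "1 - tau k"]
   by (intro continuous_intros cG continuous_on_compose2[OF cG]) (auto simp: h_def intro!: continuous_intros)
  hence "set_integrable lborel S (q k)" for k
   by (intro set_integrable_continuous_on_closure[OF Sb closure_subset cS])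
  thus "(\<lambda>x. indicator S x *\<^sub>R q k x) \<in> borel_measurable lborel" for k
   by (auto simp: set_integrable_def)
  show "AE x in lborel. (\<lambda>k. indicator S x *\<^sub>R q k x) \<longlonglongrightarrow> indicator S x *\<^sub>R (real ?n * G x + dG x \<bullet> (x - c))"
  proof (rule AE_I2)
   fix x
   show "(\<lambda>k. indicator S x *\<^sub>R q k x) \<longlonglongrightarrow> indicator S x *\<^sub>R (real ?n * G x + dG x \<bullet> (x - c))"
   proof (cases "x \<in> S")
    case True
    obtain s where s: "\<And>k. 1 - tau k < s k" "\<And>k. s k < 1" "\<And>k. q k x = H' (s k) x"
     using q[OF True] by metis
    have "s \<longlonglongrightarrow> 1"
    proof (rule tendsto_sandwich[where f = "\<lambda>k. 1 - tau k" and h = "\<lambda>k. 1"])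
     show "(\<lambda>k. 1 - tau k) \<longlonglongrightarrow> 1" using tendsto_diff[OF tendsto_const tau0] by simp
    qed (use s in \<open>auto intro!: always_eventually less_imp_le\<close>)
    hence hl: "(\<lambda>k. h (s k) x) \<longlonglongrightarrow> h 1 x" unfolding h_def by (intro tendsto_intros)
    have xc: "x \<in> closure S" using True closure_subset by blast
    have "\<forall>\<^sub>F k in sequentially. h (s k) x \<in> closure S"
     by (intro always_eventually allI hc[OF xc] order_trans[OF _ less_imp_le[OF s(1)]] less_imp_le[OF s(2)])
      (use tau in \<open>simp add: less_imp_le\<close>)
    note l = continuous_on_tendsto_compose[OF _ hl hc[OF xc] this]
    have "(\<lambda>k. H' (s k) x) \<longlonglongrightarrow> H' 1 x"
     unfolding H'_def by (intro tendsto_intros \<open>s \<longlonglongrightarrow> 1\<close> l[OF cG] l[OF cdG]) auto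
    thus ?thesis using s(3) True by (simp add: H'_def h_def)
   qed simp
  qed
  show "AE x in lborel. norm (indicator S x *\<^sub>R q k x) \<le> (real ?n * B + B' * D) * indicator S x" for k
  proof (rule AE_I2)
   show "norm (indicator S x *\<^sub>R q k x) \<le> (real ?n * B + B' * D) * indicator S x" for x
    using q[of x k] H'_le[of _ x] tau[of k] by (cases "x \<in> S") force+
  qed
 qed
 have "\<bar>LINT x:S|lborel. real ?n * G x + dG x \<bullet> (x - c)\<bar> \<le> (M + ep) * (real ?n * ?m)" if ep: "0 < ep" for ep
 proof (rule LIMSEQ_le_const2[OF tendsto_rabs[OF lim]])
  obtain d where d: "0 < d" "\<And>x y. x \<in> closure S ==> y \<in> closure S ==> dist y x < d ==> dist (G y) (G x) < ep"
   using compact_uniformly_continuous[OF cG cS] ep unfolding uniformly_continuous_on_def by meson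
  have "(\<lambda>k. tau k / (1 - tau k) * D) \<longlonglongrightarrow> 0 / (1 - 0) * D" by (intro tendsto_intros tau0) simp
  hence "\<forall>\<^sub>F k in sequentially. tau k / (1 - tau k) * D < d" using d(1) by (intro order_tendstoD) auto
  then obtain N where N: "\<And>k. N \<le> k ==> tau k / (1 - tau k) * D < d" by (auto simp: eventually_sequentially)
  show "\<exists>N. \<forall>k\<ge>N. \<bar>LINT x:S|lborel. q k x\<bar> \<le> (M + ep) * (real ?n * ?m)"
  proof (intro exI[of _ N] allI impI)
   fix k assume "N \<le> k"
   note N = N[OF this]
   define s where "s = 1 - tau k"
   have s: "0 < s" "s < 1" "tau k = 1 - s" using tau[of k] by (auto simp: s_def)
   define T where "T = {x \<in> S. c + (1 / s) *\<^sub>R (x - c) \<in> S}"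
   have hT: "h s x \<in> T \<longleftrightarrow> x \<in> S" for x
    using hS[of x s] s by (auto simp: T_def h_def)
   have "open (S \<inter> (\<lambda>x. c + (1 / s) *\<^sub>R (x - c)) -` S)"
    by (intro continuous_open_preimage continuous_intros S)
   also have "S \<inter> (\<lambda>x. c + (1 / s) *\<^sub>R (x - c)) -` S = T" by (auto simp: T_def)
   finally have Tb: "T \<in> sets borel" by simp
   have TS: "T \<subseteq> S" by (auto simp: T_def)
   have iS: "set_integrable lborel S G" by (rule set_integrable_continuous_on_closure[OF Sb closure_subset cS cG])
   have iT: "set_integrable lborel T G" by (rule set_integrable_subset[OF iS]) (use Tb TS in auto)
   have fT: "emeasure lborel T < \<infinity>" using bounded_subset[OF S(3) TS] by (rule emeasure_bounded_finite)
   have "vol T = s ^ ?n * ?m"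
    using set_integral_homothety[of T "\<lambda>_. 1", OF _ s(1) hT[unfolded h_def]] Tb fT by (simp add: set_lebesgue_integral_def set_integrable_def)
   hence mD: "vol (S - T) = (1 - s ^ ?n) * ?m"
    using measure_Diff[of lborel S T] fin Sb Tb TS by (simp add: left_diff_distrib)
   have "continuous_on (closure S) (\<lambda>x. s ^ ?n * G (h s x))"
    using hc s by (intro continuous_intros continuous_on_compose2[OF cG]) (auto simp: h_def intro!: continuous_intros)
   hence "set_integrable lborel S (\<lambda>x. s ^ ?n * G (h s x))"
    by (rule set_integrable_continuous_on_closure[OF Sb closure_subset cS])
   hence "(LINT x:S|lborel. q k x) = ((LINT x:S|lborel. G x) - (LINT x:T|lborel. G x)) / tau k"
    using iS set_integral_homothety[OF iT s(1) hT[unfolded h_def]] by (simp add: q_def s_def h_def)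
   also have "(LINT x:S|lborel. G x) - (LINT x:T|lborel. G x) = (LINT x:S - T|lborel. G x)"
    using set_integral_Un[of "S - T" T lborel G] set_integrable_subset[OF iS, of "S - T"] iT Sb Tb TS
    by (simp add: Un_absorb2 Int_commute[of _ T])
   finally have I: "\<bar>LINT x:S|lborel. q k x\<bar> = \<bar>LINT x:S - T|lborel. G x\<bar> / tau k" using tau[of k] by simp
   \<comment> \<open>The segment from \<open>x\<close> to its preimage under the homothety leaves
     \<open>S\<close>, so it meets the frontier; it is short, and uniform continuity transfers the
     bound \<open>M\<close> up to \<open>ep\<close>.\<close>
   have "\<bar>G x\<bar> \<le> M + ep" if x: "x \<in> S - T" for x
   proof -
    let ?z = "c + (1 / s) *\<^sub>R (x - c)"
    have "?z \<notin> S" using x by (auto simp: T_def)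
    hence "closed_segment x ?z \<inter> frontier S \<noteq> {}" using x by (intro connected_Int_frontier) auto
    then obtain y where y: "y \<in> closed_segment x ?z" "y \<in> frontier S" by blast
    have xS: "x \<in> closure S" "y \<in> closure S" using x y closure_subset by (auto simp: frontier_def)
    have "norm (y - x) \<le> norm (?z - x)" using segment_bound(1)[OF y(1)] .
    also have "?z - x = (1 / s - 1) *\<^sub>R (x - c)" by (simp add: algebra_simps)
    also have "1 / s - 1 = tau k / s" using s by (simp add: diff_divide_distrib)
    also have "norm ((tau k / s) *\<^sub>R (x - c)) \<le> tau k / s * D" using mult_left_mono[OF D[OF xS(1)], of "tau k / s"] s by simp
    also have "\<dots> < d" using N by (simp add: s_def)
    finally have "dist (G y) (G x) < ep" by (intro d(2) xS) (simp add: dist_norm)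
    thus ?thesis using M[OF y(2)] by (simp add: dist_real_def)
   qed
   note GD = this
   have iD: "set_integrable lborel (S - T) f" if "continuous_on (closure S) f" for f :: "'a => real"
    by (rule set_integrable_continuous_on_closure[OF _ _ cS that]) (use Sb Tb closure_subset in auto)
   have "\<bar>LINT x:S - T|lborel. G x\<bar> \<le> (LINT x:S - T|lborel. \<bar>G x\<bar>)"
    using set_integral_norm_bound[OF iD[OF cG]] by simp
   also have "\<dots> \<le> (LINT x:S - T|lborel. M + ep)"
    by (intro set_integral_mono iD continuous_on_rabs cG continuous_on_const GD)
   also have "\<dots> = (M + ep) * ((1 - s ^ ?n) * ?m)" using mD by (simp add: set_lebesgue_integral_def)
   also have "\<dots> \<le> (M + ep) * (real ?n * tau k * ?m)"
   proof (intro mult_left_mono mult_right_mono)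
    show "1 - s ^ ?n \<le> real ?n * tau k" using Bernoulli_inequality[of "- tau k" ?n] tau[of k] by (simp add: s_def)
    have "frontier S \<noteq> {}" using S c frontier_eq_empty[of S] not_bounded_UNIV by blast
    then obtain y where "y \<in> frontier S" by blast
    thus "0 \<le> M + ep" using M[of y] ep by simp
   qed simp
   finally show "\<bar>LINT x:S|lborel. q k x\<bar> \<le> (M + ep) * (real ?n * ?m)"
    unfolding I using tau[of k] by (simp add: pos_divide_le_eq mult_ac)
  qed
 qed
 note le = this
 have "((\<lambda>ep. (M + ep) * (real ?n * ?m)) \<longlongrightarrow> (M + 0) * (real ?n * ?m)) (at_right 0)" by (intro tendsto_intros)
 hence "\<bar>LINT x:S|lborel. real ?n * G x + dG x \<bullet> (x - c)\<bar> \<le> (M + 0) * (real ?n * ?m)"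
  by (rule tendsto_lowerbound)
   (use le eventually_at_right_less[of "0::real"] in \<open>auto elim!: eventually_mono\<close>)
 thus ?thesis by (simp add: mult_ac)
qed

text \<open>Subtract \<open>radial_flux\<close> about two centres that differ by \<open>e\<close>:
  the terms with \<open>G\<close> cancel. A bound on the frontier thus takes the place of a boundary
  integral, and sections need no regularity beyond convexity.\<close>

lemma flux:
 fixes G :: "'a::euclidean_space => real" and dG :: "'a => 'a"
 assumes S: "open S" "convex S" "bounded S" and c0: "c0 \<in> S" "c0 + e \<in> S"
  and V: "closure S \<subseteq> V"
  and der: "\<And>x. x \<in> V ==> (G has_derivative (\<lambda>v. dG x \<bullet> v)) (at x)"
  and cdG: "continuous_on V dG"
  and M: "\<And>y. y \<in> frontier S ==> \<bar>G y\<bar> \<le> M"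
 shows "\<bar>LINT x:S|lborel. dG x \<bullet> e\<bar> \<le> 2 * real DIM('a) * M * vol S"
proof -
 let ?J = "\<lambda>c. LINT x:S|lborel. real DIM('a) * G x + dG x \<bullet> (x - c)"
 have d: "(G has_derivative (\<lambda>v. dG x \<bullet> v)) (at x)" if "x \<in> closure S" for x using der V that by blast
 note c = continuous_on_subset[OF cdG V]
 have "set_integrable lborel S (\<lambda>x. real DIM('a) * G x + dG x \<bullet> (x - c))" for c
  using S by (intro set_integrable_continuous_on_closure[OF _ closure_subset] continuous_intros c
    continuous_at_imp_continuous_on ballI has_derivative_continuous[OF d]) auto
 from set_integral_diff(2)[OF this[of c0] this[of "c0 + e"]]
 have "?J c0 - ?J (c0 + e) = (LINT x:S|lborel. dG x \<bullet> e)" by (simp add: inner_diff_right inner_add_right)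
 thus ?thesis using radial_flux[OF S c0(1) d c M] radial_flux[OF S c0(2) d c M] by linarith
qed

section \<open>The Laplacian on sections is of Muckenhoupt type\<close>

lemma psd_quadratic_le: "psd N ==> v \<bullet> (N *v v) \<le> trace N * (norm v)\<^sup>2"
proof (induction rule: psd_induct)
 case (step A u)
 have "(u \<bullet> v)\<^sup>2 \<le> (norm u)\<^sup>2 * (norm v)\<^sup>2"
  by (metis Cauchy_Schwarz_ineq power2_norm_eq_inner)
 moreover have "trace (outer u u) = (norm u)\<^sup>2"
  by (simp add: trace_def outer_def power2_norm_eq_inner inner_vec_def)
 moreover have "v \<bullet> (outer u u *v v) = (u \<bullet> v)\<^sup>2"
  by (simp add: outer_mult_vec power2_eq_square inner_commute)
 ultimately show ?case using step
  by (simp add: matrix_vector_mult_add_rdistrib inner_add_right trace_add distrib_right)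
qed (simp add: trace_def)

lemma trace_mult_le:
 fixes M N :: "real^'n^'n"
 assumes "psd M" "psd N" shows "trace (M ** N) \<le> trace M * trace N"
proof -
 have "psd (trace N *\<^sub>R mat 1 - N)"
  using assms(2) psd_quadratic_le[OF assms(2)] by (simp add: psd_def transpose_diff transpose_scaleR matrix_vector_mult_diff_rdistrib scaleR_mat_vec inner_diff_right power2_norm_eq_inner)
 from trace_mult_psd_nonneg[OF assms(1) this]
 have "0 \<le> trace ((trace N *\<^sub>R mat 1 - N) ** M)" .
 also have "(trace N *\<^sub>R mat 1 - N) ** M = trace N *\<^sub>R M - N ** M"
  by (simp add: matrix_diff_rdistrib scaleR_mat_mult)
 finally have "trace (N ** M) \<le> trace N * trace M" by (simp add: trace_def sum_distrib_left sum_subtractf)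
 thus ?thesis by (simp add: trace_mul_sym[of N M] mult.commute)
qed

lemma inner_vector_matrix: "v \<bullet> (y v* B) = (B *v v) \<bullet> y" for B :: "real^'n^'m"
 by (metis dot_lmul_matrix inner_commute)

lemma psd_congruence: "psd A ==> psd (transpose B ** A ** B)" unfolding psd_def
 by (simp add: matrix_transpose_mul matrix_mul_assoc matrix_vector_mul_assoc[symmetric]
   inner_vector_matrix)

context mafun
begin

text \<open>In the normalized frame the mean of the trace over a section is at most
  \<open>2 * flc * h\<close>; \<open>trc\<close> gives the Chebyshev level that is exceeded on at
  most half of the section of height \<open>tht * h\<close>; \<open>ainfc\<close> is the resulting
  eigenvalue bound divided by \<open>flc\<close>.\<close>

definition "flc = 6 * (real CARD('n))\<^sup>2 * (1 + kap)"
definition "trc = 2 * flc / tht ^ CARD('n)"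
definition "ainfc = lam / (8 * (8 * real CARD('n)) ^ CARD('n) * Lam) /
 (real CARD('n) * fact CARD('n) * trc ^ CARD('n)) / flc"

lemma sect_open: "open (sect x h)"
proof -
 have "open (U \<inter> breg x -` {..<h})" by (intro continuous_open_preimage cont_breg openU) simp
 moreover have "U \<inter> breg x -` {..<h} = sect x h" by (auto simp: sect_def)
 ultimately show ?thesis by simp
qed

lemma sect_convex: "convex (sect x h)"
proof (rule convexI)
 fix y z and a b :: real
 assume *: "y \<in> sect x h" "z \<in> sect x h" "0 \<le> a" "0 \<le> b" "a + b = 1"
 have e: "a *\<^sub>R y + b *\<^sub>R z = y + b *\<^sub>R (z - y)" using *(5) by (simp add: algebra_simps flip: scaleR_left_distrib)
 have "breg x (y + b *\<^sub>R (z - y)) \<le> (1 - b) * breg x y + b * breg x z"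
  using * by (intro breg_convex) (auto simp: sect_def)
 also have "\<dots> < h" using convex_bound_lt[of "breg x y" h "breg x z" "1 - b" b] * by (simp add: sect_def)
 finally show "a *\<^sub>R y + b *\<^sub>R z \<in> sect x h"
  unfolding e using * segment_in_U[of y z b] by (auto simp: sect_def)
qed

lemma sect_mono: "h \<le> h' ==> sect x h \<subseteq> sect x h'" by (auto simp: sect_def)

lemma centre_in_sect: "x \<in> U ==> 0 < h ==> x \<in> sect x h" by (simp add: sect_def)

lemma room_closure: "room x h ==> closure (sect x h) \<subseteq> {y \<in> U. breg x y \<le> h}"
 by (rule closure_minimal) (auto simp: sect_def room_def compact_imp_closed)

lemma room_bounded: "room x h ==> bounded (sect x h)"
 by (rule bounded_subset[of "{y \<in> U. breg x y \<le> h}"]) (auto simp: room_def sect_def compact_imp_bounded)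

lemma sect_fm: "room x h ==> sect x h \<in> fmeasurable lborel"
 using emeasure_bounded_finite[OF room_bounded] sect_open by (auto simp: fmeasurable_def)

lemma sect_measure_pos: assumes "room x h" shows "0 < vol (sect x h)"
proof -
 have "x \<in> sect x h" using assms by (simp add: centre_in_sect room_def)
 hence "\<not> negligible (sect x h)" using open_not_negligible[OF sect_open, of x h] by blast
 hence "measure lebesgue (sect x h) \<noteq> 0"
  using lmeasurable_open[OF room_bounded[OF assms] sect_open] by (simp add: negligible_iff_measure)
 thus ?thesis using sect_open by (simp add: zero_less_measure_iff)
qed

text \<open>By convexity the smaller section contains the image of the larger one under the
  homothety of ratio \<open>t\<close> about \<open>x\<close>.\<close>

lemma sect_shrink_measure:
 assumes "room x h" "0 < t" "t \<le> 1"
 shows "t ^ CARD('n) * vol (sect x h) \<le> vol (sect x (t * h))"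
proof -
 have x: "x \<in> U" and h: "0 < h" using assms by (auto simp: room_def)
 define Q where "Q = (\<lambda>y. t *\<^sub>R y + (1 - t) *\<^sub>R x) ` sect x h"
 have "Q = (+) ((1 - t) *\<^sub>R x) ` ((*\<^sub>R) t ` sect x h)" unfolding Q_def by auto
 hence Qo: "open Q" using assms by (auto intro!: open_translation sect_open)
 have "measure lebesgue Q = \<bar>t\<bar> ^ DIM(real^'n) * measure lebesgue (sect x h)"
  unfolding Q_def measure_def using emeasure_lebesgue_affine[of t "(1 - t) *\<^sub>R x" "sect x h"] by (simp add: enn2real_mult)
 hence mQ: "vol Q = t ^ CARD('n) * vol (sect x h)" using assms Qo sect_open by simp
 have "Q \<subseteq> sect x (t * h)"
 proof
  fix z assume "z \<in> Q"
  then obtain y where y: "y \<in> sect x h" "z = x + t *\<^sub>R (y - x)" by (auto simp: Q_def algebra_simps)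
  hence "breg x z \<le> (1 - t) * breg x x + t * breg x y"
   unfolding y(2) using assms x by (intro breg_convex) (auto simp: sect_def)
  also have "\<dots> < t * h" using y assms by (simp add: sect_def)
  finally show "z \<in> sect x (t * h)" using y segment_in_U[OF x, of y t] assms by (simp add: sect_def)
 qed
 moreover have "room x (t * h)" using assms h by (intro room_mono[OF assms(1)]) (auto simp: mult_le_cancel_right1)
 ultimately show ?thesis unfolding mQ[symmetric] using Qo by (intro measure_mono_fmeasurable sect_fm) auto
qed

definition w :: "real^'n => real" where "w y = trace (A y)"

lemma contw: "continuous_on U w" unfolding w_def trace_def by (intro continuous_intros contA)

lemma w_pos: "y \<in> U ==> 0 < w y"
proof -
 assume y: "y \<in> U"
 have "0 < axis i 1 \<bullet> (A y *v axis i 1)" for i using detA(3)[OF y] unfolding pd_def by simp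
 thus ?thesis by (auto simp: w_def trace_def inner_axis_mat intro!: sum_pos)
qed

lemma w_set_integrable:
 assumes "S \<in> sets borel" "S \<subseteq> K" "compact K" "K \<subseteq> U" shows "set_integrable lborel S w"
 using assms continuous_on_subset[OF contw] by (intro set_integrable_continuous_on_closure) auto

lemma constants_pos: "0 < flc" "1 \<le> trc"
 "0 < ainfc"
proof -
 have "1 * 1 \<le> real CARD('n) * real CARD('n)" by (intro mult_mono) auto
 hence "1 * 1 \<le> (real CARD('n))\<^sup>2 * (1 + kap)"
  using kap_pos by (intro mult_mono) (auto simp: power2_eq_square)
 hence fl: "1 \<le> flc" by (simp add: flc_def)
 thus "0 < flc" by simp
 have "tht ^ CARD('n) \<le> 1" using tht by (intro power_le_one) auto
 thus tr: "1 \<le> trc" using tht fl by (simp add: trc_def)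
 show "0 < ainfc" unfolding ainfc_def using lam Lam fl tr by simp
qed

text \<open>In the frame \<open>B\<close> one has \<open>w y = trace (M y ** N)\<close> with a
  constant \<open>N\<close>. The mean of \<open>w\<close> is at most \<open>trace N\<close> times
  the mean of \<open>trace (M y)\<close>, which the flux bounds by a multiple of \<open>h\<close>.
  Conversely, where \<open>trace (M y)\<close> is below a multiple of \<open>h\<close>, the
  determinant bound makes every eigenvalue of \<open>M y\<close> at least a multiple of
  \<open>h\<close>, so \<open>w y\<close> is at least a multiple of
  \<open>h * trace N\<close>.\<close>

lemma muckenhoupt:
 assumes r: "room x (2 * h)"
 shows "vol (sect x (tht * h)) / 2 \<le> vol {y \<in> sect x (tht * h).
   ainfc * (LINT z:sect x h|lborel. w z) \<le> w y * vol (sect x h)}"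
  (is "_ \<le> vol ?F")
proof -
 let ?S = "sect x h" and ?s = "sect x (tht * h)" and ?n = "real CARD('n)"
 have fl: "0 < flc" and tr: "1 \<le> trc" using constants_pos by auto
 have x: "x \<in> U" and h: "0 < h" using r by (auto simp: room_def)
 have rh: "room x h" by (rule room_mono[OF r]) (use h in auto)
 have e: "phi y - g x \<bullet> y - (phi x - g x \<bullet> x + 2 * h) = breg x y - 2 * h" for y
  by (simp add: breg_affine)
 interpret C: cut U lam Lam phi g A "g x" "phi x - g x \<bullet> x + 2 * h"
 proof
  show "compact {y \<in> U. phi y - g x \<bullet> y - (phi x - g x \<bullet> x + 2 * h) \<le> 0}"
   unfolding e using r by (simp add: room_def)
  show "\<exists>y\<in>U. phi y - g x \<bullet> y - (phi x - g x \<bullet> x + 2 * h) < 0" using x h by force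
 qed (rule ma)
 have Cu: "C.u y = breg x y - 2 * h" for y unfolding C.u_def e ..
 have CK: "C.K = {y \<in> U. breg x y \<le> 2 * h}" by (simp add: C.K_def Cu)
 obtain y0 B where nB: "C.normalizing y0 B" by (rule C.normalizing_exists)
 have dB: "det B \<noteq> 0" using nB by (simp add: C.normalizing_def)
 obtain Bi where Bi: "B ** Bi = mat 1" "Bi ** B = mat 1" using dB by (metis invertible_def invertible_det_nz)
 define N where "N = Bi ** transpose Bi"
 define M where "M y = transpose B ** A y ** B" for y
 have psdN: "psd N" using psd_congruence[of "mat 1" "transpose Bi"] pd_imp_psd[OF pd_mat_scaleR[of 1]]
  by (simp add: N_def)
 have psdA: "psd (A y)" if "y \<in> U" for y using detA(3)[OF that] by (rule pd_imp_psd)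
 have psdM: "psd (M y)" if "y \<in> U" for y unfolding M_def by (rule psd_congruence[OF psdA[OF that]])
 have wMN: "w y = trace (M y ** N)" for y
 proof -
  have "transpose Bi ** (M y) ** Bi = A y"
  proof -
   have "transpose Bi ** transpose B = mat 1" by (metis Bi(1) matrix_transpose_mul transpose_mat)
   thus ?thesis by (metis Bi(1) M_def matrix_mul_assoc matrix_mul_lid matrix_mul_rid)
  qed
  hence "w y = trace (transpose Bi ** (M y ** Bi))" by (simp add: w_def matrix_mul_assoc)
  also have "\<dots> = trace ((M y ** Bi) ** transpose Bi)" by (rule trace_mul_sym)
  finally show ?thesis by (simp add: N_def matrix_mul_assoc)
 qed
 have trN: "0 \<le> trace N" unfolding trace_def by (intro sum_nonneg psd_diag_nonneg psdN)
 define b where "b i = B *v axis i 1" for i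
 define X where "X y = trace (M y)" for y
 have X_b: "X y = (\<Sum>i\<in>UNIV. (A y *v b i) \<bullet> b i)" for y
 proof -
  have "M y $ i $ i = (A y *v b i) \<bullet> b i" for i
  proof -
   have "M y $ i $ i = axis i 1 \<bullet> (transpose B *v (A y *v (B *v axis i 1)))"
    unfolding M_def inner_axis_mat[symmetric] by (simp add: matrix_vector_mul_assoc matrix_mul_assoc)
   thus ?thesis by (simp only: b_def transpose_matrix_vector inner_commute[of "axis i 1"] dot_lmul_matrix)
  qed
  thus ?thesis by (simp add: X_def trace_def)
 qed
 have X0: "0 \<le> X y" if "y \<in> U" for y
  unfolding X_def trace_def by (intro sum_nonneg psd_diag_nonneg psdM that)
 have contX: "continuous_on U X"
  unfolding X_b by (intro continuous_intros) (simp add: matrix_vector_mult_def, intro continuous_intros contA)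
 have Sfm: "?S \<in> fmeasurable lborel" by (rule sect_fm[OF rh])
 let ?Kh = "{y \<in> U. breg x y \<le> h}"
 have cKh: "compact ?Kh" using rh by (simp add: room_def)
 have SK: "?S \<subseteq> ?Kh" by (auto simp: sect_def)
 have Sb: "?S \<in> sets borel" using sect_open by simp
 have simplex: "y0 + B *v c \<in> C.K" if "\<forall>i. 0 \<le> c $ i" "(\<Sum>i\<in>UNIV. c $ i) \<le> 1" for c
  using nB that unfolding C.normalizing_def by blast
 have bK: "y0 \<in> C.K" "y0 + b i \<in> C.K" for i
  using simplex[of 0] simplex[of "axis i 1"] by (auto simp: b_def axis_def)
 \<comment> \<open>The frame vectors join points of the section of height \<open>2 * h\<close>.
   Shrinking by 1/3 towards \<open>x\<close> moves these points into \<open>?S\<close>, at the price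
   of a factor 3.\<close>
 have flux_b: "(LINT y:?S|lborel. (A y *v b i) \<bullet> b i) \<le> 6 * ?n * (1 + kap) * h * vol ?S * 2" for i
 proof -
  define z0 where "z0 = x + (1/3) *\<^sub>R (y0 - x)"
  have in_S: "x + (1/3) *\<^sub>R (y - x) \<in> ?S" if "y \<in> C.K" for y
  proof -
   have "breg x (x + (1/3) *\<^sub>R (y - x)) \<le> (1 - 1/3) * breg x x + 1/3 * breg x y"
    using that x by (intro breg_convex) (auto simp: CK)
   also have "\<dots> < h" using that h by (simp add: CK)
   finally show ?thesis using segment_in_U[OF x, of y "1/3"] that by (simp add: sect_def CK)
  qed
  have pts: "z0 \<in> ?S" "z0 + (1/3) *\<^sub>R b i \<in> ?S"
   using in_S[OF bK(1)] in_S[OF bK(2)[of i]] by (simp_all add: z0_def algebra_simps)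
  have G: "((\<lambda>y. (g y - g x) \<bullet> b i) has_derivative (\<lambda>v. (A y *v b i) \<bullet> v)) (at y)" if "y \<in> U" for y
  proof -
   have sy: "transpose (A y) = A y" using psdA[OF that] by (simp add: psd_def)
   have "((\<lambda>y. (g y - g x) \<bullet> b i) has_derivative (\<lambda>v. (A y *v v) \<bullet> b i)) (at y)"
    by (auto intro!: derivative_eq_intros dg that)
   moreover have "(A y *v v) \<bullet> b i = (A y *v b i) \<bullet> v" for v
    using sym_inner[OF sy, of "b i" v] by (simp add: inner_commute)
   ultimately show ?thesis by simp
  qed
  \<comment> \<open>The component along \<open>b i\<close> is a difference of two increments, each
    between \<open>- (2 * h)\<close> and \<open>kap * (2 * h)\<close>.\<close>
  have bound: "\<bar>(g y - g x) \<bullet> b i\<bar> \<le> (1 + kap) * (2 * h)" if y: "y \<in> U" "breg x y \<le> h" for y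
  proof -
   have 1: "(g y - g x) \<bullet> (y - z) \<le> kap * (2 * h)" if "z \<in> C.K" for z
    using gradient_bound[OF r y(1) _ , of z] y that by (simp add: CK)
   have 2: "- (2 * h) \<le> (g y - g x) \<bullet> (y - z)" if "z \<in> C.K" for z
    using breg_three[of x z y] breg_nonneg[OF x y(1)] breg_nonneg[OF y(1), of z] that
    by (simp add: CK inner_diff_right)
   have "(g y - g x) \<bullet> b i = (g y - g x) \<bullet> (y - y0) - (g y - g x) \<bullet> (y - (y0 + b i))"
    by (simp add: inner_diff_right inner_add_right)
   moreover have "(1 + kap) * (2 * h) = 2 * h + kap * (2 * h)" by (simp add: algebra_simps)
   ultimately show ?thesis using 1[OF bK(1)] 1[OF bK(2)[of i]] 2[OF bK(1)] 2[OF bK(2)[of i]] by simp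
  qed
  have "\<bar>LINT y:?S|lborel. (A y *v b i) \<bullet> ((1/3) *\<^sub>R b i)\<bar> \<le>
    2 * real DIM(real^'n) * ((1 + kap) * (2 * h)) * vol ?S"
  proof (rule flux[OF sect_open sect_convex room_bounded[OF rh] pts])
   show "closure ?S \<subseteq> U" using room_closure[OF rh] by blast
   show "continuous_on U (\<lambda>y. A y *v b i)"
    by (simp add: matrix_vector_mult_def) (intro continuous_intros contA)
   show "\<bar>(g y - g x) \<bullet> b i\<bar> \<le> (1 + kap) * (2 * h)" if "y \<in> frontier ?S" for y
    using that room_closure[OF rh] by (intro bound) (auto simp: frontier_def)
  qed (rule G)
  moreover have "(LINT y:?S|lborel. (A y *v b i) \<bullet> ((1/3) *\<^sub>R b i)) = (LINT y:?S|lborel. (A y *v b i) \<bullet> b i) / 3"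
   by simp
  ultimately show ?thesis by simp
 qed
 have intb: "set_integrable lborel ?S (\<lambda>y. (A y *v b i) \<bullet> b i)" for i
 proof (rule set_integrable_continuous_on_closure[OF Sb SK cKh])
  show "continuous_on ?Kh (\<lambda>y. (A y *v b i) \<bullet> b i)"
   by (intro continuous_intros, simp add: matrix_vector_mult_def)
    (intro continuous_intros continuous_on_subset[OF contA], auto)
 qed
 have intX: "(LINT y:?S|lborel. X y) \<le> 2 * flc * h * vol ?S"
 proof -
  have "(LINT y:?S|lborel. X y) = (\<Sum>i\<in>UNIV. LINT y:?S|lborel. (A y *v b i) \<bullet> b i)"
   unfolding X_b set_lebesgue_integral_def scaleR_sum_right
   using intb by (intro Bochner_Integration.integral_sum) (simp add: set_integrable_def)
  also have "\<dots> \<le> (\<Sum>i\<in>(UNIV::'n set). 6 * ?n * (1 + kap) * h * vol ?S * 2)"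
   by (intro sum_mono flux_b)
  also have "\<dots> = 2 * flc * h * vol ?S" by (simp add: flc_def power2_eq_square)
  finally show ?thesis .
 qed
 have sX: "set_integrable lborel ?S X"
  using continuous_on_subset[OF contX] by (intro set_integrable_continuous_on_closure[OF Sb SK cKh]) auto
 have sw: "set_integrable lborel ?S w" by (rule w_set_integrable[OF Sb SK cKh]) auto
 have W_le: "(LINT y:?S|lborel. w y) \<le> trace N * (2 * flc * h * vol ?S)"
 proof -
  have "(LINT y:?S|lborel. w y) \<le> (LINT y:?S|lborel. trace N * X y)"
  proof (rule set_integral_mono[OF sw])
   show "set_integrable lborel ?S (\<lambda>y. trace N * X y)" using sX by simp
   show "w y \<le> trace N * X y" if "y \<in> ?S" for y
    using trace_mult_le[OF psdM psdN, of y] that by (simp add: wMN X_def sect_def mult.commute)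
  qed
  also have "\<dots> = trace N * (LINT y:?S|lborel. X y)" by simp
  also have "\<dots> \<le> trace N * (2 * flc * h * vol ?S)" by (intro mult_left_mono intX trN)
  finally show ?thesis .
 qed
 define T where "T = 2 * trc * h"
 have T0: "0 < T" using tr h by (simp add: T_def)
 define E where "E = {y \<in> ?S. T \<le> X y}"
 have borelX: "{y \<in> V. P (f y)} \<in> sets borel"
  if "open V" "V \<subseteq> U" "continuous_on U f" "closed {z::real. P z}" for V f P
 proof -
  have "{y \<in> V. P (f y)} = V \<inter> (U - (U \<inter> f -` (- {z. P z})))" using that by auto
  moreover have "open (U \<inter> f -` (- {z. P z}))"
   using that by (intro continuous_open_preimage openU) auto
  ultimately show ?thesis using that openU by auto
 qed
 have SU: "?S \<subseteq> U" by (auto simp: sect_def)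
 have Eb: "E \<in> sets borel"
  unfolding E_def by (rule borelX[OF sect_open SU contX]) (simp add: closed_atLeast[unfolded atLeast_def])
 have Efm: "E \<in> fmeasurable lborel" by (rule fmeasurableI2[OF Sfm]) (use Eb in \<open>auto simp: E_def\<close>)
 have cheb: "T * vol E \<le> 2 * flc * h * vol ?S"
 proof -
  have "T * vol E = (LINT y|lborel. T * indicator E y)" by simp
  also have "\<dots> \<le> (LINT y|lborel. indicator ?S y *\<^sub>R X y)"
  proof (rule integral_mono)
   show "integrable lborel (\<lambda>y. T * indicator E y)"
    using Efm by (intro integrable_mult_right) (auto simp: fmeasurable_def)
   show "integrable lborel (\<lambda>y. indicator ?S y *\<^sub>R X y)" using sX by (simp add: set_integrable_def)
   show "T * indicator E y \<le> indicator ?S y *\<^sub>R X y" for y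
    using X0[of y] SU by (auto simp: E_def indicator_def)
  qed
  also have "\<dots> \<le> 2 * flc * h * vol ?S" using intX by (simp add: set_lebesgue_integral_def)
  finally show ?thesis .
 qed
 have sS: "tht ^ CARD('n) * vol ?S \<le> vol ?s" by (rule sect_shrink_measure[OF rh]) (use tht in auto)
 have small: "vol E \<le> vol ?s / 2"
 proof -
  have e: "2 * flc = trc * tht ^ CARD('n)" unfolding trc_def using tht(1) by simp
  have e2: "2 * flc * h * vol ?S = trc * h * (tht ^ CARD('n) * vol ?S)" unfolding e by simp
  have "T * vol E \<le> trc * h * (tht ^ CARD('n) * vol ?S)" using cheb unfolding e2 .
  also have "\<dots> \<le> trc * h * vol ?s" using sS tr h by simp
  finally have "T * vol E \<le> T * (vol ?s / 2)" by (simp add: T_def)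
  thus ?thesis using T0 by simp
 qed
 have ssub: "?s \<subseteq> ?S" by (rule sect_mono) (use tht h in \<open>simp add: mult_le_cancel_right1\<close>)
 have sfm: "?s \<in> fmeasurable lborel" using ssub sect_open by (intro fmeasurableI2[OF Sfm]) auto
 have F_b: "?F \<in> sets borel" by (rule borelX[OF sect_open _ contw, where P =
     "\<lambda>z. ainfc * (LINT z:?S|lborel. w z) \<le> z * vol ?S"])
   (use ssub SU in \<open>auto intro!: closed_Collect_le continuous_intros\<close>)
 have Ffm: "?F \<in> fmeasurable lborel" by (rule fmeasurableI2[OF sfm]) (use F_b in auto)
 define m where "m = lam / (8 * (8 * ?n) ^ CARD('n) * Lam)"
 have m0: "0 < m" using lam Lam by (simp add: m_def)
 \<comment> \<open>Off \<open>E\<close> the matrix \<open>M y\<close> divided by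
   \<open>2 * h\<close> has trace at most \<open>trc\<close>; its determinant is at least
   \<open>m\<close>, because the depth \<open>2 * h\<close> of the cut at \<open>x\<close> bounds
   \<open>(det B)\<^sup>2\<close> from below.\<close>
 have sub: "?s - E \<subseteq> ?F"
 proof
  fix y assume y: "y \<in> ?s - E"
  hence yU: "y \<in> U" and XT: "X y < T" using ssub by (auto simp: E_def sect_def)
  define M' where "M' = (1 / (2 * h)) *\<^sub>R M y"
  have "pd (M y)" unfolding pd_def
  proof (intro conjI allI impI)
   show "transpose (M y) = M y" using psdM[OF yU] by (simp add: psd_def)
   fix v :: "real^'n" assume v: "v \<noteq> 0"
   have "B *v v \<noteq> 0" by (metis Bi(2) matrix_vector_mul_assoc matrix_vector_mul_lid matrix_vector_mult_0_right v)
   hence "0 < (B *v v) \<bullet> (A y *v (B *v v))" using detA(3)[OF yU] by (simp add: pd_def)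
   moreover have "v \<bullet> (M y *v v) = (B *v v) \<bullet> (A y *v (B *v v))"
    by (simp add: M_def matrix_vector_mul_assoc[symmetric] inner_commute[of v] dot_lmul_matrix) (simp add: inner_commute)
   ultimately show "0 < v \<bullet> (M y *v v)" by simp
  qed
  hence pdM': "pd M'" using h by (simp add: M'_def pd_def transpose_scaleR scaleR_mat_vec)
  have trM': "trace M' \<le> trc"
  proof -
   have "trace M' = X y / (2 * h)" by (simp add: M'_def X_def trace_def sum_divide_distrib)
   also have "\<dots> \<le> trc" using XT h by (simp add: T_def field_simps)
   finally show ?thesis .
  qed
  have detM': "m \<le> det M'"
  proof -
   have "(- C.u x) ^ CARD('n) \<le> 8 * (8 * ?n) ^ CARD('n) * Lam * (det B)\<^sup>2"
    by (rule C.normalizing_upper'[OF nB]) (use x h in \<open>auto simp: CK Cu\<close>)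
   hence le: "(2 * h) ^ CARD('n) \<le> 8 * (8 * ?n) ^ CARD('n) * Lam * (det B)\<^sup>2" by (simp add: Cu)
   have "det M' = (1 / (2 * h)) ^ CARD('n) * det (M y)"
   proof -
    have "det M' = det (((1 / (2 * h)) *\<^sub>R mat 1) ** M y)"
     by (simp only: M'_def scaleR_mat_mult matrix_mul_lid)
    thus ?thesis by (simp only: det_mul det_scaleR_mat1)
   qed
   also have "det (M y) = (det B)\<^sup>2 * det (A y)" by (simp add: M_def det_mul power2_eq_square)
   finally have d: "det M' = (det B)\<^sup>2 * det (A y) / (2 * h) ^ CARD('n)" by (simp add: power_divide)
   define q where "q = 8 * (8 * ?n) ^ CARD('n) * Lam"
   have q: "0 < q" using Lam by (simp add: q_def)
   have "lam * (2 * h) ^ CARD('n) \<le> lam * (q * (det B)\<^sup>2)" using le lam unfolding q_def by simp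
   also have "\<dots> \<le> det (A y) * (q * (det B)\<^sup>2)" using detA(1)[OF yU] q by (intro mult_right_mono) auto
   finally have "lam / q \<le> (det B)\<^sup>2 * det (A y) / (2 * h) ^ CARD('n)"
    using q h by (simp add: pos_divide_le_eq pos_le_divide_eq mult_ac)
   thus ?thesis unfolding d m_def q_def .
  qed
  define c' where "c' = m / (CARD('n) * fact CARD('n) * trc ^ CARD('n))"
  have c'0: "0 < c'" using m0 tr by (simp add: c'_def)
  have "c' * trace N \<le> trace (M' ** N)" unfolding c'_def
   by (intro trace_le_trace_mult psdN pd_imp_psd[OF pdM'] pd_lower_bound pdM' trM' tr detM' m0)
  also have "trace (M' ** N) = w y / (2 * h)"
   by (simp add: M'_def scaleR_mat_mult wMN trace_def sum_divide_distrib)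
  finally have low: "2 * h * (c' * trace N) \<le> w y" using h by (simp add: field_simps)
  have "ainfc * (LINT z:?S|lborel. w z) \<le>
    c' / flc * (trace N * (2 * flc * h * vol ?S))"
  proof -
   have ac: "ainfc = c' / flc" by (simp add: ainfc_def c'_def m_def)
   show ?thesis unfolding ac using W_le c'0 fl by (intro mult_left_mono) auto
  qed
  also have "\<dots> = 2 * h * (c' * trace N) * vol ?S" using fl by simp
  also have "\<dots> \<le> w y * vol ?S" using low by (intro mult_right_mono) auto
  finally show "y \<in> ?F" using y by simp
 qed
 have "vol ?s \<le> vol (?F \<union> E)" using sub Ffm Efm sect_open by (intro measure_mono_fmeasurable) auto
 also have "\<dots> \<le> vol ?F + vol E" using F_b Eb by (intro measure_Un_le) auto
 finally show ?thesis using small by simp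
qed

end

section \<open>Covering by sections\<close>

locale maint = mafun U lam Lam phi g A kap sg tht
 for U :: "(real^'n::finite) set" and lam Lam phi g A kap sg tht +
 assumes bddU: "bounded U" and intw: "set_integrable lborel U w"
begin

text \<open>\<open>gc\<close> undoes the shrinking of volumes by \<open>tht\<close> and the factor
  1/2 of \<open>muckenhoupt\<close>; \<open>levc\<close> accounts for the loss of
  \<open>2 ^ CARD('n)\<close> in \<open>good_height\<close>.\<close>

definition "gc = 2 / tht ^ CARD('n)"
definition "levc = ainfc / 2 ^ CARD('n)"

definition W :: "(real^'n) set => real" where "W S = (LINT z:S|lborel. w z)"

definition mu :: "(real^'n) measure" where "mu = density lborel (\<lambda>x. ennreal (indicator U x * w x))"

lemma int_ind: "integrable lborel (\<lambda>x. indicator U x * w x)"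
 using intw by (simp add: set_integrable_def)

lemma ind_nonneg: "0 \<le> indicator U x * w x" using w_pos[of x] by force

lemma finite_mu: "finite_measure mu"
proof
 have "emeasure mu (space mu) = (\<integral>\<^sup>+ x. ennreal (indicator U x * w x) \<partial>lborel)"
  unfolding mu_def using int_ind by (subst emeasure_density) (auto intro!: nn_integral_cong)
 also have "\<dots> = ennreal (LINT x|lborel. indicator U x * w x)"
  by (rule nn_integral_eq_integral[OF int_ind]) (simp add: ind_nonneg)
 finally show "emeasure mu (space mu) \<noteq> \<infinity>" by simp
qed

lemma sets_mu [simp]: "sets mu = sets borel" by (simp add: mu_def)

lemma W_eq: assumes "S \<in> sets borel" "S \<subseteq> U" shows "W S = measure mu S"
proof -
 have i: "integrable lborel (\<lambda>x. indicator S x * w x)"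
  using set_integrable_subset[OF intw, of S] assms by (simp add: set_integrable_def)
 have nn: "0 \<le> indicator S x * w x" for x using w_pos[of x] assms by (auto simp: indicator_def)
 have "emeasure mu S = (\<integral>\<^sup>+ x. ennreal (indicator U x * w x) * indicator S x \<partial>lborel)"
  unfolding mu_def using assms int_ind by (subst emeasure_density) auto
 also have "\<dots> = (\<integral>\<^sup>+ x. ennreal (indicator S x * w x) \<partial>lborel)"
  using assms by (intro nn_integral_cong) (auto simp: indicator_def)
 also have "\<dots> = ennreal (LINT x|lborel. indicator S x * w x)"
  by (rule nn_integral_eq_integral[OF i]) (simp add: nn)
 finally show ?thesis
  by (simp add: measure_def W_def set_lebesgue_integral_def integral_nonneg_AE[OF AE_I2[OF nn]])
qed

lemma W_mono: "S \<in> sets borel ==> T \<in> sets borel ==> S \<subseteq> T ==> T \<subseteq> U ==> W S \<le> W T"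
 using finite_measure.finite_measure_mono[OF finite_mu, of S T] by (simp add: W_eq)

lemma W_nonneg: "S \<in> sets borel ==> S \<subseteq> U ==> 0 \<le> W S" by (simp add: W_eq)

lemma sect_U: "sect x h \<subseteq> U" by (auto simp: sect_def)

lemma sect_borel [simp]: "sect x h \<in> sets borel" using sect_open by simp

lemma W_ge_level:
 assumes S: "S \<in> sets borel" "S \<subseteq> U" and c: "\<And>y. y \<in> S ==> c \<le> w y"
 shows "c * vol S \<le> W S"
proof -
 have fin: "emeasure lborel S < \<infinity>"
  using bounded_subset[OF bddU S(2)] by (rule emeasure_bounded_finite)
 have "c * vol S = (LINT y|lborel. c * indicator S y)" by simp
 also have "\<dots> \<le> (LINT y|lborel. indicator S y *\<^sub>R w y)"
 proof (rule integral_mono)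
  show "integrable lborel (\<lambda>y. c * indicator S y)" using S fin by simp
  show "integrable lborel (\<lambda>y. indicator S y *\<^sub>R w y)"
   using set_integrable_subset[OF intw, of S] S by (simp add: set_integrable_def)
  show "c * indicator S y \<le> indicator S y *\<^sub>R w y" for y using c by (auto simp: indicator_def)
 qed
 finally show ?thesis by (simp add: W_def set_lebesgue_integral_def)
qed

text \<open>Vitali selection: a section of maximal height is kept and those that meet it are
  discarded, since by \<open>sect_containment\<close> its enlargement covers them.\<close>

lemma greedy:
 assumes "finite F" "\<And>x. x \<in> F ==> room x (h x)"
 obtains F' where "F' \<subseteq> F" "disjoint_family_on (\<lambda>x. sect x (tht * h x)) F'"
  "(\<Union>x\<in>F. sect x (tht * h x)) \<subseteq> (\<Union>x\<in>F'. sect x (h x))"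
proof -
 have "\<exists>F'. F' \<subseteq> F \<and> disjoint_family_on (\<lambda>x. sect x (tht * h x)) F' \<and>
  (\<Union>x\<in>F. sect x (tht * h x)) \<subseteq> (\<Union>x\<in>F'. sect x (h x))" using assms
 proof (induction "card F" arbitrary: F rule: less_induct)
  case less
  show ?case
  proof (cases "F = {}")
   case True
   thus ?thesis by (auto simp: disjoint_family_on_def)
  next
   case False
   obtain m where m: "m \<in> F" "\<And>x. x \<in> F ==> h x \<le> h m"
   proof -
    have "Max (h ` F) \<in> h ` F" using less.prems(1) False by simp
    then obtain m where "m \<in> F" "Max (h ` F) = h m" by auto
    thus ?thesis using that less.prems(1) Max_ge[of "h ` F"] by auto
   qed
   define G where "G = {x \<in> F. sect m (tht * h m) \<inter> sect x (tht * h x) = {}}"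
   have mh: "0 < h m" "m \<in> U" using less.prems(2)[OF m(1)] by (auto simp: room_def)
   have "m \<in> sect m (tht * h m)" using mh tht by (intro centre_in_sect) auto
   hence "m \<notin> G" by (auto simp: G_def)
   hence c1: "card G < card F" using m less.prems(1) by (intro psubset_card_mono) (auto simp: G_def)
   have c2: "finite G" using less.prems(1) by (simp add: G_def)
   have c3: "room x (h x)" if "x \<in> G" for x using less.prems(2) that by (simp add: G_def)
   from less.hyps[OF c1 c2 c3] obtain G' where G': "G' \<subseteq> G" "disjoint_family_on (\<lambda>x. sect x (tht * h x)) G'"
    "(\<Union>x\<in>G. sect x (tht * h x)) \<subseteq> (\<Union>x\<in>G'. sect x (h x))" by blast
   have "disjoint_family_on (\<lambda>x. sect x (tht * h x)) (insert m G')"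
    using G' by (auto simp: disjoint_family_on_def G_def)
   moreover have "(\<Union>x\<in>F. sect x (tht * h x)) \<subseteq> (\<Union>x\<in>insert m G'. sect x (h x))"
   proof
    fix z assume "z \<in> (\<Union>x\<in>F. sect x (tht * h x))"
    then obtain x where x: "x \<in> F" "z \<in> sect x (tht * h x)" by blast
    show "z \<in> (\<Union>x\<in>insert m G'. sect x (h x))"
    proof (cases "x \<in> G")
     case True
     thus ?thesis using x G'(3) by auto
    next
     case False
     hence "sect m (tht * h m) \<inter> sect x (tht * h x) \<noteq> {}" using x by (auto simp: G_def)
     from sect_containment[OF less.prems(2)[OF m(1)] less.prems(2)[OF x(1)] m(2)[OF x(1)] this]
     show ?thesis using x by auto
    qed
   qed
   moreover have "insert m G' \<subseteq> F" using m G' by (auto simp: G_def)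
   ultimately show ?thesis by blast
  qed
 qed
 thus ?thesis using that by blast
qed

text \<open>The measure \<open>M\<close> is a parameter because good points are compared with
  Lebesgue measure and bad ones with \<open>mu\<close>. Finite families are thinned by
  \<open>greedy\<close>; an arbitrary one is reduced to a countable one by Lindelof and exhausted by
  finite unions.\<close>

lemma cover_bound:
 assumes r: "\<And>x. x \<in> P ==> room x (h x)"
  and L: "finite_measure M" "sets M = sets borel" "E \<in> sets borel"
  and b: "\<And>x. x \<in> P ==> W (sect x (h x)) \<le> c * measure M (sect x (tht * h x) \<inter> E)" and c: "0 \<le> c"
 shows "W (\<Union>x\<in>P. sect x (tht * h x)) \<le> c * measure M E"
proof -
 have fin: "W (\<Union>x\<in>F. sect x (tht * h x)) \<le> c * measure M E" if F: "finite F" "F \<subseteq> P" for F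
 proof -
  have rr: "\<And>x. x \<in> F ==> room x (h x)" using r F by blast
  obtain F' where F': "F' \<subseteq> F" "disjoint_family_on (\<lambda>x. sect x (tht * h x)) F'"
   "(\<Union>x\<in>F. sect x (tht * h x)) \<subseteq> (\<Union>x\<in>F'. sect x (h x))"
   using greedy[OF F(1) rr] by blast
  have fF': "finite F'" using F F' finite_subset by blast
  have "W (\<Union>x\<in>F. sect x (tht * h x)) \<le> W (\<Union>x\<in>F'. sect x (h x))"
  proof (intro W_mono sets.finite_UN)
   show "(\<Union>x\<in>F'. sect x (h x)) \<subseteq> U" using sect_U by blast
  qed (use F'(3) F fF' in auto)
  also have "\<dots> = measure mu (\<Union>x\<in>F'. sect x (h x))"
   using sect_U fF' by (intro W_eq sets.finite_UN) auto
  also have "\<dots> \<le> (\<Sum>x\<in>F'. measure mu (sect x (h x)))"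
   by (rule finite_measure.finite_measure_subadditive_finite[OF finite_mu fF']) auto
  also have "\<dots> = (\<Sum>x\<in>F'. W (sect x (h x)))" by (simp add: W_eq sect_U)
  also have "\<dots> \<le> (\<Sum>x\<in>F'. c * measure M (sect x (tht * h x) \<inter> E))"
   using F F' by (intro sum_mono b) auto
  also have "\<dots> = c * (\<Sum>x\<in>F'. measure M (sect x (tht * h x) \<inter> E))" by (simp add: sum_distrib_left)
  also have "(\<Sum>x\<in>F'. measure M (sect x (tht * h x) \<inter> E)) = measure M (\<Union>x\<in>F'. sect x (tht * h x) \<inter> E)"
   using F'(2) L fF' by (intro finite_measure.finite_measure_finite_Union[symmetric])
    (auto simp: disjoint_family_on_def)
  also have "c * \<dots> \<le> c * measure M E"
   using L c by (intro mult_left_mono finite_measure.finite_measure_mono) auto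
  finally show ?thesis .
 qed
 define \<F> where "\<F> = (\<lambda>x. sect x (tht * h x)) ` P"
 obtain \<G> where \<G>: "\<G> \<subseteq> \<F>" "countable \<G>" "\<Union>\<G> = \<Union>\<F>"
  using Lindelof[of \<F>] sect_open by (auto simp: \<F>_def)
 have PG: "(\<Union>x\<in>P. sect x (tht * h x)) = \<Union>\<G>" using \<G>(3) by (simp add: \<F>_def)
 show ?thesis
 proof (cases "\<G> = {}")
  case True
  thus ?thesis using c unfolding PG by (simp add: W_def set_lebesgue_integral_def)
 next
  case False
  obtain C where C: "C \<subseteq> P" "countable C" "\<G> = (\<lambda>x. sect x (tht * h x)) ` C"
   using countable_subset_image[of \<G> "\<lambda>x. sect x (tht * h x)" P] \<G> unfolding \<F>_def by metis
  define f where "f = from_nat_into C"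
  have Cne: "C \<noteq> {}" using False C by auto
  have rf: "range f = C" unfolding f_def using C(2) Cne by simp
  define A where "A k = (\<Union>x\<in>f ` {..k}. sect x (tht * h x))" for k :: nat
  have Ab: "A k \<in> sets borel" for k unfolding A_def by auto
  have AU: "A k \<subseteq> U" for k unfolding A_def using sect_U by blast
  have inc: "incseq A" unfolding A_def incseq_def by force
  have UA: "(\<Union>k. A k) = \<Union>\<G>" unfolding A_def C(3) rf[symmetric] by auto
  have "(\<lambda>k. measure mu (A k)) \<longlonglongrightarrow> measure mu (\<Union>k. A k)"
   by (rule finite_measure.finite_Lim_measure_incseq[OF finite_mu _ inc]) (use Ab in auto)
  moreover have "measure mu (A k) \<le> c * measure M E" for k
  proof -
   have "f ` {..k} \<subseteq> P" using rf C(1) by blast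
   thus ?thesis using fin[of "f ` {..k}"] W_eq[OF Ab AU] by (simp add: A_def)
  qed
  ultimately have le: "measure mu (\<Union>k. A k) \<le> c * measure M E" by (intro LIMSEQ_le_const2) auto
  have "\<Union>\<G> \<in> sets borel" using UA Ab by (metis sets.countable_UN image_subsetI)
  moreover have "\<Union>\<G> \<subseteq> U" using UA AU by blast
  ultimately show ?thesis using le UA by (simp add: PG W_eq)
 qed
qed

text \<open>If \<open>breg x\<close> vanished at \<open>y\<close>, it would vanish on the whole
  segment by convexity; all its points would be minima, so the gradient would be constant there,
  against positivity of \<open>A x\<close>.\<close>

lemma breg_pos: assumes "x \<in> U" "y \<in> U" "x \<noteq> y" shows "0 < breg x y"
proof (rule ccontr)
 assume "\<not> 0 < breg x y"
 hence b0: "breg x y = 0" using breg_nonneg[OF assms(1,2)] by simp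
 define v where "v = y - x"
 have gz: "g (x + t *\<^sub>R v) = g x" if t: "0 \<le> t" "t \<le> 1" for t
 proof -
  have zU: "x + t *\<^sub>R v \<in> U" unfolding v_def by (rule segment_in_U[OF assms(1,2) t])
  have "breg x (x + t *\<^sub>R v) \<le> (1 - t) * breg x x + t * breg x y"
   unfolding v_def by (rule breg_convex[OF assms(1,2) t])
  hence "breg x (x + t *\<^sub>R v) = 0" using breg_nonneg[OF assms(1) zU] b0 by simp
  hence "g (x + t *\<^sub>R v) - g x = 0"
   using C2fun_min(1)[OF C2fun_diff_affine[OF C2, of "g x" "phi x - g x \<bullet> x"] zU]
    breg_nonneg[OF assms(1)] by (simp add: breg_affine)
  thus ?thesis by simp
 qed
 have "((\<lambda>t. g (x + t *\<^sub>R v) \<bullet> v) has_real_derivative (A x *v v) \<bullet> v) (at 0)"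
  using dg[OF assms(1)] by (intro DERIV_along_line[where f = "\<lambda>y. g y \<bullet> v"] has_derivative_inner_left) simp
 moreover have "0 < (A x *v v) \<bullet> v" using detA(3)[OF assms(1)] assms(3) by (simp add: pd_def v_def inner_commute)
 ultimately obtain d where "0 < d" "\<And>h. 0 < h ==> h < d ==> g (x + 0 *\<^sub>R v) \<bullet> v < g (x + (0 + h) *\<^sub>R v) \<bullet> v"
  using DERIV_pos_inc_right by blast
 moreover define s where "s = min (d / 2) 1"
 ultimately have "0 < s" "s < d" "s \<le> 1" by auto
 thus False using \<open>\<And>h. 0 < h ==> h < d ==> _\<close>[of s] gz[of s] by simp
qed

lemma sect_small:
 assumes x: "x \<in> U" and ep: "0 < ep" obtains h0 where "0 < h0" "sect x h0 \<subseteq> ball x ep"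
proof -
 obtain r where r: "0 < r" "cball x r \<subseteq> U" using openU x open_contains_cball by blast
 define s where "s = min r (ep / 2)"
 have s: "0 < s" "s < ep" "sphere x s \<subseteq> U" using r ep by (auto simp: s_def)
 have "sphere x s \<noteq> {}" using s(1) by simp
 then obtain z where z: "z \<in> sphere x s" "\<And>y. y \<in> sphere x s ==> breg x z \<le> breg x y"
  using continuous_attains_inf[OF compact_sphere _ continuous_on_subset[OF cont_breg s(3)]] by metis
 have pos: "0 < breg x z" using z(1) s by (intro breg_pos x) auto
 have "y \<in> ball x ep" if y: "y \<in> sect x (breg x z)" for y
 proof (rule ccontr)
  assume "y \<notin> ball x ep"
  hence d: "s < dist x y" using s by simp
  define t where "t = s / dist x y"
  have dp: "0 < dist x y" using d s by auto
  have t: "0 \<le> t" "t \<le> 1" using d s dp by (auto simp: t_def)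
  have "dist x (x + t *\<^sub>R (y - x)) = t * dist x y" using t by (simp add: dist_norm norm_minus_commute)
  also have "\<dots> = s" using dp by (simp add: t_def)
  finally have sph: "x + t *\<^sub>R (y - x) \<in> sphere x s" by simp
  have yU: "y \<in> U" using y by (simp add: sect_def)
  from sph have "breg x z \<le> breg x (x + t *\<^sub>R (y - x))" by (rule z(2))
  also have "\<dots> \<le> (1 - t) * breg x x + t * breg x y" by (rule breg_convex[OF x yU t])
  also have "\<dots> \<le> 1 * breg x y" using t breg_nonneg[OF x yU] by (simp add: mult_left_le_one_le)
  finally show False using y by (simp add: sect_def)
 qed
 thus ?thesis using that[OF pos] by blast
qed

text \<open>A stopping height. Among the heights with mean at least \<open>t\<close>, pick
  \<open>h1\<close> within a factor 2 of the supremum and double it, capped at \<open>H\<close>: the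
  mean is now at most \<open>t\<close>, and at least \<open>t / 2 ^ CARD('n)\<close> because the
  volume grows at most by that power. Working up to a factor 2 dispenses with continuity of the mean
  in the height.\<close>

lemma good_height:
 assumes x: "x \<in> U" "t < w x" and H: "0 < H" "room x H" and lt: "W (sect x H) < t * vol (sect x H)"
 obtains h where "0 < h" "h \<le> H" "W (sect x h) \<le> t * vol (sect x h)"
  "t / 2 ^ CARD('n) * vol (sect x h) \<le> W (sect x h)"
proof -
 define B where "B = {h. 0 < h \<and> h \<le> H \<and> t * vol (sect x h) \<le> W (sect x h)}"
 have rm: "room x h" if "0 < h" "h \<le> H" for h using room_mono[OF H(2)] that by blast
 have Wle: "0 \<le> W (sect x h)" for h by (rule W_nonneg) (auto simp: sect_U)
 have Bne: "\<exists>h. h \<in> B"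
 proof -
  have "open (U \<inter> w -` {t<..})" by (intro continuous_open_preimage contw openU) simp
  then obtain ep where ep: "0 < ep" "ball x ep \<subseteq> U \<inter> w -` {t<..}" using x open_contains_ball by blast
  obtain h0 where h0: "0 < h0" "sect x h0 \<subseteq> ball x ep" using sect_small[OF x(1) ep(1)] by blast
  let ?h = "min h0 H"
  have "sect x ?h \<subseteq> ball x ep" using h0 sect_mono[of ?h h0 x] by auto
  hence "t * vol (sect x ?h) \<le> W (sect x ?h)" using ep(2) by (intro W_ge_level) (auto simp: sect_U)
  thus ?thesis using h0 H by (intro exI[of _ ?h]) (auto simp: B_def)
 qed
 have bdd: "bdd_above B" by (auto simp: B_def)
 have Sup0: "0 < Sup B"
 proof -
  obtain h where "h \<in> B" using Bne by blast
  hence "0 < h" "h \<le> Sup B" using cSup_upper[OF _ bdd] by (auto simp: B_def)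
  thus ?thesis by simp
 qed
 hence "Sup B / 2 < Sup B" by simp
 then obtain h1 where h1: "h1 \<in> B" "Sup B / 2 < h1" using less_cSup_iff[OF _ bdd] Bne by blast
 define h2 where "h2 = min (2 * h1) H"
 have h12: "0 < h1" "h1 \<le> h2" "h2 \<le> 2 * h1" "h2 \<le> H" "0 < h2"
  using h1 by (auto simp: h2_def B_def)
 have lt2: "W (sect x h2) \<le> t * vol (sect x h2)"
 proof (cases "2 * h1 \<le> H")
  case True
  have "2 * h1 \<notin> B" using h1(2) cSup_upper[OF _ bdd, of "2 * h1"] by auto
  thus ?thesis using True h12 by (simp add: B_def h2_def)
 next
  case False
  thus ?thesis using lt by (simp add: h2_def)
 qed
 have "t / 2 ^ CARD('n) * vol (sect x h2) \<le> W (sect x h2)"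
 proof (cases "t \<le> 0")
  case True
  hence "t / 2 ^ CARD('n) * vol (sect x h2) \<le> 0" by (intro mult_nonpos_nonneg divide_nonpos_nonneg) auto
  thus ?thesis using Wle[of h2] by simp
 next
  case False
  have "(h1 / h2) ^ CARD('n) * vol (sect x h2) \<le> vol (sect x (h1 / h2 * h2))"
   using h12 by (intro sect_shrink_measure rm) auto
  moreover have "(1 / 2) ^ CARD('n) * vol (sect x h2) \<le> (h1 / h2) ^ CARD('n) * vol (sect x h2)"
   using h12 by (intro mult_right_mono power_mono) (auto simp: field_simps)
  ultimately have "(1 / 2) ^ CARD('n) * vol (sect x h2) \<le> vol (sect x h1)" using h12 by simp
  hence "t * ((1 / 2) ^ CARD('n) * vol (sect x h2)) \<le> t * vol (sect x h1)" using False by simp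
  also have "\<dots> \<le> W (sect x h1)" using h1 by (simp add: B_def)
  also have "\<dots> \<le> W (sect x h2)" using h12 by (intro W_mono sect_mono) (auto simp: sect_U)
  finally show ?thesis by (simp add: power_divide)
 qed
 thus ?thesis using that[of h2] h12 lt2 by blast
qed

text \<open>Good points have a stopping height up to \<open>H x\<close>, and
  \<open>muckenhoupt\<close> finds \<open>levc * t \<le> w\<close> on a fixed fraction of their
  small section. At bad points the mean is at least \<open>t\<close> even at height
  \<open>H x\<close>; the same estimate charges the mass of the section to its small part, which
  lies in \<open>L\<close>.\<close>

lemma level_estimate:
 assumes H: "\<And>x. x \<in> U ==> room x (2 * H x)" and t: "0 < t" and L: "L \<in> sets borel" "L \<subseteq> U"
  and bad: "\<And>x. x \<in> U ==> t * vol (sect x (H x)) \<le> W (sect x (H x)) ==> sect x (tht * H x) \<subseteq> L"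
 shows "W {x \<in> U. t < w x} \<le> gc *
  (t * vol {x \<in> U. levc * t \<le> w x} + W L / ainfc)"
proof -
 define a where "a = ainfc"
 have a: "0 < a" using constants_pos by (simp add: a_def)
 note gc = gc_def
 have gc0: "0 < gc" using tht by (simp add: gc)
 have Hpos: "0 < H x" "room x (H x)" if "x \<in> U" for x
 proof -
  show "0 < H x" using H[OF that] by (simp add: room_def)
  thus "room x (H x)" by (intro room_mono[OF H[OF that]]) auto
 qed
 define c2 where "c2 = levc"
 have c2: "c2 = a / 2 ^ CARD('n)" by (simp add: c2_def levc_def a_def)
 define E where "E = {x \<in> U. c2 * t \<le> w x}"
 have lev: "{x \<in> U. c \<le> w x} \<in> sets borel" "{x \<in> U. c < w x} \<in> sets borel" for c
 proof -
  have "{x \<in> U. c < w x} = U \<inter> w -` {c<..}" by auto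
  moreover have "open (U \<inter> w -` {c<..})" by (intro continuous_open_preimage contw openU) simp
  ultimately show "{x \<in> U. c < w x} \<in> sets borel" by simp
  have "{x \<in> U. c \<le> w x} = U - (U \<inter> w -` {..<c})" by auto
  moreover have "open (U \<inter> w -` {..<c})" by (intro continuous_open_preimage contw openU) simp
  ultimately show "{x \<in> U. c \<le> w x} \<in> sets borel" using openU by simp
 qed
 define Bd where "Bd = {x \<in> U. t * vol (sect x (H x)) \<le> W (sect x (H x))}"
 have m_sect: "tht ^ CARD('n) * vol (sect x h) / 2 \<le>
   vol {y \<in> sect x (tht * h). a * W (sect x h) \<le> w y * vol (sect x h)}"
  if "room x (2 * h)" for x h
 proof -
  have "0 < h" using that by (simp add: room_def)
  hence "room x h" by (intro room_mono[OF that]) auto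
  hence "tht ^ CARD('n) * vol (sect x h) \<le> vol (sect x (tht * h))"
   by (rule sect_shrink_measure) (use tht in auto)
  thus ?thesis using muckenhoupt[OF that] by (simp add: a_def W_def)
 qed
 have set_b: "{y \<in> sect x h. c \<le> w y * m} \<in> sets borel" if "0 < m" for x h c m
 proof -
  have "{y \<in> sect x h. c \<le> w y * m} = sect x h \<inter> {y \<in> U. c / m \<le> w y}"
   using that sect_U by (auto simp: pos_divide_le_eq)
  thus ?thesis using lev by auto
 qed
 have mpos: "0 < vol (sect x h)" if "room x (2 * h)" for x h
 proof -
  have "0 < h" using that by (simp add: room_def)
  thus ?thesis by (intro sect_measure_pos room_mono[OF that]) auto
 qed
 let ?M = "restrict_space lborel U"
 have lU: "finite_measure (density lborel (indicator U :: _ => ennreal))"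
 proof
  show "emeasure (density lborel (indicator U :: _ => ennreal)) (space (density lborel (indicator U))) \<noteq> \<infinity>"
   using emeasure_bounded_finite[OF bddU] openU by (simp add: emeasure_density)
 qed
 have mU: "measure (density lborel (indicator U :: _ => ennreal)) S = vol S"
  if "S \<in> sets borel" "S \<subseteq> U" for S
 proof -
  have "emeasure (density lborel (indicator U :: _ => ennreal)) S = (\<integral>\<^sup>+ x. indicator U x * indicator S x \<partial>lborel)"
   using that openU by (subst emeasure_density) auto
  also have "\<dots> = (\<integral>\<^sup>+ x. indicator S x \<partial>lborel)"
   using that by (intro nn_integral_cong) (auto simp: indicator_def)
  finally show ?thesis using that by (simp add: measure_def)
 qed
 define P where "P = {x \<in> U. t < w x} - Bd"
 have "\<exists>h. 0 < h \<and> h \<le> H x \<and> W (sect x h) \<le> t * vol (sect x h) \<and>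
   t / 2 ^ CARD('n) * vol (sect x h) \<le> W (sect x h)" if "x \<in> P" for x
  using good_height[of x t "H x"] Hpos[of x] that by (force simp: P_def Bd_def)
 then obtain h where h: "\<And>x. x \<in> P ==> 0 < h x \<and> h x \<le> H x \<and>
   W (sect x (h x)) \<le> t * vol (sect x (h x)) \<and>
   t / 2 ^ CARD('n) * vol (sect x (h x)) \<le> W (sect x (h x))" by metis
 have good: "W (\<Union>x\<in>P. sect x (tht * h x)) \<le> (gc * t) * measure (density lborel (indicator U :: _ => ennreal)) E"
 proof (rule cover_bound)
  fix x assume x: "x \<in> P"
  hence xU: "x \<in> U" by (simp add: P_def)
  have r2: "room x (2 * h x)" by (rule room_mono[OF H[OF xU]]) (use h[OF x] in auto)
  show "room x (h x)" by (rule room_mono[OF r2]) (use h[OF x] in auto)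
  have "W (sect x (h x)) \<le> t * vol (sect x (h x))" using h[OF x] by simp
  also have "\<dots> = gc * t * (tht ^ CARD('n) * vol (sect x (h x)) / 2)" using tht by (simp add: gc)
  also have "\<dots> \<le> gc * t * vol {y \<in> sect x (tht * h x).
    a * W (sect x (h x)) \<le> w y * vol (sect x (h x))}" using gc0 t by (intro mult_left_mono m_sect r2) auto
  also have "\<dots> \<le> gc * t * vol (sect x (tht * h x) \<inter> E)"
  proof (intro mult_left_mono measure_mono_fmeasurable)
   show "{y \<in> sect x (tht * h x). a * W (sect x (h x)) \<le> w y * vol (sect x (h x))} \<subseteq>
     sect x (tht * h x) \<inter> E"
   proof
    fix y assume y: "y \<in> {y \<in> sect x (tht * h x). a * W (sect x (h x)) \<le> w y * vol (sect x (h x))}"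
    have "a * (t / 2 ^ CARD('n) * vol (sect x (h x))) \<le> a * W (sect x (h x))"
     using h[OF x] a by (intro mult_left_mono) auto
    also have "\<dots> \<le> w y * vol (sect x (h x))" using y by simp
    finally have "(c2 * t) * vol (sect x (h x)) \<le> w y * vol (sect x (h x))" by (simp add: c2)
    hence "c2 * t \<le> w y" using mpos[OF r2] by simp
    thus "y \<in> sect x (tht * h x) \<inter> E" using y sect_U by (auto simp: E_def)
   qed
   have "emeasure lborel (sect x (tht * h x) \<inter> E) < \<infinity>"
    by (rule emeasure_bounded_finite[OF bounded_subset[OF bddU]]) (auto simp: E_def)
   thus "sect x (tht * h x) \<inter> E \<in> fmeasurable lborel" using lev by (auto simp: fmeasurable_def E_def)
  qed (use gc0 t set_b[OF mpos[OF r2]] in auto)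
  also have "vol (sect x (tht * h x) \<inter> E) =
    measure (density lborel (indicator U :: _ => ennreal)) (sect x (tht * h x) \<inter> E)"
   using lev by (intro mU[symmetric]) (auto simp: E_def)
  finally show "W (sect x (h x)) \<le>
    gc * t * measure (density lborel (indicator U :: _ => ennreal)) (sect x (tht * h x) \<inter> E)" .
 qed (use lU lev gc0 t in \<open>auto simp: E_def\<close>)
 have bad': "W (\<Union>x\<in>Bd. sect x (tht * H x)) \<le> (gc / a) * measure mu L"
 proof (rule cover_bound)
  fix x assume x: "x \<in> Bd"
  hence xU: "x \<in> U" by (simp add: Bd_def)
  show "room x (H x)" using Hpos xU by blast
  let ?S = "sect x (H x)" and ?s = "sect x (tht * H x)"
  define F where "F = {y \<in> ?s. a * W ?S \<le> w y * vol ?S}"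
  define m where "m = vol ?S"
  have m0: "0 < m" unfolding m_def by (rule mpos[OF H[OF xU]])
  have Fb: "F \<in> sets borel" "F \<subseteq> U" using set_b[OF mpos[OF H[OF xU]]] by (auto simp: F_def sect_def)
  have "a * W ?S / m * vol F \<le> W F"
   by (rule W_ge_level[OF Fb]) (use m0 in \<open>auto simp: F_def m_def pos_divide_le_eq\<close>)
  also have "\<dots> \<le> W ?s" using Fb sect_U by (intro W_mono) (auto simp: F_def)
  also have "\<dots> = measure mu (?s \<inter> L)"
  proof -
   have "?s \<inter> L = ?s" using bad[OF xU] x by (auto simp: Bd_def)
   thus ?thesis using sect_U by (simp add: W_eq)
  qed
  finally have 1: "a * W ?S / m * vol F \<le> measure mu (?s \<inter> L)" .
  have "tht ^ CARD('n) * m / 2 \<le> vol F" unfolding m_def F_def by (rule m_sect[OF H[OF xU]])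
  hence "a * W ?S / m * (tht ^ CARD('n) * m / 2) \<le> a * W ?S / m * vol F"
   using a m0 W_nonneg[of ?S] sect_U by (intro mult_left_mono) auto
  with 1 have 2: "a * W ?S / m * (tht ^ CARD('n) * m / 2) \<le> measure mu (?s \<inter> L)" by linarith
  have "W ?S = gc / a * (a * W ?S / m * (tht ^ CARD('n) * m / 2))" using a m0 tht by (simp add: gc)
  also have "\<dots> \<le> gc / a * measure mu (?s \<inter> L)" using a gc0 2 by (intro mult_left_mono) auto
  finally show "W ?S \<le> gc / a * measure mu (?s \<inter> L)" .
 qed (use finite_mu L a gc0 in auto)
 have V: "(\<Union>x\<in>P. sect x (tht * h x)) \<in> sets borel" "(\<Union>x\<in>Bd. sect x (tht * H x)) \<in> sets borel"
  by (intro borel_open open_UN ballI sect_open)+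
 have sub: "{x \<in> U. t < w x} \<subseteq> (\<Union>x\<in>P. sect x (tht * h x)) \<union> (\<Union>x\<in>Bd. sect x (tht * H x))"
 proof
  fix x assume x: "x \<in> {x \<in> U. t < w x}"
  show "x \<in> (\<Union>x\<in>P. sect x (tht * h x)) \<union> (\<Union>x\<in>Bd. sect x (tht * H x))"
  proof (cases "x \<in> Bd")
   case True
   hence "x \<in> sect x (tht * H x)" using x Hpos tht by (intro centre_in_sect) auto
   thus ?thesis using True by blast
  next
   case False
   hence "x \<in> P" using x by (simp add: P_def)
   hence "x \<in> sect x (tht * h x)" using x h tht by (intro centre_in_sect) auto
   thus ?thesis using \<open>x \<in> P\<close> by blast
  qed
 qed
 have "W {x \<in> U. t < w x} = measure mu {x \<in> U. t < w x}" using lev by (intro W_eq) auto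
 also have "\<dots> \<le> measure mu ((\<Union>x\<in>P. sect x (tht * h x)) \<union> (\<Union>x\<in>Bd. sect x (tht * H x)))"
  using V sub by (intro finite_measure.finite_measure_mono[OF finite_mu]) auto
 also have "\<dots> \<le> measure mu (\<Union>x\<in>P. sect x (tht * h x)) + measure mu (\<Union>x\<in>Bd. sect x (tht * H x))"
  using V by (intro measure_Un_le) auto
 also have "\<dots> = W (\<Union>x\<in>P. sect x (tht * h x)) + W (\<Union>x\<in>Bd. sect x (tht * H x))"
 proof -
  have "(\<Union>x\<in>P. sect x (tht * h x)) \<subseteq> U" "(\<Union>x\<in>Bd. sect x (tht * H x)) \<subseteq> U" using sect_U by blast+
  thus ?thesis using V by (simp only: W_eq)
 qed
 also have "\<dots> \<le> gc * t * vol E + gc / a * W L"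
  using good bad' mU[of E] lev W_eq[OF L] by (simp add: E_def)
 finally show ?thesis unfolding a_def[symmetric] c2_def[symmetric] E_def[symmetric]
  by (simp add: algebra_simps)
qed

end

section \<open>Higher integrability from a decay estimate\<close>

lemma geometric_decay:
 fixes F :: "nat => real"
 assumes q: "0 \<le> kap" "kap < q" "q < 1" "0 \<le> p" "p \<le> q" and R: "0 \<le> R" "0 \<le> F 0"
  and step: "\<And>k. F (Suc k) \<le> kap * F k + R * p ^ k"
 shows "F k \<le> (F 0 + R / (q - kap)) * q ^ k"
proof (induction k)
 case 0
 thus ?case using q R by simp
next
 case (Suc k)
 let ?D = "F 0 + R / (q - kap)"
 have "F (Suc k) \<le> kap * F k + R * p ^ k" by (rule step)
 also have "\<dots> \<le> kap * (?D * q ^ k) + R * q ^ k"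
  using Suc q R by (intro add_mono mult_left_mono power_mono) auto
 also have "\<dots> = (kap * ?D + R) * q ^ k" by (simp add: algebra_simps)
 also have "\<dots> \<le> (q * ?D) * q ^ k"
 proof (intro mult_right_mono)
  have "(q - kap) * ?D = (q - kap) * F 0 + R" using q by (simp add: distrib_left)
  moreover have "0 \<le> (q - kap) * F 0" using q R by simp
  ultimately have "R \<le> q * ?D - kap * ?D" by (simp only: left_diff_distrib)
  thus "kap * ?D + R \<le> q * ?D" by simp
 qed (use q in simp)
 finally show ?case by (simp add: mult_ac)
qed

text \<open>Layer-cake estimate over the geometric levels \<open>N ^ k * s0\<close>, whose sum
  converges because the weights grow by \<open>N powr ep\<close> per level.\<close>

lemma powr_moment_bound:
 assumes M: "finite_measure M" and w [measurable]: "w \<in> borel_measurable M"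
  and nn: "\<And>x. x \<in> space M ==> 0 \<le> w x"
  and s0: "0 < s0" and N: "1 < N" and ep: "0 < ep" and D: "0 \<le> D" "0 \<le> q" "N powr ep * q < 1"
  and dec: "\<And>k. measure M {x \<in> space M. N ^ k * s0 < w x} \<le> D * q ^ k"
 shows "(\<integral>\<^sup>+x. ennreal (w x powr ep) \<partial>M) \<le>
  ennreal (s0 powr ep * measure M (space M) + (N * s0) powr ep * D / (1 - N powr ep * q))"
proof -
 interpret finite_measure M by (rule M)
 define A where "A k = {x \<in> space M. N ^ k * s0 < w x}" for k
 have A [measurable]: "A k \<in> sets M" for k unfolding A_def by simp
 define c where "c k = (N ^ Suc k * s0) powr ep" for k :: nat
 have c: "c k = (N * s0) powr ep * (N powr ep) ^ k" for k
 proof -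
  have "c k = (N * s0) powr ep * (N ^ k) powr ep" unfolding c_def by (simp add: powr_mult[symmetric] mult_ac)
  also have "(N ^ k) powr ep = (N powr ep) ^ k"
   using N by (simp add: powr_realpow[symmetric] powr_powr mult.commute)
  finally show ?thesis .
 qed
 have c0: "0 \<le> c k" for k by (simp add: c_def)
 have single: "f j \<le> (\<Sum>k. f k)" for f :: "nat => ennreal" and j
  using sum_le_suminf[of f "{j}"] by simp
 have pw: "ennreal (w x powr ep) \<le> ennreal (s0 powr ep) + (\<Sum>k. ennreal (c k) * indicator (A k) x)"
  if x: "x \<in> space M" for x
 proof (cases "w x \<le> s0")
  case True
  hence "w x powr ep \<le> s0 powr ep" using ep nn[OF x] by (intro powr_mono2) auto
  hence "ennreal (w x powr ep) \<le> ennreal (s0 powr ep) + 0" by simp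
  also have "\<dots> \<le> ennreal (s0 powr ep) + (\<Sum>k. ennreal (c k) * indicator (A k) x)" by simp
  finally show ?thesis .
 next
  case False
  obtain m where m: "w x / s0 < N ^ m" using real_arch_pow[OF N] by blast
  define k where "k = (LEAST m. w x / s0 < N ^ m)"
  have k: "w x / s0 < N ^ k" unfolding k_def by (rule LeastI[of _ m]) (rule m)
  have k0: "k \<noteq> 0" using k False s0 by (intro notI) (simp add: pos_divide_less_eq)
  then obtain j where j: "k = Suc j" by (cases k) auto
  have "\<not> w x / s0 < N ^ j" using not_less_Least[of j "\<lambda>m. w x / s0 < N ^ m"] j by (simp add: k_def)
  hence lower: "N ^ j * s0 \<le> w x" using s0 by (simp add: pos_divide_less_eq)
  have upper: "w x < N ^ Suc j * s0" using k j s0 by (simp add: pos_divide_less_eq)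
  show ?thesis
  proof (cases "N ^ j * s0 < w x")
   case True
   have "w x powr ep \<le> c j" unfolding c_def using upper nn[OF x] ep by (intro powr_mono2) auto
   hence "ennreal (w x powr ep) \<le> ennreal (c j) * indicator (A j) x"
    using True x by (simp add: ennreal_leI A_def)
   also have "\<dots> \<le> (\<Sum>k. ennreal (c k) * indicator (A k) x)" by (rule single)
   finally show ?thesis by (simp add: add_increasing)
  next
   \<comment> \<open>Levels are strict, so a value equal to \<open>N ^ j * s0\<close> is counted in
     the preceding shell, where \<open>c i\<close> is exactly its power.\<close>
   case eq: False
   hence e: "w x = N ^ j * s0" using lower by simp
   have "j \<noteq> 0" using e False by (intro notI) simp
   then obtain i where i: "j = Suc i" by (cases j) auto
   have "N ^ i * s0 < w x" using N s0 unfolding e i by simp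
   moreover have "w x powr ep = c i" by (simp add: c_def e i)
   ultimately have "ennreal (w x powr ep) \<le> ennreal (c i) * indicator (A i) x"
    using x by (simp add: A_def)
   also have "\<dots> \<le> (\<Sum>k. ennreal (c k) * indicator (A k) x)" by (rule single)
   finally show ?thesis by (simp add: add_increasing)
  qed
 qed
 have sm: "(\<lambda>k. c k * (D * q ^ k)) sums ((N * s0) powr ep * D / (1 - N powr ep * q))"
 proof -
  have "(\<lambda>k. (N powr ep * q) ^ k) sums (1 / (1 - N powr ep * q))"
   using D by (intro geometric_sums) (simp add: abs_mult)
  from sums_mult[OF this, of "(N * s0) powr ep * D"] show ?thesis by (simp add: c power_mult_distrib mult_ac)
 qed
 have "(\<integral>\<^sup>+x. ennreal (w x powr ep) \<partial>M) \<le>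
   (\<integral>\<^sup>+x. ennreal (s0 powr ep) + (\<Sum>k. ennreal (c k) * indicator (A k) x) \<partial>M)"
  by (intro nn_integral_mono pw)
 also have "\<dots> = ennreal (s0 powr ep) * emeasure M (space M) + (\<Sum>k. ennreal (c k) * emeasure M (A k))"
  by (subst nn_integral_add) (simp_all add: nn_integral_suminf nn_integral_cmult)
 also have "\<dots> \<le> ennreal (s0 powr ep * measure M (space M)) + (\<Sum>k. ennreal (c k * (D * q ^ k)))"
 proof (intro add_mono suminf_le summableI)
  show "ennreal (s0 powr ep) * emeasure M (space M) \<le> ennreal (s0 powr ep * measure M (space M))"
   by (simp add: emeasure_eq_measure ennreal_mult)
  show "ennreal (c k) * emeasure M (A k) \<le> ennreal (c k * (D * q ^ k))" for k using dec[of k] c0[of k]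
   by (simp add: emeasure_eq_measure ennreal_mult'[symmetric] A_def ennreal_leI mult_left_mono)
 qed
 also have "(\<Sum>k. ennreal (c k * (D * q ^ k))) = ennreal ((N * s0) powr ep * D / (1 - N powr ep * q))"
  using c0 D by (intro suminf_ennreal_eq[OF _ sm]) auto
 finally show ?thesis using D by simp
qed

text \<open>The order of quantifiers is the point: \<open>ep\<close> and \<open>C\<close> are
  produced before the measure and the function, so they depend on the decay constants alone.\<close>

lemma higher_integrability:
 fixes N kap R dlt s0 C0 :: real
 assumes N: "1 < N" and kap: "0 \<le> kap" "kap < 1" and R: "0 \<le> R" and dlt: "0 < dlt" and s0: "0 < s0" and C0: "0 \<le> C0"
 obtains ep C where "0 < ep" "0 \<le> C"
  "\<And>M (w :: 'a => real). finite_measure M ==> w \<in> borel_measurable M ==> (\<And>x. x \<in> space M ==> 0 \<le> w x) ==>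
   measure M (space M) \<le> C0 ==>
   (\<And>s. s0 \<le> s ==> measure M {x \<in> space M. N * s < w x} \<le>
     kap * measure M {x \<in> space M. s < w x} + R * s powr - dlt) ==>
   (\<integral>\<^sup>+x. ennreal (w x powr ep) \<partial>M) \<le> ennreal C"
proof -
 define p where "p = N powr - dlt"
 have p: "0 < p" "p < 1" using N dlt by (auto simp: p_def powr_less_one)
 define q where "q = (1 + max kap p) / 2"
 have q: "kap < q" "p \<le> q" "q < 1" "0 < q" using kap p by (auto simp: q_def)
 \<comment> \<open>Chosen to make \<open>N powr ep * q\<close> equal to \<open>(1 + q) / 2\<close>,
   hence below 1.\<close>
 define ep where "ep = log N ((1 + q) / (2 * q))"
 have "1 < (1 + q) / (2 * q)" using q by simp
 hence ep: "0 < ep" "N powr ep = (1 + q) / (2 * q)" using N by (auto simp: ep_def)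
 hence Nq: "N powr ep * q < 1" using q by simp
 define D where "D = C0 + R * s0 powr - dlt / (q - kap)"
 have D: "0 \<le> D" using C0 R q by (simp add: D_def)
 define C where "C = s0 powr ep * C0 + (N * s0) powr ep * D / (1 - N powr ep * q)"
 have C: "0 \<le> C" using C0 D Nq by (simp add: C_def)
 have "(\<integral>\<^sup>+x. ennreal (w x powr ep) \<partial>M) \<le> ennreal C"
  if M: "finite_measure M" and w: "w \<in> borel_measurable M" and nn: "\<And>x. x \<in> space M ==> 0 \<le> w x"
   and m: "measure M (space M) \<le> C0"
   and dec: "\<And>s. s0 \<le> s ==> measure M {x \<in> space M. N * s < w x} \<le>
     kap * measure M {x \<in> space M. s < w x} + R * s powr - dlt" for M and w :: "'a => real"
 proof -
  define F where "F k = measure M {x \<in> space M. N ^ k * s0 < w x}" for k :: nat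
  have F0: "0 \<le> F 0" "F 0 \<le> C0"
   using finite_measure.bounded_measure[OF M] m unfolding F_def by (auto intro: order_trans)
  have "F k \<le> D * q ^ k" for k
  proof -
   have "F k \<le> (F 0 + R * s0 powr - dlt / (q - kap)) * q ^ k"
   proof (rule geometric_decay[OF kap(1) q(1,3) _ q(2)])
    fix k
    have "1 * s0 \<le> N ^ k * s0" using N s0 by simp
    hence "F (Suc k) \<le> kap * F k + R * (N ^ k * s0) powr - dlt"
     using dec[of "N ^ k * s0"] by (simp add: F_def mult.assoc)
    also have "(N ^ k * s0) powr - dlt = s0 powr - dlt * p ^ k"
    proof -
     have "(N ^ k) powr - dlt = p ^ k"
      using N by (simp add: p_def powr_realpow[symmetric] powr_powr mult.commute)
     thus ?thesis by (simp add: powr_mult)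
    qed
    finally show "F (Suc k) \<le> kap * F k + R * s0 powr - dlt * p ^ k" by simp
   qed (use p R F0 in auto)
   also have "\<dots> \<le> D * q ^ k" using F0 q by (intro mult_right_mono) (auto simp: D_def)
   finally show ?thesis .
  qed
  hence "(\<integral>\<^sup>+x. ennreal (w x powr ep) \<partial>M) \<le>
   ennreal (s0 powr ep * measure M (space M) + (N * s0) powr ep * D / (1 - N powr ep * q))"
   using q by (intro powr_moment_bound M w nn s0 N ep D Nq) (auto simp: F_def)
  also have "\<dots> \<le> ennreal C" unfolding C_def using m by (intro ennreal_leI add_mono mult_left_mono) auto
  finally show ?thesis .
 qed
 thus ?thesis using that[OF ep(1) C] by blast
qed

section \<open>Solutions with zero boundary values\<close>

lemma transpose_zero: "transpose (0 :: real^'n^'m) = 0" by (simp add: transpose_def vec_eq_iff)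

lemma C2fun_zero: "open U ==> C2fun U (\<lambda>x. 0) (\<lambda>x. 0) (\<lambda>x. 0)"
 by (simp add: C2fun_def transpose_zero)

text \<open>The two conditions in \<open>normal\<close> say that \<open>U\<close> lies in the ball
  of diameter \<open>R\<close> and contains the ball of radius \<open>rho\<close>, both touching at
  \<open>y\<close> with inner normal \<open>nu\<close>. The enclosing ball gives lower barriers for
  \<open>phi\<close>, the interior one gives points of \<open>U\<close> at controlled distance from
  the tangent plane.\<close>

locale bdry = mafun U lam Lam phi g A kap sg tht
 for U :: "(real^'n::finite) set" and lam Lam phi g A kap sg tht +
 fixes c0 :: "real^'n" and r0 D R rho :: real
 assumes bdd: "bounded U"
  and c0: "ball c0 r0 \<subseteq> U" "0 < r0"
  and D: "\<And>x y. x \<in> closure U ==> y \<in> closure U ==> norm (x - y) \<le> D"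
  and R: "0 < R" and rho: "0 < rho"
  and normal: "\<And>y. y \<in> frontier U ==> \<exists>nu. norm nu = 1 \<and>
    (\<forall>x\<in>U. (norm (x - y))\<^sup>2 \<le> R * ((x - y) \<bullet> nu)) \<and> ball (y + rho *\<^sub>R nu) rho \<subseteq> U"
  and cont_cl: "continuous_on (closure U) phi"
  and zero: "\<And>y. y \<in> frontier U ==> phi y = 0"
begin

lemma c0_in: "c0 \<in> U" using c0 by auto

lemma closure_split: "y \<in> closure U \<longleftrightarrow> y \<in> U \<or> y \<in> frontier U"
 using openU closure_subset by (auto simp: frontier_def interior_open)

lemma frontier_disjoint: "y \<in> frontier U ==> y \<notin> U"
 using openU by (auto simp: frontier_def interior_open)

lemma cpt: "compact (closure U)" using bdd by simp

lemma cpt_frontier: "compact (frontier U)" using bdd by auto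

lemma frontier_ne: "frontier U \<noteq> {}"
proof -
 have "U \<noteq> UNIV" using bdd by auto
 thus ?thesis using frontier_not_empty U_ne by blast
qed

lemma D_pos: "0 < D"
proof -
 obtain y where y: "y \<in> frontier U" using frontier_ne by blast
 hence "0 < norm (y - c0)" using frontier_disjoint c0_in by force
 also have "\<dots> \<le> D" using y c0_in by (intro D) (auto simp: closure_split)
 finally show ?thesis .
qed

lemma n_pos: "0 < CARD('n)" "1 \<le> CARD('n)" by auto

lemma phi_nonpos: "x \<in> closure U ==> phi x \<le> 0"
proof -
 assume x: "x \<in> closure U"
 have "C2fun U (\<lambda>x. 0 - phi x) (\<lambda>x. 0 - g x) (\<lambda>x. 0 - A x)"
  by (rule C2fun_diff[OF C2fun_zero[OF openU] C2])
 hence "0 \<le> 0 - phi x"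
 proof (rule C2fun_comparison[OF _ cpt closure_subset])
  show "continuous_on (closure U) (\<lambda>x. 0 - phi x)" by (intro continuous_intros cont_cl)
  show "\<not> psd (0 - A x)" if "x \<in> U" for x
  proof
   assume "psd (0 - A x)"
   hence "0 \<le> - (axis undefined 1 \<bullet> (A x *v axis undefined 1))"
   proof -
    have "(0 - A x) *v v = - (A x *v v)" for v by (subst matrix_vector_mult_diff_rdistrib) simp
    thus ?thesis using \<open>psd (0 - A x)\<close> unfolding psd_def by simp
   qed
   moreover have "0 < axis undefined 1 \<bullet> (A x *v axis undefined 1)"
    using detA(3)[OF that] unfolding pd_def by simp
   ultimately show False by simp
  qed
 qed (use x zero in \<open>auto simp: closure_split\<close>)
 thus ?thesis by simp
qed

section \<open>Barriers: depth at \<open>c0\<close>, linear growth at the boundary, gradient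
  bound\<close>

definition k0 :: real where "k0 = min 1 (lam / 2) * r0\<^sup>2 / 8"

lemma k0_pos: "0 < k0" using lam c0 by (simp add: k0_def)

text \<open>Comparison with a paraboloid of determinant below \<open>lam\<close> that vanishes on a
  sphere of radius \<open>r0 / 2\<close>, so that the closed ball lies in \<open>U\<close>. The
  minimum with 1 is there because powers of \<open>a\<close> must not exceed
  \<open>a\<close>.\<close>

lemma phi_c0: "phi c0 \<le> - k0"
proof -
 define a where "a = min 1 (lam / 2)"
 have a: "0 < a" "a \<le> 1" "a < lam" using lam by (auto simp: a_def)
 define M where "M = a *\<^sub>R (mat 1 :: real^'n^'n)"
 let ?V = "ball c0 (r0 / 2)" and ?K = "cball c0 (r0 / 2)"
 have KO: "?K \<subseteq> U" using c0 by auto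
 define ps where "ps x = 1 / 2 * ((x - c0) \<bullet> (M *v (x - c0))) + 0 \<bullet> x + (- k0)" for x
 have psi: "ps x = a / 2 * (norm (x - c0))\<^sup>2 - k0" for x
  by (simp add: ps_def M_def scaleR_mat_vec power2_norm_eq_inner)
 have C: "C2fun ?V ps (\<lambda>x. M *v (x - c0) + 0) (\<lambda>x. M)"
  unfolding ps_def by (rule C2fun_quadratic) (auto simp: M_def transpose_scaleR transpose_mat)
 have "0 \<le> ps c0 - phi c0"
 proof (rule C2fun_comparison[OF C2fun_diff[OF C C2fun_subset[OF C2]] compact_cball ball_subset_cball])
  show "?V \<subseteq> U" using KO by auto
  show "continuous_on ?K (\<lambda>x. ps x - phi x)"
   unfolding psi using KO by (intro continuous_intros continuous_on_subset[OF contphi]) auto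
  show "\<not> psd (M - A x)" if "x \<in> ?V" for x
  proof -
   have xO: "x \<in> U" using that KO by auto
   have "det M = a ^ CARD('n)" by (simp only: M_def det_scaleR_mat1)
   also have "\<dots> \<le> a ^ 1" using a by (intro power_decreasing) auto
   finally have "det M < det (A x)" using a detA(1)[OF xO] by simp
   thus ?thesis using detA[OF xO] lam by (intro not_psd_diff) auto
  qed
  fix x assume x: "x \<in> ?K" "x \<notin> ?V"
  hence nx: "norm (x - c0) = r0 / 2" by (simp add: dist_norm norm_minus_commute)
  have "ps x = 0" unfolding psi nx by (simp add: k0_def a_def power_divide)
  moreover have "phi x \<le> 0" using x KO closure_subset by (intro phi_nonpos) blast
  ultimately show "0 \<le> ps x - phi x" by simp
 qed (use c0 in auto)
 thus ?thesis by (simp add: psi)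
qed

lemma phi_convex_cl:
 assumes "x \<in> closure U" "y \<in> U" "0 \<le> t" "t \<le> 1"
 shows "phi (x + t *\<^sub>R (y - x)) \<le> (1 - t) * phi x + t * phi y"
proof -
 have seg: "x + t *\<^sub>R (y - x) \<in> closure U" if "x \<in> closure U" for x
  using convexD_alt[OF convex_closure[OF convU] that, of y t] assms closure_subset[of U]
  by (auto simp: algebra_simps)
 have "0 \<le> (1 - t) * phi x + t * phi y - phi (x + t *\<^sub>R (y - x))"
 proof (rule continuous_ge_on_closure[of U "\<lambda>x. (1 - t) * phi x + t * phi y - phi (x + t *\<^sub>R (y - x))"])
  show "continuous_on (closure U) (\<lambda>x. (1 - t) * phi x + t * phi y - phi (x + t *\<^sub>R (y - x)))"
   by (intro continuous_intros cont_cl continuous_on_compose2[OF cont_cl]) (use seg in auto)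
  fix x assume x: "x \<in> U"
  have "phi ((1 - t) *\<^sub>R x + t *\<^sub>R y) \<le> (1 - t) * phi x + t * phi y"
   using conv assms x by (auto simp: convex_on_def)
  moreover have "(1 - t) *\<^sub>R x + t *\<^sub>R y = x + t *\<^sub>R (y - x)" by (simp add: algebra_simps)
  ultimately show "0 \<le> (1 - t) * phi x + t * phi y - phi (x + t *\<^sub>R (y - x))" by simp
 qed (rule assms(1))
 thus ?thesis by simp
qed

lemma segment_in: "x \<in> closure U ==> y \<in> U ==> 0 < t ==> t \<le> 1 ==> x + t *\<^sub>R (y - x) \<in> U"
proof -
 assume *: "x \<in> closure U" "y \<in> U" "0 < t" "t \<le> 1"
 have "x - t *\<^sub>R (x - y) \<in> interior U"
  by (rule mem_interior_closure_convex_shrink[OF convU]) (use * openU in \<open>auto simp: interior_open\<close>)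
 moreover have "x + t *\<^sub>R (y - x) = x - t *\<^sub>R (x - y)" by (simp add: scaleR_diff_right)
 ultimately show ?thesis using openU by (simp add: interior_open)
qed

lemma exit_point:
 assumes "x \<in> U" "e \<noteq> 0" obtains t where "0 < t" "x + t *\<^sub>R e \<in> frontier U"
proof -
 have "x \<in> interior U" using assms openU by (simp add: interior_open)
 from ray_to_frontier[OF bdd this assms(2)] show ?thesis using that by blast
qed

lemma phi_ray: "y \<in> frontier U ==> 0 \<le> s ==> s \<le> 1 ==> phi (y + s *\<^sub>R (c0 - y)) \<le> - (s * k0)"
proof -
 assume y: "y \<in> frontier U" and s: "0 \<le> s" "s \<le> 1"
 have "phi (y + s *\<^sub>R (c0 - y)) \<le> (1 - s) * phi y + s * phi c0"
  by (rule phi_convex_cl) (use y s c0_in in \<open>auto simp: closure_split\<close>)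
 also have "\<dots> \<le> s * (- k0)" using zero[OF y] mult_left_mono[OF phi_c0 s(1)] by simp
 finally show ?thesis by simp
qed

lemma on_ray:
 assumes x: "x \<in> U" obtains y s where "y \<in> frontier U" "0 < s" "s \<le> 1" "x = y + s *\<^sub>R (c0 - y)"
proof (cases "x = c0")
 case True
 obtain y where "y \<in> frontier U" using frontier_ne by blast
 thus ?thesis using that[of y 1] True by simp
next
 case False
 then obtain t where t: "0 < t" "c0 + t *\<^sub>R (x - c0) \<in> frontier U"
  using exit_point[OF c0_in, of "x - c0"] by auto
 have "1 < t"
 proof (rule ccontr)
  assume "\<not> 1 < t"
  hence "c0 + t *\<^sub>R (x - c0) \<in> U" using segment_in_U[OF c0_in x, of t] t by simp
  thus False using t frontier_disjoint by blast
 qed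
 define y where "y = c0 + t *\<^sub>R (x - c0)"
 have "(1 - 1 / t) *\<^sub>R (c0 - y) = ((1 - 1 / t) * - t) *\<^sub>R (x - c0)" by (simp only: y_def) simp
 also have "(1 - 1 / t) * - t = 1 - t" using t by (simp add: field_simps)
 finally have "x = y + (1 - 1 / t) *\<^sub>R (c0 - y)" by (simp add: y_def scaleR_diff_left)
 moreover have "y \<in> frontier U" unfolding y_def by (rule t(2))
 moreover have "0 < 1 - 1 / t" "1 - 1 / t \<le> 1" using \<open>1 < t\<close> by auto
 ultimately show ?thesis using that by blast
qed

definition dd :: "real^'n => real" where "dd x = infdist x (frontier U)"

lemma dd_le: "y \<in> frontier U ==> dd x \<le> norm (x - y)"
 unfolding dd_def using infdist_le[of y "frontier U" x] by (simp add: dist_norm)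

lemma dd_pos: "x \<in> U ==> 0 < dd x"
 using frontier_disjoint[of x] in_closed_iff_infdist_zero[OF frontier_closed frontier_ne, of x] infdist_nonneg[of x "frontier U"] by (auto simp: dd_def)

lemma phi_upper: "x \<in> U ==> k0 / D * dd x \<le> - phi x"
proof -
 assume x: "x \<in> U"
 obtain y s where y: "y \<in> frontier U" "0 < s" "s \<le> 1" "x = y + s *\<^sub>R (c0 - y)" by (rule on_ray[OF x])
 have "norm (x - y) = s * norm (c0 - y)" using y by simp
 also have "\<dots> \<le> s * D" using y c0_in by (intro mult_left_mono D) (auto simp: closure_split)
 finally have "dd x \<le> s * D" using dd_le[OF y(1), of x] by simp
 hence "k0 / D * dd x \<le> k0 / D * (s * D)" using k0_pos D_pos by (intro mult_left_mono) auto
 also have "\<dots> = s * k0" using D_pos by simp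
 also have "\<dots> \<le> - phi x" using phi_ray[OF y(1), of s] y by simp
 finally show ?thesis .
qed

lemma normal_cl:
 assumes "\<forall>x\<in>U. (norm (x - y))\<^sup>2 \<le> R * ((x - y) \<bullet> nu)" "x \<in> closure U"
 shows "(norm (x - y))\<^sup>2 \<le> R * ((x - y) \<bullet> nu)"
proof -
 have "0 \<le> R * ((x - y) \<bullet> nu) - (norm (x - y))\<^sup>2"
  by (rule continuous_ge_on_closure[of U "\<lambda>x. R * ((x - y) \<bullet> nu) - (norm (x - y))\<^sup>2"])
   (use assms in \<open>auto intro!: continuous_intros\<close>)
 thus ?thesis by simp
qed

definition L :: real where "L = (Lam + 1) * R / 2"

lemma L_pos: "0 < L" using Lam R by (simp add: L_def)

text \<open>The quadratic with Hessian \<open>Lam + 1\<close> times the identity that vanishes on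
  the enclosing sphere is nonpositive on the frontier; its determinant exceeds \<open>Lam\<close>
  because \<open>1 \<le> b\<close>.\<close>

lemma barrier:
 assumes y: "y \<in> frontier U" and nu: "\<forall>x\<in>U. (norm (x - y))\<^sup>2 \<le> R * ((x - y) \<bullet> nu)" and x: "x \<in> U"
 shows "- (L * ((x - y) \<bullet> nu)) \<le> phi x"
proof -
 define b where "b = Lam + 1"
 have b: "1 \<le> b" "Lam < b" using Lam by (auto simp: b_def)
 define M where "M = b *\<^sub>R (mat 1 :: real^'n^'n)"
 define ps where "ps x = 1 / 2 * ((x - y) \<bullet> (M *v (x - y))) + (- (b * R / 2) *\<^sub>R nu) \<bullet> x + b * R / 2 * (y \<bullet> nu)" for x
 have psi: "ps x = b / 2 * ((norm (x - y))\<^sup>2 - R * ((x - y) \<bullet> nu))" for x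
  by (simp add: ps_def M_def scaleR_mat_vec power2_norm_eq_inner inner_commute algebra_simps)
 have C: "C2fun U ps (\<lambda>x. M *v (x - y) + - (b * R / 2) *\<^sub>R nu) (\<lambda>x. M)"
  unfolding ps_def by (rule C2fun_quadratic[OF openU]) (auto simp: M_def transpose_scaleR transpose_mat)
 have "0 \<le> phi x - ps x"
 proof (rule C2fun_comparison[OF C2fun_diff[OF C2 C] cpt closure_subset])
  show "continuous_on (closure U) (\<lambda>x. phi x - ps x)"
   unfolding psi by (intro continuous_intros cont_cl)
  show "\<not> psd (A x - M)" if "x \<in> U" for x
  proof -
   have "b ^ 1 \<le> b ^ CARD('n)" using b by (intro power_increasing) auto
   hence "det (A x) < det M" using b detA(2)[OF that] by (simp add: M_def det_scaleR_mat1)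
   thus ?thesis using detA[OF that] lam b unfolding M_def by (intro not_psd_diff pd_mat_scaleR) auto
  qed
  fix x assume "x \<in> closure U" "x \<notin> U"
  hence x: "x \<in> frontier U" by (simp add: closure_split)
  have "ps x \<le> 0" unfolding psi using normal_cl[OF nu, of x] x b
   by (intro mult_nonneg_nonpos) (auto simp: closure_split)
  thus "0 \<le> phi x - ps x" using zero[OF x] by simp
 qed (use x closure_subset in auto)
 moreover have "- (L * ((x - y) \<bullet> nu)) \<le> ps x"
 proof -
  have "0 \<le> b / 2 * (norm (x - y))\<^sup>2" using b by simp
  moreover have Lb: "L = b / 2 * R" by (simp add: L_def b_def)
  ultimately show ?thesis unfolding psi Lb right_diff_distrib by simp
 qed
 ultimately show ?thesis by simp
qed

lemma breg_cl_nonneg: assumes "x \<in> U" "z \<in> closure U" shows "0 \<le> breg x z"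
 by (rule continuous_ge_on_closure[of U "breg x"])
  (use assms breg_nonneg in \<open>auto simp: breg_def[abs_def] intro!: continuous_intros cont_cl\<close>)

lemma cont_breg_cl: "continuous_on (closure U) (breg x)"
 unfolding breg_def[abs_def] by (intro continuous_intros cont_cl)

text \<open>Follow the gradient to the exit point \<open>?z\<close>. The tangent plane rises by
  \<open>t * (norm (g x))\<^sup>2\<close> and stays below \<open>phi ?z = 0\<close>, while the
  barrier at \<open>?z\<close> bounds \<open>- phi x\<close> by
  \<open>L * t * norm (g x)\<close>.\<close>

lemma gradient_le: assumes x: "x \<in> U" shows "norm (g x) \<le> L"
proof (cases "g x = 0")
 case True
 thus ?thesis using L_pos by simp
next
 case False
 obtain t where t: "0 < t" "x + t *\<^sub>R g x \<in> frontier U" using exit_point[OF x False] by blast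
 let ?z = "x + t *\<^sub>R g x"
 obtain nu where nu: "norm nu = 1" "\<forall>x\<in>U. (norm (x - ?z))\<^sup>2 \<le> R * ((x - ?z) \<bullet> nu)" using normal[OF t(2)] by blast
 have "0 \<le> breg x ?z" by (rule breg_cl_nonneg[OF x]) (use t in \<open>auto simp: closure_split\<close>)
 hence "t * (norm (g x))\<^sup>2 \<le> - phi x"
  using zero[OF t(2)] by (simp add: breg_def power2_norm_eq_inner)
 also have "\<dots> \<le> L * ((x - ?z) \<bullet> nu)" using barrier[OF t(2) nu(2) x] by simp
 also have "\<dots> \<le> L * (norm (x - ?z) * norm nu)" using L_pos by (intro mult_left_mono norm_cauchy_schwarz) auto
 also have "\<dots> = t * (L * norm (g x))" using t nu by simp
 finally have "norm (g x) * norm (g x) \<le> L * norm (g x)" using t by (simp add: power2_eq_square)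
 thus ?thesis using False by simp
qed

text \<open>The critical height at \<open>x\<close>: sections below it stay compactly inside
  \<open>U\<close>, and at this height the section touches the frontier.\<close>

definition hb :: "real^'n => real" where "hb x = Inf (breg x ` frontier U)"

lemma hb_attained:
 obtains y where "y \<in> frontier U" "hb x = breg x y" "\<And>z. z \<in> frontier U ==> breg x y \<le> breg x z"
proof -
 obtain y where y: "y \<in> frontier U" "\<And>z. z \<in> frontier U ==> breg x y \<le> breg x z"
  using continuous_attains_inf[OF cpt_frontier frontier_ne
    continuous_on_subset[OF cont_breg_cl[of x]]] by (auto simp: frontier_def)
 moreover have "hb x = breg x y" unfolding hb_def using y by (intro cInf_eq_minimum) auto
 ultimately show ?thesis using that by blast
qed

lemma hb_le: "z \<in> frontier U ==> hb x \<le> breg x z"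
proof -
 assume z: "z \<in> frontier U"
 obtain y where "hb x = breg x y" "\<And>z. z \<in> frontier U ==> breg x y \<le> breg x z"
  by (rule hb_attained[of x]) blast
 thus ?thesis using z by simp
qed

lemma hb_room: assumes "x \<in> U" "0 < h" "h < hb x" shows "room x h"
proof -
 have "{y \<in> U. breg x y \<le> h} = closure U \<inter> breg x -` {..h}"
  using hb_le[of _ x] assms by (force simp: closure_split)
 moreover have "compact (closure U \<inter> breg x -` {..h})"
  using continuous_closedin_preimage[OF cont_breg_cl closed_atMost, of x h] cpt closedin_compact by blast
 ultimately show ?thesis using assms by (simp add: room_def)
qed

text \<open>\<open>engulf\<close> requires a height strictly below \<open>hb x\<close>, so the
  touching point \<open>z\<close> is approached along the segment towards \<open>x\<close>. With a
  third of \<open>hb x\<close> for \<open>y\<close>, the half-height condition holds as long as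
  \<open>t < 1/3\<close>.\<close>

lemma hb_engulf:
 assumes x: "x \<in> U" and y: "y \<in> sect x (hb x / 3)" shows "hb y \<le> (1 + kap) * hb x"
proof -
 obtain z where z: "z \<in> frontier U" "hb x = breg x z" by (rule hb_attained[of x]) blast
 have yO: "y \<in> U" "breg x y < hb x / 3" using y by (auto simp: sect_def)
 have h0: "0 < hb x" using yO breg_nonneg[OF x yO(1)] by simp
 have zc: "z \<in> closure U" using z by (simp add: closure_split)
 define p where "p t = z + t *\<^sub>R (x - z)" for t
 have "((\<lambda>t. breg y (p t)) \<longlongrightarrow> breg y (p 0)) (at_right 0)"
 proof -
  have "continuous_on {0..1} (\<lambda>t. breg y (p t))"
  proof (rule continuous_on_compose2[OF cont_breg_cl])
   show "continuous_on {0..1} p" unfolding p_def by (intro continuous_intros)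
   have "p t \<in> closure U" if "0 \<le> t" "t \<le> 1" for t
   proof (cases "t = 0")
    case False
    hence "p t \<in> U" unfolding p_def using that by (intro segment_in[OF zc x]) auto
    thus ?thesis using closure_subset by blast
   qed (simp add: p_def zc)
   thus "p ` {0..1} \<subseteq> closure U" by auto
  qed
  hence "((\<lambda>t. breg y (p t)) \<longlongrightarrow> breg y (p 0)) (at 0 within {0..1})"
   by (simp add: continuous_on_def)
  thus ?thesis by (simp add: at_within_Icc_at_right)
 qed
 hence "breg y (p 0) \<le> (1 + kap) * hb x"
 proof (rule tendsto_upperbound)
  show "\<forall>\<^sub>F t in at_right 0. breg y (p t) \<le> (1 + kap) * hb x"
  proof (rule eventually_at_rightI[of 0 "1/3"])
   fix t :: real assume t: "t \<in> {0<..<1/3}"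
   have pO: "p t \<in> U" unfolding p_def using t by (intro segment_in[OF zc x]) auto
   have "breg x (p t) \<le> (1 - t) * breg x z"
   proof -
    have "phi (p t) \<le> (1 - t) * phi z + t * phi x" unfolding p_def using t by (intro phi_convex_cl zc x) auto
    moreover have "p t - x = (1 - t) *\<^sub>R (z - x)" by (simp add: p_def algebra_simps)
    moreover have "F - X - (1 - t) * q \<le> (1 - t) * (Z - X - q)"
     if "F \<le> (1 - t) * Z + t * X" for F X q Z :: real using that by (simp add: algebra_simps)
    ultimately show ?thesis by (simp add: breg_def)
   qed
   hence b: "breg x (p t) \<le> (1 - t) * hb x" using z by simp
   have r: "room x ((1 - t) * hb x)" by (rule hb_room[OF x]) (use t h0 in auto)
   have "(1 / 3) * hb x \<le> (1 - t) * hb x / 2" using t h0 by simp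
   hence "breg y (p t) \<le> (1 + kap) * ((1 - t) * hb x)" using yO by (intro engulf[OF r yO(1) _ pO b]) auto
   also have "\<dots> \<le> (1 + kap) * hb x" using kap_pos t h0 by simp
   finally show "breg y (p t) \<le> (1 + kap) * hb x" .
  qed simp
 qed simp
 hence "breg y z \<le> (1 + kap) * hb x" by (simp add: p_def)
 thus ?thesis using hb_le[OF z(1), of y] by simp
qed

text \<open>Slopes in a cube of size proportional to \<open>h / D\<close> rise by at most
  \<open>h / 4\<close> over \<open>U\<close>, so each is attained by the gradient in the section;
  their volume is at most \<open>Lam\<close> times that of the section.\<close>

lemma sect_volume:
 assumes r: "room x h"
 shows "(h / (2 * real CARD('n) * D)) ^ CARD('n) \<le> Lam * vol (sect x h)"
proof -
 let ?n = "real CARD('n)"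
 have n: "0 < ?n" by simp
 have x: "x \<in> U" and h: "0 < h" using r by (auto simp: room_def)
 let ?K = "{y \<in> U. breg x y \<le> h / 2}"
 have r2: "room x (h / 2)" by (rule room_mono[OF r]) (use h in auto)
 hence cK: "compact ?K" by (simp add: room_def)
 define a where "a = h / (4 * ?n * D)"
 have a: "0 < a" using h D_pos by (simp add: a_def)
 define l u :: "real^'n" where "l = (\<chi> i. - a)" and "u = (\<chi> i. a)"
 let ?F = "\<lambda>y. g y - g x"
 have sub: "cbox l u \<subseteq> ?F ` ?K"
 proof
  fix q assume q: "q \<in> cbox l u"
  have qi: "\<bar>q $ i\<bar> \<le> a" for i
  proof -
   have "- a \<le> q $ i" "q $ i \<le> a" using q by (auto simp: mem_box_cart l_def u_def)
   thus ?thesis by simp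
  qed
  have slope: "q \<bullet> (y - x) \<le> h / 4" if y: "y \<in> U" for y
  proof -
   have "q \<bullet> (y - x) \<le> (\<Sum>i\<in>(UNIV::'n set). a * D)" unfolding inner_vec_def
   proof (rule sum_mono)
    fix i
    have "\<bar>(y - x) $ i\<bar> \<le> D" using component_le_norm_cart[of "y - x" i] D[of y x] y x closure_subset[of U] by force
    hence "\<bar>q $ i\<bar> * \<bar>(y - x) $ i\<bar> \<le> a * D" using qi a by (intro mult_mono) auto
    moreover have "q $ i * (y - x) $ i \<le> \<bar>q $ i\<bar> * \<bar>(y - x) $ i\<bar>"
     by (simp only: abs_mult[symmetric])
    ultimately show "q $ i \<bullet> (y - x) $ i \<le> a * D" by simp
   qed
   also have "\<dots> = h / 4" using D_pos by (simp add: a_def)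
   finally show ?thesis .
  qed
  define f where "f y = breg x y - q \<bullet> y - 0" for y
  have cf: "continuous_on ?K f" unfolding f_def
   by (intro continuous_intros continuous_on_subset[OF cont_breg]) auto
  have xK: "x \<in> ?K" using x h by simp
  obtain y where y: "y \<in> ?K" "\<And>z. z \<in> ?K ==> f y \<le> f z"
   using continuous_attains_inf[OF cK _ cf] xK by blast
  have yO: "y \<in> sect x (h / 2)"
  proof (rule ccontr)
   assume "y \<notin> sect x (h / 2)"
   hence "breg x y = h / 2" using y(1) by (auto simp: sect_def)
   hence "f x < f y" using slope[of y] y(1) h by (simp add: f_def inner_diff_right)
   thus False using y(2)[OF xK] by simp
  qed
  have "C2fun (sect x (h / 2)) (breg x) (\<lambda>y. g y - g x) A" unfolding breg_affine
   by (rule C2fun_diff_affine, rule C2fun_subset[OF C2 _ sect_open]) (auto simp: sect_def)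
  hence "C2fun (sect x (h / 2)) f (\<lambda>y. (g y - g x) - q) A" unfolding f_def by (rule C2fun_diff_affine)
  from C2fun_min(1)[OF this yO] have "g y - g x - q = 0" using y(2) by (auto simp: sect_def)
  thus "q \<in> ?F ` ?K" using y(1) by auto
 qed
 have dF: "(?F has_derivative (\<lambda>v. A y *v v)) (at y)" if "y \<in> ?K" for y
  using dg[of y] that by (auto intro!: derivative_eq_intros)
 have "continuous_on ?K A" using contA by (rule continuous_on_subset) auto
 note im = measure_compact_differentiable_image[OF cK dF this, of Lam]
 have "compact (?F ` ?K)" by (intro compact_continuous_image cK continuous_at_imp_continuous_on ballI
    has_derivative_continuous[OF dF])
 hence "measure lebesgue (cbox l u) \<le> measure lebesgue (?F ` ?K)"
  using sub by (intro measure_mono_fmeasurable) (auto intro: lmeasurable_compact)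
 also have "\<dots> \<le> Lam * measure lebesgue ?K" by (rule im) (use detA lam in fastforce)+
 also have "measure lebesgue ?K \<le> measure lebesgue (sect x h)"
  using h lmeasurable_compact[OF cK] lmeasurable_open[OF room_bounded[OF r] sect_open] by (intro measure_mono_fmeasurable) (auto simp: sect_def fmeasurableD)
 also have "measure lebesgue (cbox l u) = (h / (2 * ?n * D)) ^ CARD('n)"
 proof -
  have "cbox l u \<noteq> {}" using a by (auto simp: interval_ne_empty_cart l_def u_def)
  hence "measure lebesgue (cbox l u) = (2 * a) ^ CARD('n)" by (simp add: content_cbox_if_cart l_def u_def)
  moreover have "2 * a = h / (2 * ?n * D)" by (simp add: a_def)
  ultimately show ?thesis by simp
 qed
 finally show ?thesis using Lam sect_open by simp
qed

end

text \<open>A half-space containing a ball with \<open>y\<close> on its sphere and in its boundary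
  is tangent to it, so \<open>mu\<close> points to the centre. This identifies normals obtained in
  different ways.\<close>

lemma ball_center_of_support:
 fixes y z mu :: "'a::euclidean_space"
 assumes mu: "norm mu = 1" and z: "norm (z - y) = rho" "0 < rho"
  and nn: "\<And>x. x \<in> ball z rho ==> 0 \<le> (x - y) \<bullet> mu"
 shows "z = y + rho *\<^sub>R mu"
proof -
 have mu1: "mu \<bullet> mu = 1" using mu by (simp add: norm_eq_1)
 have ge: "rho \<le> (z - y) \<bullet> mu"
 proof (rule field_le_epsilon)
  fix e :: real assume e: "0 < e"
  define e' where "e' = min e rho"
  have e': "0 < e'" "e' \<le> e" "e' \<le> rho" using e z(2) by (auto simp: e'_def)
  have "z - (rho - e') *\<^sub>R mu \<in> ball z rho" using e' mu by simp
  from nn[OF this] have "0 \<le> (z - y) \<bullet> mu - (rho - e')" by (simp add: mu1 algebra_simps)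
  thus "rho \<le> (z - y) \<bullet> mu + e" using e' by simp
 qed
 have "(norm ((z - y) - rho *\<^sub>R mu))\<^sup>2 = (norm (z - y))\<^sup>2 - 2 * rho * ((z - y) \<bullet> mu) + rho\<^sup>2"
  unfolding power2_norm_eq_inner
  by (simp add: inner_diff_left[of "z - y"] inner_diff_right[of _ "z - y"] inner_commute[of mu "z - y"] mu1)
   (simp add: power2_eq_square algebra_simps)
 also have "\<dots> \<le> 0" using mult_left_mono[OF ge, of "2 * rho"] z by (simp add: power2_eq_square)
 finally have "(z - y) - rho *\<^sub>R mu = 0" by simp
 thus ?thesis by (simp add: algebra_simps)
qed

text \<open>A form adapted to an oblique cone with axis \<open>w\<close>: \<open>b\<close> weighs
  the height along \<open>nu\<close>, \<open>a\<close> the displacement from the axis within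
  hyperplanes orthogonal to \<open>nu\<close>. The matrix \<open>C\<close>, a rank-one change of the
  identity, maps the two parts to orthogonal vectors.\<close>

lemma cone_matrix:
 fixes nu w :: "real^'n" and a b :: real
 assumes nu: "norm nu = 1" and w: "w \<bullet> nu \<noteq> 0" and ab: "0 < a" "0 < b"
 obtains M where "transpose M = M" "det M = a ^ (CARD('n) - 1) * b"
  "\<And>v. v \<bullet> (M *v v) = a * (norm (v - ((v \<bullet> nu) / (w \<bullet> nu)) *\<^sub>R w))\<^sup>2 + b * (v \<bullet> nu)\<^sup>2"
proof -
 have n1: "nu \<bullet> nu = 1" using nu by (simp add: norm_eq_1)
 define t where "t = sqrt (b / a)"
 have t: "0 < t" "a * t\<^sup>2 = b" using ab by (auto simp: t_def)
 define q where "q = t *\<^sub>R nu - (1 / (w \<bullet> nu)) *\<^sub>R w"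
 define C where "C = mat 1 + outer q nu"
 define M where "M = a *\<^sub>R (transpose C ** C)"
 have detC: "det C = t" unfolding C_def det_mat1_add_outer using w by (simp add: q_def inner_diff_left n1)
 have Cv: "C *v v = (v - ((v \<bullet> nu) / (w \<bullet> nu)) *\<^sub>R w) + (t * (v \<bullet> nu)) *\<^sub>R nu" for v
  by (simp add: C_def q_def matrix_vector_mult_add_rdistrib outer_mult_vec scaleR_diff_right inner_commute)
 have "(norm (C *v v))\<^sup>2 = (norm (v - ((v \<bullet> nu) / (w \<bullet> nu)) *\<^sub>R w))\<^sup>2 + (norm ((t * (v \<bullet> nu)) *\<^sub>R nu))\<^sup>2" for v
  unfolding Cv by (rule norm_add_Pythagorean) (use w in \<open>simp add: orthogonal_def inner_diff_left\<close>)
 hence "a * (norm (C *v v))\<^sup>2 = a * (norm (v - ((v \<bullet> nu) / (w \<bullet> nu)) *\<^sub>R w))\<^sup>2 + a * t\<^sup>2 * (v \<bullet> nu)\<^sup>2" for v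
  by (simp add: nu power_mult_distrib distrib_left)
 moreover have "v \<bullet> (M *v v) = a * (norm (C *v v))\<^sup>2" for v
  by (simp add: M_def scaleR_mat_vec matrix_vector_mul_assoc[symmetric] power2_norm_eq_inner inner_commute[of v] dot_lmul_matrix)
 moreover have "transpose M = M" by (simp add: M_def transpose_scaleR matrix_transpose_mul)
 moreover have "det M = a ^ (CARD('n) - 1) * b"
 proof -
  have "M = (a *\<^sub>R mat 1) ** (transpose C ** C)" by (simp add: M_def scaleR_mat_mult)
  hence "det M = a ^ CARD('n) * t\<^sup>2" by (simp add: det_mul detC det_scaleR_mat1 power2_eq_square)
  also have "a ^ CARD('n) = a ^ (CARD('n) - 1) * a" by (rule power_minus_mult[symmetric]) simp
  finally show ?thesis by (simp add: t(2))
 qed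
 ultimately show ?thesis using that[of M] by (simp add: t(2))
qed

context bdry
begin

text \<open>The two terms belong to the two cases of \<open>hb_lower\<close>: \<open>- phi x\<close>
  at most \<open>4 * h\<close>, or larger.\<close>

definition hb_const :: real where
 "hb_const = min (1 / (4 * (L * D))) (lam / (384 * L\<^sup>2 * (96 * (L + L * D / rho) / rho) ^ (CARD('n) - 1)))"

lemma hb_const_pos: "0 < hb_const" unfolding hb_const_def using lam L_pos D_pos rho by (simp add: add_pos_pos)

lemma hb_const_le: "hb_const \<le> 1 / (4 * (L * D))"
 "hb_const \<le> lam / (384 * L\<^sup>2 * (96 * (L + L * D / rho) / rho) ^ (CARD('n) - 1))"
 unfolding hb_const_def by auto

text \<open>If \<open>breg x\<close> is at most \<open>h\<close> at the boundary point \<open>y\<close>, then it is at most \<open>2 h\<close> on a sphere of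
 radius comparable to \<open>sqrt h\<close> near \<open>y\<close>, hence on an ellipsoid in the cone over that sphere with
 apex \<open>x\<close>; comparison with a quadratic polynomial on this ellipsoid bounds \<open>h\<close> from below.\<close>

lemma hb_lower:
 assumes x: "x \<in> U" shows "hb_const * (phi x)\<^sup>2 \<le> hb x"
proof (rule dense_ge)
 fix h assume h: "hb x < h"
 obtain y where y: "y \<in> frontier U" "hb x = breg x y" "\<And>z. z \<in> frontier U ==> breg x y \<le> breg x z"
  by (rule hb_attained[of x]) blast
 have yc: "y \<in> closure U" using y by (simp add: closure_split)
 have h0: "0 < h" using h y breg_cl_nonneg[OF x yc] by simp
 define q where "q = - phi x"
 obtain nu where nu: "norm nu = 1" "\<forall>x\<in>U. (norm (x - y))\<^sup>2 \<le> R * ((x - y) \<bullet> nu)"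
   "ball (y + rho *\<^sub>R nu) rho \<subseteq> U" using normal[OF y(1)] by blast
 have nu1: "nu \<bullet> nu = 1" using nu(1) by (simp add: norm_eq_1)
 have q: "0 \<le> q" "q \<le> L * D"
 proof -
  show "0 \<le> q" using phi_nonpos[of x] x closure_subset by (auto simp: q_def)
  have "q \<le> L * ((x - y) \<bullet> nu)" using barrier[OF y(1) nu(2) x] by (simp add: q_def)
  also have "\<dots> \<le> L * D"
   using norm_cauchy_schwarz[of "x - y" nu] nu(1) D[of x y] x yc closure_subset L_pos by (intro mult_left_mono) force+
  finally show "q \<le> L * D" .
 qed
 define L' where "L' = L + L * D / rho"
 have L': "0 < L'" "L \<le> L'" "L * D \<le> L' * rho"
  using L_pos D_pos rho by (auto simp: L'_def add_pos_pos distrib_right)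
 define a where "a = 96 * L' / rho"
 have a: "0 < a" using L' rho by (simp add: a_def)
 show "hb_const * (phi x)\<^sup>2 \<le> h"
 proof (cases "q \<le> 4 * h")
  case True
  have "hb_const * (phi x)\<^sup>2 \<le> 1 / (4 * (L * D)) * (q * q)"
   using mult_right_mono[OF hb_const_le(1), of "q * q"] by (simp add: q_def power2_eq_square)
  also have "\<dots> \<le> 1 / (4 * (L * D)) * (L * D * (4 * h))"
   using q True by (intro mult_left_mono mult_mono) auto
  also have "\<dots> = h" using L_pos D_pos by simp
  finally show ?thesis .
 next
  case False
  hence hq: "4 * h < q" by simp
  define s where "s p = - (g x \<bullet> (p - y))" for p
  have phis: "breg x p = phi p + hb x + s p" for p
   unfolding y(2) using zero[OF y(1)] by (simp add: breg_def s_def inner_diff_right)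
  \<comment> \<open>As \<open>phi\<close> vanishes on the frontier, the minimum point
    \<open>y\<close> of \<open>breg x\<close> there minimizes the linear function \<open>s\<close>
    on the frontier, hence on \<open>U\<close>.\<close>
  have s_nonneg: "0 \<le> s p" if "p \<in> U" for p
  proof (cases "g x = 0")
   case False
   have "p \<in> interior U" using that openU by (simp add: interior_open)
   from ray_to_frontier[OF bdd this False]
   obtain d where d: "0 < d" "p + d *\<^sub>R g x \<in> frontier U" by blast
   have "0 \<le> s (p + d *\<^sub>R g x)"
    using y(3)[OF d(2)] zero[OF d(2)] phis[of "p + d *\<^sub>R g x"] y(2) by simp
   also have "\<dots> \<le> s p" using d(1) by (simp add: s_def inner_add_right inner_diff_right)
   finally show ?thesis .
  qed (simp add: s_def)
  have sx: "s x = q - hb x" using phis[of x] by (simp add: q_def)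
  hence gx: "g x \<noteq> 0" using h hq h0 by (auto simp: s_def)
  define gam where "gam = norm (g x)"
  have gam: "0 < gam" "gam \<le> L" using gx gradient_le[OF x] by (auto simp: gam_def)
  \<comment> \<open>So \<open>s\<close> defines a supporting half-space at \<open>y\<close>, and the
    interior ball forces \<open>- g x\<close> to be a positive multiple of
    \<open>nu\<close>.\<close>
  have "y + rho *\<^sub>R nu = y + rho *\<^sub>R ((- 1 / gam) *\<^sub>R g x)"
  proof (rule ball_center_of_support)
   show "norm ((- 1 / gam) *\<^sub>R g x) = 1" "norm (y + rho *\<^sub>R nu - y) = rho"
    using gam(1) nu(1) rho by (auto simp: gam_def)
   show "0 \<le> (p - y) \<bullet> ((- 1 / gam) *\<^sub>R g x)" if "p \<in> ball (y + rho *\<^sub>R nu) rho" for p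
    using s_nonneg[of p] that nu(3) gam(1) by (auto simp: s_def inner_commute divide_le_0_iff)
  qed (rule rho)
  hence "rho *\<^sub>R nu = rho *\<^sub>R ((- 1 / gam) *\<^sub>R g x)" by simp
  hence "nu = (- 1 / gam) *\<^sub>R g x" using rho unfolding scaleR_cancel_left by blast
  hence s: "s p = gam * ((p - y) \<bullet> nu)" for p using gam(1) by (simp add: s_def inner_commute)
  \<comment> \<open>A height above \<open>y\<close> at which \<open>s\<close> is at most
    \<open>h\<close>; the second summand of \<open>L'\<close> keeps it below
    \<open>rho\<close>.\<close>
  define e where "e = h / L'"
  have e: "0 < e" "L' * e = h" using h0 L' by (auto simp: e_def)
  have erho: "e < rho"
  proof -
   have "4 * h < L' * rho" using hq q L' by simp
   hence "L' * e < L' * rho" using e h0 by simp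
   thus ?thesis using L' by simp
  qed
  \<comment> \<open>Radius of a disc at height \<open>e\<close> that fits into the interior
    ball.\<close>
  define r where "r = sqrt (rho * e)"
  have r: "0 < r" "r\<^sup>2 = rho * e" using rho e by (auto simp: r_def)
  define b0 where "b0 = y + e *\<^sub>R nu"
  have base: "b0 + tau \<in> U" "breg x (b0 + tau) \<le> 2 * h" if tau: "tau \<bullet> nu = 0" "norm tau \<le> r" for tau
  proof -
   have "(b0 + tau) - (y + rho *\<^sub>R nu) = tau + (e - rho) *\<^sub>R nu" by (simp add: b0_def algebra_simps)
   also have "(norm \<dots>)\<^sup>2 = (norm tau)\<^sup>2 + (norm ((e - rho) *\<^sub>R nu))\<^sup>2"
    by (rule norm_add_Pythagorean) (simp add: orthogonal_def tau)
   also have "\<dots> \<le> rho * e + (rho - e)\<^sup>2"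
    using power_mono[OF tau(2), of 2] r(2) nu(1) by (simp add: power2_commute)
   also have "\<dots> = rho\<^sup>2 - e * (rho - e)" by (simp add: power2_eq_square algebra_simps)
   also have "\<dots> < rho\<^sup>2" using e erho by simp
   finally have "(norm ((b0 + tau) - (y + rho *\<^sub>R nu)))\<^sup>2 < rho\<^sup>2" .
   hence "norm ((b0 + tau) - (y + rho *\<^sub>R nu)) < rho" using rho by (simp add: power2_less_imp_less)
   thus O: "b0 + tau \<in> U" using nu(3) by (auto simp: dist_norm norm_minus_commute)
   have "s (b0 + tau) = gam * e" unfolding s by (simp add: b0_def inner_add_left tau nu1)
   also have "\<dots> \<le> L' * e" using gam L' e by auto
   finally have "s (b0 + tau) \<le> h" using e by simp
   moreover have "phi (b0 + tau) \<le> 0" using O closure_subset by (intro phi_nonpos) auto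
   ultimately show "breg x (b0 + tau) \<le> 2 * h" using phis[of "b0 + tau"] h by simp
  qed
  define w where "w = x - b0"
  have w: "q / (2 * L) \<le> w \<bullet> nu"
  proof -
   have "3 / 4 * q \<le> gam * ((x - y) \<bullet> nu)" using s[of x] sx hq h by simp
   also have "\<dots> \<le> L * ((x - y) \<bullet> nu)"
    using s_nonneg[OF x] s[of x] gam by (intro mult_right_mono) (auto simp: zero_le_mult_iff)
   finally have "3 / 4 * q / L \<le> (x - y) \<bullet> nu" using L_pos by (simp only: pos_divide_le_eq mult.commute)
   moreover have "e \<le> (q / 4) / L" unfolding e_def using hq L' L_pos q by (intro frac_le) auto
   moreover have "3 / 4 * q / L - (q / 4) / L = q / (2 * L)" by simp
   moreover have "w \<bullet> nu = (x - y) \<bullet> nu - e" by (simp add: w_def b0_def inner_diff_left inner_add_left nu1)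
   ultimately show ?thesis by simp
  qed
  have q0: "0 < q" using hq h0 by simp
  hence w0: "0 < w \<bullet> nu" using w L_pos by (metis divide_pos_pos less_le_trans mult_pos_pos zero_less_numeral)
  \<comment> \<open>Since also \<open>a = 96 * h / r\<^sup>2\<close>, the condition
    \<open>Q p \<le> 6 * h\<close> keeps \<open>p\<close> within a quarter of the axis around its
    midpoint and within distance \<open>r / 4\<close> of the axis; on that stretch the cone has
    radius at least \<open>r / 4\<close>.\<close>
  define b where "b = 96 * h / (w \<bullet> nu)\<^sup>2"
  have b: "0 < b" using h0 w0 by (simp add: b_def)
  obtain M where M: "transpose M = M" "det M = a ^ (CARD('n) - 1) * b"
   "\<And>v. v \<bullet> (M *v v) = a * (norm (v - ((v \<bullet> nu) / (w \<bullet> nu)) *\<^sub>R w))\<^sup>2 + b * (v \<bullet> nu)\<^sup>2"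
   using cone_matrix[OF nu(1) _ a b, of w] w0 by auto
  define c where "c = b0 + (1 / 2) *\<^sub>R w"
  define Q where "Q p = (p - c) \<bullet> (M *v (p - c))" for p
  have in_cone: "p \<in> U \<and> breg x p \<le> 2 * h" if p: "Q p \<le> 6 * h" for p
  proof -
   define alp where "alp = (p - c) \<bullet> nu / (w \<bullet> nu)"
   define tau where "tau = (p - c) - alp *\<^sub>R w"
   have taunu: "tau \<bullet> nu = 0" using w0 by (simp add: tau_def alp_def inner_diff_left)
   have Qp: "a * (norm tau)\<^sup>2 + b * ((p - c) \<bullet> nu)\<^sup>2 \<le> 6 * h" using p by (simp add: Q_def M(3) tau_def alp_def)
   have "b * ((p - c) \<bullet> nu)\<^sup>2 = 96 * h * alp\<^sup>2" by (simp add: b_def alp_def power_divide)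
   moreover have "0 \<le> a * (norm tau)\<^sup>2" "0 \<le> b * ((p - c) \<bullet> nu)\<^sup>2" using a b by auto
   ultimately have "h * (16 * alp\<^sup>2) \<le> h * 1" "a * (norm tau)\<^sup>2 \<le> 6 * h" using Qp by auto
   hence "(4 * \<bar>alp\<bar>)\<^sup>2 \<le> 1\<^sup>2" using h0 by simp
   hence alp: "\<bar>alp\<bar> \<le> 1 / 4" using power2_le_imp_le[of "4 * \<bar>alp\<bar>" 1] by simp
   have "96 * h * (norm tau)\<^sup>2 = a * (norm tau)\<^sup>2 * r\<^sup>2" using r(2) rho e(2)[symmetric] by (simp add: a_def)
   also have "\<dots> \<le> 6 * h * r\<^sup>2" using \<open>a * (norm tau)\<^sup>2 \<le> 6 * h\<close> by (intro mult_right_mono) auto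
   finally have "(4 * norm tau)\<^sup>2 \<le> r\<^sup>2" using h0 by simp
   hence taur: "4 * norm tau \<le> r" using r by (intro power2_le_imp_le[of "4 * norm tau"]) auto
   define t where "t = 1 / 2 + alp"
   have t: "1 / 4 \<le> t" "t \<le> 3 / 4" using alp by (auto simp: t_def)
   define tau' where "tau' = (1 / (1 - t)) *\<^sub>R tau"
   have "norm tau' \<le> r"
   proof -
    have "norm tau \<le> r * (1 - t)" using taur t mult_left_mono[of "1 / 4" "1 - t" r] r by linarith
    thus ?thesis using t by (simp add: tau'_def pos_divide_le_eq)
   qed
   hence b': "b0 + tau' \<in> U" "breg x (b0 + tau') \<le> 2 * h" using base[of tau'] taunu by (auto simp: tau'_def)
   have pe: "p = (b0 + tau') + t *\<^sub>R (x - (b0 + tau'))"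
   proof -
    have "(b0 + tau') + t *\<^sub>R (x - (b0 + tau')) = b0 + t *\<^sub>R w + (1 - t) *\<^sub>R tau'"
     by (simp add: w_def algebra_simps)
    also have "(1 - t) *\<^sub>R tau' = tau" using t by (simp add: tau'_def)
    finally show ?thesis by (simp add: tau_def c_def t_def algebra_simps)
   qed
   have "breg x p \<le> (1 - t) * breg x (b0 + tau') + t * breg x x"
    unfolding pe by (rule breg_convex[OF b'(1) x]) (use t in auto)
   also have "breg x x = 0" by simp
   also have "(1 - t) * breg x (b0 + tau') + t * 0 \<le> 1 * (2 * h) + t * 0"
    using b' t breg_nonneg[OF x b'(1)] by (intro add_right_mono mult_mono) auto
   finally have "breg x p \<le> 2 * h" by simp
   moreover have "p \<in> U" unfolding pe by (rule segment_in_U[OF b'(1) x]) (use t in auto)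
   ultimately show ?thesis by blast
  qed
  define K where "K = {p. Q p \<le> 6 * h}"
  define V where "V = {p. Q p < 6 * h}"
  have cQ: "continuous_on UNIV Q" unfolding Q_def by (intro continuous_intros)
  have K: "compact K"
  proof -
   have "closed K" unfolding K_def using cQ by (intro closed_Collect_le continuous_intros) auto
   moreover have "bounded K" by (rule bounded_subset[OF bdd]) (use in_cone in \<open>auto simp: K_def\<close>)
   ultimately show ?thesis by (simp add: compact_eq_bounded_closed)
  qed
  have V: "open V" "V \<subseteq> K" "V \<subseteq> U"
   unfolding V_def K_def using in_cone open_Collect_less[OF cQ continuous_on_const] by auto
  \<comment> \<open>On the boundary of the ellipsoid the quadratic \<open>Q / 2 - h\<close> equals
    \<open>2 * h\<close> and dominates \<open>breg x\<close>. A determinant below \<open>lam\<close>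
    would carry this to the centre and give \<open>breg x c \<le> - h\<close>.\<close>
  have "lam \<le> det M"
  proof (rule ccontr)
   assume "\<not> lam \<le> det M"
   hence dM: "det M < lam" by simp
   have C1: "C2fun V (\<lambda>p. 1 / 2 * ((p - c) \<bullet> (M *v (p - c))) + 0 \<bullet> p + (- h)) (\<lambda>p. M *v (p - c) + 0) (\<lambda>p. M)"
    by (rule C2fun_quadratic[OF V(1) M(1)])
   have C2': "C2fun V (\<lambda>p. phi p - g x \<bullet> p - (phi x - g x \<bullet> x)) (\<lambda>p. g p - g x) A"
    by (rule C2fun_subset[OF C2fun_diff_affine[OF C2] V(3,1)])
   have cK: "c \<in> K" using h0 by (simp add: K_def Q_def)
   have "0 \<le> (1 / 2 * ((c - c) \<bullet> (M *v (c - c))) + 0 \<bullet> c + (- h)) - (phi c - g x \<bullet> c - (phi x - g x \<bullet> x))"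
   proof (rule C2fun_comparison[OF C2fun_diff[OF C1 C2'] K V(2) _ _ _ cK])
    have KU: "K \<subseteq> U" using in_cone by (auto simp: K_def)
    show "continuous_on K (\<lambda>p. 1 / 2 * ((p - c) \<bullet> (M *v (p - c))) + 0 \<bullet> p + (- h) - (phi p - g x \<bullet> p - (phi x - g x \<bullet> x)))"
     using KU by (intro continuous_intros continuous_on_subset[OF contphi])
    show "\<not> psd (M - A p)" if "p \<in> V" for p
     using detA[of p] that V(3) dM lam by (intro not_psd_diff) auto
    fix p assume p: "p \<in> K" "p \<notin> V"
    hence "Q p = 6 * h" by (simp add: K_def V_def)
    thus "0 \<le> 1 / 2 * ((p - c) \<bullet> (M *v (p - c))) + 0 \<bullet> p + (- h) - (phi p - g x \<bullet> p - (phi x - g x \<bullet> x))"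
     using in_cone[of p] by (simp add: Q_def breg_affine)
   qed
   moreover have "0 \<le> breg x c" using in_cone[of c] cK breg_nonneg[OF x] by (simp add: K_def)
   ultimately show False using h0 by (simp add: breg_affine)
  qed
  also have "det M \<le> a ^ (CARD('n) - 1) * (96 * h / (q / (2 * L))\<^sup>2)"
   unfolding M(2) b_def using a h0 w q0 L_pos w0 by (intro mult_left_mono divide_left_mono power_mono mult_pos_pos) auto
  also have "\<dots> = 384 * L\<^sup>2 * a ^ (CARD('n) - 1) * h / q\<^sup>2" by (simp add: power_divide)
  finally have "lam * q\<^sup>2 \<le> 384 * L\<^sup>2 * a ^ (CARD('n) - 1) * h" using q0 by (simp add: pos_le_divide_eq)
  hence "lam / (384 * L\<^sup>2 * a ^ (CARD('n) - 1)) * q\<^sup>2 \<le> h" using L_pos a by (simp add: pos_divide_le_eq mult_ac)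
  moreover have "hb_const * (phi x)\<^sup>2 \<le> lam / (384 * L\<^sup>2 * a ^ (CARD('n) - 1)) * q\<^sup>2"
   using mult_right_mono[OF hb_const_le(2), of "q\<^sup>2"] unfolding a_def L'_def q_def by simp
  ultimately show ?thesis by simp
 qed
qed

section \<open>Hoelder continuity of the gradient at the boundary\<close>

definition "hol_T = 3 * L / rho + 2 * L * D"

text \<open>The region on which the barrier is compared lies within height
  \<open>hol_1 * s / k\<^sup>2\<close> above the tangent plane at \<open>y\<close>.\<close>

definition "hol_1 = 8 * L\<^sup>2 * (1 + D + hol_T * D) + hol_T\<^sup>2 * R"

text \<open>The barrier may grow by \<open>hol_5 * k ^ 3\<close> times the height: the first term
  keeps this below \<open>G\<close> inside \<open>U\<close>, the second one below \<open>G\<close>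
  on the frontier.\<close>

definition "hol_5 = min (1 / hol_1) (k0 / D / (2 * L) ^ 3)"

text \<open>Up to this threshold for \<open>s / k ^ (3 * CARD('n) + 2)\<close>, the normal quadratic
  term that the determinant bound forces on the barrier fits into a third of its allowance.\<close>

definition "hol_6 = 2 / 3 * hol_5 * (2 * hol_5 / (3 * R)) ^ (CARD('n) - 1) / (Lam * hol_1)"

text \<open>Inverse of the power of \<open>k\<close> in the threshold; the power collects 3 from the
  barrier slope, 2 from the height of the region, and 3 from each of the remaining directions in the
  determinant.\<close>

definition "hol_exp = 1 / (3 * real CARD('n) + 2)"

definition "hol_const = 1 + hol_T * D / r0 + hol_T + (1 / hol_6) powr hol_exp + 2 * L * (1 / rho\<^sup>2) powr hol_exp"

lemma pd_barrier:
 fixes nu :: "real^'n" and c C :: real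
 assumes "0 < c" "0 \<le> C"
 shows "pd ((2 * c) *\<^sub>R mat 1 + (2 * C) *\<^sub>R outer nu nu)"
proof (rule pd_add_psd)
 show "pd ((2 * c) *\<^sub>R mat 1)" using assms by (intro pd_mat_scaleR) simp
 show "psd ((2 * C) *\<^sub>R outer nu nu)"
  using assms psd_outer[of nu] by (simp add: psd_def transpose_scaleR scaleR_mat_vec)
qed

lemma det_barrier:
 fixes nu :: "real^'n" and c C :: real
 assumes "0 < c" "0 \<le> C" "norm nu = 1"
 shows "det ((2 * c) *\<^sub>R mat 1 + (2 * C) *\<^sub>R outer nu nu) = (2 * c) ^ (CARD('n) - 1) * (2 * c + 2 * C)"
proof -
 have o: "(2 * C) *\<^sub>R outer nu nu = outer (sqrt (2 * C) *\<^sub>R nu) (sqrt (2 * C) *\<^sub>R nu)"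
  using assms by (simp add: outer_def vec_eq_iff)
 have inv: "((2 * c) *\<^sub>R mat 1) ** ((1 / (2 * c)) *\<^sub>R mat 1) = (mat 1 :: real^'n^'n)"
  using assms by (simp add: scaleR_mat_mult)
 have "det ((2 * c) *\<^sub>R mat 1 + (2 * C) *\<^sub>R outer nu nu) =
   (2 * c) ^ CARD('n) * (1 + (((1 / (2 * c)) *\<^sub>R mat 1) *v (sqrt (2 * C) *\<^sub>R nu)) \<bullet> (sqrt (2 * C) *\<^sub>R nu))"
  unfolding o det_add_outer[OF inv] det_scaleR_mat1 ..
 also have "(((1 / (2 * c)) *\<^sub>R mat 1) *v (sqrt (2 * C) *\<^sub>R nu)) \<bullet> (sqrt (2 * C) *\<^sub>R nu) = C / c"
  using assms by (simp add: scaleR_mat_vec power2_norm_eq_inner[symmetric])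
 also have "(2 * c) ^ CARD('n) * (1 + C / c) = (2 * c) ^ (CARD('n) - 1) * (2 * c + 2 * C)"
 proof -
  have "(2 * c) ^ CARD('n) = (2 * c) ^ (CARD('n) - 1) * (2 * c)" by (rule power_minus_mult[symmetric]) simp
  thus ?thesis using assms by (simp add: algebra_simps)
 qed
 finally show ?thesis .
qed

text \<open>With \<open>mu\<close> the slope of \<open>phi\<close> at \<open>y\<close> in normal direction, \<open>phi + mu y1\<close> vanishes to first order
 at \<open>y\<close>. A large gradient close to \<open>y\<close> would make this function so large on a hyperplane near \<open>y\<close>
 that a quadratic lower barrier with positive slope at \<open>y\<close> fits below it.\<close>

lemma gradient_holder:
 assumes y: "y \<in> frontier U"
 shows "\<exists>m. \<forall>s. 0 < s \<and> s \<le> 1 \<longrightarrow> norm (g (y + s *\<^sub>R (c0 - y)) - m) \<le>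
  hol_const * s powr hol_exp"
proof -
 define T where "T = hol_T"
 define C1 where "C1 = hol_1"
 define c5 where "c5 = hol_5"
 define C6 where "C6 = hol_6"
 define dlt where "dlt = hol_exp"
 note pos = L_pos D_pos k0_pos R rho c0(2) Lam(2)
 have T1: "T = 3 * L / rho + 2 * L * D" by (simp add: T_def hol_T_def)
 have "0 < T" unfolding T1 using pos by (intro add_pos_pos divide_pos_pos mult_pos_pos) auto
 note T = T1 this
 have C1: "C1 = 8 * L\<^sup>2 * (1 + D + T * D) + T\<^sup>2 * R" by (simp add: C1_def hol_1_def T_def)
 have "0 < 8 * L\<^sup>2 * (1 + D + T * D)" using pos T by (intro mult_pos_pos add_pos_pos) auto
 hence C1p: "0 < C1" unfolding C1 using pos by (intro add_pos_nonneg) auto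
 have c5: "0 < c5" "c5 \<le> 1 / C1" "c5 * (2 * L) ^ 3 \<le> k0 / D"
 proof -
  show "0 < c5" using pos C1p by (simp add: c5_def hol_5_def C1_def)
  show "c5 \<le> 1 / C1" by (simp add: c5_def hol_5_def C1_def)
  have "c5 \<le> k0 / D / (2 * L) ^ 3" by (simp add: c5_def hol_5_def)
  moreover have "0 < (2 * L) ^ 3" using pos by simp
  ultimately show "c5 * (2 * L) ^ 3 \<le> k0 / D" using pos_le_divide_eq by blast
 qed
 have C6: "C6 = 2 / 3 * c5 * (2 * c5 / (3 * R)) ^ (CARD('n) - 1) / (Lam * C1)"
  by (simp add: C6_def hol_6_def c5_def C1_def)
 have C6p: "0 < C6" unfolding C6 using c5 pos C1p by simp
 have dlt: "0 < dlt" "dlt \<le> 1 / 2" by (auto simp: dlt_def hol_exp_def)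
 obtain nu where nu: "norm nu = 1" "\<forall>x\<in>U. (norm (x - y))\<^sup>2 \<le> R * ((x - y) \<bullet> nu)"
   "ball (y + rho *\<^sub>R nu) rho \<subseteq> U" using normal[OF y] by blast
 have nu1: "nu \<bullet> nu = 1" using nu(1) by (simp add: norm_eq_1)
 have yc: "y \<in> closure U" using y by (simp add: closure_split)
 define h where "h x = (x - y) \<bullet> nu" for x
 have hcl: "(norm (x - y))\<^sup>2 \<le> R * h x" if "x \<in> closure U" for x
  unfolding h_def by (rule normal_cl[OF nu(2) that])
 have h0: "0 \<le> h x" if "x \<in> closure U" for x
  using hcl[OF that] R by (metis order_trans zero_le_mult_iff zero_le_power2 not_le)
 have hpos: "0 < h x" if "x \<in> U" for x
 proof -
  have "x \<noteq> y" using that frontier_disjoint[OF y] by auto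
  hence "0 < R * h x" using hcl[of x] that closure_subset by (smt (verit, best) subsetD zero_less_power2 norm_eq_zero right_minus_eq)
  thus ?thesis using R by (simp add: zero_less_mult_iff)
 qed
 have hD: "h x \<le> D" if "x \<in> closure U" for x
  using D[OF that yc] norm_cauchy_schwarz[of "x - y" nu] nu(1) by (simp add: h_def)
 \<comment> \<open>The least slope for which \<open>phi + mu * h\<close> is nonnegative; that it
   cannot be lowered is what the final contradiction uses.\<close>
 define mu where "mu = Sup ((\<lambda>x. - phi x / h x) ` U)"
 have bdmu: "- phi x / h x \<le> L" if "x \<in> U" for x
  unfolding pos_divide_le_eq[OF hpos[OF that]] using barrier[OF y nu(2) that] by (simp add: h_def)
 have bdda: "bdd_above ((\<lambda>x. - phi x / h x) ` U)" using bdmu by force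
 have mu_ge: "- phi x / h x \<le> mu" if "x \<in> U" for x
  unfolding mu_def using that bdda by (intro cSup_upper) auto
 have muL: "mu \<le> L" unfolding mu_def using bdmu U_ne by (intro cSup_least) auto
 have muk: "k0 / D \<le> mu"
 proof -
  have "k0 / D \<le> - phi c0 / h c0"
   using phi_c0 hpos[OF c0_in] hD[of c0] c0_in closure_subset k0_pos by (intro frac_le) auto
  thus ?thesis using mu_ge[OF c0_in] by simp
 qed
 hence mu0: "0 < mu" using pos by (meson divide_pos_pos less_le_trans)
 define G where "G x = phi x + mu * h x" for x
 have G0: "0 \<le> G x" if "x \<in> U" for x
  using mu_ge[OF that] unfolding pos_divide_le_eq[OF hpos[OF that]] by (simp add: G_def)
 have hc0: "r0 \<le> h c0"
 proof (rule field_le_epsilon)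
  fix ep :: real assume ep: "0 < ep"
  show "r0 \<le> h c0 + ep"
  proof (cases "ep < r0")
   case True
   hence "c0 - (r0 - ep) *\<^sub>R nu \<in> ball c0 r0" using ep nu(1) by simp
   hence "0 < h (c0 - (r0 - ep) *\<^sub>R nu)" using c0 by (intro hpos) auto
   thus ?thesis by (simp add: h_def inner_diff_left nu1)
  next
   case False
   thus ?thesis using hpos[OF c0_in] by simp
  qed
 qed
 have main: "norm (g (y + s *\<^sub>R (c0 - y)) + mu *\<^sub>R nu) \<le> (1 + T * D / r0 + T + (1 / C6) powr dlt) * s powr dlt"
  if s: "0 < s" "s \<le> 1" "s < rho\<^sup>2" for s
 proof -
  define P where "P = y + s *\<^sub>R (c0 - y)"
  have PO: "P \<in> U" unfolding P_def by (rule segment_in[OF yc c0_in s(1,2)])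
  define zet where "zet = g P + mu *\<^sub>R nu"
  define k where "k = zet \<bullet> nu"
  have Py: "norm (P - y) \<le> s * D" using D[of c0 y] c0_in yc closure_subset s by (auto simp: P_def)
  have hP: "s * r0 \<le> h P" using hc0 s by (simp add: P_def h_def)
  have z2L: "norm zet \<le> 2 * L"
  proof -
   have "norm zet \<le> norm (g P) + norm (mu *\<^sub>R nu)" unfolding zet_def by (rule norm_triangle_ineq)
   thus ?thesis using gradient_le[OF PO] muL mu0 nu(1) by simp
  qed
  have k2L: "k \<le> 2 * L" using norm_cauchy_schwarz[of zet nu] z2L nu(1) by (simp add: k_def)
  have Gsup: "G P + zet \<bullet> (x - P) \<le> G x" if "x \<in> closure U" for x
  proof -
   have 1: "h x - h P = nu \<bullet> (x - P)" by (simp add: h_def inner_diff_right inner_commute)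
   have 2: "zet \<bullet> (x - P) = g P \<bullet> (x - P) + mu * (h x - h P)"
    unfolding 1 zet_def inner_add_left inner_scaleR_left ..
   have "G x - G P - zet \<bullet> (x - P) = breg P x" unfolding 2 G_def breg_def right_diff_distrib by simp
   thus ?thesis using breg_cl_nonneg[OF PO that] by simp
  qed
  have sq: "0 < sqrt s" "sqrt s * sqrt s = s" "sqrt s < rho" using s rho real_sqrt_less_mono[OF s(3)] by auto
  \<comment> \<open>Test the supporting plane of \<open>G\<close> at \<open>P\<close> with a point
    \<open>Y\<close> of the interior ball at tangential distance \<open>sqrt s\<close>: its height,
    and hence \<open>G Y\<close>, is only of order \<open>s\<close>.\<close>
  have tang1: "zet \<bullet> tau \<le> T * sqrt s" if tau: "tau \<bullet> nu = 0" "norm tau = 1" for tau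
  proof -
   define r where "r = sqrt s"
   have r: "0 < r" "r * r = s" "r < rho" using sq by (auto simp: r_def)
   define Y where "Y = y + r *\<^sub>R tau + (r\<^sup>2 / rho) *\<^sub>R nu"
   have "(norm (Y - (y + rho *\<^sub>R nu)))\<^sup>2 = r\<^sup>2 + (r\<^sup>2 / rho - rho)\<^sup>2"
   proof -
    have "Y - (y + rho *\<^sub>R nu) = r *\<^sub>R tau + (r\<^sup>2 / rho - rho) *\<^sub>R nu" by (simp add: Y_def algebra_simps)
    moreover have "tau \<bullet> tau = 1" using tau(2) by (simp add: norm_eq_1)
    ultimately show ?thesis unfolding power2_norm_eq_inner using tau(1)
     by (simp add: inner_add_left inner_add_right nu1 inner_commute[of nu tau])
      (simp add: power2_eq_square)
   qed
   also have "\<dots> < rho\<^sup>2"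
   proof -
    have "r\<^sup>2 < rho\<^sup>2" using r by (intro power_strict_mono) auto
    hence "r\<^sup>2 * (r\<^sup>2 / rho\<^sup>2 - 1) < 0" using r by (intro mult_pos_neg) (auto simp: field_simps)
    moreover have "r\<^sup>2 + (r\<^sup>2 / rho - rho)\<^sup>2 = rho\<^sup>2 + r\<^sup>2 * (r\<^sup>2 / rho\<^sup>2 - 1)"
     using rho by (simp add: power2_diff field_simps) (simp add: power2_eq_square)
    ultimately show ?thesis by simp
   qed
   finally have "norm (Y - (y + rho *\<^sub>R nu)) < rho" using rho by (simp add: power2_less_imp_less)
   hence YO: "Y \<in> U" using nu(3) by (auto simp: dist_norm norm_minus_commute)
   have hY: "h Y = r\<^sup>2 / rho" using tau(1) by (simp add: h_def Y_def inner_add_left nu1)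
   have "G P + zet \<bullet> (Y - P) \<le> G Y" using YO closure_subset by (intro Gsup) auto
   moreover have "G Y \<le> mu * (r\<^sup>2 / rho)"
    using phi_nonpos[of Y] YO closure_subset by (auto simp: G_def hY)
   moreover have "mu * (r\<^sup>2 / rho) \<le> L * (r\<^sup>2 / rho)" using muL rho by (intro mult_right_mono) auto
   ultimately have 1: "zet \<bullet> (Y - P) \<le> L * (r\<^sup>2 / rho)" using G0[OF PO] by simp
   have 2: "zet \<bullet> (Y - P) = r * (zet \<bullet> tau) + (r\<^sup>2 / rho) * k - zet \<bullet> (P - y)"
    by (simp add: Y_def k_def inner_diff_right inner_add_right)
   have "zet \<bullet> (P - y) \<le> norm zet * norm (P - y)" by (rule norm_cauchy_schwarz)
   also have "\<dots> \<le> 2 * L * (s * D)" using z2L Py pos by (intro mult_mono) auto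
   finally have 3: "zet \<bullet> (P - y) \<le> 2 * L * (s * D)" .
   have "\<bar>k\<bar> \<le> 2 * L" using Cauchy_Schwarz_ineq2[of zet nu] z2L nu(1) by (simp add: k_def)
   hence "(r\<^sup>2 / rho) * (- k) \<le> (r\<^sup>2 / rho) * (2 * L)" using rho by (intro mult_left_mono) auto
   hence "r * (zet \<bullet> tau) \<le> L * (r\<^sup>2 / rho) + (r\<^sup>2 / rho) * (2 * L) + 2 * L * (s * D)"
    using 1 2 3 by linarith
   also have "\<dots> = r * (T * r)" unfolding r(2)[symmetric] T(1) by (simp add: power2_eq_square algebra_simps)
   finally show ?thesis using r by auto
  qed
  have tang: "\<bar>zet \<bullet> tau\<bar> \<le> T * sqrt s * norm tau" if tau: "tau \<bullet> nu = 0" for tau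
  proof (cases "tau = 0")
   case False
   define u where "u = (1 / norm tau) *\<^sub>R tau"
   have u: "u \<bullet> nu = 0" "norm u = 1" "- u \<bullet> nu = 0" "norm (- u) = 1" using False tau by (auto simp: u_def)
   have "\<bar>zet \<bullet> u\<bar> \<le> T * sqrt s" using tang1[OF u(1,2)] tang1[OF u(3,4)] by simp
   hence "norm tau * \<bar>zet \<bullet> u\<bar> \<le> norm tau * (T * sqrt s)" by (intro mult_left_mono) auto
   thus ?thesis using False by (simp add: u_def mult_ac)
  qed simp
  define pr where "pr x = x - (x \<bullet> nu) *\<^sub>R nu" for x
  have pr: "pr x \<bullet> nu = 0" "zet \<bullet> x = k * (x \<bullet> nu) + zet \<bullet> pr x" "norm (pr x) \<le> norm x" for x
  proof -
   show "pr x \<bullet> nu = 0" by (simp add: pr_def inner_diff_left nu1)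
   show "zet \<bullet> x = k * (x \<bullet> nu) + zet \<bullet> pr x" by (simp add: pr_def k_def inner_diff_right)
   have "(norm (pr x))\<^sup>2 = (norm x)\<^sup>2 - (x \<bullet> nu)\<^sup>2"
    unfolding power2_norm_eq_inner pr_def
    by (simp add: inner_diff_left inner_diff_right nu1 inner_commute[of nu x]) (simp add: power2_eq_square)
   hence "(norm (pr x))\<^sup>2 \<le> (norm x)\<^sup>2" by simp
   thus "norm (pr x) \<le> norm x" by simp
  qed
  have zPy: "0 \<le> zet \<bullet> (P - y)"
  proof -
   have "G P + zet \<bullet> (y - P) \<le> G y" by (rule Gsup[OF yc])
   moreover have "G y = 0" using zero[OF y] by (simp add: G_def h_def)
   ultimately show ?thesis using G0[OF PO] by (simp add: inner_diff_right)
  qed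
  \<comment> \<open>The supporting plane at \<open>P\<close> is nonpositive at \<open>y\<close>
    while \<open>G P\<close> is not negative, so \<open>zet\<close> does not decrease from
    \<open>y\<close> to \<open>P\<close>; the tangential part is already known to be small.\<close>
  have k_low: "- (T * D / r0) * sqrt s \<le> k"
  proof -
   have "zet \<bullet> pr (P - y) \<le> T * sqrt s * norm (pr (P - y))" using tang[OF pr(1)] by (simp add: abs_le_iff)
   also have "\<dots> \<le> T * sqrt s * (s * D)" using pr(3)[of "P - y"] Py T sq by simp
   finally have "0 \<le> k * h P + T * sqrt s * (s * D)" using zPy pr(2)[of "P - y"] by (simp add: h_def)
   show ?thesis
   proof (cases "0 \<le> k")
    case True
    have "0 \<le> T * D / r0 * sqrt s" using T pos sq by simp
    thus ?thesis using True by simp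
   next
    case False
    hence "k * h P \<le> k * (s * r0)" using hP by simp
    hence "0 \<le> s * (k * r0 + T * D * sqrt s)"
     using \<open>0 \<le> k * h P + T * sqrt s * (s * D)\<close> by (simp add: algebra_simps)
    hence "0 \<le> k * r0 + T * D * sqrt s" using s by (simp add: zero_le_mult_iff)
    hence "- (T * D * sqrt s / r0) \<le> k" using pos(6) by (simp add: field_simps)
    thus ?thesis by simp
   qed
  qed
  have k_up: "k \<le> sqrt s \<or> C6 * k ^ (3 * CARD('n) + 2) < s"
  proof (rule ccontr)
   assume "\<not> ?thesis"
   hence kgt: "sqrt s < k" and sle: "s \<le> C6 * k ^ (3 * CARD('n) + 2)" by auto
   have k0': "0 < k" using kgt sq by linarith
   define E where "E = 1 + D + T * D"
   have E: "0 < E" using pos T by (simp add: E_def add_pos_pos)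
   \<comment> \<open>The points to which the supporting plane of \<open>G\<close> at
     \<open>P\<close> has risen by at most \<open>k * s\<close>. Where it has risen by exactly that,
     \<open>G\<close> is at least \<open>k * s\<close>; on the frontier of \<open>U\<close> one has
     \<open>G = mu * h\<close>.\<close>
   define K where "K = {x \<in> closure U. zet \<bullet> (x - P) \<le> k * s}"
   define V where "V = {x \<in> U. zet \<bullet> (x - P) < k * s}"
   have cK: "compact K"
   proof -
    have "K = closure U \<inter> {x. zet \<bullet> (x - P) \<le> k * s}" by (auto simp: K_def)
    moreover have "closed {x. zet \<bullet> (x - P) \<le> k * s}" by (intro closed_Collect_le continuous_intros)
    ultimately show ?thesis using cpt by auto
   qed
   have oV: "open V"
   proof -
    have "V = U \<inter> {x. zet \<bullet> (x - P) < k * s}" by (auto simp: V_def)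
    moreover have "open {x. zet \<bullet> (x - P) < k * s}" by (intro open_Collect_less continuous_intros)
    ultimately show ?thesis using openU by auto
   qed
   have VK: "V \<subseteq> K" using closure_subset by (auto simp: K_def V_def)
   define Y1 where "Y1 = C1 * s / k\<^sup>2"
   have hK: "h x \<le> Y1" if x: "x \<in> K" for x
   proof -
    have xc: "x \<in> closure U" and xs: "zet \<bullet> (x - P) \<le> k * s" using x by (auto simp: K_def)
    have hx: "0 \<le> h x" by (rule h0[OF xc])
    have "zet \<bullet> pr (P - y) \<le> T * sqrt s * norm (pr (P - y))" using tang[OF pr(1)] by (simp add: abs_le_iff)
    also have "\<dots> \<le> T * k * (s * D)"
     using pr(3)[of "P - y"] Py T(2) kgt k0' by (intro mult_mono mult_left_mono mult_nonneg_nonneg) auto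
    finally have "zet \<bullet> pr (P - y) \<le> T * k * (s * D)" .
    moreover have "k * h P \<le> k * (s * D)"
    proof -
     have "h P \<le> norm (P - y) * norm nu" unfolding h_def by (rule norm_cauchy_schwarz)
     thus ?thesis using Py nu(1) k0' by simp
    qed
    ultimately have "zet \<bullet> (P - y) \<le> k * (s * D) + T * k * (s * D)" using pr(2)[of "P - y"] by (simp add: h_def)
    hence "zet \<bullet> (x - y) \<le> k * s * E" using xs by (simp add: E_def algebra_simps)
    moreover have "zet \<bullet> (x - y) = k * h x + zet \<bullet> pr (x - y)" using pr(2)[of "x - y"] by (simp add: h_def)
    moreover have "- (T * sqrt s * sqrt (R * h x)) \<le> zet \<bullet> pr (x - y)"
    proof -
     have "norm (pr (x - y)) \<le> sqrt (R * h x)"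
      using pr(3)[of "x - y"] hcl[OF xc] by (meson order_trans real_le_rsqrt)
     hence "T * sqrt s * norm (pr (x - y)) \<le> T * sqrt s * sqrt (R * h x)" using T sq by simp
     thus ?thesis using tang[OF pr(1)[of "x - y"]] by simp
    qed
    ultimately have 1: "k * h x \<le> k * s * E + T * sqrt s * sqrt (R * h x)" by simp
    \<comment> \<open>Weighted arithmetic-geometric mean, with weights such that half of
      \<open>k * h x\<close> remains on the left.\<close>
    have "T * sqrt s * sqrt (R * h x) \<le> k * h x / 2 + T\<^sup>2 * s * R / (2 * k)"
    proof -
     define a b where "a = sqrt (k * h x)" and "b = T * sqrt s * sqrt R / sqrt k"
     have sk: "0 < sqrt k" using k0' by simp
     have "a * b = T * sqrt s * sqrt (R * h x)" using sk by (simp add: a_def b_def real_sqrt_mult)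
     moreover have "a\<^sup>2 = k * h x" using k0' hx by (simp add: a_def)
     moreover have "b\<^sup>2 = T\<^sup>2 * s * R / k" using k0' s R by (simp add: b_def power_mult_distrib power_divide)
     moreover have "0 \<le> (a - b)\<^sup>2" by simp
     ultimately show ?thesis by (simp add: power2_diff field_simps)
    qed
    with 1 have "k * h x / 2 \<le> k * s * E + T\<^sup>2 * s * R / (2 * k)" by linarith
    hence "(k * h x / 2) * (2 * k) \<le> (k * s * E + T\<^sup>2 * s * R / (2 * k)) * (2 * k)"
     using k0' by (intro mult_right_mono) auto
    hence "k\<^sup>2 * h x \<le> 2 * k\<^sup>2 * s * E + T\<^sup>2 * s * R"
    proof -
     have "(k * h x / 2) * (2 * k) = k\<^sup>2 * h x" by (simp add: power2_eq_square)
     moreover have "(k * s * E + T\<^sup>2 * s * R / (2 * k)) * (2 * k) = 2 * k\<^sup>2 * s * E + T\<^sup>2 * s * R"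
      using k0' by (simp add: distrib_right power2_eq_square)
     ultimately show ?thesis using \<open>(k * h x / 2) * (2 * k) \<le> _\<close> by linarith
    qed
    also have "2 * k\<^sup>2 * s * E \<le> 2 * (2 * L)\<^sup>2 * s * E"
     using k0' k2L s E by (intro mult_right_mono mult_left_mono power_mono) auto
    finally have "k\<^sup>2 * h x \<le> C1 * s" by (simp add: C1 E_def algebra_simps)
    thus ?thesis using k0' by (simp add: Y1_def pos_le_divide_eq mult.commute)
   qed
   define q where "q = c5 * k ^ 3"
   have q0: "0 < q" using c5 k0' by (simp add: q_def)
   have qmu: "q \<le> mu"
   proof -
    have "q \<le> c5 * (2 * L) ^ 3" unfolding q_def using c5 k0' k2L by (intro mult_left_mono power_mono) auto
    thus ?thesis using c5(3) muk by simp
   qed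
   have qY: "q * Y1 \<le> k * s"
   proof -
    have "q * Y1 \<le> (1 / C1 * k ^ 3) * Y1"
     unfolding q_def using c5 k0' C1p s by (intro mult_right_mono) (auto simp: Y1_def)
    also have "\<dots> = k * s" using C1p by (simp add: Y1_def power3_eq_cube power2_eq_square)
    finally show ?thesis .
   qed
   \<comment> \<open>The three terms of the barrier get a third of \<open>q * h\<close> each: the
     isotropic one by the enclosing ball, the normal quadratic one by the height bound
     \<open>Y1\<close>, and the linear one. \<open>B\<close> alone brings the determinant to
     \<open>Lam\<close>; the isotropic part makes the inequality strict.\<close>
   define c where "c = q / (3 * R)"
   define B where "B = Lam / (2 * (2 * c) ^ (CARD('n) - 1))"
   have c: "0 < c" using q0 R by (simp add: c_def)
   have B: "0 < B" using c pos by (simp add: B_def)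
   have BY: "B * Y1 \<le> q / 3"
   proof -
    define N where "N = (2 * c5 / (3 * R)) ^ (CARD('n) - 1)"
    have N: "0 < N" unfolding N_def using c5 R by simp
    have kk: "k ^ (3 * CARD('n) + 2) = k ^ 3 * k\<^sup>2 * (k ^ 3) ^ (CARD('n) - 1)"
    proof -
     have "3 * m + 2 = 3 + 2 + 3 * (m - 1)" if "1 \<le> m" for m :: nat using that by simp
     hence "3 * CARD('n) + 2 = 3 + 2 + 3 * (CARD('n) - 1)" by simp
     thus ?thesis by (simp only: power_add power_mult)
    qed
    have c2: "(2 * c) ^ (CARD('n) - 1) = N * (k ^ 3) ^ (CARD('n) - 1)"
    proof -
     have "2 * c = 2 * c5 / (3 * R) * k ^ 3" by (simp add: c_def q_def)
     thus ?thesis unfolding N_def by (simp only: power_mult_distrib)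
    qed
    define kn where "kn = (k ^ 3) ^ (CARD('n) - 1)"
    have kn: "0 < kn" using k0' by (simp add: kn_def)
    have "s \<le> 2 / 3 * c5 * N / (Lam * C1) * (k ^ 3 * k\<^sup>2 * kn)"
     using sle unfolding C6 kk N_def kn_def by simp
    hence "Lam * C1 * s \<le> 2 / 3 * c5 * N * (k ^ 3 * k\<^sup>2 * kn)"
     using pos C1p by (simp add: pos_le_divide_eq mult_ac)
    hence "Lam * C1 * s / (2 * (N * kn) * k\<^sup>2) \<le> c5 * k ^ 3 / 3"
     using N kn k0' by (simp add: pos_divide_le_eq mult_ac)
    moreover have "B * Y1 = Lam * C1 * s / (2 * (N * kn) * k\<^sup>2)"
     unfolding B_def c2 kn_def[symmetric] Y1_def by simp
    ultimately show ?thesis by (simp add: q_def)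
   qed
   define M where "M = (2 * c) *\<^sub>R mat 1 + (2 * B) *\<^sub>R outer nu nu"
   have symM: "transpose M = M" using pd_barrier[of c B nu] c B by (simp add: M_def pd_def)
   define bet where "bet = q / 3"
   define ps where "ps x = 1 / 2 * ((x - y) \<bullet> (M *v (x - y))) + (bet *\<^sub>R nu) \<bullet> x + (- bet * (y \<bullet> nu))" for x
   have psi: "ps x = c * (norm (x - y))\<^sup>2 + B * (h x)\<^sup>2 + bet * h x" for x
   proof -
    have "(x - y) \<bullet> (M *v (x - y)) = 2 * c * (norm (x - y))\<^sup>2 + 2 * B * (h x)\<^sup>2"
     by (simp add: M_def matrix_vector_mult_add_rdistrib scaleR_mat_vec outer_mult_vec inner_add_right power2_norm_eq_inner h_def inner_commute[of nu]) (simp add: power2_eq_square)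
    moreover have "(bet *\<^sub>R nu) \<bullet> x + (- bet * (y \<bullet> nu)) = bet * h x"
     by (simp add: h_def inner_commute algebra_simps)
    ultimately show ?thesis unfolding ps_def by linarith
   qed
   have psi_le: "ps x \<le> q * h x" if x: "x \<in> K" for x
   proof -
    have xc: "x \<in> closure U" using x by (simp add: K_def)
    have hx: "0 \<le> h x" by (rule h0[OF xc])
    have "c * (norm (x - y))\<^sup>2 \<le> c * (R * h x)" using hcl[OF xc] c by simp
    also have "\<dots> = q / 3 * h x" using R by (simp add: c_def)
    finally have 1: "c * (norm (x - y))\<^sup>2 \<le> q / 3 * h x" .
    have "B * h x \<le> B * Y1" using hK[OF x] B by simp
    hence "B * h x * h x \<le> q / 3 * h x" using BY hx by (intro mult_right_mono) auto
    with 1 show ?thesis unfolding psi bet_def by (simp add: power2_eq_square)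
   qed
   have detM: "Lam < det M"
   proof -
    have "det M = (2 * c) ^ (CARD('n) - 1) * (2 * c + 2 * B)"
     unfolding M_def by (rule det_barrier) (use c B nu in auto)
    moreover have "(2 * c) ^ (CARD('n) - 1) * (2 * B) = Lam" using c by (simp add: B_def)
    moreover have "0 < (2 * c) ^ (CARD('n) - 1) * (2 * c)" using c by simp
    ultimately show ?thesis by (simp add: distrib_left)
   qed
   have CG: "C2fun U (\<lambda>x. phi x - (- mu *\<^sub>R nu) \<bullet> x - mu * (y \<bullet> nu)) (\<lambda>x. g x - (- mu *\<^sub>R nu)) A"
    by (rule C2fun_diff_affine[OF C2])
   have Geq: "phi x - (- mu *\<^sub>R nu) \<bullet> x - mu * (y \<bullet> nu) = G x" for x
    by (simp add: G_def h_def inner_commute algebra_simps)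
   have CG': "C2fun V G (\<lambda>x. g x - (- mu *\<^sub>R nu)) A"
    using C2fun_subset[OF CG _ oV] unfolding Geq by (auto simp: V_def)
   have Cpsi: "C2fun V ps (\<lambda>x. M *v (x - y) + bet *\<^sub>R nu) (\<lambda>x. M)"
    unfolding ps_def by (rule C2fun_quadratic[OF oV symM])
   have comp: "0 \<le> G x - ps x" if "x \<in> K" for x
   proof (rule C2fun_comparison[OF C2fun_diff[OF CG' Cpsi] cK VK _ _ _ that])
    show "continuous_on K (\<lambda>x. G x - ps x)" unfolding psi G_def h_def
     by (intro continuous_intros continuous_on_subset[OF cont_cl]) (auto simp: K_def)
    show "\<not> psd (A x - M)" if "x \<in> V" for x
    proof (rule not_psd_diff)
     show "pd M" unfolding M_def by (rule pd_barrier) (use c B in auto)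
     show "0 < det M" using detM pos by simp
     show "det (A x) < det M" using detM detA(2)[of x] that by (auto simp: V_def)
    qed
    fix x assume x: "x \<in> K" "x \<notin> V"
    hence xc: "x \<in> closure U" by (simp add: K_def)
    show "0 \<le> G x - ps x"
    proof (cases "x \<in> U")
     case True
     hence "zet \<bullet> (x - P) = k * s" using x by (auto simp: K_def V_def)
     hence "k * s \<le> G x" using Gsup[OF xc] G0[OF PO] by simp
     moreover have "q * h x \<le> q * Y1" using hK[OF x(1)] q0 by simp
     ultimately show ?thesis using psi_le[OF x(1)] qY by simp
    next
     case False
     hence "x \<in> frontier U" using xc by (simp add: closure_split)
     hence "G x = mu * h x" using zero by (simp add: G_def)
     moreover have "q * h x \<le> mu * h x" using qmu h0[OF xc] by (intro mult_right_mono) auto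
     ultimately show ?thesis using psi_le[OF x(1)] by simp
    qed
   qed
   have "- phi x / h x \<le> mu - bet" if x: "x \<in> U" for x
   proof -
    \<comment> \<open>Shrinking towards \<open>y\<close> brings any point into \<open>K\<close>;
      convexity of \<open>phi\<close> and \<open>phi y = 0\<close> carry the bound back to
      \<open>x\<close>.\<close>
    define t where "t = min 1 (k * s / (1 + norm zet * norm (x - y)))"
    have den: "0 < 1 + norm zet * norm (x - y)" by (simp add: add_pos_nonneg)
    have t: "0 < t" "t \<le> 1" using k0' s den by (auto simp: t_def)
    define x' where "x' = y + t *\<^sub>R (x - y)"
    have x'O: "x' \<in> U" unfolding x'_def by (rule segment_in[OF yc x t])
    have "zet \<bullet> (x' - P) = t * (zet \<bullet> (x - y)) - zet \<bullet> (P - y)"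
     by (simp add: x'_def algebra_simps)
    also have "\<dots> \<le> t * (norm zet * norm (x - y))"
     using zPy mult_left_mono[OF norm_cauchy_schwarz[of zet "x - y"], of t] t by linarith
    also have "\<dots> \<le> t * (1 + norm zet * norm (x - y))" using t by simp
    also have "\<dots> \<le> k * s / (1 + norm zet * norm (x - y)) * (1 + norm zet * norm (x - y))"
     by (intro mult_right_mono) (auto simp: t_def)
    also have "\<dots> = k * s" using den by simp
    finally have x'K: "x' \<in> K" using x'O closure_subset by (auto simp: K_def)
    have "bet * h x' \<le> ps x'" unfolding psi using c B by simp
    hence "bet * h x' \<le> G x'" using comp[OF x'K] by simp
    moreover have "h x' = t * h x" by (simp add: h_def x'_def)
    moreover have "phi x' \<le> t * phi x"
     unfolding x'_def using phi_convex_cl[OF yc x, of t] t zero[OF y] by simp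
    ultimately have "t * (bet * h x) \<le> t * (phi x + mu * h x)" by (simp add: G_def algebra_simps)
    hence "bet * h x \<le> phi x + mu * h x" using t by simp
    hence "- phi x \<le> (mu - bet) * h x" by (simp add: left_diff_distrib)
    thus ?thesis unfolding pos_divide_le_eq[OF hpos[OF x]] .
   qed
   hence "mu \<le> mu - bet" unfolding mu_def[of ] using U_ne by (intro cSup_least) (auto simp: mu_def[symmetric])
   thus False using q0 by (simp add: bet_def)
  qed
  have sd: "sqrt s \<le> s powr dlt"
  proof -
   have "sqrt s = s powr (1 / 2)" using s by (simp add: powr_half_sqrt)
   also have "\<dots> \<le> s powr dlt" using s dlt by (intro powr_mono') auto
   finally show ?thesis .
  qed
  have sd0: "0 \<le> s powr dlt" by simp
  have k_le: "k \<le> (1 + (1 / C6) powr dlt) * s powr dlt"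
  proof (cases "k \<le> sqrt s")
   case True
   have "0 \<le> (1 / C6) powr dlt * s powr dlt" by simp
   thus ?thesis using True sd unfolding distrib_right by linarith
  next
   case False
   hence k0': "0 < k" using sq by linarith
   have "k ^ (3 * CARD('n) + 2) \<le> s / C6" using k_up False C6p by (simp add: pos_le_divide_eq mult.commute)
   hence "(k ^ (3 * CARD('n) + 2)) powr dlt \<le> (s / C6) powr dlt" using dlt k0' by (intro powr_mono2) auto
   moreover have "(k ^ (3 * CARD('n) + 2)) powr dlt = k"
   proof -
    have "(k ^ (3 * CARD('n) + 2)) powr dlt = k powr (real (3 * CARD('n) + 2) * dlt)"
     using k0' by (subst powr_realpow[symmetric]) (auto simp: powr_powr)
    also have "real (3 * CARD('n) + 2) * dlt = 1" by (simp add: dlt_def hol_exp_def)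
    finally show ?thesis using k0' by simp
   qed
   moreover have "(s / C6) powr dlt = (1 / C6) powr dlt * s powr dlt" by (simp add: powr_divide)
   ultimately show ?thesis using sd0 unfolding distrib_right by linarith
  qed
  have kabs: "\<bar>k\<bar> \<le> (1 + T * D / r0 + (1 / C6) powr dlt) * s powr dlt"
  proof -
   have "T * D / r0 * sqrt s \<le> T * D / r0 * s powr dlt" using sd T pos by (intro mult_left_mono) auto
   moreover have "0 \<le> T * D / r0 * s powr dlt" "0 \<le> (1 + (1 / C6) powr dlt) * s powr dlt"
    using T pos by auto
   moreover have "(1 + T * D / r0 + (1 / C6) powr dlt) * s powr dlt =
     (1 + (1 / C6) powr dlt) * s powr dlt + T * D / r0 * s powr dlt" by (simp add: algebra_simps)
   moreover have "- (T * D / r0) * sqrt s = - (T * D / r0 * sqrt s)" by simp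
   ultimately show ?thesis using k_le k_low by linarith
  qed
  have "zet = k *\<^sub>R nu + pr zet" by (simp add: pr_def k_def)
  hence "norm zet \<le> norm (k *\<^sub>R nu) + norm (pr zet)" by (metis norm_triangle_ineq)
  moreover have "norm (pr zet) \<le> T * s powr dlt"
  proof (cases "pr zet = 0")
   case False
   have "zet \<bullet> pr zet = norm (pr zet) * norm (pr zet)"
    by (simp add: pr_def) (simp add: pr_def power2_norm_eq_inner[unfolded power2_eq_square] inner_diff_left inner_diff_right nu1 inner_commute)
   moreover have "zet \<bullet> pr zet \<le> T * sqrt s * norm (pr zet)" using tang[OF pr(1)[of zet]] by simp
   ultimately have "norm (pr zet) \<le> T * sqrt s" using False by simp
   also have "\<dots> \<le> T * s powr dlt" using sd T by simp
   finally show ?thesis .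
  qed (use T in simp)
  ultimately have "norm zet \<le> \<bar>k\<bar> + T * s powr dlt" using nu(1) by simp
  hence "norm zet \<le> (1 + T * D / r0 + (1 / C6) powr dlt) * s powr dlt + T * s powr dlt" using kabs by simp
  also have "\<dots> = (1 + T * D / r0 + T + (1 / C6) powr dlt) * s powr dlt" by (simp add: algebra_simps)
  finally show ?thesis by (simp add: zet_def P_def)
 qed
 have all: "norm (g (y + s *\<^sub>R (c0 - y)) - (- mu *\<^sub>R nu)) \<le> hol_const * s powr dlt"
  if s: "0 < s" "s \<le> 1" for s
 proof -
  define a where "a = 1 + T * D / r0 + T + (1 / C6) powr dlt"
  have a0: "0 \<le> a" using T pos by (simp add: a_def)
  have hc: "hol_const = a + 2 * L * (1 / rho\<^sup>2) powr dlt"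
   by (simp add: hol_const_def a_def T_def C6_def dlt_def)
  show ?thesis
  proof (cases "s < rho\<^sup>2")
   case True
   have "0 \<le> 2 * L * (1 / rho\<^sup>2) powr dlt * s powr dlt" using pos by simp
   moreover have "g (y + s *\<^sub>R (c0 - y)) - (- mu *\<^sub>R nu) = g (y + s *\<^sub>R (c0 - y)) + mu *\<^sub>R nu" by simp
   ultimately show ?thesis using main[OF s True] unfolding hc a_def[symmetric] distrib_right by (metis add_increasing2)
  next
   \<comment> \<open>For large \<open>s\<close> the gradient bound suffices; this is the last
     summand of \<open>hol_const\<close>.\<close>
   case False
   have PO: "y + s *\<^sub>R (c0 - y) \<in> U" by (rule segment_in[OF yc c0_in s])
   have "norm (g (y + s *\<^sub>R (c0 - y)) - (- mu *\<^sub>R nu)) \<le> norm (g (y + s *\<^sub>R (c0 - y))) + norm (- mu *\<^sub>R nu)"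
    by (rule norm_triangle_ineq4)
   also have "\<dots> \<le> 2 * L" using gradient_le[OF PO] muL mu0 nu(1) by simp
   also have "\<dots> \<le> 2 * L * (s / rho\<^sup>2) powr dlt"
   proof -
    have "1 \<le> s / rho\<^sup>2" using False rho by simp
    hence "1 \<le> (s / rho\<^sup>2) powr dlt" using dlt by (intro ge_one_powr_ge_zero) auto
    thus ?thesis using pos by simp
   qed
   also have "(s / rho\<^sup>2) powr dlt = (1 / rho\<^sup>2) powr dlt * s powr dlt" by (simp add: powr_divide)
   finally show ?thesis using mult_nonneg_nonneg[OF a0, of "s powr dlt"] unfolding hc by (simp add: distrib_right)
  qed
 qed
 show ?thesis using all unfolding dlt_def by blast
qed

lemma hol_const_nonneg: "0 \<le> hol_const"
proof -
 obtain y where y: "y \<in> frontier U" using frontier_ne by blast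
 obtain m where "\<forall>s. 0 < s \<and> s \<le> 1 \<longrightarrow> norm (g (y + s *\<^sub>R (c0 - y)) - m) \<le> hol_const * s powr hol_exp"
  using gradient_holder[OF y] by blast
 from spec[OF this, of 1] have "norm (g (y + 1 *\<^sub>R (c0 - y)) - m) \<le> hol_const * 1 powr hol_exp"
  by simp
 hence "norm (g (y + 1 *\<^sub>R (c0 - y)) - m) \<le> hol_const" by simp
 thus ?thesis using norm_ge_zero[of "g (y + 1 *\<^sub>R (c0 - y)) - m"] by linarith
qed

lemma hol_exp: "0 < hol_exp" "hol_exp \<le> 1" by (auto simp: hol_exp_def)

section \<open>Integrability of the Laplacian up to the boundary and its mass in boundary
  layers\<close>

definition dil :: "real => real^'n => real^'n" where "dil a x = c0 + a *\<^sub>R (x - c0)"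

lemma dil_in: "x \<in> closure U ==> 0 \<le> a ==> a < 1 ==> dil a x \<in> U"
 using segment_in[OF _ c0_in, of x "1 - a"] by (simp add: dil_def algebra_simps)

text \<open>The mass of \<open>w\<close> on a dilated copy of \<open>U\<close>, pulled back so that
  all copies are integrals over the same set.\<close>

definition Jd :: "real => real" where
 "Jd a = a ^ CARD('n) * (LINT x:U|lborel. w (dil a x))"

text \<open>The power of \<open>a\<close> is such that the divergence is the integrand of
  \<open>Jd a\<close>.\<close>

definition Gd :: "real => real^'n => real^'n" where
 "Gd a x = a ^ (CARD('n) - 1) *\<^sub>R g (dil a x)"

lemma cont_dil: "continuous_on S (dil a)" unfolding dil_def by (intro continuous_intros)

lemma Gd_der:
 assumes "dil a x \<in> U"
 shows "((\<lambda>x. e \<bullet> Gd a x) has_derivative (\<lambda>v. (a ^ CARD('n) *\<^sub>R (A (dil a x) *v e)) \<bullet> v)) (at x)"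
proof -
 have 1: "(dil a has_derivative (\<lambda>v. a *\<^sub>R v)) (at x)"
  unfolding dil_def by (auto intro!: derivative_eq_intros)
 have "(g has_derivative (\<lambda>v. A (dil a x) *v v)) (at (dil a x))"
  using C2 assms by (simp add: C2fun_def)
 from has_derivative_compose[OF 1 this]
 have 2: "((\<lambda>x. g (dil a x)) has_derivative (\<lambda>v. A (dil a x) *v (a *\<^sub>R v))) (at x)" .
 have an: "a ^ CARD('n) = a ^ (CARD('n) - 1) * a" using n_pos by (metis power_minus_mult)
 have "transpose (A (dil a x)) = A (dil a x)" using C2 assms by (simp add: C2fun_def)
 hence "e \<bullet> (A (dil a x) *v v) = (A (dil a x) *v e) \<bullet> v" for v
  by (metis dot_lmul_matrix vector_transpose_matrix)
 thus ?thesis unfolding Gd_def by (auto intro!: derivative_eq_intros 2 simp: an)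
qed

text \<open>Both gradients are taken on the ray from \<open>y\<close> to \<open>c0\<close>, where
  \<open>gradient_holder\<close> compares them with the same limit; Bernoulli's inequality handles
  the powers of the dilation factors.\<close>

lemma Gd_bound:
 assumes y: "y \<in> frontier U" and a: "0 \<le> b" "b < a" "a < 1"
 shows "norm (Gd a y - Gd b y) \<le> (2 * hol_const + CARD('n) * L) * (1 - b) powr hol_exp"
proof -
 define dlt where "dlt = hol_exp"
 have dlt: "0 < dlt" "dlt \<le> 1" using hol_exp unfolding dlt_def by auto
 define k where "k = CARD('n) - 1"
 obtain m where m: "\<And>s. 0 < s ==> s \<le> 1 ==> norm (g (y + s *\<^sub>R (c0 - y)) - m) \<le> hol_const * s powr dlt"
  using gradient_holder[OF y] unfolding dlt_def by blast
 have dy: "dil t y = y + (1 - t) *\<^sub>R (c0 - y)" for t by (simp add: dil_def algebra_simps)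
 have ga: "norm (g (dil a y) - m) \<le> hol_const * (1 - b) powr dlt"
 proof -
  have "norm (g (dil a y) - m) \<le> hol_const * (1 - a) powr dlt" unfolding dy by (rule m) (use a in auto)
  also have "\<dots> \<le> hol_const * (1 - b) powr dlt" using a dlt hol_const_nonneg by (intro mult_left_mono powr_mono2) auto
  finally show ?thesis .
 qed
 have gb: "norm (g (dil b y) - m) \<le> hol_const * (1 - b) powr dlt" unfolding dy by (rule m) (use a in auto)
 have yc: "y \<in> closure U" using y by (simp add: closure_split)
 have gL: "norm (g (dil b y)) \<le> L" by (intro gradient_le dil_in yc) (use a in auto)
 have "1 + real k * (b - 1) \<le> (1 + (b - 1)) ^ k" by (rule Bernoulli_inequality) (use a in auto)
 moreover have "a ^ k \<le> 1" using a by (intro power_le_one) auto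
 ultimately have "a ^ k - b ^ k \<le> real k * (1 - b)" by (simp add: algebra_simps)
 also have "\<dots> \<le> real CARD('n) * (1 - b)" using a by (intro mult_right_mono) (auto simp: k_def)
 also have "\<dots> \<le> real CARD('n) * (1 - b) powr dlt"
 proof -
  have "(1 - b) powr 1 \<le> (1 - b) powr dlt" using a dlt by (intro powr_mono') auto
  thus ?thesis by simp
 qed
 finally have k1: "a ^ k - b ^ k \<le> real CARD('n) * (1 - b) powr dlt" .
 have k0: "0 \<le> a ^ k - b ^ k" using a by (simp add: power_mono)
 have "Gd a y - Gd b y = a ^ k *\<^sub>R ((g (dil a y) - m) - (g (dil b y) - m)) + (a ^ k - b ^ k) *\<^sub>R g (dil b y)"
  unfolding Gd_def k_def[symmetric] by (simp add: algebra_simps)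
 also have "norm \<dots> \<le> norm (a ^ k *\<^sub>R ((g (dil a y) - m) - (g (dil b y) - m))) + norm ((a ^ k - b ^ k) *\<^sub>R g (dil b y))"
  by (rule norm_triangle_ineq)
 also have "\<dots> \<le> 1 * (hol_const * (1 - b) powr dlt + hol_const * (1 - b) powr dlt) + real CARD('n) * (1 - b) powr dlt * L"
 proof (rule add_mono)
  have "norm ((g (dil a y) - m) - (g (dil b y) - m)) \<le> hol_const * (1 - b) powr dlt + hol_const * (1 - b) powr dlt"
   using norm_triangle_ineq4[of "g (dil a y) - m" "g (dil b y) - m"] ga gb by linarith
  thus "norm (a ^ k *\<^sub>R ((g (dil a y) - m) - (g (dil b y) - m))) \<le> 1 * (hol_const * (1 - b) powr dlt + hol_const * (1 - b) powr dlt)"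
   unfolding norm_scaleR using \<open>a ^ k \<le> 1\<close> a by (intro mult_mono) auto
  show "norm ((a ^ k - b ^ k) *\<^sub>R g (dil b y)) \<le> real CARD('n) * (1 - b) powr dlt * L"
   unfolding norm_scaleR using gL k1 k0 by (intro mult_mono) auto
 qed
 finally show ?thesis by (simp add: dlt_def algebra_simps)
qed

definition "fl0 = 2 / r0 * (real CARD('n) * (2 * real CARD('n) * (2 * hol_const + real CARD('n) * L) * vol U))"

lemma fl0_nonneg: "0 \<le> fl0" unfolding fl0_def using hol_const_nonneg L_pos c0(2) by simp

text \<open>The flux of the difference of two rescaled gradients through the fixed frontier of
  \<open>U\<close>, summed over the coordinate directions. For \<open>b\<close> near 1 it bounds the
  mass of a layer, for \<open>b = 0\<close> the total mass.\<close>

lemma Jd_diff: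
 assumes a: "0 \<le> b" "b < a" "a < 1"
 shows "Jd a - Jd b \<le> fl0 * (1 - b) powr hol_exp"
proof -
 define K where "K = (2 * hol_const + CARD('n) * L) * (1 - b) powr hol_exp"
 define dG where "dG i x = a ^ CARD('n) *\<^sub>R (A (dil a x) *v axis i 1) - b ^ CARD('n) *\<^sub>R (A (dil b x) *v axis i 1)" for i x
 define G where "G i x = axis i 1 \<bullet> Gd a x - axis i 1 \<bullet> Gd b x" for i x
 define V where "V = dil a -` U \<inter> dil b -` U"
 have V: "closure U \<subseteq> V" unfolding V_def using dil_in a by auto
 have fl: "\<bar>LINT x:U|lborel. dG i x \<bullet> ((r0 / 2) *\<^sub>R axis i 1)\<bar> \<le> 2 * real DIM(real^'n) * K * vol U" for i
 proof (rule flux[OF openU convU bdd c0_in _ V])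
  have "c0 + (r0 / 2) *\<^sub>R axis i 1 \<in> ball c0 r0" using c0(2) by (simp add: dist_norm)
  thus "c0 + (r0 / 2) *\<^sub>R axis i 1 \<in> U" using c0(1) by blast
  show "(G i has_derivative (\<bullet>) (dG i x)) (at x)" if "x \<in> V" for x
   unfolding G_def dG_def inner_diff_left
   by (intro has_derivative_diff Gd_der) (use that in \<open>auto simp: V_def\<close>)
  show "continuous_on V (dG i)"
  proof -
   have "continuous_on V (\<lambda>x. A (dil t x) *v axis i 1)" if "V \<subseteq> dil t -` U" for t
   proof -
    have "continuous_on V (\<lambda>x. A (dil t x))"
     using C2 that by (intro continuous_on_compose2[OF _ cont_dil]) (auto simp: C2fun_def)
    thus ?thesis unfolding matrix_vector_mult_basis column_def by (intro continuous_intros)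
   qed
   thus ?thesis unfolding dG_def by (intro continuous_intros) (auto simp: V_def)
  qed
  show "\<bar>G i y\<bar> \<le> K" if "y \<in> frontier U" for y
  proof -
   have "\<bar>G i y\<bar> = \<bar>axis i 1 \<bullet> (Gd a y - Gd b y)\<bar>" by (simp add: G_def inner_diff_right)
   also have "\<dots> \<le> norm (Gd a y - Gd b y)"
    using Cauchy_Schwarz_ineq2[of "axis i 1" "Gd a y - Gd b y"] by simp
   also have "\<dots> \<le> K" unfolding K_def by (rule Gd_bound[OF that a])
   finally show ?thesis .
  qed
 qed
 have ii: "dG i x \<bullet> ((r0 / 2) *\<^sub>R axis i 1) = r0 / 2 * (a ^ CARD('n) * A (dil a x) $ i $ i - b ^ CARD('n) * A (dil b x) $ i $ i)" for i x
  by (simp add: dG_def inner_axis matrix_vector_mult_basis column_def)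
 have entry: "set_integrable lborel U (\<lambda>x. A (dil t x) $ i $ i)" if "0 \<le> t" "t < 1" for t i
 proof (rule set_integrable_continuous_on_closure[OF _ closure_subset cpt])
  have "continuous_on (closure U) (\<lambda>x. A (dil t x))"
   using C2 that dil_in by (intro continuous_on_compose2[OF _ cont_dil]) (auto simp: C2fun_def)
  thus "continuous_on (closure U) (\<lambda>x. A (dil t x) $ i $ i)" by (intro continuous_intros)
 qed (simp add: openU)
 have "(\<Sum>i\<in>UNIV. LINT x:U|lborel. dG i x \<bullet> ((r0 / 2) *\<^sub>R axis i 1)) = r0 / 2 * (Jd a - Jd b)"
 proof -
  have int: "set_integrable lborel U (\<lambda>x. a ^ CARD('n) * A (dil a x) $ i $ i)"
   "set_integrable lborel U (\<lambda>x. b ^ CARD('n) * A (dil b x) $ i $ i)" for i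
   using entry[of a i] entry[of b i] a by auto
  have "(\<Sum>i\<in>UNIV. LINT x:U|lborel. dG i x \<bullet> ((r0 / 2) *\<^sub>R axis i 1)) =
    r0 / 2 * (\<Sum>i\<in>UNIV. a ^ CARD('n) * (LINT x:U|lborel. A (dil a x) $ i $ i) -
     b ^ CARD('n) * (LINT x:U|lborel. A (dil b x) $ i $ i))"
   unfolding ii using int by (simp add: sum_distrib_left)
  also have "\<dots> = r0 / 2 * (Jd a - Jd b)"
  proof -
   have "(LINT x:U|lborel. w (dil t x)) = (\<Sum>i\<in>UNIV. LINT x:U|lborel. A (dil t x) $ i $ i)"
    if "0 \<le> t" "t < 1" for t
   proof -
    have "(LINT x:U|lborel. w (dil t x)) = (LINT x|lborel. (\<Sum>i\<in>UNIV. indicator U x *\<^sub>R (A (dil t x) $ i $ i)))"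
     by (simp only: w_def trace_def set_lebesgue_integral_def scaleR_sum_right)
    also have "\<dots> = (\<Sum>i\<in>UNIV. LINT x:U|lborel. A (dil t x) $ i $ i)"
     unfolding set_lebesgue_integral_def
     using entry[OF that] by (intro Bochner_Integration.integral_sum) (simp add: set_integrable_def)
    finally show ?thesis .
   qed
   thus ?thesis using a by (simp add: Jd_def sum_subtractf sum_distrib_left)
  qed
  finally show ?thesis .
 qed
 moreover have "(\<Sum>i\<in>UNIV. LINT x:U|lborel. dG i x \<bullet> ((r0 / 2) *\<^sub>R axis i 1)) \<le>
   (\<Sum>i\<in>(UNIV :: 'n set). 2 * real DIM(real^'n) * K * vol U)"
  by (intro sum_mono) (rule abs_le_D1[OF fl])
 moreover have "(\<Sum>i\<in>(UNIV :: 'n set). 2 * real DIM(real^'n) * K * vol U) =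
   real CARD('n) * (2 * real CARD('n) * K * vol U)" by simp
 ultimately have "r0 / 2 * (Jd a - Jd b) \<le> real CARD('n) * (2 * real CARD('n) * K * vol U)" by simp
 hence "2 / r0 * (r0 / 2 * (Jd a - Jd b)) \<le> 2 / r0 * (real CARD('n) * (2 * real CARD('n) * K * vol U))"
  by (rule mult_left_mono) (use c0(2) in simp)
 also have "2 / r0 * (r0 / 2 * (Jd a - Jd b)) = Jd a - Jd b" using c0(2) by simp
 finally show ?thesis by (simp only: fl0_def K_def mult.assoc mult.commute[of "vol U"])
qed

lemma Jd_0: "Jd 0 = 0" by (simp add: Jd_def)

lemma Jd_le: assumes "0 < a" "a < 1" shows "Jd a \<le> fl0" using Jd_diff[of 0 a] Jd_0 assms by simp

text \<open>The image of \<open>U\<close> under \<open>dil a\<close>, written as a preimage to make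
  openness immediate.\<close>

definition Od :: "real => (real^'n) set" where "Od a = dil (1 / a) -` U"

lemma Od_open: "open (Od a)" unfolding Od_def by (intro open_vimage openU cont_dil)

lemma Od_mono:
 assumes "0 < a" "a \<le> b" "b \<le> 1" shows "Od a \<subseteq> Od b"
proof
 fix x assume "x \<in> Od a"
 hence 1: "dil (1 / a) x \<in> U" by (simp add: Od_def)
 have "dil (1 / b) x = dil (1 / a) x + (1 - a / b) *\<^sub>R (c0 - dil (1 / a) x)"
  using assms by (simp add: dil_def algebra_simps)
 hence "a = b \<or> dil (1 / b) x \<in> U"
  using segment_in[of "dil (1 / a) x" c0 "1 - a / b"] 1 c0_in closure_subset assms
  by (cases "a = b") (auto simp: divide_less_eq)
 thus "x \<in> Od b" using 1 by (auto simp: Od_def)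
qed

lemma Od_1: "Od 1 = U" by (auto simp: Od_def dil_def)

lemma Od_UN: "(\<Union>k. Od (1 - 1 / (real k + 2))) = U"
proof (intro equalityI subsetI)
 fix x assume "x \<in> (\<Union>k. Od (1 - 1 / (real k + 2)))"
 then obtain k where "x \<in> Od (1 - 1 / (real k + 2))" by blast
 thus "x \<in> U" using Od_mono[of "1 - 1 / (real k + 2)" 1] Od_1 by auto
next
 fix x assume x: "x \<in> U"
 have "(\<lambda>k. 1 - 1 / (real k + 2)) \<longlonglongrightarrow> 1" by real_asymp
 hence "(\<lambda>k. dil (1 / (1 - 1 / (real k + 2))) x) \<longlonglongrightarrow> dil (1 / 1) x"
  unfolding dil_def by (intro tendsto_intros) auto
 hence "(\<lambda>k. dil (1 / (1 - 1 / (real k + 2))) x) \<longlonglongrightarrow> x" by (simp add: dil_def)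
 hence "\<forall>\<^sub>F k in sequentially. dil (1 / (1 - 1 / (real k + 2))) x \<in> U"
  using openU x by (rule topological_tendstoD)
 then obtain k where "dil (1 / (1 - 1 / (real k + 2))) x \<in> U" by force
 thus "x \<in> (\<Union>k. Od (1 - 1 / (real k + 2)))" by (auto simp: Od_def)
qed

lemma w_ind_meas: "S \<in> sets borel ==> S \<subseteq> U ==> (\<lambda>x. indicator S x * w x) \<in> borel_measurable borel"
 using borel_measurable_continuous_on_indicator[OF _ continuous_on_subset[OF contw], of S] by simp

lemma Od_sub: "0 < a ==> a \<le> 1 ==> Od a \<subseteq> U" using Od_mono[of a 1] Od_1 by auto

lemma integral_Od:
 assumes a: "0 < a" "a < 1"
 shows "set_integrable lborel (Od a) w" "(LINT x:Od a|lborel. w x) = Jd a"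
proof -
 have d: "dil a (dil (1 / a) x) = x" "dil (1 / a) (dil a x) = x" for x using a by (auto simp: dil_def)
 show i: "set_integrable lborel (Od a) w"
 proof (rule w_set_integrable[of _ "dil a ` closure U"])
  show "Od a \<subseteq> dil a ` closure U"
  proof
   fix x assume "x \<in> Od a"
   hence "dil (1 / a) x \<in> closure U" using closure_subset by (auto simp: Od_def)
   thus "x \<in> dil a ` closure U" by (rule image_eqI[rotated]) (simp add: d)
  qed
 qed (use Od_open compact_continuous_image[OF cont_dil cpt] dil_in a in auto)
 show "(LINT x:Od a|lborel. w x) = Jd a"
  using set_integral_homothety[OF i a(1), of c0 U] d(2) by (simp add: Jd_def Od_def dil_def)
qed

definition ak :: "nat => real" where "ak k = 1 - 1 / (real k + 2)"

lemma ak: "0 < ak k" "ak k < 1" by (auto simp: ak_def)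

text \<open>Monotone convergence along dilated copies of \<open>U\<close>, which have compact
  closure in \<open>U\<close> and mass at most \<open>fl0\<close>.\<close>

lemma w_integrable: "set_integrable lborel U w"
 and integral_limit: "(\<lambda>k. Jd (ak k)) \<longlonglongrightarrow> (LINT x:U|lborel. w x)"
proof -
 let ?f = "\<lambda>k x. indicator (Od (ak k)) x * w x"
 have i: "integrable lborel (?f k)" "integral\<^sup>L lborel (?f k) = Jd (ak k)" for k
  using integral_Od[OF ak] by (simp_all add: set_integrable_def set_lebesgue_integral_def)
 have inc: "incseq (\<lambda>k. Od (ak k))"
  by (intro incseq_SucI Od_mono) (auto simp: ak_def less_imp_le intro!: divide_left_mono)
 have wn: "0 \<le> w x" if "x \<in> Od (ak k)" for x k
  using w_pos Od_sub[OF ak(1) less_imp_le[OF ak(2)]] that by force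
 have mono: "mono (\<lambda>k. ?f k x)" for x
  using inc wn by (intro monoI) (auto simp: indicator_def incseq_def)
 have lim: "(\<lambda>k. ?f k x) \<longlonglongrightarrow> indicator U x * w x" for x
  using LIMSEQ_indicator_incseq[OF inc, of x, where 'a = real] Od_UN by (intro tendsto_mult_right) (simp add: ak_def)
 have "incseq (\<lambda>k. Jd (ak k))"
  unfolding i(2)[symmetric] using i(1) mono by (intro incseq_SucI integral_mono) (auto simp: mono_def)
 then obtain l where l: "(\<lambda>k. Jd (ak k)) \<longlonglongrightarrow> l"
  using incseq_convergent[of _ fl0] Jd_le ak by metis
 note mc = AE_I2[OF mono] AE_I2[OF lim] l[folded i(2)] borel_measurable_LIMSEQ_real[OF lim borel_measurable_integrable[OF i(1)]]
 show "set_integrable lborel U w"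
  using integrable_monotone_convergence[OF i(1) mc] by (simp add: set_integrable_def)
 show "(\<lambda>k. Jd (ak k)) \<longlonglongrightarrow> (LINT x:U|lborel. w x)"
  using l integral_monotone_convergence[OF i(1) mc] by (simp add: set_lebesgue_integral_def)
qed

end

text \<open>With finite total mass established, the covering estimates become available.\<close>

sublocale bdry \<subseteq> maint U lam Lam phi g A kap sg tht by unfold_locales (rule bdd w_integrable)+

context bdry
begin

lemma W_Omega: "W U \<le> fl0"
 using LIMSEQ_le_const2[OF integral_limit, of fl0] Jd_le[OF ak] by (auto simp: W_def)

lemma W_Od: assumes "0 < a" "a < 1" shows "W U - W (Od a) \<le> fl0 * (1 - a) powr hol_exp"
proof -
 have "ak \<longlonglongrightarrow> 1" unfolding ak_def[abs_def] by real_asymp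
 hence "\<forall>\<^sub>F k in sequentially. a < ak k" using assms by (intro order_tendstoD) auto
 hence "\<forall>\<^sub>F k in sequentially. Jd (ak k) - Jd a \<le> fl0 * (1 - a) powr hol_exp"
  by eventually_elim (use assms ak in \<open>auto intro!: Jd_diff\<close>)
 hence "W U - Jd a \<le> fl0 * (1 - a) powr hol_exp"
  unfolding W_def by (intro tendsto_upperbound[OF tendsto_diff[OF integral_limit tendsto_const]]) auto
 thus ?thesis using integral_Od[OF assms] by (simp add: W_def)
qed

text \<open>\<open>x\<close> is a convex combination of a point of \<open>U\<close> and
  \<open>c0\<close> with weight \<open>1 - a\<close> on the latter; replacing \<open>c0\<close> by
  the points of its ball shows that a ball of radius \<open>(1 - a) * r0\<close> about
  \<open>x\<close> lies in \<open>U\<close>.\<close>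

lemma dd_Od:
 assumes a: "0 < a" "a < 1" and x: "x \<in> Od a" shows "(1 - a) * r0 \<le> dd x"
proof (rule ccontr)
 assume "\<not> ?thesis"
 hence lt: "dd x < (1 - a) * r0" by simp
 obtain y where y: "y \<in> frontier U" "infdist x (frontier U) = dist x y"
  using infdist_attains_inf[OF compact_imp_closed[OF cpt_frontier] frontier_ne] by blast
 hence "dist x y < (1 - a) * r0" using lt by (simp only: dd_def)
 note y = y(1) this
 define u where "u = c0 + (1 / (1 - a)) *\<^sub>R (y - x)"
 have "dist c0 u < r0" using y a by (simp add: u_def dist_norm norm_minus_commute pos_divide_less_eq mult.commute)
 hence u: "u \<in> U" using c0(1) by auto
 have z: "dil (1 / a) x \<in> U" using x by (simp add: Od_def)
 have "a *\<^sub>R dil (1 / a) x + (1 - a) *\<^sub>R u \<in> U" using convexD[OF convU z u, of a "1 - a"] a by simp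
 also have "a *\<^sub>R dil (1 / a) x + (1 - a) *\<^sub>R u = y"
 proof -
  have "a *\<^sub>R dil (1 / a) x = a *\<^sub>R c0 + (x - c0)" using a by (simp add: dil_def scaleR_add_right)
  moreover have "(1 - a) *\<^sub>R u = (1 - a) *\<^sub>R c0 + (y - x)" using a by (simp add: u_def scaleR_add_right)
  moreover have "a *\<^sub>R c0 + (1 - a) *\<^sub>R c0 = c0" by (simp add: scaleR_left_diff_distrib)
  ultimately show ?thesis by (metis (no_types, opaque_lifting) add.assoc add_diff_cancel_left' add_diff_eq)
 qed
 finally show False using frontier_disjoint[OF y(1)] by simp
qed

lemma dd_cont: "continuous_on S dd" unfolding dd_def by (intro continuous_intros)

lemma layer:
 assumes ep: "0 < ep"
 shows "W {x \<in> U. dd x < ep} \<le> fl0 * (ep / r0) powr hol_exp"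
proof -
 have m: "{x \<in> U. dd x < ep} \<in> sets borel"
 proof -
  have "{x \<in> U. dd x < ep} = U \<inter> {x. dd x < ep}" by auto
  moreover have "open {x. dd x < ep}" using dd_cont by (intro open_Collect_less continuous_intros) auto
  ultimately show ?thesis using openU by simp
 qed
 show ?thesis
 proof (cases "ep < r0")
  case True
  define a where "a = 1 - ep / r0"
  have a: "0 < a" "a < 1" using True ep by (auto simp: a_def)
  have aa: "(1 - a) * r0 = ep" "1 - a = ep / r0" using c0(2) by (auto simp: a_def)
  have sub: "Od a \<subseteq> U" using Od_sub a by simp
  have "{x \<in> U. dd x < ep} \<subseteq> U - Od a" using dd_Od[OF a] unfolding aa(1) by force
  hence "W {x \<in> U. dd x < ep} \<le> W (U - Od a)" using m openU Od_open by (intro W_mono) auto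
  also have "\<dots> = W U - W (Od a)"
  proof -
   interpret mu: finite_measure mu by (rule finite_mu)
   show ?thesis using sub openU Od_open[of a] by (simp add: W_eq mu.finite_measure_Diff)
  qed
  also have "\<dots> \<le> fl0 * (1 - a) powr hol_exp" by (rule W_Od[OF a])
  finally show ?thesis unfolding aa .
 next
  case False
  have "W {x \<in> U. dd x < ep} \<le> W U" using m openU by (intro W_mono) auto
  also have "\<dots> \<le> fl0" by (rule W_Omega)
  also have "\<dots> \<le> fl0 * (ep / r0) powr hol_exp"
  proof -
   have "1 \<le> (ep / r0) powr hol_exp"
    using False c0(2) hol_exp by (intro ge_one_powr_ge_zero) (auto simp: pos_le_divide_eq)
   thus ?thesis using mult_left_mono[of 1 _ fl0] fl0_nonneg by simp
  qed
  finally show ?thesis .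
 qed
qed

section \<open>Decay of the mass of \<open>w\<close> above growing levels\<close>

definition "K1 = (1 + kap) * (6 * real CARD('n) * D) * (Lam * fl0) powr (1 / real CARD('n)) / hb_const"
text \<open>A section of mean at least \<open>t\<close> has critical height of order at most
  \<open>t\<close> to the power \<open>- 1 / n\<close>, where \<open>n\<close> is the dimension, and
  the distance to the frontier is at most of order the square root of that height.\<close>

definition "pp = 1 / (2 * real CARD('n))"
text \<open>The summand 1 makes the inequality in \<open>bad_dist\<close> strict.\<close>

definition "K2 = D / k0 * sqrt K1 + 1"

lemma pp: "0 < pp" unfolding pp_def by simp

lemma K2: "0 < K2" unfolding K2_def K1_def using D_pos k0_pos kap_pos hb_const_pos
 by (intro add_nonneg_pos mult_nonneg_nonneg real_sqrt_ge_zero divide_nonneg_pos) auto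

lemma hb_ge_dd: "x \<in> U ==> hb_const * (k0 / D * dd x)\<^sup>2 \<le> hb x"
proof -
 assume x: "x \<in> U"
 have "(k0 / D * dd x)\<^sup>2 \<le> (- phi x)\<^sup>2"
  using phi_upper[OF x] k0_pos D_pos dd_pos[OF x] by (intro power_mono) auto
 from order_trans[OF mult_left_mono[OF this less_imp_le[OF hb_const_pos]]] hb_lower[OF x]
 show ?thesis by simp
qed

lemma hb_pos: "x \<in> U ==> 0 < hb x"
proof -
 assume x: "x \<in> U"
 have "0 < hb_const * (k0 / D * dd x)\<^sup>2" using hb_const_pos k0_pos D_pos dd_pos[OF x] by simp
 thus ?thesis using hb_ge_dd[OF x] by simp
qed

text \<open>A section on which \<open>w\<close> has a large mean is small, hence close to the boundary.\<close>

lemma bad_dist: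
 assumes x: "x \<in> U" and t: "0 < t"
  and bad: "t * vol (sect x (hb x / 3)) \<le> W (sect x (hb x / 3))"
  and y: "y \<in> sect x (tht * (hb x / 3))"
 shows "dd y < K2 * t powr - pp"
proof -
 define v where "v = hb x"
 define m where "m = vol (sect x (hb x / 3))"
 define n where "n = real CARD('n)"
 define F where "F = Lam * fl0"
 have n: "1 \<le> n" by (simp add: n_def)
 have v: "0 < v" using hb_pos[OF x] by (simp add: v_def)
 have F: "0 \<le> F" using Lam fl0_nonneg by (simp add: F_def)
 have "room x (hb x / 3)" by (rule hb_room[OF x]) (use v v_def in auto)
 from sect_volume[OF this] have vol: "(v / 3 / (2 * n * D)) ^ CARD('n) \<le> Lam * m"
  by (simp add: m_def v_def n_def)
 \<comment> \<open>The total mass bounds the volume of the section by \<open>fl0 / t\<close>; with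
   \<open>sect_volume\<close> this bounds its height, and \<open>hb_engulf\<close> carries the bound
   from \<open>x\<close> to \<open>y\<close>.\<close>
 have "t * m \<le> fl0"
 proof -
  have "W (sect x (hb x / 3)) \<le> W U" using openU by (intro W_mono) (auto simp: sect_U)
  thus ?thesis using bad W_Omega by (simp add: m_def)
 qed
 hence "t * m * Lam \<le> fl0 * Lam" using Lam by simp
 moreover have "t * (v / 3 / (2 * n * D)) ^ CARD('n) \<le> t * (Lam * m)" using vol t by simp
 ultimately have "t * (v / 3 / (2 * n * D)) ^ CARD('n) \<le> F" by (simp add: F_def mult_ac)
 hence 1: "(v / 3 / (2 * n * D)) ^ CARD('n) \<le> F * (1 / t)" using t by (simp add: pos_le_divide_eq mult.commute)
 define q where "q = v / 3 / (2 * n * D)"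
 have q: "0 < q" using v n D_pos by (simp add: q_def)
 have "(q powr n) powr (1 / n) \<le> (F * (1 / t)) powr (1 / n)"
  using 1 q n by (intro powr_mono2) (auto simp: q_def n_def powr_realpow)
 hence "q \<le> (F * (1 / t)) powr (1 / n)" using n by (simp add: powr_powr)
 also have "\<dots> = F powr (1 / n) * (1 / t) powr (1 / n)" by (intro powr_mult)
 finally have "6 * n * D * q \<le> 6 * n * D * (F powr (1 / n) * (1 / t) powr (1 / n))" using n D_pos by simp
 moreover have "6 * n * D * q = v" using n D_pos by (simp add: q_def)
 ultimately have v_le: "v \<le> 6 * n * D * (F powr (1 / n) * (1 / t) powr (1 / n))" by simp
 have th: "tht * (hb x / 3) \<le> hb x / 3" using tht(3) v by (simp add: v_def)
 have yO: "y \<in> U" using y sect_U by blast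
 have hy: "hb y \<le> (1 + kap) * v"
  unfolding v_def by (rule hb_engulf[OF x]) (use y sect_mono[OF th] in blast)
 define z where "z = k0 / D * dd y"
 have "hb_const * z\<^sup>2 \<le> (1 + kap) * (6 * n * D * (F powr (1 / n) * (1 / t) powr (1 / n)))"
  using hb_ge_dd[OF yO] hy mult_left_mono[OF v_le, of "1 + kap"] kap_pos unfolding z_def by linarith
 hence "z\<^sup>2 \<le> K1 * (1 / t) powr (1 / n)"
  using hb_const_pos by (simp add: K1_def n_def F_def pos_le_divide_eq mult_ac)
 also have "(1 / t) powr (1 / n) = t powr (- pp + - pp)"
  by (simp add: pp_def n_def powr_divide powr_minus_divide)
 also have "\<dots> = (t powr - pp)\<^sup>2" by (simp only: powr_add power2_eq_square)
 finally have "sqrt (z\<^sup>2) \<le> sqrt (K1 * (t powr - pp)\<^sup>2)" by (rule real_sqrt_le_mono)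
 hence zle: "z \<le> sqrt K1 * t powr - pp" by (simp add: real_sqrt_mult)
 have "dd y = D / k0 * z" using k0_pos D_pos by (simp add: z_def)
 also have "\<dots> \<le> D / k0 * (sqrt K1 * t powr - pp)"
  using zle k0_pos D_pos by (intro mult_left_mono) auto
 also have "\<dots> < D / k0 * sqrt K1 * t powr - pp + t powr - pp" using t unfolding mult.assoc by simp
 also have "\<dots> = K2 * t powr - pp" by (simp only: K2_def distrib_right)
 finally show ?thesis .
qed

definition "dl = pp * hol_exp"
definition "BB = fl0 * (K2 / r0) powr hol_exp / ainfc"
text \<open>Capped at 1 so that \<open>2 * s / cc\<close> is at least \<open>s\<close>.\<close>

definition "cc = min (levc) 1"

text \<open>With a third of \<open>hb x\<close>, the doubled height required by
  \<open>level_estimate\<close> stays strictly below \<open>hb x\<close>. The bad sections lie in a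
  layer, whose mass \<open>layer\<close> bounds.\<close>

lemma level_W:
 assumes t: "0 < t"
 shows "W {x \<in> U. t < w x} \<le> gc * (t * vol {x \<in> U. levc * t \<le> w x} + BB * t powr - dl)"
proof -
 define La where "La = {x \<in> U. dd x < K2 * t powr - pp}"
 have K: "0 < K2 * t powr - pp" using K2 t by simp
 have Lab: "La \<in> sets borel"
 proof -
  have "La = U \<inter> dd -` {..<K2 * t powr - pp}" unfolding La_def by blast
  moreover have "open (U \<inter> dd -` {..<K2 * t powr - pp})" by (intro continuous_open_preimage dd_cont openU open_lessThan)
  ultimately show ?thesis by simp
 qed
 have a: "0 < ainfc" using constants_pos by simp
 have "W {x \<in> U. t < w x} \<le> gc * (t * vol {x \<in> U. levc * t \<le> w x} + W La / ainfc)"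
 proof (rule level_estimate[where H = "\<lambda>x. hb x / 3", OF _ t Lab])
  show "room x (2 * (hb x / 3))" if "x \<in> U" for x
   using hb_room[OF that, of "2 * (hb x / 3)"] hb_pos[OF that] by auto
  show "sect x (tht * (hb x / 3)) \<subseteq> La"
   if "x \<in> U" "t * vol (sect x (hb x / 3)) \<le> W (sect x (hb x / 3))" for x
   using bad_dist[OF that(1) t that(2)] sect_U by (auto simp: La_def)
 qed (auto simp: La_def)
 also have "\<dots> \<le> gc * (t * vol {x \<in> U. levc * t \<le> w x} + BB * t powr - dl)"
 proof (intro mult_left_mono add_left_mono)
  show "W La / ainfc \<le> BB * t powr - dl"
  proof -
   have "W La \<le> fl0 * (K2 * t powr - pp / r0) powr hol_exp" unfolding La_def by (rule layer[OF K])
   also have "K2 * t powr - pp / r0 = K2 / r0 * t powr - pp" by simp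
   also have "(K2 / r0 * t powr - pp) powr hol_exp = (K2 / r0) powr hol_exp * (t powr - pp) powr hol_exp"
    by (rule powr_mult)
   also have "(t powr - pp) powr hol_exp = t powr - dl" by (simp add: powr_powr dl_def)
   finally have "W La / ainfc \<le>
     fl0 * ((K2 / r0) powr hol_exp * t powr - dl) / ainfc" using a by (intro divide_right_mono) auto
   thus ?thesis by (simp add: BB_def)
  qed
  show "0 \<le> gc" using tht by (simp add: gc_def)
 qed
 finally show ?thesis .
qed

lemma gc_ge: "2 \<le> gc"
proof -
 have "tht ^ CARD('n) \<le> 1" "0 < tht ^ CARD('n)" using tht by (auto intro!: power_le_one)
 thus ?thesis by (simp add: gc_def pos_le_divide_eq)
qed

lemma cc: "0 < cc" "cc \<le> 1" "cc \<le> levc" using constants_pos(3) by (auto simp: cc_def levc_def)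

definition "AA = 2 * gc / cc"
definition "NN = 4 * gc / cc"

lemma AA: "0 < AA" unfolding AA_def using gc_ge cc by simp

lemma NN: "1 < NN"
proof -
 have "1 < 4 * gc / 1" using gc_ge by simp
 also have "\<dots> \<le> 4 * gc / cc" using gc_ge cc by (intro divide_left_mono) auto
 finally show ?thesis by (simp add: NN_def)
qed

lemma BB: "0 \<le> BB" unfolding BB_def using fl0_nonneg constants_pos(3) by simp

lemma dl: "0 < dl" unfolding dl_def using pp hol_exp by simp

text \<open>Hole filling. The volume of the superlevel set is split at \<open>P * t\<close>. Above,
  Chebyshev gives half of the mass \<open>FP\<close>, which is absorbed on the left; below, it gives
  the mass difference \<open>Fs - FP\<close>, and adding \<open>AA * FP\<close> on both sides
  produces a factor below 1.\<close>

lemma level_decay: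
 assumes s: "0 < s"
 shows "W {x \<in> U. NN * s < w x} \<le> AA / (1 + AA) * W {x \<in> U. s < w x} + 2 * gc * BB * s powr - dl"
proof -
 \<comment> \<open>The factor 2 puts \<open>cc * t\<close> strictly above \<open>s\<close>, and
   \<open>P = 2 * gc\<close> is what the absorption needs; together they give
   \<open>NN\<close>.\<close>
 define t where "t = 2 * s / cc"
 define P where "P = 2 * gc"
 have t: "0 < t" "s \<le> t" "cc * t = 2 * s" "P * t = NN * s"
  using s cc by (auto simp: t_def P_def NN_def pos_le_divide_eq)
 have P: "4 \<le> P" using gc_ge by (simp add: P_def)
 have lev: "{x \<in> U. c \<le> w x} \<in> sets borel" "{x \<in> U. c < w x} \<in> sets borel" for c
 proof -
  have "{x \<in> U. c < w x} = U \<inter> w -` {c<..}" by auto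
  moreover have "open (U \<inter> w -` {c<..})" by (intro continuous_open_preimage contw openU) auto
  ultimately show "{x \<in> U. c < w x} \<in> sets borel" by simp
  have "{x \<in> U. c \<le> w x} = U - (U \<inter> w -` {..<c})" by auto
  moreover have "open (U \<inter> w -` {..<c})" by (intro continuous_open_preimage contw openU) auto
  ultimately show "{x \<in> U. c \<le> w x} \<in> sets borel" using openU by simp
 qed
 interpret mu: finite_measure mu by (rule finite_mu)
 define E1 where "E1 = {x \<in> U. cc * t \<le> w x} - {x \<in> U. P * t < w x}"
 define E2 where "E2 = {x \<in> U. P * t < w x}"
 define Fs where "Fs = W {x \<in> U. s < w x}"
 define FP where "FP = W {x \<in> U. P * t < w x}"
 define Ft where "Ft = W {x \<in> U. t < w x}"
 define m1 where "m1 = vol E1"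
 define m2 where "m2 = vol E2"
 have Es: "E1 \<in> sets borel" "E2 \<in> sets borel" "E1 \<subseteq> U" "E2 \<subseteq> U" using lev by (auto simp: E1_def E2_def)
 have "W E1 + W E2 = measure mu (E1 \<union> E2)"
  using Es by (subst mu.finite_measure_Union) (auto simp: W_eq E1_def E2_def)
 also have "\<dots> \<le> Fs"
 proof -
  have "s * 4 \<le> P * t" using P t by (subst mult.commute) (intro mult_mono, auto)
  hence "s < P * t" "s < cc * t" using t s by auto
  hence "E1 \<union> E2 \<subseteq> {x \<in> U. s < w x}" unfolding E1_def E2_def by force
  thus ?thesis unfolding Fs_def using lev by (subst W_eq) (auto intro!: mu.finite_measure_mono)
 qed
 finally have W12: "W E1 + FP \<le> Fs" by (simp add: FP_def E2_def)
 have "cc * t * m1 \<le> W E1" unfolding m1_def by (rule W_ge_level) (use Es in \<open>auto simp: E1_def\<close>)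
 hence 1: "t * m1 \<le> (Fs - FP) / cc" using W12 cc by (simp add: pos_le_divide_eq mult_ac)
 have "P * t * m2 \<le> W E2" unfolding m2_def by (rule W_ge_level) (use Es in \<open>auto simp: E2_def\<close>)
 hence 2: "2 * gc * (t * m2) \<le> FP" by (simp add: FP_def E2_def P_def)
 have FPt: "FP \<le> Ft" unfolding FP_def Ft_def
 proof (intro W_mono lev)
  show "{x \<in> U. P * t < w x} \<subseteq> {x \<in> U. t < w x}" using P t mult_right_mono[of 1 P t] by auto
 qed auto
 have "vol {x \<in> U. levc * t \<le> w x} \<le> m1 + m2"
 proof -
  have fin: "E \<in> fmeasurable lborel" if "E \<subseteq> U" "E \<in> sets borel" for E
   using that emeasure_bounded_finite[OF bounded_subset[OF bdd that(1)]] by (auto simp: fmeasurable_def)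
  have "cc * t \<le> levc * t" using cc t by (intro mult_right_mono) auto
  hence "{x \<in> U. levc * t \<le> w x} \<subseteq> E1 \<union> E2" by (auto simp: E1_def E2_def)
  hence "vol {x \<in> U. levc * t \<le> w x} \<le> vol (E1 \<union> E2)"
   using lev Es by (intro measure_mono_fmeasurable fin) auto
  also have "\<dots> \<le> m1 + m2" unfolding m1_def m2_def by (rule measure_Un_le) (use Es in auto)
  finally show ?thesis .
 qed
 hence "t * vol {x \<in> U. levc * t \<le> w x} \<le> t * (m1 + m2)" using t by simp
 hence "gc * (t * vol {x \<in> U. levc * t \<le> w x} + BB * t powr - dl) \<le>
   gc * (t * (m1 + m2) + BB * t powr - dl)" using gc_ge by simp
 hence "FP \<le> gc * (t * (m1 + m2) + BB * t powr - dl)" using level_W[OF t(1)] FPt unfolding Ft_def by simp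
 also have "\<dots> = gc * (t * m1) + gc * (t * m2) + gc * BB * t powr - dl" by (simp add: algebra_simps)
 also have "\<dots> \<le> gc * ((Fs - FP) / cc) + FP / 2 + gc * BB * s powr - dl"
 proof (intro add_mono)
  show "gc * (t * m1) \<le> gc * ((Fs - FP) / cc)" using 1 gc_ge by (intro mult_left_mono) auto
  show "gc * (t * m2) \<le> FP / 2" using 2 by simp
  show "gc * BB * t powr - dl \<le> gc * BB * s powr - dl"
   using gc_ge BB s t dl by (intro mult_left_mono powr_mono2') auto
 qed
 finally have "FP \<le> 2 * gc * ((Fs - FP) / cc) + 2 * gc * BB * s powr - dl" by simp
 hence "FP \<le> AA * (Fs - FP) + 2 * gc * BB * s powr - dl" by (simp add: AA_def)
 hence "(1 + AA) * FP \<le> AA * Fs + 2 * gc * BB * s powr - dl" by (simp add: algebra_simps)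
 also have "\<dots> \<le> AA * Fs + (1 + AA) * (2 * gc * BB * s powr - dl)"
  using AA gc_ge BB by (simp add: distrib_right)
 finally have "FP \<le> (AA * Fs + (1 + AA) * (2 * gc * BB * s powr - dl)) / (1 + AA)"
  using AA by (simp add: pos_le_divide_eq mult.commute)
 also have "\<dots> = AA / (1 + AA) * Fs + 2 * gc * BB * s powr - dl" using AA by (simp add: add_divide_distrib)
 finally show ?thesis by (simp add: FP_def Fs_def t)
qed

lemma decay_mu:
 assumes s: "1 \<le> s"
 shows "measure mu {x \<in> space mu. NN * s < indicator U x * w x} \<le>
  AA / (1 + AA) * measure mu {x \<in> space mu. s < indicator U x * w x} + 2 * gc * BB * s powr - dl"
proof -
 have "measure mu {x \<in> space mu. s < indicator U x * w x} = W {x \<in> U. s < w x}" if "0 < s" for s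
 proof -
  have "{x \<in> space mu. s < indicator U x * w x} = {x \<in> U. s < w x}"
   using that by (auto simp: mu_def indicator_def)
  moreover have "{x \<in> U. s < w x} = U \<inter> w -` {s<..}" by auto
  moreover have "open (U \<inter> w -` {s<..})" by (intro continuous_open_preimage contw openU) auto
  ultimately show ?thesis by (simp add: W_eq)
 qed
 moreover have "0 < NN * s" using NN s by simp
 ultimately show ?thesis using level_decay[of s] s by simp
qed

end

text \<open>Uniformity in \<open>phi\<close>: the constants of \<open>bdry\<close> mention neither
  \<open>phi\<close> nor \<open>g\<close> nor \<open>A\<close>, so those of \<open>B0\<close> and of
  \<open>B\<close> are the same terms, and one call of \<open>higher_integrability\<close> serves
  all functions.\<close>

theorem trace_higher_integrability:
 fixes U :: "(real^'n::finite) set"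
 shows "\<exists>ep>0. \<exists>C\<ge>0. \<forall>phi g A. bdry U lam Lam phi g A kap sg tht c0 r0 D R rho \<longrightarrow>
  (\<integral>\<^sup>+x. ennreal (indicator U x * trace (A x) powr (1 + ep)) \<partial>lborel) \<le> ennreal C"
proof (cases "\<exists>phi g A. bdry U lam Lam phi g A kap sg tht c0 r0 D R rho")
 case True
 then obtain phi0 g0 A0 where "bdry U lam Lam phi0 g0 A0 kap sg tht c0 r0 D R rho" by blast
 then interpret B0: bdry U lam Lam phi0 g0 A0 kap sg tht c0 r0 D R rho .
 have 1: "0 \<le> B0.AA / (1 + B0.AA)" "B0.AA / (1 + B0.AA) < 1" using B0.AA by auto
 have 2: "0 \<le> 2 * B0.gc * B0.BB" using B0.gc_ge B0.BB by simp
 obtain ep C where e: "0 < ep" "0 \<le> C" and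
  hi: "\<And>M (w :: real^'n => real). finite_measure M ==> w \<in> borel_measurable M ==> (\<And>x. x \<in> space M ==> 0 \<le> w x) ==>
   measure M (space M) \<le> B0.fl0 ==>
   (\<And>s. 1 \<le> s ==> measure M {x \<in> space M. B0.NN * s < w x} \<le>
     B0.AA / (1 + B0.AA) * measure M {x \<in> space M. s < w x} + 2 * B0.gc * B0.BB * s powr - B0.dl) ==>
   (\<integral>\<^sup>+x. ennreal (w x powr ep) \<partial>M) \<le> ennreal C"
  using higher_integrability[OF B0.NN 1 2 B0.dl zero_less_one B0.fl0_nonneg, where 'a = "real^'n"] by blast
 show ?thesis
 proof (rule exI[of _ ep], intro conjI e, rule exI[of _ C], intro conjI e allI impI)
  fix phi g A
  assume "bdry U lam Lam phi g A kap sg tht c0 r0 D R rho"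
  then interpret B: bdry U lam Lam phi g A kap sg tht c0 r0 D R rho .
  have m: "(\<lambda>x. indicator U x * B.w x) \<in> borel_measurable borel"
   using B.w_ind_meas[of U] B.openU by simp
  have "(\<integral>\<^sup>+x. ennreal ((indicator U x * B.w x) powr ep) \<partial>B.mu) \<le> ennreal C"
  proof (rule hi[OF B.finite_mu])
   show "(\<lambda>x. indicator U x * B.w x) \<in> borel_measurable B.mu" using m by (simp add: B.mu_def)
   show "0 \<le> indicator U x * B.w x" for x by (rule B.ind_nonneg)
   have "emeasure B.mu (space B.mu) = emeasure B.mu U" unfolding B.mu_def using m B.openU
    by (simp add: emeasure_density) (intro nn_integral_cong, auto simp: indicator_def)
   hence "measure B.mu (space B.mu) = measure B.mu U" by (simp add: measure_def)
   also have "\<dots> = B.W U" using B.openU by (simp add: B.W_eq)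
   also have "\<dots> \<le> B.fl0" by (rule B.W_Omega)
   finally show "measure B.mu (space B.mu) \<le> B0.fl0" .
  qed (rule B.decay_mu)
  \<comment> \<open>The measure \<open>B.mu\<close> has density \<open>w\<close>, which adds 1 to
    the exponent.\<close>
  also have "(\<integral>\<^sup>+x. ennreal ((indicator U x * B.w x) powr ep) \<partial>B.mu) =
    (\<integral>\<^sup>+x. ennreal (indicator U x * trace (A x) powr (1 + ep)) \<partial>lborel)"
   unfolding B.mu_def
  proof (subst nn_integral_density)
   show "(\<integral>\<^sup>+x. ennreal (indicator U x * B.w x) * ennreal ((indicator U x * B.w x) powr ep) \<partial>lborel) =
    (\<integral>\<^sup>+x. ennreal (indicator U x * trace (A x) powr (1 + ep)) \<partial>lborel)"
   proof (rule nn_integral_cong)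
    fix x
    show "ennreal (indicator U x * B.w x) * ennreal ((indicator U x * B.w x) powr ep) =
      ennreal (indicator U x * trace (A x) powr (1 + ep))"
     using B.w_pos[of x] by (cases "x \<in> U") (auto simp: B.w_def powr_add ennreal_mult'')
   qed
  qed (use m in auto)
  finally show "(\<integral>\<^sup>+x. ennreal (indicator U x * trace (A x) powr (1 + ep)) \<partial>lborel) \<le> ennreal C" .
 qed
next
 case False
 thus ?thesis by (intro exI[of _ 1]) auto
qed

section \<open>Classical second derivatives\<close>

text \<open>The mean value theorem in each direction. It yields the symmetry of second derivatives
  and, later, the convergence of second difference quotients of test functions.\<close>

lemma second_difference:
 fixes f :: "'a::real_normed_vector => real"
 assumes df: "\<And>y. y \<in> S ==> (f has_derivative f' y) (at y)"
  and ddf: "\<And>y. y \<in> S ==> ((\<lambda>x. f' x u) has_derivative f'' y) (at y)"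
  and t: "0 < t" and S: "\<And>a b. 0 \<le> a ==> a \<le> t ==> 0 \<le> b ==> b \<le> t ==> x + a *\<^sub>R u + b *\<^sub>R v \<in> S"
 shows "\<exists>a b. 0 \<le> a \<and> a \<le> t \<and> 0 \<le> b \<and> b \<le> t \<and>
  f (x + t *\<^sub>R u + t *\<^sub>R v) - f (x + t *\<^sub>R u) - f (x + t *\<^sub>R v) + f x = t * t * f'' (x + a *\<^sub>R u + b *\<^sub>R v) v"
proof -
 have d1: "((\<lambda>a. f (x + a *\<^sub>R u + b *\<^sub>R v)) has_real_derivative f' (x + a *\<^sub>R u + b *\<^sub>R v) u) (at a)"
  if "0 \<le> a" "a \<le> t" "0 \<le> b" "b \<le> t" for a b
  using DERIV_along_line[of f "f' (x + a *\<^sub>R u + b *\<^sub>R v)" "x + b *\<^sub>R v" a u] df[OF S[OF that]]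
  by (simp add: add_ac)
 have d2: "((\<lambda>b. f' (x + a *\<^sub>R u + b *\<^sub>R v) u) has_real_derivative f'' (x + a *\<^sub>R u + b *\<^sub>R v) v) (at b)"
  if "0 \<le> a" "a \<le> t" "0 \<le> b" "b \<le> t" for a b
  by (rule DERIV_along_line[where f = "\<lambda>x. f' x u"]) (rule ddf[OF S[OF that]])
 define p where "p a = f (x + a *\<^sub>R u + t *\<^sub>R v) - f (x + a *\<^sub>R u + 0 *\<^sub>R v)" for a
 have "\<exists>z. z > 0 \<and> z < t \<and> p t - p 0 = (t - 0) * (f' (x + z *\<^sub>R u + t *\<^sub>R v) u - f' (x + z *\<^sub>R u + 0 *\<^sub>R v) u)"
 proof (rule MVT2[OF t])
  fix a assume "0 \<le> a" "a \<le> t"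
  thus "(p has_real_derivative f' (x + a *\<^sub>R u + t *\<^sub>R v) u - f' (x + a *\<^sub>R u + 0 *\<^sub>R v) u) (at a)"
   unfolding p_def by (intro DERIV_diff d1) auto
 qed
 then obtain a where a: "0 < a" "a < t"
  "p t - p 0 = t * (f' (x + a *\<^sub>R u + t *\<^sub>R v) u - f' (x + a *\<^sub>R u + 0 *\<^sub>R v) u)" by auto
 have "\<exists>z. z > 0 \<and> z < t \<and> f' (x + a *\<^sub>R u + t *\<^sub>R v) u - f' (x + a *\<^sub>R u + 0 *\<^sub>R v) u =
   (t - 0) * f'' (x + a *\<^sub>R u + z *\<^sub>R v) v" by (rule MVT2[OF t]) (use a d2 in auto)
 then obtain b where b: "0 < b" "b < t" "f' (x + a *\<^sub>R u + t *\<^sub>R v) u - f' (x + a *\<^sub>R u + 0 *\<^sub>R v) u =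
   t * f'' (x + a *\<^sub>R u + b *\<^sub>R v) v" by auto
 show ?thesis using a b by (intro exI[of _ a] exI[of _ b]) (auto simp: p_def)
qed

text \<open>The second difference is symmetric in \<open>u\<close> and \<open>v\<close>, and up to
  the factor \<open>t * t\<close> it equals either mixed derivative at some nearby point.\<close>

lemma second_derivative_symmetric:
 fixes f :: "'a::real_normed_vector => real"
 assumes S: "open S" "x \<in> S"
  and df: "\<And>y. y \<in> S ==> (f has_derivative f' y) (at y)"
  and du: "\<And>y. y \<in> S ==> ((\<lambda>x. f' x u) has_derivative Fu y) (at y)"
  and dv: "\<And>y. y \<in> S ==> ((\<lambda>x. f' x v) has_derivative Fv y) (at y)"
  and cu: "continuous_on S (\<lambda>y. Fu y v)" and cv: "continuous_on S (\<lambda>y. Fv y u)"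
 shows "Fu x v = Fv x u"
proof (rule ccontr)
 assume ne: "Fu x v \<noteq> Fv x u"
 define e where "e = dist (Fu x v) (Fv x u) / 2"
 have e: "0 < e" using ne by (simp add: e_def)
 obtain r where r: "0 < r" "ball x r \<subseteq> S" using S open_contains_ball by blast
 obtain d1 where d1: "0 < d1" "\<And>y. y \<in> S ==> dist y x < d1 ==> dist (Fu y v) (Fu x v) < e"
  using cu S(2) e unfolding continuous_on_iff by blast
 obtain d2 where d2: "0 < d2" "\<And>y. y \<in> S ==> dist y x < d2 ==> dist (Fv y u) (Fv x u) < e"
  using cv S(2) e unfolding continuous_on_iff by blast
 define d where "d = Min {r, d1, d2}"
 have d: "0 < d" "d \<le> r" "d \<le> d1" "d \<le> d2" using r d1 d2 by (auto simp: d_def)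
 define N where "N = norm u + norm v + 1"
 have N: "0 < N" by (simp add: N_def add_nonneg_pos)
 define t where "t = d / (2 * N)"
 have t: "0 < t" using d N by (simp add: t_def)
 have near: "dist (x + a *\<^sub>R u + b *\<^sub>R v) x < d" if "0 \<le> a" "a \<le> t" "0 \<le> b" "b \<le> t" for a b
 proof -
  have "norm (a *\<^sub>R u + b *\<^sub>R v) \<le> t * norm u + t * norm v"
   using that by (intro norm_triangle_le add_mono) (auto intro!: mult_right_mono)
  also have "\<dots> \<le> t * N" using t by (simp add: N_def algebra_simps)
  also have "\<dots> = d / 2" using N by (simp add: t_def)
  also have "\<dots> < d" using d by simp
  finally show ?thesis by (simp add: dist_norm)
 qed
 have near': "dist (x + a *\<^sub>R v + b *\<^sub>R u) x < d" if "0 \<le> a" "a \<le> t" "0 \<le> b" "b \<le> t" for a b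
  using near[OF that(3,4,1,2)] by (simp add: add_ac)
 have inS: "y \<in> S" if "dist y x < d" for y using that r d by (auto simp: dist_commute)
 obtain a b where ab: "0 \<le> a" "a \<le> t" "0 \<le> b" "b \<le> t"
  "f (x + t *\<^sub>R u + t *\<^sub>R v) - f (x + t *\<^sub>R u) - f (x + t *\<^sub>R v) + f x = t * t * Fu (x + a *\<^sub>R u + b *\<^sub>R v) v"
  using second_difference[OF df du t inS[OF near]] by blast
 obtain a' b' where ab': "0 \<le> a'" "a' \<le> t" "0 \<le> b'" "b' \<le> t"
  "f (x + t *\<^sub>R v + t *\<^sub>R u) - f (x + t *\<^sub>R v) - f (x + t *\<^sub>R u) + f x = t * t * Fv (x + a' *\<^sub>R v + b' *\<^sub>R u) u"
  using second_difference[OF df dv t inS[OF near']] by blast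
 have "f (x + t *\<^sub>R v + t *\<^sub>R u) = f (x + t *\<^sub>R u + t *\<^sub>R v)" by (simp add: add_ac)
 hence "t * t * Fu (x + a *\<^sub>R u + b *\<^sub>R v) v = t * t * Fv (x + a' *\<^sub>R v + b' *\<^sub>R u) u"
  using ab(5) ab'(5) by linarith
 hence eq: "Fu (x + a *\<^sub>R u + b *\<^sub>R v) v = Fv (x + a' *\<^sub>R v + b' *\<^sub>R u) u" using t by simp
 have "dist (Fu (x + a *\<^sub>R u + b *\<^sub>R v) v) (Fu x v) < e"
  using near[OF ab(1-4)] d inS by (intro d1) auto
 moreover have "dist (Fv (x + a' *\<^sub>R v + b' *\<^sub>R u) u) (Fv x u) < e"
  using near'[OF ab'(1-4)] d inS by (intro d2) auto
 ultimately have "dist (Fu x v) (Fv x u) < e + e" unfolding eq by (metis add_strict_mono dist_commute dist_triangle le_less_trans)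
 thus False by (simp add: e_def)
qed

lemma Ck_on_2D:
 assumes "Ck_on 2 S f"
 shows "x \<in> S ==> (f has_derivative frechet_derivative f (at x)) (at x)"
  and "x \<in> S ==> ((\<lambda>y. frechet_derivative f (at y) u) has_derivative
     frechet_derivative (\<lambda>y. frechet_derivative f (at y) u) (at x)) (at x)"
  and "continuous_on S (\<lambda>x. frechet_derivative (\<lambda>y. frechet_derivative f (at y) u) (at x) v)"
 using assms unfolding numeral_2_eq_2 by (auto simp: frechet_derivative_works[symmetric])

lemma Ck_on_2_symmetric:
 assumes "Ck_on 2 S f" "open S" "x \<in> S"
 shows "frechet_derivative (\<lambda>y. frechet_derivative f (at y) u) (at x) v =
  frechet_derivative (\<lambda>y. frechet_derivative f (at y) v) (at x) u"
 by (rule second_derivative_symmetric[OF assms(2,3) Ck_on_2D(1)[OF assms(1)]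
   Ck_on_2D(2)[OF assms(1)] Ck_on_2D(2)[OF assms(1)] Ck_on_2D(3)[OF assms(1)] Ck_on_2D(3)[OF assms(1)]])

lemma linear_component_sum:
 fixes h :: "real^'n => real"
 assumes "linear h" shows "h v = (\<Sum>i\<in>UNIV. v $ i * h (axis i 1))"
proof -
 have "h v = h (\<Sum>i\<in>UNIV. v $ i *\<^sub>R axis i 1)" by (simp add: basis_expansion scalar_mult_eq_scaleR[symmetric])
 thus ?thesis using assms by (simp add: linear_sum linear_scale)
qed

lemma C2fun_hessian:
 fixes f :: "real^'n => real"
 assumes "Ck_on 2 S f" "open S"
 shows "C2fun S f (\<lambda>x. \<chi> i. partial_deriv i f x) (hessian f)" unfolding C2fun_def
proof (intro conjI ballI)
 show "open S" by fact
 fix x assume x: "x \<in> S"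
 have sym: "hessian f x $ i $ j = hessian f x $ j $ i" for i j
  unfolding hessian_def partial_deriv_def using Ck_on_2_symmetric[OF assms x] by simp
 thus "transpose (hessian f x) = hessian f x" by (simp add: transpose_def)
 have "frechet_derivative f (at x) = (\<lambda>v. (\<chi> i. partial_deriv i f x) \<bullet> v)"
 proof
  fix v show "frechet_derivative f (at x) v = (\<chi> i. partial_deriv i f x) \<bullet> v"
   by (subst linear_component_sum[OF has_derivative_linear[OF Ck_on_2D(1)[OF assms(1) x]]])
    (simp add: inner_vec_def partial_deriv_def mult.commute)
 qed
 thus "(f has_derivative (\<lambda>v. (\<chi> i. partial_deriv i f x) \<bullet> v)) (at x)"
  using Ck_on_2D(1)[OF assms(1) x] by simp
 show "((\<lambda>x. \<chi> i. partial_deriv i f x) has_derivative (*v) (hessian f x)) (at x)"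
 proof (rule iffD2[OF has_derivative_componentwise_within], rule)
  fix b :: "real^'n" assume "b \<in> Basis"
  then obtain i where b: "b = axis i 1" by (auto simp: Basis_vec_def)
  have d: "(partial_deriv i f has_derivative frechet_derivative (partial_deriv i f) (at x)) (at x)"
   using Ck_on_2D(2)[OF assms(1) x, of "axis i 1"] by (simp only: partial_deriv_def[abs_def])
  have "frechet_derivative (partial_deriv i f) (at x) v = (hessian f x *v v) \<bullet> b" for v
  proof -
   have "frechet_derivative (partial_deriv i f) (at x) v = (\<Sum>j\<in>UNIV. v $ j * hessian f x $ j $ i)"
    by (subst linear_component_sum[OF has_derivative_linear[OF d]])
     (simp add: hessian_def partial_deriv_def[of _ "partial_deriv i f"])
   also have "\<dots> = (\<Sum>j\<in>UNIV. hessian f x $ i $ j * v $ j)"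
    by (simp only: sym[of _ i] mult.commute)
   also have "\<dots> = (hessian f x *v v) \<bullet> b" by (simp only: b inner_axis matrix_vector_mult_def) simp
   finally show ?thesis .
  qed
  hence "frechet_derivative (partial_deriv i f) (at x) = (\<lambda>v. (hessian f x *v v) \<bullet> b)" by blast
  thus "((\<lambda>x. (\<chi> i. partial_deriv i f x) \<bullet> b) has_derivative (\<lambda>v. (hessian f x *v v) \<bullet> b)) (at x)"
   using d by (simp add: b inner_axis)
 qed
next
 show "continuous_on S (hessian f)"
  unfolding hessian_def partial_deriv_def by (intro continuous_on_vec_lambda Ck_on_2D(3)[OF assms(1)])
qed

lemma psd_hessian:
 assumes C2: "C2fun S f g A" and conv: "convex_on S f" and x: "x \<in> S"
 shows "psd (A x)"
proof (rule C2fun_min(2)[OF C2fun_diff_affine[OF C2, of "g x" 0] x])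
 fix y assume y: "y \<in> S"
 have "(f has_derivative (\<lambda>v. g x \<bullet> v)) (at x)" using C2 x by (auto simp: C2fun_def)
 from convex_above_tangent[OF conv this x y]
 show "f x - g x \<bullet> x - 0 \<le> f y - g x \<bullet> y - 0" by (simp add: inner_diff_right)
qed

text \<open>If the form vanishes at \<open>v\<close>, Cauchy-Schwarz gives
  \<open>A *v v = 0\<close>, which a nonzero determinant forbids for
  \<open>v \<noteq> 0\<close>.\<close>

lemma psd_det_pd:
 fixes A :: "real^'n^'n" assumes "psd A" "det A \<noteq> 0" shows "pd A" unfolding pd_def
proof (intro conjI allI impI)
 show "transpose A = A" using assms by (simp add: psd_def)
 fix v :: "real^'n" assume v: "v \<noteq> 0"
 have "A *v v \<noteq> 0"
 proof
  assume "A *v v = 0"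
  moreover have "inj ((*v) A)" using assms(2) by (simp add: inj_matrix_vector_mult invertible_det_nz)
  ultimately show False using v by (metis injD matrix_vector_mult_0_right)
 qed
 moreover have "((A *v v) \<bullet> (A *v v))\<^sup>2 \<le> (v \<bullet> (A *v v)) * ((A *v v) \<bullet> (A *v (A *v v)))"
  using psd_cauchy_schwarz[OF assms(1), of "A *v v" v] by (simp add: mult.commute)
 ultimately have "v \<bullet> (A *v v) \<noteq> 0" by auto
 thus "0 < v \<bullet> (A *v v)" using assms(1) by (simp add: psd_def less_le)
qed

lemma ma_hessian:
 fixes phi :: "real^'n => real"
 assumes "Ck_on 2 U phi" "open U" "convex_on U phi" "0 < lam"
  and "\<forall>x\<in>U. lam \<le> det (hessian phi x) \<and> det (hessian phi x) \<le> Lam"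
 shows "ma U lam Lam phi (\<lambda>x. \<chi> i. partial_deriv i phi x) (hessian phi)"
 unfolding ma_def using C2fun_hessian[OF assms(1,2)] assms psd_hessian[OF C2fun_hessian[OF assms(1,2)] assms(3)]
 by (force intro: psd_det_pd)

section \<open>Test functions\<close>

lemma poly_div_exp_tendsto_0: "((\<lambda>s. s ^ k * poly p s / exp s) \<longlongrightarrow> (0::real)) at_top"
proof (induction p arbitrary: k)
 case (pCons a p)
 have "((\<lambda>s. a * (s ^ k / exp s) + s ^ Suc k * poly p s / exp s) \<longlongrightarrow> a * 0 + 0) at_top"
  by (intro tendsto_intros tendsto_power_div_exp_0 pCons.IH)
 thus ?case by (simp add: distrib_left add_divide_distrib mult_ac)
qed simp

fun flat_poly :: "nat => real poly" where
 "flat_poly 0 = 1"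
| "flat_poly (Suc m) = monom 1 2 * (flat_poly m - pderiv (flat_poly m))"

text \<open>The derivative of order \<open>m\<close> of \<open>exp (- 1 / t)\<close>, extended by 0
  to \<open>t \<le> 0\<close>.\<close>

definition flat :: "nat => real => real" where
 "flat m t = (if 0 < t then poly (flat_poly m) (1 / t) / exp (1 / t) else 0)"

text \<open>At 0 the right difference quotient is again a polynomial in \<open>1 / h\<close> divided
  by \<open>exp (1 / h)\<close>, so it tends to 0.\<close>

lemma flat_deriv: "(flat m has_real_derivative flat (Suc m) t) (at t)"
proof (cases "t = 0")
 case False
 have d: "((\<lambda>t. poly (flat_poly m) (1 / t) / exp (1 / t)) has_real_derivative flat (Suc m) t) (at t)" if "0 < t"
 proof -
  have "((\<lambda>t. poly (flat_poly m) (1 / t) * exp (- (1 / t))) has_real_derivative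
    poly (pderiv (flat_poly m)) (1 / t) * (- (1 / t\<^sup>2)) * exp (- (1 / t)) +
    poly (flat_poly m) (1 / t) * (exp (- (1 / t)) * (1 / t\<^sup>2))) (at t)"
   using that by (auto intro!: derivative_eq_intros simp: power2_eq_square)
  moreover have "poly (pderiv (flat_poly m)) (1 / t) * (- (1 / t\<^sup>2)) * exp (- (1 / t)) +
    poly (flat_poly m) (1 / t) * (exp (- (1 / t)) * (1 / t\<^sup>2)) = flat (Suc m) t"
   using that by (simp add: flat_def poly_monom exp_minus field_simps)
  ultimately show ?thesis by (simp add: exp_minus divide_inverse)
 qed
 show ?thesis
 proof (cases "0 < t")
  case True
  have "\<forall>\<^sub>F s in nhds t. s \<in> {0<..}" using True by (intro eventually_nhds_in_open) auto
  hence "\<forall>\<^sub>F s in nhds t. flat m s = poly (flat_poly m) (1 / s) / exp (1 / s)"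
   by eventually_elim (simp add: flat_def)
  from DERIV_cong_ev[OF refl this refl] d[OF True] show ?thesis by blast
 next
  case f: False
  have "\<forall>\<^sub>F s in nhds t. s \<in> {..<0}" using f False by (intro eventually_nhds_in_open) auto
  hence "\<forall>\<^sub>F s in nhds t. flat m s = 0" by eventually_elim (simp add: flat_def)
  note ev = this
  have "((\<lambda>s. 0) has_real_derivative flat (Suc m) t) (at t)" using f by (simp add: flat_def)
  with DERIV_cong_ev[OF refl ev refl] show ?thesis by blast
 qed
next
 case True
 have "((\<lambda>h. flat m h / h) \<longlongrightarrow> 0) (at_right 0)"
 proof -
  have "((\<lambda>h. (1 / h) ^ 1 * poly (flat_poly m) (1 / h) / exp (1 / h)) \<longlongrightarrow> 0) (at_right 0)"
   using filterlim_inverse_at_top_right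
   by (intro filterlim_compose[OF poly_div_exp_tendsto_0]) (simp add: inverse_eq_divide)
  moreover have "\<forall>\<^sub>F h in at_right 0. (1 / h) ^ 1 * poly (flat_poly m) (1 / h) / exp (1 / h) = flat m h / h"
   using eventually_at_right_less[of 0] by eventually_elim (simp add: flat_def)
  ultimately show ?thesis by (rule Lim_transform_eventually)
 qed
 moreover have "((\<lambda>h. flat m h / h) \<longlongrightarrow> 0) (at_left 0)"
 proof -
  have "\<forall>\<^sub>F h in at_left 0. 0 = flat m h / h"
   unfolding eventually_at_left_field by (intro exI[of _ "-1"]) (auto simp: flat_def)
  thus ?thesis by (rule Lim_transform_eventually[OF tendsto_const])
 qed
 ultimately have "((\<lambda>h. flat m h / h) \<longlongrightarrow> 0) (at 0)" by (rule filterlim_split_at[rotated])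
 thus ?thesis using True by (simp add: DERIV_def flat_def)
qed

lemma flat_0: "flat 0 t = (if 0 < t then exp (- 1 / t) else 0)"
 by (simp add: flat_def exp_minus divide_inverse)

text \<open>A class closed under directional derivatives by its form, so that one induction gives
  differentiability of all orders for its members.\<close>

inductive_set flat_algebra :: "('a::euclidean_space => real) set" where
 flat: "(\<lambda>x. flat m (u \<bullet> x + c)) \<in> flat_algebra"
| const: "(\<lambda>x. r) \<in> flat_algebra"
| add: "f \<in> flat_algebra ==> g \<in> flat_algebra ==> (\<lambda>x. f x + g x) \<in> flat_algebra"
| mult: "f \<in> flat_algebra ==> g \<in> flat_algebra ==> (\<lambda>x. f x * g x) \<in> flat_algebra"

lemma flat_algebra_derivative:
 "f \<in> flat_algebra ==> \<exists>f'. (\<forall>x. (f has_derivative f' x) (at x)) \<and> (\<forall>v. (\<lambda>x. f' x v) \<in> flat_algebra)"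
proof (induction rule: flat_algebra.induct)
 case (flat m u c)
 have "((\<lambda>x. flat m (u \<bullet> x + c)) has_derivative (\<lambda>v. (u \<bullet> v) * flat (Suc m) (u \<bullet> x + c))) (at x)" for x
  by (rule has_derivative_eq_rhs[OF has_derivative_compose[OF _ flat_deriv[unfolded has_field_derivative_def]]])
   (auto intro!: derivative_eq_intros)
 thus ?case
  by (intro exI[of _ "\<lambda>x v. (u \<bullet> v) * flat (Suc m) (u \<bullet> x + c)"]) (auto intro: flat_algebra.intros)
next
 case (const r)
 show ?case by (intro exI[of _ "\<lambda>x v. 0"]) (auto intro: flat_algebra.const)
next
 case (add f g)
 then obtain f' g' where "\<forall>x. (f has_derivative f' x) (at x)" "\<forall>v. (\<lambda>x. f' x v) \<in> flat_algebra"
  "\<forall>x. (g has_derivative g' x) (at x)" "\<forall>v. (\<lambda>x. g' x v) \<in> flat_algebra" by blast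
 thus ?case
  by (intro exI[of _ "\<lambda>x v. f' x v + g' x v"]) (auto intro: flat_algebra.add has_derivative_add)
next
 case (mult f g)
 then obtain f' g' where "\<forall>x. (f has_derivative f' x) (at x)" "\<forall>v. (\<lambda>x. f' x v) \<in> flat_algebra"
  "\<forall>x. (g has_derivative g' x) (at x)" "\<forall>v. (\<lambda>x. g' x v) \<in> flat_algebra" by blast
 with mult.hyps show ?case
  by (intro exI[of _ "\<lambda>x v. f x * g' x v + f' x v * g x"] conjI allI has_derivative_mult
    flat_algebra.add flat_algebra.mult) auto
qed

lemma Ck_flat_algebra: "f \<in> flat_algebra ==> Ck_on k UNIV f"
proof (induction k arbitrary: f)
 case 0
 then obtain f' where "\<forall>x. (f has_derivative f' x) (at x)" using flat_algebra_derivative by blast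
 thus ?case by (auto intro!: continuous_at_imp_continuous_on has_derivative_continuous)
next
 case (Suc k)
 then obtain f' where f': "\<And>x. (f has_derivative f' x) (at x)" "\<And>v. (\<lambda>x. f' x v) \<in> flat_algebra"
  using flat_algebra_derivative by blast
 have "frechet_derivative f (at x) = f' x" for x using frechet_derivative_at[OF f'(1)] by simp
 thus ?case using f' Suc.IH by (auto simp: differentiable_def)
qed

text \<open>Smooth approximation of the indicator of the open box; increasing \<open>k\<close>
  steepens the flanks and moves no point of the support outside the closed box.\<close>

definition bump :: "'a::euclidean_space => 'a => nat => 'a => real" where
 "bump a b k x = (\<Prod>i\<in>Basis. flat 0 (real k * ((x - a) \<bullet> i)) * flat 0 (real k * ((b - x) \<bullet> i)))"

lemma bump_flat_algebra: "bump a b k \<in> flat_algebra"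
proof -
 have "(\<lambda>x. \<Prod>i\<in>I. f i x) \<in> flat_algebra" if "finite I" "\<And>i. f i \<in> flat_algebra"
  for f :: "'a => 'a => real" and I
  using that by (induction rule: finite_induct) (auto intro: flat_algebra.intros)
 moreover have "(\<lambda>x. flat 0 ((real k *\<^sub>R i) \<bullet> x + - (real k * (a \<bullet> i))) *
   flat 0 ((- real k *\<^sub>R i) \<bullet> x + real k * (b \<bullet> i))) \<in> flat_algebra" for i
  by (intro flat_algebra.mult flat_algebra.flat)
 ultimately show ?thesis unfolding bump_def[abs_def] by (simp add: inner_commute algebra_simps)
qed

lemma bump_nonneg: "0 \<le> bump a b k x" and bump_le_1: "bump a b k x \<le> 1"
 unfolding bump_def by (auto intro!: prod_nonneg prod_le_1 mult_le_one simp: flat_0)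

lemma bump_outside: "x \<notin> box a b ==> bump a b k x = 0"
proof -
 assume "x \<notin> box a b"
 then obtain i where i: "i \<in> Basis" "(x - a) \<bullet> i \<le> 0 \<or> (b - x) \<bullet> i \<le> 0"
  by (auto simp: mem_box inner_diff_left)
 hence "flat 0 (real k * ((x - a) \<bullet> i)) * flat 0 (real k * ((b - x) \<bullet> i)) = 0"
  by (auto simp: flat_0 zero_less_mult_iff)
 thus ?thesis unfolding bump_def using i(1) by auto
qed

lemma bump_tendsto: "(\<lambda>k. bump a b k x) \<longlonglongrightarrow> indicator (box a b) x"
proof (cases "x \<in> box a b")
 case True
 have "(\<lambda>k. flat 0 (real k * c)) \<longlonglongrightarrow> 1" if "0 < c" for c
 proof -
  have "(\<lambda>k. exp (- 1 / (real k * c))) \<longlonglongrightarrow> 1" using that by real_asymp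
  moreover have "\<forall>\<^sub>F k in sequentially. exp (- 1 / (real k * c)) = flat 0 (real k * c)"
   using eventually_gt_at_top[of 0] by eventually_elim (use that in \<open>auto simp: flat_0\<close>)
  ultimately show ?thesis by (rule Lim_transform_eventually)
 qed
 hence "(\<lambda>k. bump a b k x) \<longlonglongrightarrow> (\<Prod>i\<in>(Basis :: 'a set). 1 * 1)"
  unfolding bump_def using True by (intro tendsto_prod tendsto_mult) (auto simp: mem_box inner_diff_left)
 thus ?thesis using True by simp
qed (simp add: bump_outside)

lemma test_function_bump:
 assumes "cbox a b \<subseteq> U" shows "test_function U (bump a b k)"
proof -
 have "closure {x. bump a b k x \<noteq> 0} \<subseteq> cbox a b"
  using bump_outside[of _ a b k] box_subset_cbox by (intro closure_minimal) blast+
 thus ?thesis unfolding test_function_def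
  using assms Ck_flat_algebra[OF bump_flat_algebra] compact_eq_bounded_closed bounded_subset[OF bounded_cbox] by blast
qed

lemma Ck_on_continuous: "Ck_on k S f ==> continuous_on S f"
 by (cases k) (auto intro!: continuous_at_imp_continuous_on differentiable_imp_continuous_within)

lemma test_function_frechet:
 assumes "test_function U ps" shows "test_function U (\<lambda>x. frechet_derivative ps (at x) v)"
proof -
 have C: "Ck_on k UNIV (\<lambda>x. frechet_derivative ps (at x) v)" for k
  using assms unfolding test_function_def by (metis Ck_on.simps(2))
 have sub: "{x. frechet_derivative ps (at x) v \<noteq> 0} \<subseteq> closure {x. ps x \<noteq> 0}"
 proof (rule subsetI, rule ccontr)
  fix x assume x: "x \<in> {x. frechet_derivative ps (at x) v \<noteq> 0}" "x \<notin> closure {x. ps x \<noteq> 0}"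
  have "(ps has_derivative (\<lambda>v. 0)) (at x)"
  proof (rule has_derivative_transform_within_open[of "\<lambda>x. 0" _ _ UNIV "- closure {x. ps x \<noteq> 0}"])
   show "0 = ps y" if "y \<in> - closure {x. ps x \<noteq> 0}" for y
    using that closure_subset[of "{x. ps x \<noteq> 0}"] by auto
  qed (use x in auto)
  hence "frechet_derivative ps (at x) = (\<lambda>v. 0)" using frechet_derivative_at by metis
  thus False using x by simp
 qed
 hence "closure {x. frechet_derivative ps (at x) v \<noteq> 0} \<subseteq> closure {x. ps x \<noteq> 0}"
  by (intro closure_minimal) auto
 thus ?thesis using assms C unfolding test_function_def
  by (meson closed_closure subset_trans compact_eq_bounded_closed bounded_subset)
qed

lemma test_function_partial: "test_function U ps ==> test_function U (partial_deriv i ps)"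
 unfolding partial_deriv_def[abs_def] by (rule test_function_frechet)

section \<open>Weak Hessians of convex functions\<close>

lemma in_Lp_loc_1D:
 fixes h :: "'a::euclidean_space => real"
 assumes "in_Lp_loc 1 U h" "compact K" "K \<subseteq> U"
 shows "set_integrable lebesgue K h"
proof -
 have "in_Lp 1 K h" using assms by (simp add: in_Lp_loc_def)
 hence "integrable (lebesgue_on K) h"
  unfolding in_Lp_def using integrable_norm_iff[of h "lebesgue_on K"] by simp
 moreover have "K \<in> sets lebesgue" using assms(2) by (simp add: lmeasurable_compact fmeasurableD)
 ultimately show ?thesis unfolding set_integrable_def using integrable_restrict_space[of K lebesgue h] by simp
qed

lemma test_functionD:
 assumes "test_function U ps"
 shows "continuous_on UNIV ps" "ps \<in> borel_measurable borel" "\<And>x. x \<notin> closure {x. ps x \<noteq> 0} ==> ps x = 0"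
  "\<exists>B. \<forall>x. \<bar>ps x\<bar> \<le> B"
proof -
 show c: "continuous_on UNIV ps" using assms by (auto simp: test_function_def intro: Ck_on_continuous)
 thus "ps \<in> borel_measurable borel" by (rule borel_measurable_continuous_onI)
 show z: "\<And>x. x \<notin> closure {x. ps x \<noteq> 0} ==> ps x = 0"
  using closure_subset[of "{x. ps x \<noteq> 0}"] by auto
 have "bounded (ps ` closure {x. ps x \<noteq> 0})"
  using assms c by (intro compact_imp_bounded compact_continuous_image) (auto simp: test_function_def intro: continuous_on_subset)
 then obtain B where "\<And>x. x \<in> closure {x. ps x \<noteq> 0} ==> \<bar>ps x\<bar> \<le> B" by (auto simp: bounded_iff)
 hence "\<bar>ps x\<bar> \<le> max B 0" for x using z[of x] by force
 thus "\<exists>B. \<forall>x. \<bar>ps x\<bar> \<le> B" by blast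
qed

lemma test_integrable:
 fixes h ps :: "'a::euclidean_space => real"
 assumes "in_Lp_loc 1 U h" "test_function U ps"
 shows "integrable lebesgue (\<lambda>x. h x * ps x)"
proof -
 define K where "K = closure {x. ps x \<noteq> 0}"
 note ps = test_functionD[OF assms(2)]
 have K: "compact K" "K \<subseteq> U" using assms(2) by (auto simp: test_function_def K_def)
 obtain B where B: "\<And>x. \<bar>ps x\<bar> \<le> B" using ps(4) by blast
 have "set_integrable lebesgue K h" by (rule in_Lp_loc_1D[OF assms(1) K])
 hence i: "integrable lebesgue (\<lambda>x. indicator K x * h x)" by (simp add: set_integrable_def)
 have m: "ps \<in> borel_measurable lebesgue" using ps(2) by (intro measurable_completion) simp
 have "integrable lebesgue (\<lambda>x. (indicator K x * h x) * ps x)"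
 proof (rule Bochner_Integration.integrable_bound[OF integrable_mult_right[OF integrable_abs[OF i], of B]])
  show "(\<lambda>x. indicator K x * h x * ps x) \<in> borel_measurable lebesgue"
   using borel_measurable_times[OF borel_measurable_integrable[OF i] m] by simp
  show "AE x in lebesgue. norm (indicator K x * h x * ps x) \<le> norm (B * \<bar>indicator K x * h x\<bar>)"
  proof (intro AE_I2)
   fix x
   have "\<bar>indicator K x * h x\<bar> * \<bar>ps x\<bar> \<le> \<bar>indicator K x * h x\<bar> * \<bar>B\<bar>"
    using B[of x] by (intro mult_left_mono) auto
   thus "norm (indicator K x * h x * ps x) \<le> norm (B * \<bar>indicator K x * h x\<bar>)"
    by (simp add: abs_mult mult_ac)
  qed
 qed
 moreover have "(\<lambda>x. (indicator K x * h x) * ps x) = (\<lambda>x. h x * ps x)"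
 proof
  fix x show "(indicator K x * h x) * ps x = h x * ps x"
   using ps(3)[of x] by (cases "x \<in> K") (auto simp: K_def)
 qed
 ultimately show ?thesis by simp
qed

lemma test_integral:
 fixes h ps :: "'a::euclidean_space => real"
 assumes "open U" "test_function U ps"
 shows "(LINT x|lebesgue_on U. h x * ps x) = (LINT x|lebesgue. h x * ps x)"
proof -
 have "(LINT x|lebesgue_on U. h x * ps x) = (LINT x|lebesgue. indicator U x *\<^sub>R (h x * ps x))"
  using assms(1) by (intro integral_restrict_space) (simp add: lborelD)
 also have "\<dots> = (LINT x|lebesgue. h x * ps x)"
 proof (intro Bochner_Integration.integral_cong refl)
  fix x show "indicator U x *\<^sub>R (h x * ps x) = h x * ps x"
   using test_functionD(3)[OF assms(2), of x] assms(2) by (cases "x \<in> U") (auto simp: test_function_def)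
 qed
 finally show ?thesis .
qed

lemma AE_cboxes:
 fixes U :: "'a::euclidean_space set"
 assumes "open U" "\<And>a b. cbox a b \<subseteq> U ==> AE x in lebesgue. x \<in> cbox a b \<longrightarrow> P x"
 shows "AE x in lebesgue_on U. P x"
proof -
 obtain \<D> where \<D>: "countable \<D>" "\<D> \<subseteq> Pow U" "\<And>X. X \<in> \<D> ==> \<exists>a b. X = cbox a b" "\<Union>\<D> = U"
  using open_countable_Union_open_cbox[OF assms(1)] by blast
 have "AE x in lebesgue. \<forall>X\<in>\<D>. x \<in> X \<longrightarrow> P x"
  unfolding AE_ball_countable[OF \<D>(1)] using \<D>(2,3) assms(2) by (metis Pow_iff subsetD)
 hence "AE x in lebesgue. x \<in> U \<longrightarrow> P x" by eventually_elim (use \<D>(4) in blast)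
 thus ?thesis using assms(1) by (simp add: AE_restrict_space_iff)
qed

text \<open>Bump functions show that integrals of \<open>h\<close> over boxes are nonnegative;
  Lebesgue differentiation over shrinking boxes gives the sign almost everywhere.\<close>

lemma nonneg_of_test_functions:
 fixes h :: "'a::euclidean_space => real"
 assumes U: "open U" and h: "in_Lp_loc 1 U h"
  and nn: "\<And>ps. test_function U ps ==> (\<And>x. 0 \<le> ps x) ==> 0 \<le> (LINT x|lebesgue. h x * ps x)"
 shows "AE x in lebesgue_on U. 0 \<le> h x"
proof (rule AE_cboxes[OF U])
 fix a b :: 'a assume ab: "cbox a b \<subseteq> U"
 have box: "0 \<le> (LINT x:cbox c d|lebesgue. h x)" if cd: "cbox c d \<subseteq> cbox a b" for c d
 proof -
  have int: "set_integrable lebesgue (cbox c d) h" using cd ab by (intro in_Lp_loc_1D[OF h]) auto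
  have lim: "(\<lambda>k. LINT x|lebesgue. h x * bump c d k x) \<longlonglongrightarrow> (LINT x|lebesgue. h x * indicator (box c d) x)"
  proof (rule integral_dominated_convergence)
   show "integrable lebesgue (\<lambda>x. \<bar>indicator (cbox c d) x * h x\<bar>)"
    using int by (auto simp: set_integrable_def)
   have "integrable lebesgue (\<lambda>x. h x * bump c d k x)" for k
    using cd ab by (intro test_integrable[OF h] test_function_bump) auto
   thus "(\<lambda>x. h x * bump c d k x) \<in> borel_measurable lebesgue" for k by auto
   have "(\<lambda>x. indicator (cbox c d) x * h x * indicator (box c d) x) \<in> borel_measurable lebesgue"
    using int by (intro borel_measurable_times[OF _ borel_measurable_indicator]) (auto simp: set_integrable_def)
   also have "(\<lambda>x. indicator (cbox c d) x * h x * indicator (box c d) x) = (\<lambda>x. h x * indicator (box c d) x)"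
    using box_subset_cbox by (fastforce simp: indicator_def)
   finally show "(\<lambda>x. h x * indicator (box c d) x) \<in> borel_measurable lebesgue" .
   show "AE x in lebesgue. (\<lambda>k. h x * bump c d k x) \<longlonglongrightarrow> h x * indicator (box c d) x"
    by (intro AE_I2 tendsto_intros bump_tendsto)
   show "AE x in lebesgue. norm (h x * bump c d k x) \<le> \<bar>indicator (cbox c d) x * h x\<bar>" for k
   proof (intro AE_I2)
    fix x show "norm (h x * bump c d k x) \<le> \<bar>indicator (cbox c d) x * h x\<bar>"
    proof (cases "x \<in> box c d")
     case True
     hence "x \<in> cbox c d" using box_subset_cbox by blast
     thus ?thesis using bump_nonneg[of c d k x] bump_le_1[of c d k x] mult_left_mono[of "bump c d k x" 1 "\<bar>h x\<bar>"]
      by (simp add: abs_mult)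
    qed (simp add: bump_outside)
   qed
  qed
  have "0 \<le> (LINT x|lebesgue. h x * indicator (box c d) x)" by (rule LIMSEQ_le_const[OF lim])
    (use cd ab in \<open>auto intro!: nn test_function_bump bump_nonneg\<close>)
  also have "\<dots> = (LINT x:cbox c d|lebesgue. h x)" unfolding set_lebesgue_integral_def
  proof (rule integral_cong_AE)
   have "cbox c d - box c d \<in> null_sets lebesgue"
    using negligible_frontier_interval by (simp only: negligible_iff_null_sets)
   hence "AE x in lebesgue. x \<notin> cbox c d - box c d" by (rule AE_not_in)
   thus "AE x in lebesgue. h x * indicator (box c d) x = indicator (cbox c d) x *\<^sub>R h x"
    by eventually_elim (use box_subset_cbox[of c d] in \<open>auto simp: indicator_def\<close>)
   show "(\<lambda>x. indicator (cbox c d) x *\<^sub>R h x) \<in> borel_measurable lebesgue"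
    using int by (auto simp: set_integrable_def)
   have "(\<lambda>x. indicator (cbox c d) x * h x * indicator (box c d) x) \<in> borel_measurable lebesgue"
    using int by (intro borel_measurable_times[OF _ borel_measurable_indicator]) (auto simp: set_integrable_def)
   also have "(\<lambda>x. indicator (cbox c d) x * h x * indicator (box c d) x) = (\<lambda>x. h x * indicator (box c d) x)"
    using box_subset_cbox by (fastforce simp: indicator_def)
   finally show "(\<lambda>x. h x * indicator (box c d) x) \<in> borel_measurable lebesgue" .
  qed
  finally show ?thesis .
 qed
 define f where "f x = (if x \<in> cbox a b then h x else 0)" for x
 have hab: "set_integrable lebesgue (cbox a b) h" using ab by (intro in_Lp_loc_1D[OF h]) auto
 have hU: "h integrable_on cbox a b" using set_lebesgue_integral_eq_integral(1)[OF hab] .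
 have f: "f integrable_on cbox c d" for c d
 proof -
  have "f integrable_on UNIV" unfolding f_def using hU by (simp add: integrable_restrict_UNIV)
  thus ?thesis by (rule integrable_on_subcbox) simp
 qed
 obtain N where N: "negligible N" "\<And>x e. x \<notin> N ==> 0 < e ==> \<exists>d>0. \<forall>t. 0 < t \<and> t < d \<longrightarrow>
   norm (integral (cbox x (x + t *\<^sub>R One)) f /\<^sub>R t ^ DIM('a) - f x) < e"
  using integrable_ccontinuous_explicit[of f] f by blast
 have "0 \<le> h x" if x: "x \<in> box a b" "x \<notin> N" for x
 proof (rule ccontr)
  assume neg: "\<not> 0 \<le> h x"
  have fx: "f x = h x" using x box_subset_cbox by (auto simp: f_def)
  obtain d where d: "0 < d" "\<And>t. 0 < t ==> t < d ==>
    norm (integral (cbox x (x + t *\<^sub>R One)) f /\<^sub>R t ^ DIM('a) - f x) < - h x"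
   using N(2)[OF x(2), of "- h x"] neg by auto
  obtain r where r: "0 < r" "cball x r \<subseteq> box a b" using x(1) open_contains_cball open_box by metis
  define t where "t = min (d / 2) (r / (1 + norm (One :: 'a)))"
  have t: "0 < t" "t < d" using d r by (auto simp: t_def add_pos_nonneg)
  have tr: "t * norm (One :: 'a) \<le> r"
  proof -
   have "t * norm (One :: 'a) \<le> r / (1 + norm (One :: 'a)) * (1 + norm (One :: 'a))"
    using r by (intro mult_mono) (auto simp: t_def)
   also have "\<dots> = r" by (simp add: add_pos_nonneg less_imp_neq[symmetric])
   finally show ?thesis .
  qed
  have "x + t *\<^sub>R One \<in> cball x r" using tr t by (simp add: dist_norm)
  hence sub: "cbox x (x + t *\<^sub>R One) \<subseteq> cbox a b"
   using r x(1) by (intro subset_box_imp(1)) (force simp: mem_box less_imp_le)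
  have "integral (cbox x (x + t *\<^sub>R One)) f = integral (cbox x (x + t *\<^sub>R One)) h"
   using sub by (intro integral_cong) (auto simp: f_def)
  also have "\<dots> = (LINT y:cbox x (x + t *\<^sub>R One)|lebesgue. h y)"
   by (rule set_lebesgue_integral_eq_integral(2)[symmetric], rule set_integrable_subset[OF hab]) (use sub in auto)
  also have "\<dots> \<ge> 0" by (rule box[OF sub])
  finally have "0 \<le> integral (cbox x (x + t *\<^sub>R One)) f /\<^sub>R t ^ DIM('a)" using t by simp
  thus False using d(2)[OF t] fx by simp
 qed
 moreover have "N \<union> (cbox a b - box a b) \<in> null_sets lebesgue"
  using negligible_Un[OF N(1) negligible_frontier_interval[of a b]] by (simp only: negligible_iff_null_sets)
 hence "AE x in lebesgue. x \<notin> N \<union> (cbox a b - box a b)" by (rule AE_not_in)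
 ultimately show "AE x in lebesgue. x \<in> cbox a b \<longrightarrow> 0 \<le> h x" by auto
qed

text \<open>Second differences of the test function are moved onto \<open>v\<close> by translation,
  where midpoint convexity gives their sign; the quotients converge to the second derivative. No
  derivative of \<open>v\<close> occurs.\<close>

lemma convex_weak_second_derivative:
 fixes v :: "'a::euclidean_space => real"
 assumes U: "open U" and v: "convex_on U v" "continuous_on U v"
  and ps: "test_function U ps" "\<And>x. 0 \<le> ps x"
 shows "0 \<le> (LINT x|lebesgue. v x * frechet_derivative (\<lambda>y. frechet_derivative ps (at y) xi) (at x) xi)"
proof -
 define F where "F x = frechet_derivative (\<lambda>y. frechet_derivative ps (at y) xi) (at x) xi" for x
 define K where "K = closure {x. ps x \<noteq> 0}"
 have K: "compact K" "K \<subseteq> U" using ps(1) by (auto simp: test_function_def K_def)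
 have F: "test_function U F" unfolding F_def by (intro test_function_frechet ps)
 note F' = test_functionD[OF F] and ps' = test_functionD[OF ps(1)]
 obtain M where M: "\<And>x. \<bar>F x\<bar> \<le> M" using F'(4) by blast
 have ps0: "x \<notin> K ==> ps x = 0" for x unfolding K_def by (rule ps'(3))
 \<comment> \<open>Extension by 0, a Borel function on the whole space that can be
   translated.\<close>
 define v' where "v' x = indicator U x * v x" for x
 have v'm: "v' \<in> borel_measurable borel"
  using borel_measurable_continuous_on_indicator[OF _ v(2)] U by (simp add: v'_def[abs_def])
 \<comment> \<open>All translates used below move points of the support by at most \<open>r\<close>,
   hence stay inside \<open>U\<close>.\<close>
 obtain r where r: "0 < r" "(\<Union>x\<in>K. cball x r) \<subseteq> U" "compact (\<Union>x\<in>K. cball x r)"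
 proof -
  obtain e where e: "0 < e" "(\<Union>x\<in>K. ball x e) \<subseteq> U" using compact_subset_open_imp_ball_epsilon_subset[OF K(1) U K(2)] by blast
  have "(\<Union>x\<in>K. cball x (e / 2)) \<subseteq> (\<Union>x\<in>K. ball x e)" using e by auto
  moreover have "compact (\<Union>x\<in>K. cball x (e / 2))"
   using compact_minkowski_sum_cball[OF K(1), of "e / 2"] .
  ultimately show ?thesis using e by (intro that[of "e / 2"]) auto
 qed
 define Kr where "Kr = (\<Union>x\<in>K. cball x r)"
 have Kr: "K \<subseteq> Kr" using r by (auto simp: Kr_def)
 define t where "t k = r / ((norm xi + 1) * (real k + 1))" for k
 have t: "0 < t k" "t k * norm xi \<le> r" for k
 proof -
  have n: "0 < norm xi + 1" by (simp add: add_nonneg_pos)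
  show "0 < t k" using r n by (simp add: t_def)
  have "t k * norm xi = r * (norm xi / ((norm xi + 1) * (real k + 1)))" unfolding t_def by simp
  also have "norm xi / ((norm xi + 1) * (real k + 1)) \<le> 1"
   using n mult_mono[of "norm xi" "norm xi + 1" 1 "real k + 1"] by simp
  finally show "t k * norm xi \<le> r" using r by simp
 qed
 have t0: "t \<longlonglongrightarrow> 0"
 proof -
  have "(\<lambda>k. r / (norm xi + 1) * (1 / (real k + 1))) \<longlonglongrightarrow> r / (norm xi + 1) * 0"
   by (intro tendsto_mult tendsto_const) real_asymp
  thus ?thesis by (simp add: t_def[abs_def])
 qed
 define S where "S k x = ps (x + t k *\<^sub>R xi) - 2 * ps x + ps (x - t k *\<^sub>R xi)" for k x
 have S_F: "\<exists>c. \<bar>c\<bar> \<le> t k \<and> S k x = t k * t k * F (x + c *\<^sub>R xi)" for k x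
 proof -
  have "Ck_on 2 UNIV ps" using ps(1) by (simp add: test_function_def)
  note D = Ck_on_2D[OF this]
  obtain a b where ab: "0 \<le> a" "a \<le> t k" "0 \<le> b" "b \<le> t k"
   "ps (x - t k *\<^sub>R xi + t k *\<^sub>R xi + t k *\<^sub>R xi) - ps (x - t k *\<^sub>R xi + t k *\<^sub>R xi) - ps (x - t k *\<^sub>R xi + t k *\<^sub>R xi) + ps (x - t k *\<^sub>R xi)
    = t k * t k * F (x - t k *\<^sub>R xi + a *\<^sub>R xi + b *\<^sub>R xi)"
   using second_difference[where S = UNIV and u = xi and v = xi, OF D(1) D(2) t(1)] unfolding F_def by blast
  have "x - t k *\<^sub>R xi + a *\<^sub>R xi + b *\<^sub>R xi = x + (a + b - t k) *\<^sub>R xi" by (simp add: algebra_simps)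
  hence eq: "F (x - t k *\<^sub>R xi + a *\<^sub>R xi + b *\<^sub>R xi) = F (x + (a + b - t k) *\<^sub>R xi)" by (simp only:)
  have "S k x = t k * t k * F (x - t k *\<^sub>R xi + a *\<^sub>R xi + b *\<^sub>R xi)" using ab(5) by (simp add: S_def)
  thus ?thesis unfolding eq using ab(1-4) by force
 qed
 have S_out: "S k x = 0" if "x \<notin> Kr" for k x
 proof -
  have "x + c *\<^sub>R xi \<notin> K" if "\<bar>c\<bar> \<le> t k" for c
  proof
   assume "x + c *\<^sub>R xi \<in> K"
   moreover have "dist (x + c *\<^sub>R xi) x \<le> r"
    using t(2)[of k] mult_right_mono[OF that norm_ge_zero[of xi]] by (simp add: dist_norm)
   ultimately show False using \<open>x \<notin> Kr\<close> by (auto simp: Kr_def)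
  qed
  from ps0[OF this, of "t k"] ps0[OF this, of 0] ps0[OF this, of "- t k"] t(1)[of k]
  show ?thesis by (simp add: S_def)
 qed
 have cshift: "continuous_on T (\<lambda>x. ps (x + d))" for T d
  by (rule continuous_on_compose2[OF ps'(1)]) (intro continuous_intros, simp)
 have i1: "integrable lborel (\<lambda>x. v' x * ps (x + d))" if "norm d \<le> r" for d
 proof -
  have "set_integrable lborel Kr (\<lambda>x. v x * ps (x + d))"
   using r(2,3) by (intro set_integrable_continuous_on_closure[of Kr Kr] continuous_on_mult
     continuous_on_subset[OF v(2)] cshift) (auto simp: Kr_def compact_imp_closed)
  moreover have "indicator Kr x * (v x * ps (x + d)) = v' x * ps (x + d)" for x
  proof (cases "x \<in> Kr")
   case False
   hence "x + d \<notin> K" using that by (auto simp: Kr_def dist_norm)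
   thus ?thesis using ps0 by simp
  next
   case True
   hence "x \<in> U" using r(2) unfolding Kr_def by blast
   thus ?thesis using True by (simp add: v'_def)
  qed
  ultimately show ?thesis by (simp add: set_integrable_def)
 qed
 have i2: "integrable lborel (\<lambda>x. v' (x + c) * ps x)" if c: "norm c \<le> r" for c
 proof -
  have inU: "x + c \<in> U" if "x \<in> K" for x using that c r(2) by (force simp: dist_norm)
  have "set_integrable lborel K (\<lambda>x. v (x + c) * ps x)"
   using K(1) inU by (intro set_integrable_continuous_on_closure[of K K] continuous_on_mult
     continuous_on_compose2[OF v(2)] continuous_on_subset[OF ps'(1)] continuous_intros) (auto simp: compact_imp_closed)
  moreover have "indicator K x * (v (x + c) * ps x) = v' (x + c) * ps x" for x
   using ps0[of x] inU[of x] by (cases "x \<in> K") (auto simp: v'_def)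
  ultimately show ?thesis by (simp add: set_integrable_def)
 qed
 have shift: "(LINT x|lborel. v' x * ps (x + d)) = (LINT x|lborel. v' (x + (- d)) * ps x)" for d
 proof -
  have "(\<lambda>x. v' (x + (- d)) * ps x) \<in> borel_measurable borel" using v'm ps'(2) by simp
  from lborel_integral_translate[OF this, of d] show ?thesis by simp
 qed
 have pos: "0 \<le> (LINT x|lborel. v' x * S k x)" for k
 proof -
  define d where "d = t k *\<^sub>R xi"
  have d: "norm d \<le> r" "norm (- d) \<le> r" "norm (0 :: 'a) \<le> r" using t[of k] r(1) by (auto simp: d_def)
  have "(LINT x|lborel. v' x * S k x) =
    (LINT x|lborel. v' x * ps (x + d) - 2 * (v' x * ps (x + 0)) + v' x * ps (x + (- d)))"
   by (simp add: S_def d_def algebra_simps)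
  also have "\<dots> = (LINT x|lborel. v' x * ps (x + d)) - 2 * (LINT x|lborel. v' x * ps (x + 0)) +
    (LINT x|lborel. v' x * ps (x + (- d)))" using i1[OF d(1)] i1[OF d(2)] i1[OF d(3)] by simp
  also have "\<dots> = (LINT x|lborel. v' (x + (- d)) * ps x) - 2 * (LINT x|lborel. v' (x + 0) * ps x) +
    (LINT x|lborel. v' (x + d) * ps x)" unfolding shift by simp
  also have "\<dots> = (LINT x|lborel. v' (x + (- d)) * ps x - 2 * (v' (x + 0) * ps x) + v' (x + d) * ps x)"
   using i2[OF d(1)] i2[OF d(2)] i2[OF d(3)] by simp
  also have "\<dots> \<ge> 0"
  proof (intro integral_nonneg_AE AE_I2)
   fix x
   show "0 \<le> v' (x + (- d)) * ps x - 2 * (v' (x + 0) * ps x) + v' (x + d) * ps x"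
   proof (cases "x \<in> K")
    case True
    have "x + d \<in> cball x r" "x - d \<in> cball x r" "x \<in> cball x r" using d by (auto simp: dist_norm)
    hence U': "x + d \<in> U" "x - d \<in> U" "x \<in> U" using True r(2) by blast+
    have "v ((1 - 1 / 2) *\<^sub>R (x + d) + (1 / 2) *\<^sub>R (x - d)) \<le> (1 - 1 / 2) * v (x + d) + 1 / 2 * v (x - d)"
     using U' by (intro convex_onD[OF v(1)]) auto
    moreover have "(1 - 1 / 2) *\<^sub>R (x + d) + (1 / 2) *\<^sub>R (x - d) = x"
     by (simp add: scaleR_add_right scaleR_diff_right flip: scaleR_add_left)
    ultimately have "0 \<le> v (x - d) - 2 * v x + v (x + d)" by simp
    hence "0 \<le> (v (x - d) - 2 * v x + v (x + d)) * ps x" using ps(2) by simp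
    thus ?thesis using U' by (simp add: v'_def algebra_simps)
   qed (simp add: ps0)
  qed
  finally show ?thesis .
 qed
 have lim: "(\<lambda>k. LINT x|lborel. v' x * (S k x / (t k * t k))) \<longlonglongrightarrow> (LINT x|lborel. v' x * F x)"
 proof (rule integral_dominated_convergence)
  have cKr: "continuous_on Kr (\<lambda>x. M * \<bar>v x\<bar>)"
   using r(2) by (intro continuous_intros continuous_on_subset[OF v(2)]) (auto simp: Kr_def)
  have "set_integrable lborel Kr (\<lambda>x. M * \<bar>v x\<bar>)"
   using r(3) cKr by (intro set_integrable_continuous_on_closure[of Kr Kr]) (auto simp: Kr_def compact_imp_closed)
  thus "integrable lborel (\<lambda>x. indicator Kr x * (M * \<bar>v x\<bar>))" by (simp add: set_integrable_def)
  have Sm: "S k \<in> borel_measurable borel" for k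
   unfolding S_def by (intro borel_measurable_continuous_onI continuous_intros continuous_on_compose2[OF ps'(1)]) auto
  show "(\<lambda>x. v' x * (S k x / (t k * t k))) \<in> borel_measurable lborel" for k using Sm v'm by simp
  show "(\<lambda>x. v' x * F x) \<in> borel_measurable lborel" using v'm F'(2) by auto
  show "AE x in lborel. (\<lambda>k. v' x * (S k x / (t k * t k))) \<longlonglongrightarrow> v' x * F x"
  proof (intro AE_I2 tendsto_mult tendsto_const)
   fix x
   obtain c where c: "\<And>k. \<bar>c k\<bar> \<le> t k" "\<And>k. S k x = t k * t k * F (x + c k *\<^sub>R xi)" using S_F[of _ x] by metis
   have "c \<longlonglongrightarrow> 0" by (rule Lim_null_comparison[OF _ t0]) (simp add: c)
   hence "(\<lambda>k. x + c k *\<^sub>R xi) \<longlonglongrightarrow> x + 0 *\<^sub>R xi" by (intro tendsto_intros)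
   hence "(\<lambda>k. F (x + c k *\<^sub>R xi)) \<longlonglongrightarrow> F x"
    using continuous_on_tendsto_compose[OF F'(1)] by auto
   moreover have "S k x / (t k * t k) = F (x + c k *\<^sub>R xi)" for k using c(2)[of k] t(1)[of k] by simp
   ultimately show "(\<lambda>k. S k x / (t k * t k)) \<longlonglongrightarrow> F x" by simp
  qed
  show "AE x in lborel. norm (v' x * (S k x / (t k * t k))) \<le> indicator Kr x * (M * \<bar>v x\<bar>)" for k
  proof (intro AE_I2)
   fix x
   obtain c where "S k x = t k * t k * F (x + c *\<^sub>R xi)" using S_F by blast
   hence "\<bar>S k x / (t k * t k)\<bar> \<le> M" using t(1)[of k] M by simp
   hence "\<bar>v' x\<bar> * \<bar>S k x / (t k * t k)\<bar> \<le> \<bar>v x\<bar> * M"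
    by (intro mult_mono) (auto simp: v'_def indicator_def)
   thus "norm (v' x * (S k x / (t k * t k))) \<le> indicator Kr x * (M * \<bar>v x\<bar>)"
    using S_out[of x k] by (cases "x \<in> Kr") (simp_all add: abs_mult mult.commute)
  qed
 qed
 have "0 \<le> (LINT x|lborel. v' x * (S k x / (t k * t k)))" for k
 proof -
  have "(LINT x|lborel. v' x * (S k x / (t k * t k))) = (LINT x|lborel. v' x * S k x / (t k * t k))" by simp
  also have "\<dots> = (LINT x|lborel. v' x * S k x) / (t k * t k)" by simp
  finally show ?thesis using pos[of k] by simp
 qed
 hence "0 \<le> (LINT x|lborel. v' x * F x)" by (intro LIMSEQ_le_const[OF lim]) auto
 also have "(LINT x|lborel. v' x * F x) = (LINT x|lebesgue. v' x * F x)"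
  using v'm F'(2) by (intro integral_completion[symmetric]) auto
 also have "\<dots> = (LINT x|lebesgue. v x * F x)"
 proof (intro Bochner_Integration.integral_cong refl)
  fix x show "v' x * F x = v x * F x"
   using F'(3)[of x] F by (cases "x \<in> U") (auto simp: v'_def test_function_def)
 qed
 finally show ?thesis unfolding F_def .
qed

lemma in_Lp_loc_cong_add:
 fixes f g :: "'a::euclidean_space => real"
 assumes "in_Lp_loc 1 U f" "in_Lp_loc 1 U g"
 shows "in_Lp_loc 1 U (\<lambda>x. f x + c * g x)"
proof -
 have "in_Lp 1 K (\<lambda>x. f x + c * g x)" if K: "compact K" "K \<subseteq> U" for K
 proof -
  have i: "integrable (lebesgue_on K) h" if "in_Lp_loc 1 U h" for h :: "'a => real"
   using that K integrable_norm_iff[of h "lebesgue_on K"] by (auto simp: in_Lp_loc_def in_Lp_def)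
  have "integrable (lebesgue_on K) (\<lambda>x. f x + c * g x)" using i[OF assms(1)] i[OF assms(2)] by simp
  thus ?thesis by (auto simp: in_Lp_def)
 qed
 thus ?thesis by (simp add: in_Lp_loc_def)
qed

lemma in_Lp_loc_sum:
 fixes f :: "'i => 'a::euclidean_space => real"
 assumes "finite I" "\<And>i. i \<in> I ==> in_Lp_loc 1 U (f i)"
 shows "in_Lp_loc 1 U (\<lambda>x. \<Sum>i\<in>I. c i * f i x)" using assms
proof (induction I rule: finite_induct)
 case empty
 show ?case by (simp add: in_Lp_loc_def in_Lp_def)
next
 case (insert i I)
 hence "in_Lp_loc 1 U (\<lambda>x. (\<Sum>i\<in>I. c i * f i x) + c i * f i x)"
  by (intro in_Lp_loc_cong_add) auto
 thus ?case using insert by (simp add: add.commute)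
qed

lemma weak_hessian_test:
 assumes U: "open U" and H: "weak_hessian U v H" and ps: "test_function U ps"
 shows "(LINT x|lebesgue. H x $ i $ j * ps x) = (LINT x|lebesgue. v x * partial_deriv j (partial_deriv i ps) x)"
proof -
 obtain G where G: "\<And>j. weak_partial U j v (\<lambda>x. G x $ j)"
  "\<And>i j. weak_partial U i (\<lambda>x. G x $ j) (\<lambda>x. H x $ i $ j)"
  using H by (auto simp: weak_hessian_def)
 have psi: "test_function U (partial_deriv i ps)" by (rule test_function_partial[OF ps])
 have "(LINT x|lebesgue. G x $ j * partial_deriv i ps x) = - (LINT x|lebesgue. H x $ i $ j * ps x)"
  using G(2)[of i j] ps unfolding weak_partial_def test_integral[OF U ps, symmetric] test_integral[OF U psi, symmetric] by blast
 moreover have "(LINT x|lebesgue. v x * partial_deriv j (partial_deriv i ps) x) = - (LINT x|lebesgue. G x $ j * partial_deriv i ps x)"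
  using G(1)[of j] psi unfolding weak_partial_def test_integral[OF U psi, symmetric]
   test_integral[OF U test_function_partial[OF psi], symmetric] by blast
 ultimately show ?thesis by simp
qed

lemma weak_hessian_loc:
 assumes "weak_hessian U v H" shows "in_Lp_loc 1 U v" "in_Lp_loc 1 U (\<lambda>x. H x $ i $ j)"
 using assms by (auto simp: weak_hessian_def weak_partial_def)

text \<open>Second partial derivatives of test functions commute, so the difference of the two
  entries integrates to 0 against each of them; the sign lemma is used for both orders.\<close>

lemma weak_hessian_symmetric:
 assumes U: "open U" and H: "weak_hessian U v H"
 shows "AE x in lebesgue_on U. H x $ i $ j = H x $ j $ i"
proof -
 note loc = weak_hessian_loc[OF H]
 have "AE x in lebesgue_on U. 0 \<le> H x $ i $ j + - 1 * H x $ j $ i" for i j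
 proof (rule nonneg_of_test_functions[OF U in_Lp_loc_cong_add[OF loc(2) loc(2)]])
  fix ps assume ps: "test_function U ps"
  have C: "Ck_on 2 UNIV ps" using ps by (simp add: test_function_def)
  have "partial_deriv j (partial_deriv i ps) = partial_deriv i (partial_deriv j ps)"
   unfolding partial_deriv_def[abs_def] using Ck_on_2_symmetric[OF C open_UNIV UNIV_I] by simp
  hence "(LINT x|lebesgue. H x $ i $ j * ps x) = (LINT x|lebesgue. H x $ j $ i * ps x)"
   by (simp add: weak_hessian_test[OF U H ps])
  thus "0 \<le> (LINT x|lebesgue. (H x $ i $ j + - 1 * H x $ j $ i) * ps x)"
   using test_integrable[OF loc(2) ps] by (simp add: left_diff_distrib)
 qed
 from this[of i j] this[of j i] show ?thesis by auto
qed

text \<open>One sum over pairs instead of two nested ones, so that linearity of the integral is used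
  once.\<close>

lemma sum_pairs: "(\<Sum>p\<in>UNIV. f (fst p) (snd p)) = (\<Sum>a\<in>UNIV. \<Sum>b\<in>UNIV. f a b)"
 for f :: "'a::finite => 'b::finite => real" by (simp add: sum.cartesian_product case_prod_beta)

lemma frechet_twice:
 fixes ps :: "real^'n => real"
 assumes "Ck_on 2 UNIV ps"
 shows "frechet_derivative (\<lambda>y. frechet_derivative ps (at y) xi) (at x) xi =
  (\<Sum>p\<in>UNIV. (xi $ fst p * xi $ snd p) * partial_deriv (snd p) (partial_deriv (fst p) ps) x)"
proof -
 note D = Ck_on_2D[OF assms]
 have 1: "frechet_derivative ps (at y) xi = (\<Sum>a\<in>UNIV. xi $ a * partial_deriv a ps y)" for y
  by (subst linear_component_sum[OF has_derivative_linear[OF D(1)]]) (auto simp: partial_deriv_def)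
 have d: "(partial_deriv a ps has_derivative frechet_derivative (partial_deriv a ps) (at x)) (at x)" for a
  using D(2)[of x "axis a 1"] by (simp add: partial_deriv_def[abs_def])
 have "((\<lambda>y. \<Sum>a\<in>UNIV. xi $ a * partial_deriv a ps y) has_derivative
   (\<lambda>h. \<Sum>a\<in>UNIV. xi $ a * frechet_derivative (partial_deriv a ps) (at x) h)) (at x)"
  by (intro has_derivative_sum has_derivative_mult_right d)
 note dps = frechet_derivative_at[OF this, symmetric]
 have e: "(\<lambda>y. frechet_derivative ps (at y) xi) = (\<lambda>y. \<Sum>a\<in>UNIV. xi $ a * partial_deriv a ps y)"
  by (rule ext) (rule 1)
 have "frechet_derivative (\<lambda>y. frechet_derivative ps (at y) xi) (at x) xi =
   (\<Sum>a\<in>UNIV. xi $ a * frechet_derivative (partial_deriv a ps) (at x) xi)" unfolding e dps ..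
 also have "\<dots> = (\<Sum>a\<in>UNIV. \<Sum>b\<in>UNIV. (xi $ a * xi $ b) * partial_deriv b (partial_deriv a ps) x)"
 proof (rule sum.cong[OF refl])
  fix a
  have "frechet_derivative (partial_deriv a ps) (at x) xi = (\<Sum>b\<in>UNIV. xi $ b * partial_deriv b (partial_deriv a ps) x)"
   unfolding partial_deriv_def[of _ "partial_deriv a ps"] by (rule linear_component_sum[OF has_derivative_linear[OF d]])
  thus "xi $ a * frechet_derivative (partial_deriv a ps) (at x) xi =
    (\<Sum>b\<in>UNIV. (xi $ a * xi $ b) * partial_deriv b (partial_deriv a ps) x)"
   by (simp add: sum_distrib_left mult.assoc)
 qed
 finally show ?thesis by (simp only: sum_pairs[of "\<lambda>a b. (xi $ a * xi $ b) * partial_deriv b (partial_deriv a ps) x"])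
qed

lemma weak_hessian_quadratic_nonneg:
 fixes xi :: "real^'n"
 assumes U: "open U" and v: "convex_on U v" "continuous_on U v" and H: "weak_hessian U v H"
 shows "AE x in lebesgue_on U. 0 \<le> xi \<bullet> (H x *v xi)"
proof -
 note loc = weak_hessian_loc[OF H]
 define h where "h x = (\<Sum>p\<in>UNIV. (xi $ fst p * xi $ snd p) * H x $ fst p $ snd p)" for x
 have h: "h x = xi \<bullet> (H x *v xi)" for x
  unfolding h_def sum_pairs[of "\<lambda>a b. (xi $ a * xi $ b) * H x $ a $ b"]
  by (simp add: inner_vec_def matrix_vector_mult_def sum_distrib_left mult_ac)
 have "AE x in lebesgue_on U. 0 \<le> h x" unfolding h_def
 proof (rule nonneg_of_test_functions[OF U in_Lp_loc_sum])
  show "in_Lp_loc 1 U (\<lambda>x. H x $ fst p $ snd p)" for p by (rule loc(2))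
  fix ps :: "real^'n => real" assume ps: "test_function U ps" "\<And>x. 0 \<le> ps x"
  have C: "Ck_on 2 UNIV ps" using ps by (simp add: test_function_def)
  have "(LINT x|lebesgue. (\<Sum>p\<in>UNIV. (xi $ fst p * xi $ snd p) * H x $ fst p $ snd p) * ps x) =
    (LINT x|lebesgue. (\<Sum>p\<in>UNIV. (xi $ fst p * xi $ snd p) * (H x $ fst p $ snd p * ps x)))"
   by (simp only: sum_distrib_right mult.assoc)
  also have "\<dots> = (\<Sum>p\<in>UNIV. (xi $ fst p * xi $ snd p) * (LINT x|lebesgue. H x $ fst p $ snd p * ps x))"
   using test_integrable[OF loc(2) ps(1)] by simp
  also have "\<dots> = (\<Sum>p\<in>UNIV. (xi $ fst p * xi $ snd p) * (LINT x|lebesgue. v x * partial_deriv (snd p) (partial_deriv (fst p) ps) x))"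
   by (simp only: weak_hessian_test[OF U H ps(1)])
  also have "\<dots> = (LINT x|lebesgue. (\<Sum>p\<in>UNIV. (xi $ fst p * xi $ snd p) * (v x * partial_deriv (snd p) (partial_deriv (fst p) ps) x)))"
   using test_integrable[OF loc(1) test_function_partial[OF test_function_partial[OF ps(1)]]] by simp
  also have "\<dots> = (LINT x|lebesgue. v x * frechet_derivative (\<lambda>y. frechet_derivative ps (at y) xi) (at x) xi)"
   unfolding frechet_twice[OF C] by (simp add: sum_distrib_left mult_ac)
  finally show "0 \<le> (LINT x|lebesgue. (\<Sum>p\<in>UNIV. (xi $ fst p * xi $ snd p) * H x $ fst p $ snd p) * ps x)"
   using convex_weak_second_derivative[OF U v ps, of xi] by simp
 qed simp
 thus ?thesis unfolding h .
qed

text \<open>The exceptional null set of \<open>weak_hessian_quadratic_nonneg\<close> depends on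
  \<open>xi\<close>; a countable dense set of directions and continuity of the form provide a common
  one.\<close>

lemma weak_hessian_psd:
 fixes v :: "real^'n => real"
 assumes U: "open U" and v: "convex_on U v" "continuous_on U v" and H: "weak_hessian U v H"
 shows "AE x in lebesgue_on U. psd (H x)"
proof -
 obtain Q :: "(real^'n) set" where Q: "countable Q" "\<And>X. open X ==> X \<noteq> {} ==> \<exists>d\<in>Q. d \<in> X"
  by (rule countable_dense_setE) blast
 have "AE x in lebesgue_on U. \<forall>xi\<in>Q. 0 \<le> xi \<bullet> (H x *v xi)"
  unfolding AE_ball_countable[OF Q(1)] using weak_hessian_quadratic_nonneg[OF U v H] by blast
 moreover have "AE x in lebesgue_on U. \<forall>i\<in>UNIV. \<forall>j\<in>UNIV. H x $ i $ j = H x $ j $ i"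
  by (intro AE_finite_allI finite_UNIV weak_hessian_symmetric[OF U H]) simp_all
 ultimately show ?thesis
 proof eventually_elim
  case (elim x)
  have "0 \<le> xi \<bullet> (H x *v xi)" for xi
  proof (rule ccontr)
   assume "\<not> ?thesis"
   hence "xi \<in> {xi. xi \<bullet> (H x *v xi) < 0}" by simp
   moreover have "open {xi. xi \<bullet> (H x *v xi) < 0}" by (intro open_Collect_less continuous_intros)
   ultimately obtain d where "d \<in> Q" "d \<bullet> (H x *v d) < 0" using Q(2) by blast
   thus False using elim(1) by force
  qed
  moreover have "transpose (H x) = H x" using elim(2) by (simp add: transpose_def)
  ultimately show ?case by (simp add: psd_def)
 qed
qed

text \<open>The cofactor matrix is \<open>det A\<close> times an inverse that dominates
  \<open>1 / trace A\<close> times the identity. As \<open>H\<close> is psd, the contraction is at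
  least \<open>lam / trace A * trace H\<close>, and the trace controls the norm.\<close>

lemma cofactor_trace_bound:
 fixes A H :: "real^'n^'n"
 assumes A: "pd A" "lam \<le> det A" "0 < lam" and H: "psd H"
  and le: "(\<Sum>i\<in>UNIV. \<Sum>j\<in>UNIV. cofactor_matrix A $ i $ j * H $ i $ j) \<le> F"
 shows "norm H \<le> (real CARD('n))\<^sup>2 / lam * F * trace A"
proof -
 have dA: "0 < det A" using A by simp
 obtain B where B: "A ** B = mat 1" "B ** A = mat 1" and pB: "pd B" by (rule pd_inverse[OF A(1)])
 have inv: "matrix_inv A ** A = mat 1" unfolding matrix_inv_def by (rule someI2[of _ B]) (use B in blast)+
 have "matrix_inv A = matrix_inv A ** (A ** B)" unfolding B(1) matrix_mul_rid ..
 also have "\<dots> = (matrix_inv A ** A) ** B" by (rule matrix_mul_assoc)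
 finally have B': "matrix_inv A = B" unfolding inv matrix_mul_lid .
 have trA: "0 < trace A"
 proof -
  have "0 < A $ i $ i" for i
   using A(1) inner_axis_mat[of i A i] unfolding pd_def by (metis axis_eq_0_iff zero_neq_one)
  thus ?thesis unfolding trace_def by (intro sum_pos) auto
 qed
 have "1 / trace A * (norm v)\<^sup>2 \<le> v \<bullet> (B *v v)" for v
  using norm_sq_le_trace_inverse[OF B(1) pd_imp_psd[OF A(1)], of v] trA by (simp add: pos_divide_le_eq mult.commute)
 hence 1: "1 / trace A * trace H \<le> trace (B ** H)" by (rule trace_le_trace_mult[OF H pd_imp_psd[OF pB]])
 have "(\<Sum>i\<in>UNIV. \<Sum>j\<in>UNIV. cofactor_matrix A $ i $ j * H $ i $ j) = det A * trace (B ** H)"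
 proof -
  have "H $ i $ j = H $ j $ i" for i j using H sym_entry by (auto simp: psd_def)
  thus ?thesis
   by (simp add: cofactor_matrix_def B' trace_def matrix_matrix_mult_def sum_distrib_left mult.assoc)
 qed
 hence 2: "det A * trace (B ** H) \<le> F" using le by simp
 have trH: "0 \<le> trace H" unfolding trace_def by (intro sum_nonneg) (simp add: psd_diag_nonneg H)
 have "lam * (1 / trace A * trace H) \<le> det A * trace (B ** H)"
  using 1 A trH trA dA by (intro mult_mono) auto
 hence "lam * trace H / trace A \<le> F" using 2 by simp
 hence "lam * trace H \<le> F * trace A" using trA by (simp only: pos_divide_le_eq)
 hence "trace H \<le> F * trace A / lam" using A(3) by (simp add: pos_le_divide_eq mult.commute)
 hence "(real CARD('n))\<^sup>2 * trace H \<le> (real CARD('n))\<^sup>2 * (F * trace A / lam)"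
  by (intro mult_left_mono) auto
 thus ?thesis using norm_matrix_le_trace[OF H] by simp
qed

section \<open>From the Laplacian to the weak Hessian\<close>

text \<open>Local integrability gives measurability on compact boxes, and countably many of them
  cover \<open>U\<close>.\<close>

lemma measurable_on_open_of_loc:
 fixes h :: "'a::euclidean_space => real"
 assumes "open U" "in_Lp_loc 1 U h"
 shows "h \<in> borel_measurable (lebesgue_on U)"
proof -
 obtain \<D> where \<D>: "countable \<D>" "\<D> \<subseteq> Pow U" "\<And>X. X \<in> \<D> ==> \<exists>a b. X = cbox a b" "\<Union>\<D> = U"
  using open_countable_Union_open_cbox[OF assms(1)] by blast
 show ?thesis
 proof (rule measurable_piecewise_restrict[of \<D>])
  show "countable \<D>" by fact
  fix X assume X: "X \<in> \<D>"
  hence XO: "X \<subseteq> U" "compact X" using \<D>(2,3) by (auto intro: compact_cbox)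
  show "X \<inter> space (lebesgue_on U) \<in> sets (lebesgue_on U)"
   using \<D>(3)[OF X] assms(1) by (auto simp: sets_restrict_space_iff)
  have "restrict_space (lebesgue_on U) X = lebesgue_on (U \<inter> X)"
   using \<D>(3)[OF X] assms(1) by (intro restrict_restrict_space) (auto simp: lborelD)
  hence "restrict_space (lebesgue_on U) X = lebesgue_on X" using XO by (simp add: Int_absorb1)
  thus "h \<in> borel_measurable (restrict_space (lebesgue_on U) X)"
   using assms(2) XO by (auto simp: in_Lp_loc_def in_Lp_def)
 qed (use \<D>(4) in auto)
qed

lemma Linf_norm_AE:
 assumes "in_Linf U f" shows "AE x in lebesgue_on U. \<bar>f x\<bar> \<le> Linf_norm U f"
 using esssup_AE[of "\<lambda>x. ereal \<bar>f x\<bar>" "lebesgue_on U"]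
proof eventually_elim
 case (elim x)
 thus ?case using assms unfolding in_Linf_def Linf_norm_def
  by (cases "esssup (lebesgue_on U) (\<lambda>x. ereal \<bar>f x\<bar>)") auto
qed

lemma Linf_norm_nonneg:
 fixes U :: "'a::euclidean_space set"
 assumes "in_Linf U f" "open U" "U \<noteq> {}" shows "0 \<le> Linf_norm U f"
proof (rule ccontr)
 assume neg: "\<not> ?thesis"
 have "AE x in lebesgue_on U. False"
  by (rule eventually_mono[OF Linf_norm_AE[OF assms(1)]]) (use neg in linarith)
 hence "AE x in lebesgue. x \<notin> U" using assms(2) by (simp add: AE_restrict_space_iff)
 hence "negligible U" using assms(2) AE_iff_null_sets[of U lebesgue] by (simp add: negligible_iff_null_sets)
 thus False using open_not_negligible[OF assms(2,3)] by simp
qed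

lemma Lp_bound_from_pointwise:
 fixes H :: "real^'n => real^'n^'n" and w :: "real^'n => real"
 assumes U: "open U" and gam: "1 < gam" and K: "0 \<le> K" and C: "0 \<le> C"
  and H: "\<And>i j. in_Lp_loc 1 U (\<lambda>x. H x $ i $ j)"
  and le: "AE x in lebesgue_on U. norm (H x) \<le> K * w x"
  and w: "\<And>x. x \<in> U ==> 0 \<le> w x" "(\<lambda>x. indicator U x * w x powr gam) \<in> borel_measurable borel"
  and int: "(\<integral>\<^sup>+x. ennreal (indicator U x * w x powr gam) \<partial>lborel) \<le> ennreal C"
 shows "in_Lp gam U H \<and> Lp_norm gam U H \<le> K * C powr (1 / gam)"
proof -
 have m: "H \<in> borel_measurable (lebesgue_on U)"
 proof (rule borel_measurable_euclidean_space[THEN iffD2], rule)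
  fix b :: "real^'n^'n" assume "b \<in> Basis"
  then obtain i j where "b = axis i (axis j 1)" by (auto simp: Basis_vec_def)
  thus "(\<lambda>x. H x \<bullet> b) \<in> borel_measurable (lebesgue_on U)"
   using measurable_on_open_of_loc[OF U H[of i j]] by (simp add: inner_axis)
 qed
 have mgam: "(\<lambda>x. norm (H x) powr gam) \<in> borel_measurable (lebesgue_on U)" using m by simp
 have "(\<integral>\<^sup>+x. ennreal (norm (H x) powr gam) \<partial>lebesgue_on U) \<le>
   (\<integral>\<^sup>+x. ennreal (K powr gam * (indicator U x * w x powr gam)) \<partial>lebesgue_on U)"
 proof (rule nn_integral_mono_AE)
  show "AE x in lebesgue_on U. ennreal (norm (H x) powr gam) \<le> ennreal (K powr gam * (indicator U x * w x powr gam))"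
   using le AE_space
  proof eventually_elim
   case (elim x)
   hence x: "x \<in> U" by simp
   have "norm (H x) powr gam \<le> (K * w x) powr gam" using elim gam by (intro powr_mono2) auto
   thus ?case using x by (simp add: powr_mult)
  qed
 qed
 also have "\<dots> = (\<integral>\<^sup>+x. ennreal (K powr gam * (indicator U x * w x powr gam)) * indicator U x \<partial>lebesgue)"
  using U by (intro nn_integral_restrict_space) (simp add: lborelD)
 also have "\<dots> = (\<integral>\<^sup>+x. ennreal (K powr gam) * ennreal (indicator U x * w x powr gam) \<partial>lebesgue)"
  by (intro nn_integral_cong) (auto simp: indicator_def ennreal_mult)
 also have "\<dots> = (\<integral>\<^sup>+x. ennreal (K powr gam) * ennreal (indicator U x * w x powr gam) \<partial>lborel)"
  by (rule nn_integral_completion)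
 also have "\<dots> = ennreal (K powr gam) * (\<integral>\<^sup>+x. ennreal (indicator U x * w x powr gam) \<partial>lborel)"
  using w(2) by (intro nn_integral_cmult) simp
 also have "\<dots> \<le> ennreal (K powr gam) * ennreal C" by (intro mult_left_mono int) simp
 also have "\<dots> = ennreal (K powr gam * C)" using C by (simp add: ennreal_mult)
 finally have nn: "(\<integral>\<^sup>+x. ennreal (norm (H x) powr gam) \<partial>lebesgue_on U) \<le> ennreal (K powr gam * C)" .
 have i: "integrable (lebesgue_on U) (\<lambda>x. norm (H x) powr gam)"
 proof (rule integrableI_bounded[OF mgam])
  show "(\<integral>\<^sup>+x. ennreal (norm (norm (H x) powr gam)) \<partial>lebesgue_on U) < \<infinity>"
   using le_less_trans[OF nn] by simp
 qed
 have "ennreal (LINT x|lebesgue_on U. norm (H x) powr gam) \<le> ennreal (K powr gam * C)"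
  using nn nn_integral_eq_integral[OF i] by simp
 hence I: "(LINT x|lebesgue_on U. norm (H x) powr gam) \<le> K powr gam * C" using C by simp
 have "Lp_norm gam U H \<le> (K powr gam * C) powr (1 / gam)"
  unfolding Lp_norm_def using I gam by (intro powr_mono2) auto
 also have "\<dots> = (K powr gam) powr (1 / gam) * C powr (1 / gam)" by (rule powr_mult)
 also have "(K powr gam) powr (1 / gam) = K" using K gam by (simp add: powr_powr)
 finally show ?thesis using m i by (simp add: in_Lp_def)
qed

section \<open>Boundary charts\<close>

lemma hyp_proj_linear: "bounded_linear (hyp_proj nu)" unfolding hyp_proj_def[abs_def]
 by (intro bounded_linear_sub bounded_linear_ident bounded_linear_compose[OF bounded_linear_scaleR_left bounded_linear_inner_left])

lemma hyp_proj_simps: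
 assumes "norm nu = 1"
 shows "hyp_proj nu x \<bullet> nu = 0" "hyp_proj nu nu = 0" "hyp_proj nu (x + y) = hyp_proj nu x + hyp_proj nu y"
  "hyp_proj nu (c *\<^sub>R x) = c *\<^sub>R hyp_proj nu x" "hyp_proj nu (x - y) = hyp_proj nu x - hyp_proj nu y"
  "hyp_proj nu (hyp_proj nu x) = hyp_proj nu x" "norm (hyp_proj nu x) \<le> norm x"
  "hyp_proj nu x + (x \<bullet> nu) *\<^sub>R nu = x" "(norm x)\<^sup>2 = (norm (hyp_proj nu x))\<^sup>2 + (x \<bullet> nu)\<^sup>2"
proof -
 have n: "nu \<bullet> nu = 1" using assms by (simp add: norm_eq_1)
 interpret bounded_linear "hyp_proj nu" by (rule hyp_proj_linear)
 show *: "hyp_proj nu x \<bullet> nu = 0" for x by (simp add: hyp_proj_def inner_diff_left n)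
 show "hyp_proj nu nu = 0" by (simp add: hyp_proj_def n)
 show "hyp_proj nu (x + y) = hyp_proj nu x + hyp_proj nu y" by (rule add)
 show "hyp_proj nu (c *\<^sub>R x) = c *\<^sub>R hyp_proj nu x" by (rule scaleR)
 show "hyp_proj nu (x - y) = hyp_proj nu x - hyp_proj nu y" by (rule diff)
 show "hyp_proj nu (hyp_proj nu x) = hyp_proj nu x" using * by (simp add: hyp_proj_def[of nu "hyp_proj nu x"])
 show d: "hyp_proj nu x + (x \<bullet> nu) *\<^sub>R nu = x" by (simp add: hyp_proj_def)
 show sq: "(norm x)\<^sup>2 = (norm (hyp_proj nu x))\<^sup>2 + (x \<bullet> nu)\<^sup>2"
 proof -
  have "(norm (hyp_proj nu x + (x \<bullet> nu) *\<^sub>R nu))\<^sup>2 = (norm (hyp_proj nu x))\<^sup>2 + (norm ((x \<bullet> nu) *\<^sub>R nu))\<^sup>2"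
   by (rule norm_add_Pythagorean) (simp add: orthogonal_def *)
  thus ?thesis by (simp add: d assms)
 qed
 hence "(norm (hyp_proj nu x))\<^sup>2 \<le> (norm x)\<^sup>2" by simp
 thus "norm (hyp_proj nu x) \<le> norm x" by simp
qed

lemma Ck_on_2I:
 assumes W: "open W" and d: "\<And>z. z \<in> W ==> (G has_derivative G' z) (at z)"
  and d2: "\<And>z u. z \<in> W ==> ((\<lambda>z. G' z u) has_derivative G'' u z) (at z)"
  and c: "\<And>u k. continuous_on W (\<lambda>z. G'' u z k)"
 shows "Ck_on 2 W G"
proof -
 have f: "frechet_derivative G (at z) = G' z" if "z \<in> W" for z
  using frechet_derivative_at[OF d[OF that]] by simp
 have d2': "((\<lambda>z. frechet_derivative G (at z) u) has_derivative G'' u z) (at z)" if "z \<in> W" for z u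
  by (rule has_derivative_transform_within_open[OF d2[OF that] W that]) (simp add: f)
 have "frechet_derivative (\<lambda>z. frechet_derivative G (at z) u) (at z) = G'' u z" if "z \<in> W" for z u
  using frechet_derivative_at[OF d2'[OF that]] by simp
 hence "continuous_on W (\<lambda>z. frechet_derivative (\<lambda>z. frechet_derivative G (at z) u) (at z) k)" for u k
  using c[of u k] by simp
 thus ?thesis unfolding numeral_2_eq_2 using d d2' by (auto simp: differentiable_def) blast
qed

text \<open>A level set as a graph over its tangent plane: \<open>x \<mapsto> hyp_proj nu x + F x nu\<close> is a local
 diffeomorphism because \<open>F\<close> is increasing in direction \<open>nu\<close>.\<close>

lemma graph_of_level_set:
 fixes y nu :: "'a::euclidean_space" and F :: "'a => real"
 assumes nu: "norm nu = 1" and r: "0 < r"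
  and F1: "\<And>x. x \<in> ball y r ==> (F has_derivative F' x) (at x)"
  and F2: "\<And>x u. x \<in> ball y r ==> ((\<lambda>x. F' x u) has_derivative F'' u x) (at x)"
  and F3: "\<And>u h. continuous_on (ball y r) (\<lambda>x. F'' u x h)"
  and F0: "F y = 0" "0 < F' y nu" and U: "U \<inter> ball y r = {x \<in> ball y r. 0 < F x}"
  and tang: "\<And>sg. sg \<bullet> nu = 0 ==> F' y sg = 0"
 obtains s G where "boundary_chart 2 U y nu s G"
  "\<And>sg. sg \<bullet> nu = 0 ==> frechet_derivative G (at (hyp_proj nu y)) sg = 0"
proof -
 define P where "P = hyp_proj nu"
 note P = hyp_proj_simps[OF nu, folded P_def]
 have n1: "nu \<bullet> nu = 1" using nu by (simp add: norm_eq_1)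
 have Pl: "bounded_linear P" unfolding P_def by (rule hyp_proj_linear)
 have Pd: "(P has_derivative P) (at x)" for x by (rule bounded_linear_imp_has_derivative[OF Pl])
 have Pc: "continuous_on S P" for S by (rule linear_continuous_on[OF Pl])
 have cF': "continuous_on (ball y r) (\<lambda>x. F' x u)" for u
  using F2[of _ u] by (auto intro!: continuous_at_imp_continuous_on has_derivative_continuous)
 obtain dlt where dlt: "0 < dlt" "dlt \<le> r" "\<And>x. x \<in> ball y dlt ==> 0 < F' x nu"
 proof -
  have "open (ball y r \<inter> (\<lambda>x. F' x nu) -` {0<..})" by (intro continuous_open_preimage cF') auto
  then obtain dlt where "0 < dlt" "ball y dlt \<subseteq> ball y r \<inter> (\<lambda>x. F' x nu) -` {0<..}"
   using F0 r by (metis (no_types, lifting) IntI centre_in_ball greaterThan_iff open_contains_ball vimageI)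
  thus ?thesis using that[of "min dlt r"] r by force
 qed
 define S where "S = ball y dlt"
 have Sr: "S \<subseteq> ball y r" using dlt(2) by (auto simp: S_def)
 have dF: "(F has_derivative F' x) (at x)" if "x \<in> S" for x using F1 Sr that by blast
 have lF: "linear (F' x)" if "x \<in> S" for x using dF[OF that] by (rule has_derivative_linear)
 have incr: "F x < F (x + t *\<^sub>R nu)" if "x \<in> S" "x + t *\<^sub>R nu \<in> S" "0 < t" for x t
 proof -
  have "\<exists>z. z > 0 \<and> z < t \<and> F (x + t *\<^sub>R nu) - F (x + 0 *\<^sub>R nu) = (t - 0) * F' (x + z *\<^sub>R nu) nu"
  proof (rule MVT2[OF that(3)])
   fix a assume a: "0 \<le> a" "a \<le> t"
   have "x + a *\<^sub>R nu = (1 - a / t) *\<^sub>R x + (a / t) *\<^sub>R (x + t *\<^sub>R nu)"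
    using that(3) by (simp add: algebra_simps)
   hence xa: "x + a *\<^sub>R nu \<in> S"
    using convexD_alt[OF convex_ball, of x y dlt "x + t *\<^sub>R nu" "a / t"] that a by (simp add: S_def)
   show "((\<lambda>a. F (x + a *\<^sub>R nu)) has_real_derivative F' (x + a *\<^sub>R nu) nu) (at a)"
    by (rule DERIV_along_line[OF dF[OF xa]])
  qed
  then obtain z where z: "0 < z" "z < t" "F (x + t *\<^sub>R nu) - F x = t * F' (x + z *\<^sub>R nu) nu" by auto
  have "x + z *\<^sub>R nu = (1 - z / t) *\<^sub>R x + (z / t) *\<^sub>R (x + t *\<^sub>R nu)"
   using that(3) by (simp add: algebra_simps)
  hence "x + z *\<^sub>R nu \<in> S"
   using convexD_alt[OF convex_ball, of x y dlt "x + t *\<^sub>R nu" "z / t"] that z by (simp add: S_def)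
  hence "0 < t * F' (x + z *\<^sub>R nu) nu" using dlt(3) that(3) by (simp add: S_def)
  thus ?thesis using z(3) by simp
 qed
 \<comment> \<open>Along lines in direction \<open>nu\<close> the values of \<open>F\<close> are
   ordered as the heights are; this turns \<open>0 < F x\<close> into lying above the graph.\<close>
 have order: "F x1 < F x2 \<longleftrightarrow> x1 \<bullet> nu < x2 \<bullet> nu" if "x1 \<in> S" "x2 \<in> S" "P x1 = P x2" for x1 x2
 proof -
  have "x2 - x1 = (P x2 + (x2 \<bullet> nu) *\<^sub>R nu) - (P x1 + (x1 \<bullet> nu) *\<^sub>R nu)" by (simp only: P(8))
  also have "\<dots> = (x2 \<bullet> nu - x1 \<bullet> nu) *\<^sub>R nu" by (simp add: that(3) scaleR_left_diff_distrib)
  finally have d: "x2 - x1 = (x2 \<bullet> nu - x1 \<bullet> nu) *\<^sub>R nu" .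
  hence e: "x2 = x1 + (x2 \<bullet> nu - x1 \<bullet> nu) *\<^sub>R nu" by (metis add.commute diff_add_cancel)
  have "x1 - x2 = (x1 \<bullet> nu - x2 \<bullet> nu) *\<^sub>R nu" using d by (metis minus_diff_eq scaleR_minus_left)
  hence e': "x1 = x2 + (x1 \<bullet> nu - x2 \<bullet> nu) *\<^sub>R nu" by (metis add.commute diff_add_cancel)
  consider "x1 \<bullet> nu < x2 \<bullet> nu" | "x1 \<bullet> nu = x2 \<bullet> nu" | "x2 \<bullet> nu < x1 \<bullet> nu" by linarith
  thus ?thesis
  proof cases
   case 1 thus ?thesis using incr[of x1 "x2 \<bullet> nu - x1 \<bullet> nu"] that e[symmetric] by simp
  next
   case 2 thus ?thesis using e by simp
  next
   case 3 thus ?thesis using incr[of x2 "x1 \<bullet> nu - x2 \<bullet> nu"] that e'[symmetric] by simp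
  qed
 qed
 define Psi where "Psi x = P x + F x *\<^sub>R nu" for x
 have PsiP: "P (Psi x) = P x" "Psi x \<bullet> nu = F x" for x by (simp_all add: Psi_def P inner_add_left n1)
 have cPsi: "continuous_on S Psi" unfolding Psi_def using dF by (intro continuous_intros Pc)
   (auto intro!: continuous_at_imp_continuous_on has_derivative_continuous)
 have inj: "inj_on Psi S"
 proof (rule inj_onI)
  fix x1 x2 assume x: "x1 \<in> S" "x2 \<in> S" "Psi x1 = Psi x2"
  hence "P x1 = P x2" "F x1 = F x2" using PsiP by metis+
  hence "x1 \<bullet> nu = x2 \<bullet> nu" using order[of x1 x2] order[of x2 x1] x by force
  thus "x1 = x2" using P(8)[of x1] P(8)[of x2] \<open>P x1 = P x2\<close> by metis
 qed
 have oS: "open S" by (simp add: S_def)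
 \<comment> \<open>Invariance of domain supplies the open image and the continuous inverse, whose
   differentiability then follows pointwise from that of \<open>Psi\<close>.\<close>
 obtain Tht where Tht: "homeomorphism S (Psi ` S) Psi Tht"
  using invariance_of_domain_homeomorphism[OF oS cPsi _ inj] by blast
 have oPsi: "open (Psi ` S)" by (rule invariance_of_domain[OF cPsi oS inj])
 have cTht: "continuous_on (Psi ` S) Tht" and ThtPsi: "\<And>x. x \<in> S ==> Tht (Psi x) = x"
  using Tht by (auto simp: homeomorphism_def)
 define W where "W = P -` (Psi ` S)"
 have oW: "open W" unfolding W_def by (intro open_vimage oPsi Pc)
 define Y where "Y z = Tht (P z)" for z
 have Y: "Y z \<in> S" "Psi (Y z) = P z" "P (Y z) = P z" "F (Y z) = 0" if "z \<in> W" for z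
 proof -
  obtain x where x: "x \<in> S" "P z = Psi x" using \<open>z \<in> W\<close> by (auto simp: W_def)
  thus 1: "Y z \<in> S" "Psi (Y z) = P z" by (auto simp: Y_def ThtPsi)
  show "P (Y z) = P z" using PsiP(1)[of "Y z"] 1 P by simp
  show "F (Y z) = 0" using PsiP(2)[of "Y z"] 1 P by simp
 qed
 define G where "G z = Y z \<bullet> nu" for z
 define G' where "G' z k = - F' (Y z) (P k) / F' (Y z) nu" for z k
 define Y' where "Y' z k = P k + G' z k *\<^sub>R nu" for z k
 have dY: "(Y has_derivative Y' z) (at z)" if z: "z \<in> W" for z
 proof -
  have YS: "Y z \<in> S" by (rule Y[OF z])
  \<comment> \<open>The inverse of the derivative of \<open>Psi\<close> at
    \<open>Y z\<close>.\<close>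
  define T where "T k = P k + ((k \<bullet> nu - F' (Y z) (P k)) / F' (Y z) nu) *\<^sub>R nu" for k
  have pos: "0 < F' (Y z) nu" using dlt(3) YS by (simp add: S_def)
  have dPsi: "(Psi has_derivative (\<lambda>h. P h + F' (Y z) h *\<^sub>R nu)) (at (Y z))"
   unfolding Psi_def by (auto intro!: derivative_eq_intros Pd dF[OF YS])
  have blF: "bounded_linear (F' (Y z))" using dF[OF YS] by auto
  have blT: "bounded_linear T" unfolding T_def
   by (intro bounded_linear_add Pl bounded_linear_compose[OF bounded_linear_scaleR_left]
     bounded_linear_compose[OF bounded_linear_divide] bounded_linear_sub bounded_linear_inner_left
     bounded_linear_compose[OF blF Pl])
  have "T \<circ> (\<lambda>h. P h + F' (Y z) h *\<^sub>R nu) = id"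
  proof
   fix h
   have Pk: "P (P h + F' (Y z) h *\<^sub>R nu) = P h" by (simp add: P)
   have kn: "(P h + F' (Y z) h *\<^sub>R nu) \<bullet> nu = F' (Y z) h" by (simp add: inner_add_left P n1)
   have "F' (Y z) h = F' (Y z) (P h + (h \<bullet> nu) *\<^sub>R nu)" by (simp add: P(8))
   also have "\<dots> = F' (Y z) (P h) + (h \<bullet> nu) * F' (Y z) nu"
    by (simp add: linear_add[OF lF[OF YS]] linear_scale[OF lF[OF YS]])
   finally have "F' (Y z) h = F' (Y z) (P h) + (h \<bullet> nu) * F' (Y z) nu" .
   hence "(F' (Y z) h - F' (Y z) (P h)) / F' (Y z) nu = h \<bullet> nu" using pos by simp
   thus "(T \<circ> (\<lambda>h. P h + F' (Y z) h *\<^sub>R nu)) h = id h" by (simp add: T_def Pk kn P(8))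
  qed
  from has_derivative_inverse_dieudonne[OF oS oPsi cPsi cTht ThtPsi YS dPsi blT this]
  have "(Tht has_derivative T) (at (P z))" by (simp add: Y(2)[OF z])
  from has_derivative_compose[OF Pd this]
  have "(Y has_derivative (\<lambda>k. T (P k))) (at z)" by (simp add: Y_def[abs_def])
  moreover have "T (P k) = Y' z k" for k by (simp add: T_def Y'_def G'_def P)
  ultimately show ?thesis by simp
 qed
 have cY: "continuous_on W Y"
  using dY by (auto intro!: continuous_at_imp_continuous_on has_derivative_continuous)
 have Yball: "Y z \<in> ball y r" if "z \<in> W" for z using Y(1)[OF that] Sr by blast
 have dG: "(G has_derivative G' z) (at z)" if z: "z \<in> W" for z
 proof -
  have "((\<lambda>z. Y z \<bullet> nu) has_derivative (\<lambda>k. Y' z k \<bullet> nu)) (at z)"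
   by (intro has_derivative_inner_left dY z)
  thus ?thesis by (simp add: G_def[abs_def] Y'_def inner_add_left P n1)
 qed
 have Fpos: "0 < F' (Y z) nu" if "z \<in> W" for z using dlt(3) Y(1)[OF that] by (simp add: S_def)
 define G'' where "G'' u z k = - ((F'' (P u) (Y z) (Y' z k) * F' (Y z) nu - F' (Y z) (P u) * F'' nu (Y z) (Y' z k)) /
   (F' (Y z) nu * F' (Y z) nu))" for u z k
 have dG2: "((\<lambda>z. G' z u) has_derivative G'' u z) (at z)" if z: "z \<in> W" for z u
 proof -
  have dd: "((\<lambda>z. F' (Y z) w) has_derivative (\<lambda>k. F'' w (Y z) (Y' z k))) (at z)" for w
   by (rule has_derivative_compose[OF dY[OF z], where g = "\<lambda>x. F' x w"]) (rule F2[OF Yball[OF z]])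
  have "((\<lambda>z. - (F' (Y z) (P u) / F' (Y z) nu)) has_derivative G'' u z) (at z)"
   unfolding G''_def using Fpos[OF z] by (intro has_derivative_minus has_derivative_divide'[OF dd dd]) simp
  thus ?thesis by (simp add: G'_def)
 qed
 have cG2: "continuous_on W (\<lambda>z. G'' u z k)" for u k
 proof -
  have c1: "continuous_on W (\<lambda>z. F' (Y z) w)" for w
   by (rule continuous_on_compose2[OF cF' cY]) (use Yball in blast)
  have c2: "continuous_on W (\<lambda>z. F'' w (Y z) h)" for w h
   by (rule continuous_on_compose2[OF F3 cY]) (use Yball in blast)
  have "continuous_on W (\<lambda>z. F'' w (Y z) (Y' z k))" for w
  proof -
   have "F'' w (Y z) (Y' z k) = F'' w (Y z) (P k) + (- F' (Y z) (P k) / F' (Y z) nu) * F'' w (Y z) nu"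
    if "z \<in> W" for z
   proof -
    have l: "linear (F'' w (Y z))" using F2[OF Yball[OF that]] by (rule has_derivative_linear)
    show ?thesis unfolding Y'_def G'_def linear_add[OF l] linear_scale[OF l] by simp
   qed
   moreover have "continuous_on W (\<lambda>z. F'' w (Y z) (P k) + (- F' (Y z) (P k) / F' (Y z) nu) * F'' w (Y z) nu)"
    by (intro continuous_intros c1 c2) (use Fpos in force)
   ultimately show ?thesis by simp
  qed
  moreover have "\<forall>z\<in>W. F' (Y z) nu * F' (Y z) nu \<noteq> 0" using Fpos by force
  ultimately show ?thesis unfolding G''_def by (intro continuous_intros c1)
 qed
 have yS: "y \<in> S" using dlt by (simp add: S_def)
 have Psiy: "Psi y = P y" by (simp add: Psi_def F0)
 have yW: "P y \<in> W" "y \<in> W" using yS Psiy by (auto simp: W_def P intro!: image_eqI[of _ _ y])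
 have Yy: "Y (P y) = y" using ThtPsi[OF yS] by (simp add: Y_def P Psiy)
 obtain s0 where s0: "0 < s0" "ball (P y) s0 \<subseteq> W" using oW yW open_contains_ball by blast
 define s where "s = min s0 dlt"
 have s: "0 < s" "s \<le> s0" "s \<le> dlt" using s0 dlt by (auto simp: s_def)
 have "boundary_chart 2 U y nu s G" unfolding boundary_chart_def
 proof (intro conjI nu s(1))
  have sub: "ball (hyp_proj nu y) s \<subseteq> W" using s s0 by (force simp: P_def)
  show "Ck_on 2 (ball (hyp_proj nu y) s) G"
   by (rule Ck_on_2I[OF open_ball dG dG2 continuous_on_subset[OF cG2 sub]]) (use sub in blast)+
  have "0 < F x \<longleftrightarrow> G (P x) < x \<bullet> nu" if x: "x \<in> ball y s" for x
  proof -
   have "dist (P y) (P x) \<le> dist y x" using P(7)[of "y - x"] by (simp add: dist_norm P)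
   hence xW: "P x \<in> W" using x s s0 by auto
   have xS: "x \<in> S" using x s by (simp add: S_def)
   show ?thesis using order[OF Y(1)[OF xW] xS] Y(3,4)[OF xW] P by (simp add: G_def)
  qed
  moreover have "U \<inter> ball y s = {x \<in> ball y s. 0 < F x}" using U s dlt by auto
  ultimately show "U \<inter> ball y s = {x \<in> ball y s. G (hyp_proj nu x) < x \<bullet> nu}" by (auto simp: P_def)
 qed
 moreover have "frechet_derivative G (at (hyp_proj nu y)) sg = 0" if "sg \<bullet> nu = 0" for sg
 proof -
  have "frechet_derivative G (at (P y)) sg = G' (P y) sg" using frechet_derivative_at[OF dG[OF yW(1)]] by simp
  also have "\<dots> = 0" using tang[of "P sg"] by (simp add: G'_def Yy P)
  finally show ?thesis by (simp add: P_def)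
 qed
 ultimately show ?thesis by (rule that)
qed

lemma Ck_on_2_continuous_derivative:
 assumes "Ck_on 2 S f" shows "continuous_on S (\<lambda>x. frechet_derivative f (at x) u)"
 using Ck_on_2D(2)[OF assms] by (auto intro!: continuous_at_imp_continuous_on has_derivative_continuous)

lemma chart_frontier:
 assumes U: "open U" and c: "boundary_chart k U y0 nu r g" and y: "y \<in> frontier U" "y \<in> ball y0 r"
 shows "y \<bullet> nu = g (hyp_proj nu y)"
proof -
 define F where "F x = x \<bullet> nu - g (hyp_proj nu x)" for x
 have nu: "norm nu = 1" and g: "Ck_on k (ball (hyp_proj nu y0) r) g"
  and eq: "U \<inter> ball y0 r = {x \<in> ball y0 r. g (hyp_proj nu x) < x \<bullet> nu}"
  using c by (auto simp: boundary_chart_def)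
 have P: "hyp_proj nu x \<in> ball (hyp_proj nu y0) r" if "x \<in> ball y0 r" for x
  using that hyp_proj_simps(7)[OF nu, of "y0 - x"] by (simp add: dist_norm hyp_proj_simps(5)[OF nu])
 have "continuous_on (ball y0 r) F"
  unfolding F_def by (intro continuous_intros continuous_on_compose2[OF Ck_on_continuous[OF g]]
    linear_continuous_on[OF hyp_proj_linear]) (use P in auto)
 hence op: "open (ball y0 r \<inter> F -` {..<0})" by (intro continuous_open_preimage) auto
 have "y \<notin> U" using y(1) U by (simp add: frontier_def interior_open)
 hence "y \<notin> {x \<in> ball y0 r. g (hyp_proj nu x) < x \<bullet> nu}" unfolding eq[symmetric] by simp
 hence "F y \<le> 0" using y(2) by (simp add: F_def)
 moreover have "\<not> F y < 0"
 proof
  assume "F y < 0"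
  hence "y \<in> ball y0 r \<inter> F -` {..<0}" using y by simp
  moreover have "y \<in> closure U" using y(1) by (simp add: frontier_def)
  ultimately obtain x where "x \<in> U" "x \<in> ball y0 r" "F x < 0"
   using open_Int_closure_eq_empty[OF op, of U] by blast
  note x = this
  hence "x \<in> {x \<in> ball y0 r. g (hyp_proj nu x) < x \<bullet> nu}" unfolding eq[symmetric] by blast
  thus False using x(3) by (simp add: F_def)
 qed
 ultimately show ?thesis by (simp add: F_def)
qed

lemma linear_inner_sum:
 fixes h :: "'a::euclidean_space => real"
 assumes "linear h" shows "h v = (\<Sum>b\<in>Basis. h b *\<^sub>R b) \<bullet> v" "h v = (\<Sum>b\<in>Basis. (v \<bullet> b) * h b)"
proof -
 have "h v = h (\<Sum>b\<in>Basis. (v \<bullet> b) *\<^sub>R b)" by (simp add: euclidean_representation)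
 thus 1: "h v = (\<Sum>b\<in>Basis. (v \<bullet> b) * h b)" using assms by (simp add: linear_sum linear_scale)
 thus "h v = (\<Sum>b\<in>Basis. h b *\<^sub>R b) \<bullet> v" unfolding 1 inner_sum_left by (simp add: inner_commute[of v] mult.commute)
qed

text \<open>A given chart has an arbitrary direction, while principal curvatures refer to the inner
  normal. The same piece of boundary is the zero set of \<open>F\<close>, and \<open>nu\<close> is
  the normalized gradient of \<open>F\<close> at \<open>y\<close>.\<close>

lemma normal_chart:
 fixes U :: "'a::euclidean_space set"
 assumes U: "open U" and y: "y \<in> frontier U" and c: "boundary_chart 2 U y nu0 r g"
 obtains nu s G where "boundary_chart 2 U y nu s G"
  "\<And>sg. sg \<bullet> nu = 0 ==> frechet_derivative G (at (hyp_proj nu y)) sg = 0"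
proof -
 define P where "P = hyp_proj nu0"
 have nu0: "norm nu0 = 1" and r: "0 < r" and g: "Ck_on 2 (ball (P y) r) g"
  and eq: "U \<inter> ball y r = {x \<in> ball y r. g (P x) < x \<bullet> nu0}"
  using c by (auto simp: boundary_chart_def P_def)
 note P = hyp_proj_simps[OF nu0, folded P_def]
 have Pl: "bounded_linear P" unfolding P_def by (rule hyp_proj_linear)
 have Pd: "(P has_derivative P) (at x)" for x by (rule bounded_linear_imp_has_derivative[OF Pl])
 have Pb: "P x \<in> ball (P y) r" if "x \<in> ball y r" for x
  using that P(7)[of "y - x"] by (simp add: dist_norm P(5))
 define F where "F x = x \<bullet> nu0 - g (P x)" for x
 define F' where "F' x h = h \<bullet> nu0 - frechet_derivative g (at (P x)) (P h)" for x h
 define F'' where "F'' u x h = - frechet_derivative (\<lambda>z. frechet_derivative g (at z) (P u)) (at (P x)) (P h)" for u x h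
 have dF: "(F has_derivative F' x) (at x)" if "x \<in> ball y r" for x unfolding F_def F'_def
  by (intro has_derivative_diff has_derivative_inner_left has_derivative_ident
    has_derivative_compose[OF Pd, where g = g] Ck_on_2D(1)[OF g] Pb that)
 have dF': "((\<lambda>x. F' x u) has_derivative F'' u x) (at x)" if "x \<in> ball y r" for x u
 proof -
  have "((\<lambda>x. frechet_derivative g (at (P x)) (P u)) has_derivative
    (\<lambda>h. frechet_derivative (\<lambda>z. frechet_derivative g (at z) (P u)) (at (P x)) (P h))) (at x)"
   by (rule has_derivative_compose[OF Pd, where g = "\<lambda>z. frechet_derivative g (at z) (P u)"])
    (rule Ck_on_2D(2)[OF g Pb[OF that]])
  from has_derivative_diff[OF has_derivative_const this, of "u \<bullet> nu0"]
  show ?thesis by (simp add: F'_def F''_def[abs_def])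
 qed
 have cF'': "continuous_on (ball y r) (\<lambda>x. F'' u x h)" for u h unfolding F''_def
  by (intro continuous_intros continuous_on_compose2[OF Ck_on_2D(3)[OF g] linear_continuous_on[OF Pl]])
   (use Pb in auto)
 have yb: "y \<in> ball y r" using r by simp
 define p where "p = (\<Sum>b\<in>Basis. F' y b *\<^sub>R b)"
 have p: "F' y h = p \<bullet> h" for h
  unfolding p_def by (rule linear_inner_sum(1)[OF has_derivative_linear[OF dF[OF yb]]])
 have "F' y nu0 = 1"
  using nu0 linear_0[OF has_derivative_linear[OF Ck_on_2D(1)[OF g Pb[OF yb]]]] by (simp add: F'_def P norm_eq_1)
 hence p0: "p \<noteq> 0" using p[of nu0] by auto
 define nu where "nu = (1 / norm p) *\<^sub>R p"
 have nu: "norm nu = 1" using p0 by (simp add: nu_def)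
 show thesis
 proof (rule graph_of_level_set[OF nu r dF dF' cF''])
  show "F y = 0" using chart_frontier[OF U c y yb] by (simp add: F_def P_def)
  show "0 < F' y nu" using p0 by (simp add: p nu_def)
  show "U \<inter> ball y r = {x \<in> ball y r. 0 < F x}" unfolding eq F_def by auto
  show "F' y sg = 0" if "sg \<bullet> nu = 0" for sg using that p0 by (simp add: p nu_def inner_commute)
 qed (use that in auto)
qed

lemma linear_coefficient_zero:
 fixes b c :: real assumes "\<And>t. 0 \<le> 2 * t * b + t\<^sup>2 * c" shows "b = 0"
proof (rule ccontr)
 assume b: "b \<noteq> 0"
 define K where "K = \<bar>c\<bar> + 1"
 have K: "0 < K" "c \<le> K" by (auto simp: K_def)
 have "0 \<le> 2 * (- b / K) * b + (- b / K)\<^sup>2 * c" by (rule assms)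
 also have "\<dots> \<le> 2 * (- b / K) * b + (- b / K)\<^sup>2 * K" using K by (intro add_left_mono mult_left_mono) auto
 also have "\<dots> = - (b\<^sup>2 / K)" by (simp add: power2_eq_square)
 also have "\<dots> < 0" using b K by simp
 finally show False by simp
qed

text \<open>The minimum of the quadratic form over unit tangent vectors is attained at an
  eigenvector, by the first-order condition, so it is itself a principal curvature.\<close>

lemma hessian_ge_of_principal_curvature:
 fixes U :: "'a::euclidean_space set"
 assumes c: "boundary_chart 2 U y nu r G"
  and tang: "\<And>sg. sg \<bullet> nu = 0 ==> frechet_derivative G (at (hyp_proj nu y)) sg = 0"
  and kap: "\<And>kap. principal_curvature U y kap ==> kap0 \<le> kap" and tau: "tau \<bullet> nu = 0"
 shows "kap0 * (norm tau)\<^sup>2 \<le> frechet_derivative (\<lambda>x. frechet_derivative G (at x) tau) (at (hyp_proj nu y)) tau"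
proof -
 define z where "z = hyp_proj nu y"
 have r: "0 < r" and CG: "Ck_on 2 (ball z r) G" using c by (auto simp: boundary_chart_def z_def)
 have z: "z \<in> ball z r" using r by simp
 define Q where "Q u h = frechet_derivative (\<lambda>x. frechet_derivative G (at x) u) (at z) h" for u h
 have sym: "Q u h = Q h u" for u h unfolding Q_def by (rule Ck_on_2_symmetric[OF CG open_ball z])
 have lin: "linear (Q u)" for u
  unfolding Q_def[abs_def] using Ck_on_2D(2)[OF CG z] by (rule has_derivative_linear)
 have blin: "bounded_linear (Q u)" for u unfolding Q_def[abs_def] using Ck_on_2D(2)[OF CG z] by auto
 have Q2: "Q (a + t *\<^sub>R b) (a + t *\<^sub>R b) = Q a a + 2 * t * Q a b + t\<^sup>2 * Q b b" for a b t
 proof -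
  have "Q (a + t *\<^sub>R b) (a + t *\<^sub>R b) = Q (a + t *\<^sub>R b) a + t * Q (a + t *\<^sub>R b) b"
   by (simp add: linear_add[OF lin] linear_scale[OF lin])
  also have "\<dots> = Q a (a + t *\<^sub>R b) + t * Q b (a + t *\<^sub>R b)" by (simp only: sym[of "a + t *\<^sub>R b"])
  also have "\<dots> = Q a a + 2 * t * Q a b + t\<^sup>2 * Q b b"
   by (simp add: linear_add[OF lin] linear_scale[OF lin] sym[of b a] algebra_simps power2_eq_square)
  finally show ?thesis .
 qed
 have Qs: "Q (t *\<^sub>R b) (t *\<^sub>R b) = t\<^sup>2 * Q b b" for t b
  using Q2[of 0 t b] linear_0[OF lin] sym[of 0 b] by simp
 define T where "T = {tau. tau \<bullet> nu = 0 \<and> norm tau = 1}"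
 have T: "compact T"
 proof -
  have "T = {tau. tau \<bullet> nu = 0} \<inter> sphere 0 1" by (auto simp: T_def)
  moreover have "closed {tau. tau \<bullet> nu = 0}" by (intro closed_Collect_eq continuous_intros)
  ultimately show ?thesis by auto
 qed
 have "kap0 * (norm tau)\<^sup>2 \<le> Q tau tau"
 proof (cases "tau = 0")
  \<comment> \<open>This case includes dimension one, where there is no unit tangent vector.\<close>
  case True
  thus ?thesis using linear_0[OF lin] by simp
 next
  case False
  have "(1 / norm tau) *\<^sub>R tau \<in> T" using tau False by (simp add: T_def)
  hence Tne: "T \<noteq> {}" by blast
  have "Q tau tau = (\<Sum>b\<in>Basis. (tau \<bullet> b) * Q b tau)" for tau
  proof -
   have "Q tau tau = (\<Sum>b\<in>Basis. (tau \<bullet> b) * Q tau b)" by (rule linear_inner_sum(2)[OF lin])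
   also have "\<dots> = (\<Sum>b\<in>Basis. (tau \<bullet> b) * Q b tau)"
    by (intro sum.cong refl arg_cong2[where f = "(*)"] sym)
   finally show ?thesis .
  qed
  note Qe = this
  have "continuous_on T (\<lambda>tau. \<Sum>b\<in>Basis. (tau \<bullet> b) * Q b tau)"
  proof (intro continuous_on_sum continuous_on_mult)
   show "continuous_on T (Q b)" for b by (rule linear_continuous_on[OF blin])
   show "continuous_on T (\<lambda>tau. tau \<bullet> b)" for b by (intro continuous_intros)
  qed
  hence "continuous_on T (\<lambda>tau. Q tau tau)" by (rule continuous_on_eq) (rule Qe[symmetric])
  from continuous_attains_inf[OF T Tne this]
  obtain tau0 where tau0: "tau0 \<in> T" "\<And>tau. tau \<in> T ==> Q tau0 tau0 \<le> Q tau tau" by blast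
  define m where "m = Q tau0 tau0"
  have ge: "m * (norm w)\<^sup>2 \<le> Q w w" if w: "w \<bullet> nu = 0" for w
  proof (cases "w = 0")
   case True thus ?thesis using linear_0[OF lin] by simp
  next
   case False
   hence "(1 / norm w) *\<^sub>R w \<in> T" using w by (simp add: T_def)
   from tau0(2)[OF this] have "m \<le> (1 / norm w)\<^sup>2 * Q w w" unfolding Qs m_def .
   thus ?thesis using False by (simp add: field_simps)
  qed
  have n0: "tau0 \<bullet> nu = 0" "norm tau0 = 1" using tau0(1) by (auto simp: T_def)
  have "Q tau0 sg - m * (tau0 \<bullet> sg) = 0" if sg: "sg \<bullet> nu = 0" for sg
  proof (rule linear_coefficient_zero)
   fix t
   have "m * (norm (tau0 + t *\<^sub>R sg))\<^sup>2 \<le> Q (tau0 + t *\<^sub>R sg) (tau0 + t *\<^sub>R sg)"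
    by (rule ge) (simp add: inner_add_left n0 sg)
   moreover have "(norm (tau0 + t *\<^sub>R sg))\<^sup>2 = 1 + 2 * t * (tau0 \<bullet> sg) + t\<^sup>2 * (norm sg)\<^sup>2"
   proof -
    have "tau0 \<bullet> tau0 = 1" using n0 by (simp add: norm_eq_1)
    thus ?thesis unfolding power2_norm_eq_inner
     by (simp add: inner_add_left inner_add_right inner_commute[of sg tau0]) (simp add: power2_eq_square algebra_simps)
   qed
   ultimately show "0 \<le> 2 * t * (Q tau0 sg - m * (tau0 \<bullet> sg)) + t\<^sup>2 * (Q sg sg - m * (norm sg)\<^sup>2)"
    unfolding Q2 m_def[symmetric] by (simp add: algebra_simps)
  qed
  hence eig: "\<forall>sg. sg \<bullet> nu = 0 \<longrightarrow> frechet_derivative (\<lambda>x. frechet_derivative G (at x) tau0) (at (hyp_proj nu y)) sg = m * (tau0 \<bullet> sg)"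
   by (simp add: Q_def z_def)
  have "tau0 \<noteq> 0" using n0 by auto
  hence "principal_curvature U y m" unfolding principal_curvature_def using c tang n0(1) eig by blast
  hence "kap0 \<le> m" by (rule kap)
  hence "kap0 * (norm tau)\<^sup>2 \<le> m * (norm tau)\<^sup>2" by (intro mult_right_mono) auto
  thus ?thesis using ge[OF tau] by simp
 qed
 thus ?thesis by (simp add: Q_def z_def)
qed

lemma finite_open_nhd:
 fixes f :: "'i => 'a::metric_space => real"
 assumes "finite I" "open S" "z \<in> S" "\<And>i. i \<in> I ==> continuous_on S (f i)" "0 < e"
 obtains dlt where "0 < dlt" "ball z dlt \<subseteq> S" "\<And>x i. x \<in> ball z dlt ==> i \<in> I ==> \<bar>f i x - f i z\<bar> < e"
proof -
 have "open (S \<inter> (\<Inter>i\<in>I. S \<inter> (\<lambda>x. f i x - f i z) -` {- e<..<e}))"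
  using assms(1-3) by (intro open_Int open_INT ballI continuous_open_preimage continuous_on_diff[OF assms(4)]
    continuous_on_const) auto
 moreover have "z \<in> S \<inter> (\<Inter>i\<in>I. S \<inter> (\<lambda>x. f i x - f i z) -` {- e<..<e})" using assms by auto
 ultimately obtain dlt where dlt: "0 < dlt" "ball z dlt \<subseteq> S \<inter> (\<Inter>i\<in>I. S \<inter> (\<lambda>x. f i x - f i z) -` {- e<..<e})"
  by (meson open_contains_ball)
 have "f i x - f i z \<in> {- e<..<e}" if "x \<in> ball z dlt" "i \<in> I" for x i using dlt(2) that by blast
 hence "\<bar>f i x - f i z\<bar> < e" if "x \<in> ball z dlt" "i \<in> I" for x i using that by force
 thus ?thesis using that[of dlt] dlt by blast
qed

section \<open>Uniformly convex domains\<close>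

text \<open>\<open>kap\<close> and \<open>M\<close> bound the derivatives in direction
  \<open>w\<close> as they stand, so they are instantiated with multiples of
  \<open>(norm w)\<^sup>2\<close> and \<open>norm w\<close>.\<close>

lemma taylor_strongly_convex:
 fixes z w :: "'a::euclidean_space"
 assumes CG: "Ck_on 2 (ball z0 r) G" and z: "z \<in> ball z0 r" "z + w \<in> ball z0 r"
  and Q: "\<And>x. x \<in> ball z0 r ==> kap \<le> frechet_derivative (\<lambda>x. frechet_derivative G (at x) w) (at x) w"
  and D: "\<And>x. x \<in> ball z0 r ==> \<bar>frechet_derivative G (at x) w\<bar> \<le> M"
 shows "G z + frechet_derivative G (at z) w + kap / 2 \<le> G (z + w)" "\<bar>G (z + w) - G z\<bar> \<le> M"
proof -
 have seg: "z + t *\<^sub>R w \<in> ball z0 r" if "0 \<le> t" "t \<le> 1" for t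
 proof -
  have "(1 - t) *\<^sub>R z + t *\<^sub>R (z + w) \<in> ball z0 r"
   using convexD_alt[OF convex_ball z] that by simp
  thus ?thesis by (simp add: algebra_simps)
 qed
 define f where "f t = G (z + t *\<^sub>R w)" for t
 define f1 where "f1 t = frechet_derivative G (at (z + t *\<^sub>R w)) w" for t
 define f2 where "f2 t = frechet_derivative (\<lambda>x. frechet_derivative G (at x) w) (at (z + t *\<^sub>R w)) w" for t
 have df: "(f has_real_derivative f1 t) (at t)" if "0 \<le> t" "t \<le> 1" for t
  unfolding f_def[abs_def] f1_def by (rule DERIV_along_line[OF Ck_on_2D(1)[OF CG seg[OF that]]])
 have df1: "(f1 has_real_derivative f2 t) (at t)" if "0 \<le> t" "t \<le> 1" for t
  unfolding f1_def[abs_def] f2_def by (rule DERIV_along_line[OF Ck_on_2D(2)[OF CG seg[OF that]]])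
 have f1: "f1 0 + kap * t \<le> f1 t" if t: "0 \<le> t" "t \<le> 1" for t
 proof -
  have "f1 0 - kap * 0 \<le> f1 t - kap * t"
  proof (rule DERIV_nonneg_imp_nondecreasing[OF t(1)])
   fix x assume "0 \<le> x" "x \<le> t"
   hence x: "0 \<le> x" "x \<le> 1" using t by auto
   have "((\<lambda>t. f1 t - kap * t) has_real_derivative f2 x - kap) (at x)"
    by (auto intro!: derivative_eq_intros df1 x)
   moreover have "0 \<le> f2 x - kap" using Q[OF seg[OF x]] by (simp add: f2_def)
   ultimately show "\<exists>d. ((\<lambda>t. f1 t - kap * t) has_real_derivative d) (at x) \<and> 0 \<le> d" by blast
  qed
  thus ?thesis by simp
 qed
 have "f 0 - f1 0 * 0 - kap / 2 * 0\<^sup>2 \<le> f 1 - f1 0 * 1 - kap / 2 * 1\<^sup>2"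
 proof (rule DERIV_nonneg_imp_nondecreasing[where f = "\<lambda>t. f t - f1 0 * t - kap / 2 * t\<^sup>2"])
  fix x :: real assume x: "0 \<le> x" "x \<le> 1"
  have "((\<lambda>t. f t - f1 0 * t - kap / 2 * t\<^sup>2) has_real_derivative f1 x - f1 0 - kap * x) (at x)"
   by (auto intro!: derivative_eq_intros df x)
  thus "\<exists>d. ((\<lambda>t. f t - f1 0 * t - kap / 2 * t\<^sup>2) has_real_derivative d) (at x) \<and> 0 \<le> d"
   using f1[OF x] by auto
 qed simp
 thus "G z + frechet_derivative G (at z) w + kap / 2 \<le> G (z + w)" by (simp add: f_def f1_def)
 have "\<exists>t::real. t > 0 \<and> t < 1 \<and> f 1 - f 0 = (1 - 0) * f1 t" by (rule MVT2) (auto intro: df)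
 then obtain t where t: "0 < t" "t < 1" "f 1 - f 0 = f1 t" by auto
 have "z + t *\<^sub>R w \<in> ball z0 r" by (rule seg) (use t in auto)
 from D[OF this] t(3) show "\<bar>G (z + w) - G z\<bar> \<le> M" by (simp add: f_def f1_def)
qed

lemma abs_double_sum_le:
 fixes sg :: "'a::euclidean_space" and c :: "'a => 'a => real"
 assumes "\<And>a b. a \<in> Basis ==> b \<in> Basis ==> \<bar>c a b\<bar> \<le> e"
 shows "\<bar>\<Sum>a\<in>Basis. \<Sum>b\<in>Basis. (sg \<bullet> a) * (sg \<bullet> b) * c a b\<bar> \<le> (real DIM('a))\<^sup>2 * e * (norm sg)\<^sup>2"
proof -
 have "\<bar>\<Sum>a\<in>Basis. \<Sum>b\<in>Basis. (sg \<bullet> a) * (sg \<bullet> b) * c a b\<bar> \<le>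
   (\<Sum>a\<in>(Basis :: 'a set). \<Sum>b\<in>(Basis :: 'a set). norm sg * norm sg * e)"
 proof (rule order_trans[OF sum_abs sum_mono], rule order_trans[OF sum_abs sum_mono])
  fix a b :: 'a assume ab: "a \<in> Basis" "b \<in> Basis"
  show "\<bar>(sg \<bullet> a) * (sg \<bullet> b) * c a b\<bar> \<le> norm sg * norm sg * e"
   unfolding abs_mult using ab by (intro mult_mono assms Basis_le_norm) auto
 qed
 thus ?thesis by (simp add: power2_eq_square mult_ac)
qed

text \<open>Near \<open>y0\<close> the graph is uniformly convex, so the squared distance to
  \<open>y\<close> is bounded by the height over the tangent plane at \<open>y\<close>, within a
  fixed ball. Convexity extends this to all of \<open>U\<close>: shrinking towards \<open>y\<close>
  by the factor \<open>s\<close> scales one side by the square of \<open>s\<close> and the other by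
  \<open>s\<close>.\<close>

lemma local_strict_convexity:
 fixes U :: "'a::euclidean_space set"
 assumes U: "open U" "convex U" and D: "0 < D" "\<And>x y. x \<in> closure U ==> y \<in> closure U ==> norm (x - y) \<le> D"
  and y0: "y0 \<in> frontier U" and c: "boundary_chart 2 U y0 nu r G"
  and tang: "\<And>sg. sg \<bullet> nu = 0 ==> frechet_derivative G (at (hyp_proj nu y0)) sg = 0"
  and kap: "0 < kap" "\<And>tau. tau \<bullet> nu = 0 ==> kap * (norm tau)\<^sup>2 \<le>
    frechet_derivative (\<lambda>x. frechet_derivative G (at x) tau) (at (hyp_proj nu y0)) tau"
 shows "\<exists>e>0. \<exists>R>0. \<forall>y\<in>frontier U \<inter> ball y0 e. \<exists>mu. norm mu = 1 \<and>
  (\<forall>x\<in>U. (norm (x - y))\<^sup>2 \<le> R * ((x - y) \<bullet> mu))"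
proof -
 define P where "P = hyp_proj nu"
 define z0 where "z0 = P y0"
 define n where "n = real DIM('a)"
 have n: "1 \<le> n" by (simp add: n_def)
 have nu: "norm nu = 1" and r: "0 < r" and CG: "Ck_on 2 (ball z0 r) G"
  and eq: "U \<inter> ball y0 r = {x \<in> ball y0 r. G (P x) < x \<bullet> nu}"
  using c by (auto simp: boundary_chart_def P_def z0_def)
 note P = hyp_proj_simps[OF nu, folded P_def]
 define G1 where "G1 x h = frechet_derivative G (at x) h" for x h
 define G2 where "G2 x u h = frechet_derivative (\<lambda>x. frechet_derivative G (at x) u) (at x) h" for x u h
 have lin1: "linear (G1 x)" if "x \<in> ball z0 r" for x
  unfolding G1_def using Ck_on_2D(1)[OF CG that] by (rule has_derivative_linear)
 have lin2: "linear (G2 x u)" if "x \<in> ball z0 r" for x u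
  unfolding G2_def using Ck_on_2D(2)[OF CG that] by (rule has_derivative_linear)
 have sym: "G2 x u h = G2 x h u" if "x \<in> ball z0 r" for x u h
  unfolding G2_def by (rule Ck_on_2_symmetric[OF CG open_ball that])
 have z0: "z0 \<in> ball z0 r" using r by simp
 \<comment> \<open>Entrywise closeness \<open>e1\<close> of the second derivatives changes the
   quadratic form by at most half of its lower bound.\<close>
 define e1 where "e1 = kap / (2 * n\<^sup>2)"
 have e1: "0 < e1" using kap n by (simp add: e1_def)
 obtain d1 where d1: "0 < d1" "ball z0 d1 \<subseteq> ball z0 r"
  "\<And>x p. x \<in> ball z0 d1 ==> p \<in> Basis \<times> Basis ==> \<bar>G2 x (fst p) (snd p) - G2 z0 (fst p) (snd p)\<bar> < e1"
  by (rule finite_open_nhd[of "Basis \<times> Basis" "ball z0 r" z0 "\<lambda>p x. G2 x (fst p) (snd p)" e1])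
   (use z0 e1 Ck_on_2D(3)[OF CG] in \<open>auto simp: G2_def\<close>)
 obtain d2 where d2: "0 < d2" "ball z0 d2 \<subseteq> ball z0 r"
  "\<And>x b. x \<in> ball z0 d2 ==> b \<in> Basis ==> \<bar>G1 x (P b) - G1 z0 (P b)\<bar> < 1 / n"
  by (rule finite_open_nhd[of "Basis" "ball z0 r" z0 "\<lambda>b x. G1 x (P b)" "1 / n"])
   (use z0 n Ck_on_2_continuous_derivative[OF CG] in \<open>auto simp: G1_def\<close>)
 define dlt where "dlt = min d1 (min d2 r)"
 have dlt: "0 < dlt" "dlt \<le> d1" "dlt \<le> d2" "dlt \<le> r" using d1 d2 r by (auto simp: dlt_def)
 have zr: "x \<in> ball z0 r" if "x \<in> ball z0 dlt" for x using that dlt by auto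
 have Q: "kap / 2 * (norm sg)\<^sup>2 \<le> G2 x sg sg" if x: "x \<in> ball z0 dlt" and sg: "sg \<bullet> nu = 0" for x sg
 proof -
  have exp: "G2 x sg sg = (\<Sum>a\<in>Basis. \<Sum>b\<in>Basis. (sg \<bullet> a) * (sg \<bullet> b) * G2 x a b)" if x: "x \<in> ball z0 r" for x
  proof -
   have "G2 x sg sg = (\<Sum>a\<in>Basis. (sg \<bullet> a) * G2 x sg a)" by (rule linear_inner_sum(2)[OF lin2[OF x]])
   also have "\<dots> = (\<Sum>a\<in>Basis. (sg \<bullet> a) * (\<Sum>b\<in>Basis. (sg \<bullet> b) * G2 x a b))"
   proof (intro sum.cong refl arg_cong2[where f = "(*)"])
    fix a :: 'a
    have "G2 x sg a = G2 x a sg" by (rule sym[OF x])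
    also have "\<dots> = (\<Sum>b\<in>Basis. (sg \<bullet> b) * G2 x a b)" by (rule linear_inner_sum(2)[OF lin2[OF x]])
    finally show "G2 x sg a = (\<Sum>b\<in>Basis. (sg \<bullet> b) * G2 x a b)" .
   qed
   finally show ?thesis by (simp add: sum_distrib_left mult.assoc)
  qed
  have "\<bar>\<Sum>a\<in>Basis. \<Sum>b\<in>Basis. (sg \<bullet> a) * (sg \<bullet> b) * (G2 x a b - G2 z0 a b)\<bar> \<le> n\<^sup>2 * e1 * (norm sg)\<^sup>2"
   unfolding n_def
  proof (rule abs_double_sum_le)
   fix a b :: 'a assume "a \<in> Basis" "b \<in> Basis"
   thus "\<bar>G2 x a b - G2 z0 a b\<bar> \<le> e1" using d1(3)[of x "(a, b)"] x dlt by simp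
  qed
  moreover have "(\<Sum>a\<in>Basis. \<Sum>b\<in>Basis. (sg \<bullet> a) * (sg \<bullet> b) * (G2 x a b - G2 z0 a b)) = G2 x sg sg - G2 z0 sg sg"
   unfolding exp[OF zr[OF x]] exp[OF z0] by (simp add: right_diff_distrib sum_subtractf)
  moreover have "n\<^sup>2 * e1 * (norm sg)\<^sup>2 = kap / 2 * (norm sg)\<^sup>2" using n by (simp add: e1_def)
  moreover have "kap * (norm sg)\<^sup>2 \<le> G2 z0 sg sg" using kap(2)[OF sg] by (simp add: G2_def z0_def P_def)
  ultimately show ?thesis by auto
 qed
 have D1: "\<bar>G1 x sg\<bar> \<le> norm sg" if x: "x \<in> ball z0 dlt" and sg: "sg \<bullet> nu = 0" for x sg
 proof -
  have "P sg = sg" using P(8)[of sg] sg by simp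
  have "linear (\<lambda>h. G1 x (P h))"
   using linear_compose[OF bounded_linear.linear[OF hyp_proj_linear] lin1[OF zr[OF x]], of nu] by (simp add: P_def comp_def)
  from linear_inner_sum(2)[OF this, of sg] have "G1 x sg = (\<Sum>b\<in>Basis. (sg \<bullet> b) * G1 x (P b))" by (simp add: \<open>P sg = sg\<close>)
  also have "\<bar>\<dots>\<bar> \<le> (\<Sum>b\<in>(Basis :: 'a set). norm sg * (1 / n))"
  proof (rule order_trans[OF sum_abs sum_mono])
   fix b :: 'a assume b: "b \<in> Basis"
   have "\<bar>G1 x (P b) - G1 z0 (P b)\<bar> < 1 / n" using d2(3)[of x b] x dlt b by simp
   moreover have "G1 z0 (P b) = 0" using tang[of "P b"] P(1) by (simp add: G1_def z0_def P_def)
   ultimately show "\<bar>(sg \<bullet> b) * G1 x (P b)\<bar> \<le> norm sg * (1 / n)"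
    unfolding abs_mult using b by (intro mult_mono Basis_le_norm) auto
  qed
  also have "\<dots> = norm sg" by (simp add: n_def)
  finally show ?thesis .
 qed
 \<comment> \<open>The first term pays for \<open>3 * (norm w)\<^sup>2\<close>, the second for
   \<open>2 * a\<^sup>2\<close> by means of \<open>a \<le> 4 * dlt\<close>.\<close>
 define R1 where "R1 = max (12 / kap) (8 * dlt)"
 have R1: "0 < R1" "12 / kap \<le> R1" "8 * dlt \<le> R1" using kap(1) by (auto simp: R1_def less_max_iff_disj)
 define s where "s = min 1 (dlt / 4 / D)"
 have s: "0 < s" "s \<le> 1" "s * D \<le> dlt / 4" using dlt D by (auto simp: s_def min_mult_distrib_right)
 have main: "\<exists>mu. norm mu = 1 \<and> (\<forall>x\<in>U. (norm (x - y))\<^sup>2 \<le> 2 * R1 / s * ((x - y) \<bullet> mu))"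
  if y: "y \<in> frontier U" "y \<in> ball y0 (dlt / 2)" for y
 proof -
  have Pball: "P x \<in> ball z0 dlt" if "x \<in> ball y0 dlt" for x
   using that P(7)[of "y0 - x"] by (simp add: dist_norm P z0_def)
  define z where "z = P y"
  have z: "z \<in> ball z0 dlt" unfolding z_def by (rule Pball) (use y dlt in auto)
  have yG: "y \<bullet> nu = G z" unfolding z_def P_def by (rule chart_frontier[OF U(1) c y(1)]) (use y dlt in auto)
  \<comment> \<open>The derivative at \<open>y\<close> of the defining function of the graph; the
    vector \<open>p\<close> representing it is the inner normal before normalization.\<close>
  define N where "N h = h \<bullet> nu - G1 z (P h)" for h
  have "linear N"
  proof -
   have "linear (\<lambda>h. G1 z (P h))"
    using linear_compose[OF bounded_linear.linear[OF hyp_proj_linear] lin1[OF zr[OF z]], of nu] by (simp add: P_def comp_def)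
   thus ?thesis unfolding N_def by (intro linear_compose_sub) (auto simp: linear_iff inner_add_left)
  qed
  define p where "p = (\<Sum>b\<in>Basis. N b *\<^sub>R b)"
  have p: "N h = p \<bullet> h" for h unfolding p_def by (rule linear_inner_sum(1)[OF \<open>linear N\<close>])
  have "N nu = 1" using nu linear_0[OF lin1[OF zr[OF z]]] by (simp add: N_def P norm_eq_1)
  hence p0: "p \<noteq> 0" using p[of nu] by auto
  have pN: "norm p \<le> 2"
  proof -
   have "(norm p)\<^sup>2 = N p" by (simp add: p power2_norm_eq_inner)
   also have "\<dots> \<le> norm p * norm nu + norm (P p)"
    using norm_cauchy_schwarz[of p nu] D1[OF z P(1)[of p]] by (simp add: N_def)
   also have "\<dots> \<le> 2 * norm p" using P(7)[of p] nu by simp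
   finally show ?thesis using p0 by (simp add: power2_eq_square)
  qed
  have near: "(norm (x - y))\<^sup>2 \<le> R1 * ((x - y) \<bullet> p)" if x: "x \<in> U" "x \<in> ball y0 dlt" for x
  proof -
   define w where "w = P x - z"
   define a where "a = x \<bullet> nu - G (P x)"
   have "x \<in> {x \<in> ball y0 r. G (P x) < x \<bullet> nu}" unfolding eq[symmetric] using x dlt by auto
   hence a: "0 < a" by (simp add: a_def)
   have wnu: "w \<bullet> nu = 0" by (simp add: w_def z_def inner_diff_left P)
   have zw: "z + w = P x" by (simp add: w_def)
   have Px: "P x \<in> ball z0 dlt" by (rule Pball[OF x(2)])
   have CGdlt: "Ck_on 2 (ball z0 dlt) G"
    using CG zr unfolding numeral_2_eq_2 by (auto intro: continuous_on_subset[of "ball z0 r"])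
   note T = taylor_strongly_convex[OF CGdlt z, of w "kap / 2 * (norm w)\<^sup>2" "norm w", unfolded zw, OF Px]
   have T1: "G z + G1 z w + kap / 4 * (norm w)\<^sup>2 \<le> G (P x)" and T2: "\<bar>G (P x) - G z\<bar> \<le> norm w"
    using T Q[OF _ wnu] D1[OF _ wnu] by (auto simp: G1_def G2_def)
   have Nx: "a + kap / 4 * (norm w)\<^sup>2 \<le> (x - y) \<bullet> p"
   proof -
    have "(x - y) \<bullet> p = x \<bullet> nu - G z - G1 z w"
    proof -
     have "(x - y) \<bullet> p = N (x - y)" unfolding p by (rule inner_commute)
     also have "\<dots> = x \<bullet> nu - y \<bullet> nu - G1 z (P x - P y)" unfolding N_def inner_diff_left P(5) ..
     finally show ?thesis unfolding yG w_def z_def .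
    qed
    thus ?thesis using T1 by (simp add: a_def)
   qed
   have xynu: "(x - y) \<bullet> nu = a + (G (P x) - G z)" by (simp add: a_def inner_diff_left yG)
   have sq: "(norm (x - y))\<^sup>2 = (norm w)\<^sup>2 + ((x - y) \<bullet> nu)\<^sup>2"
    using P(9)[of "x - y"] by (simp add: P(5) w_def z_def)
   have "((x - y) \<bullet> nu)\<^sup>2 \<le> 2 * a\<^sup>2 + 2 * (G (P x) - G z)\<^sup>2"
    unfolding xynu using sum_squares_bound[of a "G (P x) - G z"] by (simp add: power2_sum)
   moreover have "(G (P x) - G z)\<^sup>2 \<le> (norm w)\<^sup>2" using T2 by (simp add: abs_le_square_iff[symmetric])
   ultimately have 1: "(norm (x - y))\<^sup>2 \<le> 3 * (norm w)\<^sup>2 + 2 * a\<^sup>2" unfolding sq by simp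
   have "a \<le> 4 * dlt"
   proof -
    have "norm (x - y) \<le> 2 * dlt"
     using x(2) y(2) dist_triangle[of x y y0] dlt by (auto simp: dist_norm norm_minus_commute)
    moreover have "norm w \<le> norm (x - y)" using P(7)[of "x - y"] by (simp add: P(5) w_def z_def)
    moreover have "(x - y) \<bullet> nu \<le> norm (x - y)" using norm_cauchy_schwarz[of "x - y" nu] nu by simp
    ultimately show ?thesis using xynu T2 by simp
   qed
   hence "2 * a\<^sup>2 \<le> 8 * dlt * a" using a by (simp add: power2_eq_square)
   also have "\<dots> \<le> R1 * a" using R1 a by simp
   finally have 2: "2 * a\<^sup>2 \<le> R1 * a" .
   have "3 * (norm w)\<^sup>2 = 12 / kap * (kap / 4 * (norm w)\<^sup>2)" using kap(1) by simp
   also have "\<dots> \<le> R1 * (kap / 4 * (norm w)\<^sup>2)" using R1 kap(1) by (intro mult_right_mono) auto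
   finally have "(norm (x - y))\<^sup>2 \<le> R1 * (a + kap / 4 * (norm w)\<^sup>2)" using 1 2 by (simp add: distrib_left)
   also have "\<dots> \<le> R1 * ((x - y) \<bullet> p)" using Nx R1 by simp
   finally show ?thesis .
  qed
  define mu where "mu = (1 / norm p) *\<^sub>R p"
  have "(norm (x - y))\<^sup>2 \<le> 2 * R1 / s * ((x - y) \<bullet> mu)" if x: "x \<in> U" for x
  proof -
   have yc: "y \<in> closure U" and xc: "x \<in> closure U" using y(1) x closure_subset by (auto simp: frontier_def)
   define x' where "x' = y + s *\<^sub>R (x - y)"
   have "x' \<in> U" using mem_interior_closure_convex_shrink[OF U(2), of x y s] U(1) x yc s
    by (simp add: interior_open x'_def algebra_simps)
   moreover have "x' \<in> ball y0 dlt"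
   proof -
    have "norm (s *\<^sub>R (x - y)) \<le> s * D" using D(2)[OF xc yc] s by simp
    hence "dist y x' \<le> dlt / 4" using s(3) by (simp add: x'_def dist_norm)
    thus ?thesis using y(2) dist_triangle[of y0 x' y] dlt(1) by simp
   qed
   ultimately have "(norm (x' - y))\<^sup>2 \<le> R1 * ((x' - y) \<bullet> p)" by (rule near)
   hence "s * (s * (norm (x - y))\<^sup>2) \<le> s * (R1 * ((x - y) \<bullet> p))"
    by (simp add: x'_def power2_eq_square mult_ac)
   hence 1: "s * (norm (x - y))\<^sup>2 \<le> R1 * ((x - y) \<bullet> p)" using s(1) by simp
   also have "\<dots> = R1 * (norm p * ((x - y) \<bullet> mu))" by (simp add: mu_def)
   finally have 2: "s * (norm (x - y))\<^sup>2 \<le> R1 * (norm p * ((x - y) \<bullet> mu))" .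
   moreover have "0 \<le> s * (norm (x - y))\<^sup>2" using s by simp
   ultimately have "0 \<le> R1 * (norm p * ((x - y) \<bullet> mu))" by simp
   hence "0 \<le> (x - y) \<bullet> mu" using R1 p0 by (simp add: zero_le_mult_iff)
   hence "R1 * (norm p * ((x - y) \<bullet> mu)) \<le> R1 * (2 * ((x - y) \<bullet> mu))"
    using pN R1 by (intro mult_left_mono mult_right_mono) auto
   hence "(norm (x - y))\<^sup>2 * s \<le> 2 * R1 * ((x - y) \<bullet> mu)" using 2 by (simp add: mult_ac)
   hence "(norm (x - y))\<^sup>2 \<le> (2 * R1 * ((x - y) \<bullet> mu)) / s" using s(1) by (simp add: pos_le_divide_eq)
   thus ?thesis by simp
  qed
  moreover have "norm mu = 1" using p0 by (simp add: mu_def)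
  ultimately show ?thesis by blast
 qed
 show ?thesis using main dlt(1) R1(1) s(1) by (intro exI[of _ "dlt / 2"] conjI exI[of _ "2 * R1 / s"]) auto
qed

text \<open>Compactness of the frontier makes the local constants uniform; enlarging
  \<open>R\<close> is harmless because the inner product is nonnegative.\<close>

lemma uniformly_convex_support:
 fixes U :: "'a::euclidean_space set"
 assumes u: "uniformly_convex_domain U"
  and D: "0 < D" "\<And>x y. x \<in> closure U ==> y \<in> closure U ==> norm (x - y) \<le> D"
 obtains R where "0 < R" "\<And>y. y \<in> frontier U ==>
  \<exists>mu. norm mu = 1 \<and> (\<forall>x\<in>U. (norm (x - y))\<^sup>2 \<le> R * ((x - y) \<bullet> mu))"
proof -
 define good where "good R y \<longleftrightarrow> (\<exists>mu. norm mu = 1 \<and> (\<forall>x\<in>U. (norm (x - y))\<^sup>2 \<le> R * ((x - y) \<bullet> mu)))" for R y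
 have U: "open U" "convex U" "bounded U" using u by (auto simp: uniformly_convex_domain_def)
 obtain kap where kap: "0 < kap" "\<And>y k. y \<in> frontier U ==> principal_curvature U y k ==> kap \<le> k"
  using u by (auto simp: uniformly_convex_domain_def)
 have "\<exists>e>0. \<exists>R>0. \<forall>y\<in>frontier U \<inter> ball y0 e. good R y" if y0: "y0 \<in> frontier U" for y0
 proof -
  obtain nu0 r g where "boundary_chart 2 U y0 nu0 r g"
   using u y0 unfolding uniformly_convex_domain_def Ck_boundary_def by blast
  from normal_chart[OF U(1) y0 this]
  obtain nu s G where c: "boundary_chart 2 U y0 nu s G"
   and t: "\<And>sg. sg \<bullet> nu = 0 ==> frechet_derivative G (at (hyp_proj nu y0)) sg = 0" by blast
  show ?thesis unfolding good_def by (rule local_strict_convexity[OF U(1,2) D y0 c t kap(1)])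
    (use hessian_ge_of_principal_curvature[OF c t kap(2)[OF y0]] in blast)+
 qed
 then obtain e R where eR: "\<And>y0. y0 \<in> frontier U ==> 0 < e y0"
  "\<And>y0. y0 \<in> frontier U ==> 0 < R y0"
  "\<And>y0 y. y0 \<in> frontier U ==> y \<in> frontier U \<inter> ball y0 (e y0) ==> good (R y0) y" by metis
 have "compact (frontier U)" using U(3) by auto
 then obtain F where F: "F \<subseteq> frontier U" "finite F" "frontier U \<subseteq> (\<Union>y\<in>F. ball y (e y))"
  by (rule compactE_image[of _ "frontier U" "\<lambda>y. ball y (e y)"]) (use eR(1) in force)+
 define Rm where "Rm = Max (insert 1 (R ` F))"
 have Rm: "0 < Rm" "\<And>y. y \<in> F ==> R y \<le> Rm"
  using F(2) by (auto simp: Rm_def intro: less_le_trans[OF zero_less_one])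
 show ?thesis
 proof (rule that[OF Rm(1)])
  fix y assume y: "y \<in> frontier U"
  then obtain y0 where y0: "y0 \<in> F" "y \<in> ball y0 (e y0)" using F(3) by blast
  then obtain mu where mu: "norm mu = 1" "\<And>x. x \<in> U ==> (norm (x - y))\<^sup>2 \<le> R y0 * ((x - y) \<bullet> mu)"
   using eR(3)[of y0 y] F(1) y unfolding good_def by blast
  have "(norm (x - y))\<^sup>2 \<le> Rm * ((x - y) \<bullet> mu)" if "x \<in> U" for x
  proof -
   have "0 < R y0" using eR(2) y0 F(1) by blast
   moreover have "0 \<le> R y0 * ((x - y) \<bullet> mu)" using mu(2)[OF that] zero_le_power2 order_trans by blast
   ultimately have "0 \<le> (x - y) \<bullet> mu" by (simp add: zero_le_mult_iff)
   hence "R y0 * ((x - y) \<bullet> mu) \<le> Rm * ((x - y) \<bullet> mu)" using Rm(2)[OF y0(1)] by (rule mult_right_mono[rotated])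
   thus ?thesis using mu(2)[OF that] by simp
  qed
  thus "\<exists>mu. norm mu = 1 \<and> (\<forall>x\<in>U. (norm (x - y))\<^sup>2 \<le> Rm * ((x - y) \<bullet> mu))" using mu(1) by blast
 qed
qed

theorem theorem3p16:
  fixes \<Omega> :: "(real^'n) set" and lam Lam :: real
  assumes "uniformly_convex_domain \<Omega>"
    and "Ck_boundary 3 \<Omega>"
    and "\<exists>\<rho>>0. \<Omega> \<subseteq> ball 0 (1 / \<rho>) \<and>
           (\<forall>y\<in>frontier \<Omega>. \<exists>z. ball z \<rho> \<subseteq> \<Omega> \<and> dist z y = \<rho>)"
    and "0 < lam"
  shows "\<exists>\<gamma>>1. \<exists>C>0. \<forall>(\<phi> :: real^'n \<Rightarrow> real) (v :: real^'n \<Rightarrow> real) (f :: real^'n \<Rightarrow> real)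
           (D2v :: real^'n \<Rightarrow> real^'n^'n).
           continuous_on (closure \<Omega>) \<phi> \<and> Ck_on 2 \<Omega> \<phi> \<and> convex_on \<Omega> \<phi> \<and>
           (\<forall>x\<in>\<Omega>. lam \<le> det (hessian \<phi> x) \<and> det (hessian \<phi> x) \<le> Lam) \<and>
           (\<forall>x\<in>frontier \<Omega>. \<phi> x = 0) \<and>
           in_Linf \<Omega> f \<and>
           continuous_on (closure \<Omega>) v \<and> W_loc 2 (real CARD('n)) \<Omega> v \<and> convex_on \<Omega> v \<and>
           weak_hessian \<Omega> v D2v \<and>
           (AE x in lebesgue_on \<Omega>.
              (\<Sum>i\<in>UNIV. \<Sum>j\<in>UNIV. cofactor_matrix (hessian \<phi> x) $ i $ j * D2v x $ i $ j) = f x) \<and>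
           (\<forall>x\<in>frontier \<Omega>. v x = 0)
           \<longrightarrow> in_Lp \<gamma> \<Omega> D2v \<and> Lp_norm \<gamma> \<Omega> D2v \<le> C * Linf_norm \<Omega> f"
proof -
 have \<Omega>: "open \<Omega>" "bounded \<Omega>" "\<Omega> \<noteq> {}" using assms(1) by (auto simp: uniformly_convex_domain_def)
 obtain c0 r0 where c0: "ball c0 r0 \<subseteq> \<Omega>" "0 < r0" using \<Omega> by (metis all_not_in_conv open_contains_ball)
 obtain B where B: "\<And>x. x \<in> closure \<Omega> \<Longrightarrow> norm x \<le> B"
  using \<Omega>(2) bounded_closure bounded_iff by metis
 define D where "D = 2 * \<bar>B\<bar> + 1"
 have D: "0 < D" by (simp add: D_def)
 have DD: "norm (x - y) \<le> D" if "x \<in> closure \<Omega>" "y \<in> closure \<Omega>" for x y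
  using norm_triangle_ineq4[of x y] B[OF that(1)] B[OF that(2)] by (simp add: D_def)
 obtain R where R: "0 < R" "\<And>y. y \<in> frontier \<Omega> \<Longrightarrow>
   \<exists>\<mu>. norm \<mu> = 1 \<and> (\<forall>x\<in>\<Omega>. (norm (x - y))\<^sup>2 \<le> R * ((x - y) \<bullet> \<mu>))"
  by (rule uniformly_convex_support[OF assms(1) D DD]) blast+
 obtain \<rho> where \<rho>: "0 < \<rho>" "\<And>y. y \<in> frontier \<Omega> \<Longrightarrow> \<exists>z. ball z \<rho> \<subseteq> \<Omega> \<and> dist z y = \<rho>"
  using assms(3) by blast
 \<comment> \<open>\<open>\<Omega>\<close> lies in the half-space of the support vector
   \<open>\<nu>\<close>, so the interior ball touching at \<open>y\<close> has its centre on the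
   line through \<open>y\<close> in direction \<open>\<nu>\<close>: one normal serves both
   balls.\<close>
 have normal: "\<exists>\<nu>. norm \<nu> = 1 \<and> (\<forall>x\<in>\<Omega>. (norm (x - y))\<^sup>2 \<le> R * ((x - y) \<bullet> \<nu>)) \<and> ball (y + \<rho> *\<^sub>R \<nu>) \<rho> \<subseteq> \<Omega>"
  if y: "y \<in> frontier \<Omega>" for y
 proof -
  obtain \<nu> where \<nu>: "norm \<nu> = 1" "\<And>x. x \<in> \<Omega> \<Longrightarrow> (norm (x - y))\<^sup>2 \<le> R * ((x - y) \<bullet> \<nu>)" using R(2)[OF y] by blast
  obtain z where z: "ball z \<rho> \<subseteq> \<Omega>" "dist z y = \<rho>" using \<rho>(2)[OF y] by blast
  have "0 \<le> (x - y) \<bullet> \<nu>" if "x \<in> \<Omega>" for x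
  proof -
   have "0 \<le> R * ((x - y) \<bullet> \<nu>)" using \<nu>(2)[OF that] zero_le_power2 order_trans by blast
   thus ?thesis using R(1) by (simp add: zero_le_mult_iff)
  qed
  hence "z = y + \<rho> *\<^sub>R \<nu>"
   using z by (intro ball_center_of_support[OF \<nu>(1) _ \<rho>(1)]) (auto simp: dist_norm)
  thus ?thesis using \<nu> z(1) by blast
 qed
 \<comment> \<open>The values prescribed by \<open>mafun\<close>; they do not depend on
   \<open>\<phi>\<close> and can be fixed before the exponent is obtained.\<close>
 define \<kappa> where "\<kappa> = 2 ^ CARD('n) * key_const CARD('n) lam Lam"
 define \<sigma> where "\<sigma> = 1 / (32 * \<kappa> + 8)"
 define \<theta> where "\<theta> = \<sigma> / (4 * (1 + \<kappa>))"
 obtain \<epsilon> C where \<epsilon>: "0 < \<epsilon>" and C: "0 \<le> C" and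
  tr: "\<And>\<phi> g A. bdry \<Omega> lam Lam \<phi> g A \<kappa> \<sigma> \<theta> c0 r0 D R \<rho> \<Longrightarrow>
   (\<integral>\<^sup>+x. ennreal (indicator \<Omega> x * trace (A x) powr (1 + \<epsilon>)) \<partial>lborel) \<le> ennreal C"
  using trace_higher_integrability[of \<Omega> lam Lam \<kappa> \<sigma> \<theta> c0 r0 D R \<rho>] by blast
 define \<gamma> where "\<gamma> = 1 + \<epsilon>"
 define n2 where "n2 = (real CARD('n))\<^sup>2 / lam"
 \<comment> \<open>The summand 1 keeps the constant positive even if \<open>C\<close> is 0.\<close>
 define C' where "C' = n2 * C powr (1 / \<gamma>) + 1"
 have n2: "0 \<le> n2" using assms(4) by (simp add: n2_def)
 have C': "0 < C'" unfolding C'_def using n2 by (intro add_nonneg_pos mult_nonneg_nonneg) auto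
 show ?thesis
 proof (rule exI[of _ \<gamma>], rule conjI[rotated], rule exI[of _ C'], rule conjI[OF C'], goal_cases)
  case 1
  show ?case
  proof (intro allI impI, goal_cases)
  case (1 \<phi> v f D2v)
  note * = this
  define g where "g x = (\<chi> i. partial_deriv i \<phi> x)" for x
  define A where "A = hessian \<phi>"
  define F where "F = Linf_norm \<Omega> f"
  have ma: "ma \<Omega> lam Lam \<phi> g A"
   unfolding g_def[abs_def] A_def using * \<Omega> assms(4) by (intro ma_hessian) auto
  interpret B: bdry \<Omega> lam Lam \<phi> g A \<kappa> \<sigma> \<theta> c0 r0 D R \<rho>
   by unfold_locales (use ma \<Omega> c0 DD R(1) \<rho>(1) normal * \<kappa>_def \<sigma>_def \<theta>_def in auto)
  have F: "0 \<le> F" unfolding F_def by (rule Linf_norm_nonneg) (use * \<Omega> in auto)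
  have H: "weak_hessian \<Omega> v D2v" and v: "convex_on \<Omega> v" "continuous_on \<Omega> v"
   using * continuous_on_subset[OF _ closure_subset] by auto
  \<comment> \<open>Convexity of \<open>v\<close> makes its weak Hessian psd almost everywhere, so
    the equation, which prescribes one contraction, controls all entries.\<close>
  have bound: "AE x in lebesgue_on \<Omega>. norm (D2v x) \<le> n2 * F * trace (A x)"
  proof -
   have f: "AE x in lebesgue_on \<Omega>. \<bar>f x\<bar> \<le> F" unfolding F_def by (rule Linf_norm_AE) (use * in auto)
   have eq: "AE x in lebesgue_on \<Omega>.
     (\<Sum>i\<in>UNIV. \<Sum>j\<in>UNIV. cofactor_matrix (A x) $ i $ j * D2v x $ i $ j) = f x"
    using * unfolding A_def by blast
   show ?thesis using f eq weak_hessian_psd[OF \<Omega>(1) v H] AE_space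
   proof eventually_elim
    case (elim x)
    hence x: "x \<in> \<Omega>" by simp
    show ?case unfolding n2_def
    proof (rule cofactor_trace_bound)
     show "pd (A x)" "lam \<le> det (A x)" using ma x by (auto simp: ma_def)
    qed (use elim assms(4) in auto)
   qed
  qed
  have "in_Lp \<gamma> \<Omega> D2v \<and> Lp_norm \<gamma> \<Omega> D2v \<le> n2 * F * C powr (1 / \<gamma>)"
  proof (rule Lp_bound_from_pointwise[OF \<Omega>(1) _ _ C weak_hessian_loc(2)[OF H] bound])
   show "1 < \<gamma>" "0 \<le> n2 * F" using \<epsilon> n2 F by (auto simp: \<gamma>_def)
   show "0 \<le> trace (A x)" if "x \<in> \<Omega>" for x using B.w_pos[OF that] by (simp add: B.w_def)
   have "continuous_on \<Omega> (\<lambda>x. trace (A x) powr \<gamma>)"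
    using B.contw B.w_pos unfolding B.w_def by (intro continuous_intros) (auto simp: less_imp_neq[symmetric])
   from borel_measurable_continuous_on_indicator[OF _ this]
   show "(\<lambda>x. indicator \<Omega> x * trace (A x) powr \<gamma>) \<in> borel_measurable borel" using \<Omega>(1) by simp
   show "(\<integral>\<^sup>+x. ennreal (indicator \<Omega> x * trace (A x) powr \<gamma>) \<partial>lborel) \<le> ennreal C"
    unfolding \<gamma>_def by (rule tr) (rule B.bdry_axioms)
  qed
  moreover have "n2 * F * C powr (1 / \<gamma>) \<le> C' * F" using F by (simp add: C'_def algebra_simps)
  ultimately show ?case by (auto simp: F_def)
  qed
 qed (simp add: \<gamma>_def \<epsilon>)
qed

end
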